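(* Let $I\subset(-a;a)$ be a relatively closed interval, and let $\{S_\alpha\}\subset\mathcal U_a'$ be such that $\varphi_\alpha=\mathcal F(S_\alpha)\in\mathcal M_a$ for all $\alpha$. Then $W=\bigcap_\alpha\ker T_{S_\alpha,I}$ is a weakly synthesable subspace (that is, it admits weak spectral synthesis), its residual interval is $I_W=I$, and the sequence of exponents of the system $\mathrm{Exp}(W)$ equals $\bigcap_\alpha\mathcal Z_{\varphi_\alpha}$.
   Context: Weight. $\omega:[0;\infty)\to[0;\infty)$ is a non-decreasing continuous function such that: $\varphi_\omega(t):=\omega(e^t)$ is convex on $[0;\infty)$; $\omega(x)=o(x)$ and $\ln x=o(\omega(x))$ as $x\to\infty$; for every $\sigma>1$ there is $C>0$ with $\omega(x+y)\le\sigma(\omega(x)+\omega(y))+C$ for all $x,y\ge0$; $\int_1^\infty\omega(x)x^{-2}\,dx<\infty$. Fix $0<a\le+\infty$, a sequence $0<c_k\nearrow a$ such that $\{[-c_k;c_k]\}$ is an increasing sequence of closed intervals exhausting $(-a;a)$, and a sequence $0<r_k\nearrow1$. Ultradifferentiable functions. Put $\varphi_\omega^*(s)=\sup_t(st-\varphi_\omega(t))$ and, for $f\in C^\infty(-a;a)$, $q\in(0;1)$, $k\in\mathbb N$, $\|f\|_{\omega,q,k}=\sup_{j\in\mathbb N_0}\sup_{|x|\le c_k}|f^{(j)}(x)|e^{-q\varphi_\omega^*(j/q)}$. $\mathcal U_a$ is the space of all $f\in C^\infty(-a;a)$ with $\|f\|_{\omega,q,k}<\infty$ for all $q\in(0;1)$,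 $k\in\mathbb N$, with the locally convex topology given by these semi-norms. Its strong dual $\mathcal U_a'$ is the space of all ultradistributions with compact supports in $(-a;a)$. $D=d/dx$. A $D$-invariant subspace is a closed subspace $W\subset\mathcal U_a$ with $D(W)\subset W$. $\mathrm{Exp}(W)$ is the set of all exponential monomials $t^je^{-\mathrm i\lambda t}$ ($j\in\mathbb Z_+$, $\lambda\in\mathbb C$) contained in $W$; its sequence of exponents is the sequence of multiple points $\{(\lambda_k;m_k)\}$ such that $\mathrm{Exp}(W)=\{t^je^{-\mathrm i\lambda_kt}: j=0,1,\dots,m_k-1\}_k$. Fourier-Laplace transform and multipliers. $P_k$ is the Banach space of entire functions $\varphi$ with $\sup_{z\in\mathbb C}|\varphi(z)|e^{-r_k\omega(|z|)-c_k|\mathrm{Im}\,z|}<\infty$ and $\mathcal P_a$ is the locally convex inductive limit of the $P_k$; $\mathcal F(S)(z)=S(e^{-\mathrm itz})$ is a linear topological isomorphism of $\mathcal U_a'$ onto $\mathcal P_a$. $\mathcal M_a$ is the set of all multipliers of $\mathcal P_a$, i.e. entire functions $\psi$ such that $\varphi\mapsto\varphi\psi$ is a continuous map of $\mathcal P_a$ into itself; equivalently, entire functions $\psi$ with $\sup_{z\in\mathbb C}|\psi(z)|e^{-\varepsilon\omega(|z|)-\varepsilon|\mathrm{Im}\,z|}<\infty$ for every $\varepsilon>0$. $\mathcal Z_\varphi$ is the zero set of $\varphi$ with multiplicities; an intersection of zero sets consists of the common zeros, taken with the minimal multiplicities. Weak spectral synthesis. For an interval $I\subset(-a;a)$ relatively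 closed in $(-a;a)$ put $W_I=\{f\in\mathcal U_a: f=0\text{ on }I\}$. The residual interval $I_W$ of a $D$-invariant subspace $W$ is defined by the requirements: $I_W$ is relatively closed in $(-a;a)$, $W_{I_W}\subset W$, and $W_I\setminus W\ne\emptyset$ for every relatively closed interval $I\subsetneq I_W$. $W$ admits weak spectral synthesis if $W=\overline{\mathrm{span}(\mathrm{Exp}(W))+W_{I_W}}$ (closure in $\mathcal U_a$). Local convolution. For $A,B\subset\mathbb R$, $A\div B$ consists of all $x\in\mathbb R$ such that $x+B\subset A$; $\mathrm{ch}\,\mathrm{supp}\,S$ is the convex hull of the support of $S$. For $S\in\mathcal U_a'$ and $\widetilde I=I\div\mathrm{ch}\,\mathrm{supp}\,S$, the local convolution operator $T_{S,I}$ maps $f\in\mathcal U_a$ to the function $g$ on $\widetilde I$ given by $g(y)=S(f(x+y))$, $y\in\widetilde I$ ($S$ acting in the variable $x$). Thus $\ker T_{S,I}=\{f\in\mathcal U_a: S(f(x+y))=0\ \forall y\in\widetilde I\}$.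
   Formalization: The interval I is assumed to have nonempty interior and at least one S_α to be nonzero; for a one-point or empty I, or when all S_α = 0, the claim as stated fails. M_a is taken in its growth-condition form. *)

theory Defs
  imports
    "HOL-Complex_Analysis.Complex_Analysis"
    "HOL-Library.Function_Algebras"
    "HOL-Library.Set_Algebras"
    "HOL-Library.Landau_Symbols"
    "HOL-Library.Extended_Nat"
begin

definition cscale :: "complex \<Rightarrow> (real \<Rightarrow> complex) \<Rightarrow> (real \<Rightarrow> complex)" where
  "cscale z f = (\<lambda>x. z * f x)"

global_interpretation cfun: vector_space cscale
  by unfold_locales (auto simp: cscale_def fun_eq_iff algebra_simps)

subsection \<open>Weights and the interval\<close>

definition weight :: "(real \<Rightarrow> real) \<Rightarrow> bool" where
  "weight \<omega> \<longleftrightarrow>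
     (\<forall>x\<ge>0. 0 \<le> \<omega> x) \<and> mono_on {0..} \<omega> \<and> continuous_on {0..} \<omega> \<and>
     convex_on {0..} (\<lambda>t. \<omega> (exp t)) \<and>
     \<omega> \<in> o[at_top](\<lambda>x. x) \<and> ln \<in> o[at_top](\<omega>) \<and>
     (\<forall>\<sigma>>1. \<exists>C>0. \<forall>x\<ge>0. \<forall>y\<ge>0. \<omega> (x + y) \<le> \<sigma> * (\<omega> x + \<omega> y) + C) \<and>
     set_integrable lborel {1..} (\<lambda>x. \<omega> x / x\<^sup>2)"

text \<open>The supremum is over the domain \<open>[0;\<infinity>)\<close> of \<open>t \<mapsto> \<omega>(e\<^sup>t)\<close>; it is finite for a weight,
  because \<open>ln x = o(\<omega>(x))\<close>.\<close>

definition young_conj :: "(real \<Rightarrow> real) \<Rightarrow> real \<Rightarrow> real" where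
  "young_conj \<omega> s = (SUP t\<in>{0..}. s * t - \<omega> (exp t))"

definition symint :: "ereal \<Rightarrow> real set" where
  "symint a = {x. - a < ereal x \<and> ereal x < a}"

definition exhausting :: "ereal \<Rightarrow> (nat \<Rightarrow> real) \<Rightarrow> bool" where
  "exhausting a c \<longleftrightarrow>
     (\<forall>k. 0 < c k \<and> ereal (c k) < a) \<and> incseq c \<and> (\<lambda>k. ereal (c k)) \<longlonglongrightarrow> a"

definition rel_closed_interval :: "ereal \<Rightarrow> real set \<Rightarrow> bool" where
  "rel_closed_interval a I \<longleftrightarrow> is_interval I \<and> closedin (top_of_set (symint a)) I"

subsection \<open>Ultradifferentiable functions and ultradistributions\<close>

text \<open>A function on \<open>(-a;a)\<close> is represented by its extension by zero to the real line, so that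
  equality of functions on \<open>(-a;a)\<close> is equality in \<^typ>\<open>real \<Rightarrow> complex\<close>.\<close>

definition restr :: "ereal \<Rightarrow> (real \<Rightarrow> complex) \<Rightarrow> (real \<Rightarrow> complex)" where
  "restr a f = (\<lambda>x. if x \<in> symint a then f x else 0)"

definition D :: "ereal \<Rightarrow> (real \<Rightarrow> complex) \<Rightarrow> (real \<Rightarrow> complex)" where
  "D a f = restr a (\<lambda>x. vector_derivative f (at x))"

definition smooth :: "ereal \<Rightarrow> (real \<Rightarrow> complex) set" where
  "smooth a = {f. (\<forall>x. x \<notin> symint a \<longrightarrow> f x = 0) \<and>
                  (\<forall>j. \<forall>x\<in>symint a. (D a ^^ j) f differentiable (at x))}"

definition useminorm ::
  "ereal \<Rightarrow> (nat \<Rightarrow> real) \<Rightarrow> (real \<Rightarrow> real) \<Rightarrow> real \<Rightarrow> nat \<Rightarrow> (real \<Rightarrow> complex) \<Rightarrow> ereal" where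
  "useminorm a c \<omega> q k f =
     (SUP j. SUP x\<in>{- c k..c k}.
        ereal (norm ((D a ^^ j) f x) * exp (- q * young_conj \<omega> (real j / q))))"

definition U :: "ereal \<Rightarrow> (nat \<Rightarrow> real) \<Rightarrow> (real \<Rightarrow> real) \<Rightarrow> (real \<Rightarrow> complex) set" where
  "U a c \<omega> = {f \<in> smooth a. \<forall>q k. 0 < q \<and> q < 1 \<longrightarrow> useminorm a c \<omega> q k f < \<infinity>}"

definition U_topology ::
  "ereal \<Rightarrow> (nat \<Rightarrow> real) \<Rightarrow> (real \<Rightarrow> real) \<Rightarrow> (real \<Rightarrow> complex) topology" where
  "U_topology a c \<omega> = topology_generated_by
     {{g \<in> U a c \<omega>. useminorm a c \<omega> q k (g - f) < ereal e} | f q k e.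
        f \<in> U a c \<omega> \<and> 0 < q \<and> q < 1 \<and> 0 < e}"

text \<open>Only the values of a functional on \<open>U a c \<omega>\<close> are relevant.\<close>

definition U_dual ::
  "ereal \<Rightarrow> (nat \<Rightarrow> real) \<Rightarrow> (real \<Rightarrow> real) \<Rightarrow> ((real \<Rightarrow> complex) \<Rightarrow> complex) set" where
  "U_dual a c \<omega> = {S. continuous_map (U_topology a c \<omega>) euclidean S \<and>
     (\<forall>f\<in>U a c \<omega>. \<forall>g\<in>U a c \<omega>. S (f + g) = S f + S g) \<and>
     (\<forall>f\<in>U a c \<omega>. \<forall>z. S (cscale z f) = z * S f)}"

definition vanishes_on ::
  "ereal \<Rightarrow> (nat \<Rightarrow> real) \<Rightarrow> (real \<Rightarrow> real) \<Rightarrow> ((real \<Rightarrow> complex) \<Rightarrow> complex) \<Rightarrow> real set \<Rightarrow> bool" where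
  "vanishes_on a c \<omega> S V \<longleftrightarrow>
     (\<forall>f\<in>U a c \<omega>. compact (closure {x. f x \<noteq> 0}) \<and> closure {x. f x \<noteq> 0} \<subseteq> V \<longrightarrow> S f = 0)"

definition usupp ::
  "ereal \<Rightarrow> (nat \<Rightarrow> real) \<Rightarrow> (real \<Rightarrow> real) \<Rightarrow> ((real \<Rightarrow> complex) \<Rightarrow> complex) \<Rightarrow> real set" where
  "usupp a c \<omega> S =
     symint a - \<Union>{V. open V \<and> V \<subseteq> symint a \<and> vanishes_on a c \<omega> S V}"

subsection \<open>Exponential monomials, Fourier-Laplace transform, multipliers\<close>

definition exp_monomial :: "ereal \<Rightarrow> nat \<Rightarrow> complex \<Rightarrow> (real \<Rightarrow> complex)" where
  "exp_monomial a j l =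
     restr a (\<lambda>t. complex_of_real t ^ j * exp (- \<i> * l * complex_of_real t))"

definition fourier_laplace ::
  "ereal \<Rightarrow> ((real \<Rightarrow> complex) \<Rightarrow> complex) \<Rightarrow> complex \<Rightarrow> complex" where
  "fourier_laplace a S z = S (restr a (\<lambda>t. exp (- \<i> * complex_of_real t * z)))"

text \<open>The multiplier class is given by its growth condition, which does not involve \<open>a\<close>. For
  \<open>a = \<infinity>\<close> it is essential that every \<open>\<epsilon> > 0\<close> is admitted in the term with \<open>Im z\<close>: the function
  \<open>e\<^sup>-\<^sup>i\<^sup>z\<close> acts continuously by multiplication on the space of transforms, but is not in the class.\<close>

definition multipliers :: "(real \<Rightarrow> real) \<Rightarrow> (complex \<Rightarrow> complex) set" where
  "multipliers \<omega> = {\<psi>. \<psi> holomorphic_on UNIV \<and>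
     (\<forall>\<epsilon>>0. bdd_above (range (\<lambda>z. norm (\<psi> z) * exp (- \<epsilon> * \<omega> (norm z) - \<epsilon> * \<bar>Im z\<bar>))))}"

text \<open>A set of points with multiplicities is represented by its multiplicity function, with
  value \<open>0\<close> off the set. Intersection is then the pointwise infimum. The zero function has
  every point as a zero of infinite multiplicity (\<^const>\<open>zorder\<close> is meaningless there).\<close>

definition zero_mult :: "(complex \<Rightarrow> complex) \<Rightarrow> complex \<Rightarrow> enat" where
  "zero_mult \<phi> l = (if \<forall>z. \<phi> z = 0 then \<infinity> else enat (nat (zorder \<phi> l)))"

subsection \<open>Invariant subspaces and weak spectral synthesis\<close>

definition D_invariant_subspace ::
  "ereal \<Rightarrow> (nat \<Rightarrow> real) \<Rightarrow> (real \<Rightarrow> real) \<Rightarrow> (real \<Rightarrow> complex) set \<Rightarrow> bool" where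
  "D_invariant_subspace a c \<omega> W \<longleftrightarrow>
     cfun.subspace W \<and> closedin (U_topology a c \<omega>) W \<and> D a ` W \<subseteq> W"

definition Exp_set :: "ereal \<Rightarrow> (real \<Rightarrow> complex) set \<Rightarrow> (real \<Rightarrow> complex) set" where
  "Exp_set a W = {exp_monomial a j l | j l. exp_monomial a j l \<in> W}"

definition is_exponent_sequence ::
  "ereal \<Rightarrow> (real \<Rightarrow> complex) set \<Rightarrow> (complex \<Rightarrow> enat) \<Rightarrow> bool" where
  "is_exponent_sequence a W m \<longleftrightarrow>
     countable {l. m l \<noteq> 0} \<and> (\<forall>l. m l \<noteq> \<infinity>) \<and>
     Exp_set a W = {exp_monomial a j l | j l. enat j < m l}"

definition W_vanish ::
  "ereal \<Rightarrow> (nat \<Rightarrow> real) \<Rightarrow> (real \<Rightarrow> real) \<Rightarrow> real set \<Rightarrow> (real \<Rightarrow> complex) set" where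
  "W_vanish a c \<omega> I = {f \<in> U a c \<omega>. \<forall>x\<in>I. f x = 0}"

definition is_residual_interval ::
  "ereal \<Rightarrow> (nat \<Rightarrow> real) \<Rightarrow> (real \<Rightarrow> real) \<Rightarrow> (real \<Rightarrow> complex) set \<Rightarrow> real set \<Rightarrow> bool" where
  "is_residual_interval a c \<omega> W I \<longleftrightarrow>
     rel_closed_interval a I \<and> W_vanish a c \<omega> I \<subseteq> W \<and>
     (\<forall>J. rel_closed_interval a J \<and> J \<subset> I \<longrightarrow> W_vanish a c \<omega> J - W \<noteq> {})"

definition residual_interval ::
  "ereal \<Rightarrow> (nat \<Rightarrow> real) \<Rightarrow> (real \<Rightarrow> real) \<Rightarrow> (real \<Rightarrow> complex) set \<Rightarrow> real set" where
  "residual_interval a c \<omega> W = (THE I. is_residual_interval a c \<omega> W I)"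

definition weak_spectral_synthesis ::
  "ereal \<Rightarrow> (nat \<Rightarrow> real) \<Rightarrow> (real \<Rightarrow> real) \<Rightarrow> (real \<Rightarrow> complex) set \<Rightarrow> bool" where
  "weak_spectral_synthesis a c \<omega> W \<longleftrightarrow>
     W = U_topology a c \<omega> closure_of
           (cfun.span (Exp_set a W) + W_vanish a c \<omega> (residual_interval a c \<omega> W))"

subsection \<open>Local convolution\<close>

definition set_quot :: "real set \<Rightarrow> real set \<Rightarrow> real set" where
  "set_quot A B = {x. (+) x ` B \<subseteq> A}"

definition conv_domain ::
  "ereal \<Rightarrow> (nat \<Rightarrow> real) \<Rightarrow> (real \<Rightarrow> real) \<Rightarrow> ((real \<Rightarrow> complex) \<Rightarrow> complex) \<Rightarrow> real set \<Rightarrow> real set" where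
  "conv_domain a c \<omega> S I = set_quot I (convex hull usupp a c \<omega> S)"

text \<open>For \<open>y\<close> in \<^const>\<open>conv_domain\<close> the function \<open>x \<mapsto> f (x + y)\<close> is in general only
  defined near the support of \<open>S\<close>, not on all of \<open>(-a;a)\<close>. Applying \<open>S\<close> to it means
  applying \<open>S\<close> to any element of \<open>U a c \<omega>\<close> that agrees with it near the support.\<close>

definition local_conv ::
  "ereal \<Rightarrow> (nat \<Rightarrow> real) \<Rightarrow> (real \<Rightarrow> real) \<Rightarrow> ((real \<Rightarrow> complex) \<Rightarrow> complex) \<Rightarrow>
     (real \<Rightarrow> complex) \<Rightarrow> real \<Rightarrow> complex" where
  "local_conv a c \<omega> S f y =
     (THE v. \<exists>h\<in>U a c \<omega>. (\<exists>V. open V \<and> usupp a c \<omega> S \<subseteq> V \<and> (\<forall>x\<in>V. h x = f (x + y))) \<and> v = S h)"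

definition ker_local_conv ::
  "ereal \<Rightarrow> (nat \<Rightarrow> real) \<Rightarrow> (real \<Rightarrow> real) \<Rightarrow> ((real \<Rightarrow> complex) \<Rightarrow> complex) \<Rightarrow> real set \<Rightarrow>
     (real \<Rightarrow> complex) set" where
  "ker_local_conv a c \<omega> S I =
     {f \<in> U a c \<omega>. \<forall>y\<in>conv_domain a c \<omega> S I. local_conv a c \<omega> S f y = 0}"

end

theory Submission
  imports Defs "HOL-Real_Asymp.Real_Asymp"
begin

text \<open>The transforms \<open>\<phi>\<^sub>\<alpha>\<close> of the \<open>S\<^sub>\<alpha>\<close> are of zero exponential type, so each nonzero \<open>S\<^sub>\<alpha>\<close> is
  carried by \<open>{0}\<close> and \<open>W\<close> consists of the \<open>f\<close> with \<open>S\<^sub>\<alpha> * f = 0\<close> on \<open>I\<close>. By the Hahn--Banach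
  theorem it suffices that a functional \<open>R\<close> vanishing on \<open>Exp(W)\<close> and on \<open>W\<^sub>I\<close> also vanishes at every
  \<open>f \<in> W\<close>. Such an \<open>R\<close> is carried by a compact interval \<open>[\<alpha>;\<beta>] \<subseteq> I\<close>, so one may take \<open>f\<close> with compact
  support. Put \<open>\<kappa>(s) = R(f(\<cdot> + s))\<close> and \<open>Y\<^sub>i(s) = S\<^sub>i(f(\<cdot> + s))\<close>, so that \<open>\<kappa>\<close> and \<open>Y\<^sub>i\<close> have the
  transforms \<open>\<psi> F\<close> and \<open>\<phi>\<^sub>i F\<close>. As \<open>Y\<^sub>i = 0\<close> on \<open>[\<alpha>;\<beta>]\<close>, it splits into a left and a right part; let
  \<open>v\<^sub>i\<close> be the transform of the left one. A Phragmen--Lindeloef argument shows that \<open>v\<^sub>i / \<phi>\<^sub>i\<close> does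
  not depend on \<open>i\<close>, and since \<open>\<psi>\<close> vanishes on the common zeros of the \<open>\<phi>\<^sub>i\<close>, the function
  \<open>G = (transform of \<kappa> on the negative half-line) - \<psi> v\<^sub>i / \<phi>\<^sub>i\<close> is entire. It turns out to be of zero
  type and bounded on the real axis, hence constant. The same holds for \<open>f'\<close>, for which \<open>G\<close>
  becomes \<open>\<kappa>(0) - \<i> z G(z)\<close>; therefore \<open>G = 0\<close>, and by the same token \<open>R(f) = \<kappa>(0) = 0\<close>.\<close>

section \<open>Entire functions of zero exponential type\<close>

text \<open>The obstacle is that nothing bounds the \<open>\<phi>\<^sub>i\<close> from below on the
  real axis. A minimum modulus theorem controls the quotient \<open>G\<close> only up to
  \<open>exp (\<epsilon> |z|)\<close> for every \<epsilon>, which still admits unbounded functions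
  of order less than one, so Liouville's theorem alone does not apply. The missing bound comes from
  the real line: all functions there are integrable with compact support, their transforms are
  bounded on the real axis, and the splitting into a left and a right part survives multiplication
  by any function of zero type. Hence powers of \<open>G\<close> can be multiplied onto the
  transform of \<open>Y\<close> while integral norms grow only geometrically. The conditions on the
  weight enter as follows. Sublinearity gives multipliers zero type and makes entire functions test
  functions; almost subadditivity makes the test functions an algebra;
  \<open>ln x = o(\<omega>(x))\<close> pays for finitely many derivatives and for polynomial
  factors; convergence of the integral provides the cut-offs that reduce \<open>f\<close> to compact
  support and the whole problem to the real line, where translates are unrestricted.\<close>

definition zero_type :: "(complex \<Rightarrow> complex) \<Rightarrow> bool" where
  "zero_type F \<longleftrightarrow> F holomorphic_on UNIV \<and> (\<forall>\<epsilon>>0. \<exists>C. \<forall>z. norm (F z) \<le> C * exp (\<epsilon> * norm z))"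

lemma zero_typeD:
  assumes "zero_type F" "\<epsilon> > 0"
  obtains C where "C > 0" "\<And>z. norm (F z) \<le> C * exp (\<epsilon> * norm z)"
proof -
  obtain C where C: "\<And>z. norm (F z) \<le> C * exp (\<epsilon> * norm z)"
    using assms unfolding zero_type_def by blast
  have "norm (F z) \<le> max C 1 * exp (\<epsilon> * norm z)" for z
    using C[of z] by (smt (verit, best) exp_gt_zero mult_right_mono)
  then show ?thesis using that[of "max C 1"] by auto
qed

text \<open>Order one lies below the critical order 2 of a quarter plane. The damping factor
  \<open>exp (- \<delta> * g z)\<close>, with \<open>g\<close> of order 3/2 strictly between the
  two, kills the growth on large arcs; in the end \<delta> tends to 0.\<close>

lemma phragmen_lindelof_quadrant:
  assumes hol: "f holomorphic_on UNIV"
    and growth: "\<And>z. norm (f z) \<le> C * exp (A * norm z)" and "A \<ge> 0"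
    and re: "\<And>x. x \<ge> 0 \<Longrightarrow> norm (f (of_real x)) \<le> M"
    and im: "\<And>y. y \<ge> 0 \<Longrightarrow> norm (f (\<i> * of_real y)) \<le> M"
    and p: "Re p \<ge> 0" "Im p \<ge> 0" and "M > 0"
  shows "norm (f p) \<le> M"
proof -
  \<comment> \<open>The rotation by -pi/4 makes the quadrant symmetric about the positive real axis,
    so that 3/2 times the argument stays within 3 pi/8 < pi/2. Adding 1 keeps the closed quadrant
    off the branch cut of the power.\<close>
  define \<zeta> :: complex where "\<zeta> = Complex (1 / sqrt 2) (- 1 / sqrt 2)"
  define w where "w z = 1 + \<zeta> * z" for z
  define g where "g z = w z powr (3 / 2)" for z
  define c0 where "c0 = cos (3 * pi / 8)"
  have c0: "c0 > 0" unfolding c0_def by (rule cos_gt_zero) auto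
  have w_re: "Re (w z) = 1 + (Re z + Im z) / sqrt 2" for z
    by (simp add: w_def \<zeta>_def add_divide_distrib)
  have w_im: "Im (w z) = (Im z - Re z) / sqrt 2" for z
    by (simp add: w_def \<zeta>_def diff_divide_distrib)
  have w1: "Re (w z) \<ge> 1" if "Re z \<ge> 0" "Im z \<ge> 0" for z
    unfolding w_re using that by simp
  have w2: "\<bar>Im (w z)\<bar> \<le> Re (w z)" if "Re z \<ge> 0" "Im z \<ge> 0" for z
  proof -
    have "\<bar>Im z - Re z\<bar> / sqrt 2 \<le> (Re z + Im z) / sqrt 2"
      using that by (intro divide_right_mono) auto
    then show ?thesis unfolding w_re w_im by (simp add: abs_divide)
  qed
  have w3: "norm (w z) \<ge> norm z / sqrt 2" if "Re z \<ge> 0" "Im z \<ge> 0" for z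
  proof -
    have "norm z \<le> Re z + Im z" using that cmod_le[of z] by simp
    then have "norm z / sqrt 2 \<le> Re (w z)" unfolding w_re
      by (simp add: divide_right_mono add_increasing)
    also have "\<dots> \<le> norm (w z)" by (rule complex_Re_le_cmod)
    finally show ?thesis .
  qed
  have arg: "\<bar>Arg (w z)\<bar> \<le> pi / 4" if "Re z \<ge> 0" "Im z \<ge> 0" for z
  proof -
    have "Re (w z) > 0" using w1[OF that] by simp
    then have "Arg (w z) = arctan (Im (w z) / Re (w z))" by (rule arg_conv_arctan)
    moreover have "\<bar>Im (w z) / Re (w z)\<bar> \<le> 1"
      using w2[OF that] w1[OF that] by (simp add: abs_divide)
    ultimately show ?thesis
      using arctan_monotone'[of "Im (w z) / Re (w z)" 1] arctan_monotone'[of "-1" "Im (w z) / Re (w z)"]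
      unfolding arctan_one arctan_minus by linarith
  qed
  have g_re: "Re (g z) \<ge> c0 * (norm z / sqrt 2) powr (3 / 2)" if "Re z \<ge> 0" "Im z \<ge> 0" for z
  proof -
    have nz: "w z \<noteq> 0" using w1[OF that] by auto
    have "Re (g z) = norm (w z) powr (3 / 2) * cos (3 / 2 * Arg (w z))"
      using nz unfolding g_def by (simp add: powr_def Re_exp Arg_eq_Im_Ln exp_of_real)
    moreover have "cos (3 / 2 * Arg (w z)) \<ge> c0"
    proof -
      have "\<bar>3 / 2 * Arg (w z)\<bar> \<le> 3 * pi / 8" using arg[OF that] by (simp add: abs_mult)
      then have "cos (3 * pi / 8) \<le> cos \<bar>3 / 2 * Arg (w z)\<bar>"
        by (intro cos_monotone_0_pi_le) auto
      then show ?thesis unfolding cos_abs_real c0_def .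
    qed
    moreover have "norm (w z) powr (3 / 2) \<ge> (norm z / sqrt 2) powr (3 / 2)"
      using w3[OF that] by (intro powr_mono2) auto
    ultimately have "Re (g z) \<ge> norm (w z) powr (3 / 2) * c0"
      by (simp add: mult_left_mono)
    also have "norm (w z) powr (3 / 2) * c0 \<ge> (norm z / sqrt 2) powr (3 / 2) * c0"
      using \<open>norm (w z) powr (3 / 2) \<ge> _\<close> c0 by (intro mult_right_mono) auto
    finally show ?thesis by (simp add: mult.commute)
  qed
  have g_re0: "Re (g z) \<ge> 0" if "Re z \<ge> 0" "Im z \<ge> 0" for z
    using g_re[OF that] c0 by (smt (verit) mult_nonneg_nonneg powr_ge_zero)
  have C0: "C \<ge> 0" using order_trans[OF norm_ge_zero growth[of 0]] by simp
  have main: "norm (f p) * exp (- \<delta> * Re (g p)) \<le> M" if \<delta>: "\<delta> > 0" for \<delta>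
  proof -
    have "((\<lambda>R. C * exp (A * R - \<delta> * (c0 * (R / sqrt 2) powr (3 / 2)))) \<longlongrightarrow> 0) at_top"
      using \<delta> c0 by real_asymp
    then have "eventually (\<lambda>R. C * exp (A * R - \<delta> * (c0 * (R / sqrt 2) powr (3 / 2))) < M) at_top"
      using \<open>M > 0\<close> by (auto elim: order_tendstoD(2))
    then obtain R0 where R0: "\<And>R. R \<ge> R0 \<Longrightarrow> C * exp (A * R - \<delta> * (c0 * (R / sqrt 2) powr (3 / 2))) < M"
      by (auto simp: eventually_at_top_linorder)
    define R where "R = max R0 (norm p + 1)"
    define S where "S = {z. Re z \<ge> 0 \<and> Im z \<ge> 0 \<and> norm z \<le> R}"
    define h where "h z = f z * exp (- of_real \<delta> * g z)" for z
    have clS: "closed S" unfolding S_def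
      by (intro closed_Collect_conj closed_Collect_le continuous_intros)
    have w_slit: "w z \<notin> \<real>\<^sub>\<le>\<^sub>0" if "z \<in> S" for z
      using w1[of z] that by (auto simp: S_def complex_nonpos_Reals_iff)
    have h_hol: "h holomorphic_on S"
      unfolding h_def g_def using w_slit unfolding w_def
      by (intro holomorphic_intros holomorphic_on_subset[OF hol]) auto
    have h_norm: "norm (h z) = norm (f z) * exp (- \<delta> * Re (g z))" for z
      by (simp add: h_def norm_mult)
    have "norm (h p) \<le> M"
    proof (rule maximum_modulus_frontier[where f = h and S = S])
      show "h holomorphic_on interior S"
        using h_hol interior_subset holomorphic_on_subset by blast
      show "continuous_on (closure S) h"
        using h_hol clS holomorphic_on_imp_continuous_on by auto
      show "bounded S" unfolding S_def bounded_iff by auto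
      show "p \<in> S" using p by (simp add: S_def R_def)
    next
      fix z assume "z \<in> frontier S"
      then have zS: "z \<in> S" and zi: "z \<notin> interior S"
        using clS by (auto simp: frontier_def)
      have "Re z = 0 \<or> Im z = 0 \<or> norm z = R"
      proof (rule ccontr)
        assume "\<not> ?thesis"
        with zS have z: "z \<in> {z. Re z > 0 \<and> Im z > 0 \<and> norm z < R}" by (auto simp: S_def)
        moreover have "open {z. Re z > 0 \<and> Im z > 0 \<and> norm z < R}"
          by (intro open_Collect_conj open_Collect_less continuous_intros)
        moreover have "{z. Re z > 0 \<and> Im z > 0 \<and> norm z < R} \<subseteq> S" by (auto simp: S_def)
        ultimately have "z \<in> interior S" by (meson interiorI)
        then show False using zi by simp
      qed
      moreover have le: "norm (h z) \<le> norm (f z)"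
        using g_re0[of z] zS \<delta> unfolding h_norm S_def by (auto intro!: mult_left_le)
      moreover have "norm (f z) \<le> M" if "Re z = 0"
      proof -
        have "z = \<i> * of_real (Im z)" using that by (simp add: complex_eq_iff)
        then show ?thesis using im[of "Im z"] zS by (auto simp: S_def)
      qed
      moreover have "norm (f z) \<le> M" if "Im z = 0"
      proof -
        have "z = of_real (Re z)" using that by (simp add: complex_eq_iff)
        then show ?thesis using re[of "Re z"] zS by (auto simp: S_def)
      qed
      moreover have "norm (h z) \<le> M" if "norm z = R"
      proof -
        have "norm (h z) \<le> C * exp (A * R) * exp (- \<delta> * (c0 * (R / sqrt 2) powr (3 / 2)))"
          unfolding h_norm using growth[of z] g_re[of z] zS that \<delta> C0
          by (intro mult_mono) (auto simp: S_def mult_left_mono)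
        also have "\<dots> = C * exp (A * R - \<delta> * (c0 * (R / sqrt 2) powr (3 / 2)))"
          by (simp add: exp_diff exp_minus field_simps)
        also have "\<dots> < M" by (rule R0) (simp add: R_def)
        finally show ?thesis by simp
      qed
      ultimately show "norm (h z) \<le> M" by linarith
    qed
    then show ?thesis by (simp add: h_norm)
  qed
  have "((\<lambda>\<delta>. norm (f p) * exp (- \<delta> * Re (g p))) \<longlongrightarrow> norm (f p) * exp (- 0 * Re (g p))) (at_right 0)"
    by (intro tendsto_intros)
  then show ?thesis
    using main by (intro tendsto_upperbound[where F = "at_right 0"])
      (auto simp: eventually_at_right_less elim: eventually_mono[OF eventually_at_right_less[of "0::real"]])
qed

text \<open>For a half-plane order one is critical, so a bound on the positive ray is assumed. It
  cuts the half-plane into two quadrants and gives the crude bound \<open>max B M\<close>; division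
  by \<open>1 + \<delta> z\<close>, which has modulus at least 1 there, brings this down to
  \<open>M\<close> as \<delta> tends to 0.\<close>

lemma phragmen_lindelof_half_plane:
  assumes hol: "f holomorphic_on UNIV"
    and growth: "\<And>z. norm (f z) \<le> C * exp (A * norm z)" and "A \<ge> 0"
    and re: "\<And>x. x \<ge> 0 \<Longrightarrow> norm (f (of_real x)) \<le> B"
    and im: "\<And>y. norm (f (\<i> * of_real y)) \<le> M"
    and p: "Re p \<ge> 0" and "M > 0"
  shows "norm (f p) \<le> M"
proof -
  define B' where "B' = max B M"
  have B': "norm (f z) \<le> B'" if "Re z \<ge> 0" for z
  proof (cases "Im z \<ge> 0")
    case True
    show ?thesis
      by (rule phragmen_lindelof_quadrant[where f = f and p = z, OF hol growth \<open>A \<ge> 0\<close>])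
        (use re im that True \<open>M > 0\<close> in \<open>auto simp: B'_def le_max_iff_disj less_max_iff_disj\<close>)
  next
    case False
    have "norm ((\<lambda>z. f (- \<i> * z)) (\<i> * z)) \<le> B'"
    proof (rule phragmen_lindelof_quadrant[where f = "\<lambda>z. f (- \<i> * z)" and p = "\<i> * z" and C = C and A = A])
      show "(\<lambda>z. f (- \<i> * z)) holomorphic_on UNIV"
        by (intro holomorphic_on_compose_gen[OF _ hol, unfolded o_def] holomorphic_intros) auto
      show "norm (f (- \<i> * z)) \<le> C * exp (A * norm z)" for z
        using growth[of "- \<i> * z"] by (simp add: norm_mult)
      show "norm (f (- \<i> * of_real x)) \<le> B'" for x
        using im[of "- x"] by (simp add: B'_def le_max_iff_disj)
      show "norm (f (- \<i> * (\<i> * of_real y))) \<le> B'" if "y \<ge> 0" for y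
        using re[OF that] by (simp add: B'_def le_max_iff_disj)
    qed (use that False \<open>M > 0\<close> \<open>A \<ge> 0\<close> in \<open>auto simp: B'_def less_max_iff_disj\<close>)
    then show ?thesis by simp
  qed
  have main: "norm (f p) \<le> M * norm (1 + of_real \<delta> * p)" if \<delta>: "\<delta> > 0" for \<delta>
  proof -
    \<comment> \<open>On a circle of radius at least \<open>B' / (M * \<delta>)\<close> the
      denominator alone brings the crude bound \<open>B'\<close> down to \<open>M\<close>.\<close>
    define R where "R = max (norm p) (B' / (M * \<delta>))"
    define S where "S = {z. Re z \<ge> 0 \<and> norm z \<le> R}"
    define h where "h z = f z / (1 + of_real \<delta> * z)" for z
    have clS: "closed S" unfolding S_def
      by (intro closed_Collect_conj closed_Collect_le continuous_intros)
    have den: "norm (1 + of_real \<delta> * z) \<ge> 1 + \<delta> * Re z" "norm (1 + of_real \<delta> * z) \<ge> \<delta> * norm z"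
      if "Re z \<ge> 0" for z
    proof -
      show "norm (1 + of_real \<delta> * z) \<ge> 1 + \<delta> * Re z"
        using complex_Re_le_cmod[of "1 + of_real \<delta> * z"] by simp
      have "(\<delta> * norm z)\<^sup>2 \<le> (norm (1 + of_real \<delta> * z))\<^sup>2"
        using that \<delta> unfolding power_mult_distrib cmod_power2
        by (simp add: power2_eq_square algebra_simps)
      then show "norm (1 + of_real \<delta> * z) \<ge> \<delta> * norm z" by (rule power2_le_imp_le) simp
    qed
    have den1: "norm (1 + of_real \<delta> * z) \<ge> 1" if "Re z \<ge> 0" for z
      using den(1)[OF that] that \<delta> by (smt (verit) mult_nonneg_nonneg)
    have h_hol: "h holomorphic_on S"
      unfolding h_def using den1
      by (intro holomorphic_intros holomorphic_on_subset[OF hol]) (force simp: S_def)+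
    have "norm (h p) \<le> M"
    proof (rule maximum_modulus_frontier[where f = h and S = S])
      show "h holomorphic_on interior S"
        using h_hol interior_subset holomorphic_on_subset by blast
      show "continuous_on (closure S) h"
        using h_hol clS holomorphic_on_imp_continuous_on by auto
      show "bounded S" unfolding S_def bounded_iff by auto
      show "p \<in> S" using p by (simp add: S_def R_def)
    next
      fix z assume "z \<in> frontier S"
      then have zS: "z \<in> S" and zi: "z \<notin> interior S"
        using clS by (auto simp: frontier_def)
      have "Re z = 0 \<or> norm z = R"
      proof (rule ccontr)
        assume "\<not> ?thesis"
        with zS have z: "z \<in> {z. Re z > 0 \<and> norm z < R}" by (auto simp: S_def)
        moreover have "open {z. Re z > 0 \<and> norm z < R}"
          by (intro open_Collect_conj open_Collect_less continuous_intros)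
        moreover have "{z. Re z > 0 \<and> norm z < R} \<subseteq> S" by (auto simp: S_def)
        ultimately have "z \<in> interior S" by (meson interiorI)
        then show False using zi by simp
      qed
      then show "norm (h z) \<le> M"
      proof
        assume "Re z = 0"
        then have "z = \<i> * of_real (Im z)" by (simp add: complex_eq_iff)
        then have "norm (f z) \<le> M" using im[of "Im z"] by simp
        moreover have "M * 1 \<le> M * norm (1 + of_real \<delta> * z)"
          using den1[of z] \<open>Re z = 0\<close> \<open>M > 0\<close> by (intro mult_left_mono) auto
        ultimately have "norm (f z) \<le> M * norm (1 + of_real \<delta> * z)" by linarith
        then show ?thesis using den1[of z] \<open>Re z = 0\<close> \<open>M > 0\<close>
          by (simp add: h_def norm_divide divide_le_eq)
      next
        assume R: "norm z = R"
        have z: "Re z \<ge> 0" using zS by (simp add: S_def)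
        have "B' \<le> M * (\<delta> * R)"
          using \<delta> \<open>M > 0\<close> by (simp add: R_def field_simps max_def)
        also have "\<dots> \<le> M * norm (1 + of_real \<delta> * z)"
          using den(2)[OF z] \<open>M > 0\<close> R by (intro mult_left_mono) auto
        finally show ?thesis using B'[OF z] den1[OF z] \<open>M > 0\<close>
          by (simp add: h_def norm_divide divide_le_eq)
      qed
    qed
    moreover have "1 + of_real \<delta> * p \<noteq> 0" using den1[OF p] by auto
    ultimately show ?thesis by (simp add: h_def norm_divide divide_le_eq)
  qed
  have "((\<lambda>\<delta>. M * norm (1 + of_real \<delta> * p)) \<longlongrightarrow> M * norm (1 + of_real 0 * p)) (at_right 0)"
    by (intro tendsto_intros)
  then show ?thesis
    using main by (intro tendsto_lowerbound[where F = "at_right 0"])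
      (auto elim: eventually_mono[OF eventually_at_right_less[of "0::real"]])
qed

text \<open>The factor \<open>exp (- \<epsilon> * z)\<close> has modulus 1 on the imaginary axis and
  makes \<open>F\<close> bounded on the positive ray; that this works for every \<epsilon> is
  exactly zero type.\<close>

lemma zero_type_bounded_half_plane:
  assumes F: "zero_type F" and im: "\<And>y. norm (F (\<i> * of_real y)) \<le> M" and p: "Re p \<ge> 0" and "M > 0"
  shows "norm (F p) \<le> M"
proof -
  have main: "norm (F p) \<le> M * exp (\<epsilon> * Re p)" if \<epsilon>: "\<epsilon> > 0" for \<epsilon>
  proof -
    obtain C where C: "C > 0" "\<And>z. norm (F z) \<le> C * exp (\<epsilon> * norm z)"
      using zero_typeD[OF F \<epsilon>] by blast
    define f where "f z = F z * exp (- of_real \<epsilon> * z)" for z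
    have nf: "norm (f z) = norm (F z) * exp (- \<epsilon> * Re z)" for z
      by (simp add: f_def norm_mult)
    have "norm (f p) \<le> M"
    proof (rule phragmen_lindelof_half_plane[where f = f and p = p and C = C and A = "2 * \<epsilon>" and B = C])
      show "f holomorphic_on UNIV"
        using F unfolding f_def zero_type_def by (intro holomorphic_intros) auto
      show "norm (f z) \<le> C * exp (2 * \<epsilon> * norm z)" for z
      proof -
        have "exp (- \<epsilon> * Re z) \<le> exp (\<epsilon> * norm z)"
          using mult_left_mono[of "- Re z" "norm z" \<epsilon>] abs_Re_le_cmod[of z] \<epsilon> by (simp add: abs_le_iff)
        then have "norm (f z) \<le> (C * exp (\<epsilon> * norm z)) * exp (\<epsilon> * norm z)"
          unfolding nf using C by (intro mult_mono) auto
        also have "\<dots> = C * exp (2 * \<epsilon> * norm z)" by (simp flip: exp_add)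
        finally show ?thesis .
      qed
      show "norm (f (of_real x)) \<le> C" if "x \<ge> 0" for x
        using C(2)[of "of_real x"] that by (simp add: nf exp_minus field_simps)
      show "norm (f (\<i> * of_real y)) \<le> M" for y
        using im[of y] by (simp add: nf)
    qed (use \<epsilon> p \<open>M > 0\<close> in auto)
    then show ?thesis by (simp add: nf exp_minus field_simps)
  qed
  have "((\<lambda>\<epsilon>. M * exp (\<epsilon> * Re p)) \<longlongrightarrow> M * exp (0 * Re p)) (at_right 0)"
    by (intro tendsto_intros)
  then show ?thesis
    using main by (intro tendsto_lowerbound[where F = "at_right 0"])
      (auto elim: eventually_mono[OF eventually_at_right_less[of "0::real"]])
qed

lemma zero_type_scale:
  assumes "zero_type F" "norm u = 1"
  shows "zero_type (\<lambda>z. F (u * z))"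
  unfolding zero_type_def
proof (intro conjI allI impI)
  show "(\<lambda>z. F (u * z)) holomorphic_on UNIV"
    using holomorphic_on_compose_gen[of "\<lambda>z. u * z" UNIV F UNIV] assms
    by (auto simp: zero_type_def o_def intro: holomorphic_intros)
  fix \<epsilon> :: real assume "\<epsilon> > 0"
  then obtain C where "\<And>z. norm (F z) \<le> C * exp (\<epsilon> * norm z)"
    using zero_typeD[OF assms(1)] by blast
  then show "\<exists>C. \<forall>z. norm (F (u * z)) \<le> C * exp (\<epsilon> * norm z)"
    using assms(2) by (metis mult_1 norm_mult)
qed

text \<open>Liouville's theorem after the bounds in both half-planes. Zero type is essential:
  \<open>exp\<close> is bounded on the imaginary axis.\<close>

theorem zero_type_bounded_imaginary_axis:
  assumes F: "zero_type F" and im: "\<And>y. norm (F (\<i> * of_real y)) \<le> M"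
  obtains c where "\<And>z. F z = c"
proof -
  define M' where "M' = max M 1"
  have "norm (F z) \<le> M'" for z
  proof (cases "Re z \<ge> 0")
    case True
    then show ?thesis
      using im by (intro zero_type_bounded_half_plane[where p = z, OF F]) (simp_all add: M'_def le_max_iff_disj)
  next
    case False
    have "norm (F (- 1 * y)) \<le> M'" if "Re y \<ge> 0" for y
    proof (rule zero_type_bounded_half_plane[where p = y, OF zero_type_scale[OF F, of "- 1"] _ that])
      show "norm (F (- 1 * (\<i> * of_real x))) \<le> M'" for x
        using im[of "- x"] by (simp add: M'_def le_max_iff_disj)
    qed (auto simp: M'_def)
    from this[of "- z"] False show ?thesis by simp
  qed
  then have "bounded (range F)" unfolding bounded_iff by auto
  then have "F constant_on UNIV"
    using F Liouville_theorem zero_type_def by blast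
  then show ?thesis using that unfolding constant_on_def by auto
qed

theorem zero_type_bounded_real_axis:
  assumes F: "zero_type F" and re: "\<And>x. norm (F (of_real x)) \<le> M"
  obtains c where "\<And>z. F z = c"
proof -
  have "norm (F (- \<i> * (\<i> * of_real y))) \<le> M" for y
    using re[of y] by simp
  then obtain c where "F (- \<i> * z) = c" for z
    using zero_type_bounded_imaginary_axis[OF zero_type_scale[OF F, of "- \<i>"]] by auto
  from this[of "\<i> * _"] show ?thesis using that by auto
qed

section \<open>Fourier--Laplace integrals of compactly supported functions\<close>

definition cl1 :: "(real \<Rightarrow> complex) \<Rightarrow> bool" where
  "cl1 Y \<longleftrightarrow> integrable lborel Y \<and> (\<exists>T. \<forall>s. \<bar>s\<bar> > T \<longrightarrow> Y s = 0)"

text \<open>The sign is opposite to the one in \<open>fourier_laplace\<close>, so that the transform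
  of the function \<open>x \<mapsto> S (u (\<cdot> + x))\<close> becomes a plain product
  (\<open>ft_translate\<close>). With this sign, mass on a left half-line is controlled for
  \<open>Im z \<le> 0\<close> and mass on a right half-line for \<open>Im z \<ge> 0\<close>.\<close>

definition ft :: "(real \<Rightarrow> complex) \<Rightarrow> complex \<Rightarrow> complex" where
  "ft Y z = (LINT s|lborel. exp (\<i> * z * of_real s) * Y s)"

definition l1 :: "(real \<Rightarrow> complex) \<Rightarrow> real" where
  "l1 Y = (LINT s|lborel. norm (Y s))"

definition left_part :: "real \<Rightarrow> (real \<Rightarrow> complex) \<Rightarrow> real \<Rightarrow> complex" where
  "left_part c Y = (\<lambda>s. if s < c then Y s else 0)"

lemma l1_nonneg: "l1 Y \<ge> 0"
  unfolding l1_def by (intro integral_nonneg_AE) auto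

section \<open>Operations on integrable functions of compact support\<close>

lemma cl1_mult_continuous:
  assumes Y: "cl1 Y" and g: "continuous_on UNIV g"
  shows "cl1 (\<lambda>s. g s * Y s)"
proof -
  obtain T where T: "\<And>s. \<bar>s\<bar> > T \<Longrightarrow> Y s = 0" and iY: "integrable lborel Y"
    using Y unfolding cl1_def by blast
  have "compact (g ` {-T..T})"
    using compact_continuous_image[OF continuous_on_subset[OF g]] by auto
  then obtain B where B: "\<And>s. s \<in> {-T..T} \<Longrightarrow> norm (g s) \<le> B"
    by (metis bounded_iff compact_imp_bounded imageI)
  have "integrable lborel (\<lambda>s. g s * Y s)"
  proof (rule Bochner_Integration.integrable_bound)
    show "integrable lborel (\<lambda>s. of_real B * Y s)" using iY by simp
    have "g \<in> borel_measurable borel" by (rule borel_measurable_continuous_onI[OF g])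
    then show "(\<lambda>s. g s * Y s) \<in> borel_measurable lborel" using iY by measurable
    have "norm (g s * Y s) \<le> norm (of_real B * Y s)" for s
    proof (cases "\<bar>s\<bar> > T")
      case False
      then have "norm (g s) \<le> \<bar>B\<bar>" using B[of s] by (force simp: not_less abs_le_iff)
      then show ?thesis by (simp add: norm_mult mult_right_mono)
    qed (simp add: T)
    then show "AE s in lborel. norm (g s * Y s) \<le> norm (of_real B * Y s)" by simp
  qed
  then show ?thesis unfolding cl1_def using T by (auto intro!: exI[of _ T])
qed

lemma cl1_exp: "cl1 Y \<Longrightarrow> cl1 (\<lambda>s. exp (\<i> * z * of_real s) * Y s)"
  by (intro cl1_mult_continuous continuous_intros)

lemma integrable_ft: "cl1 Y \<Longrightarrow> integrable lborel (\<lambda>s. exp (\<i> * z * of_real s) * Y s)"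
  using cl1_exp cl1_def by blast

lemma cl1_left_part: "cl1 Y \<Longrightarrow> cl1 (left_part c Y)"
proof -
  assume Y: "cl1 Y"
  have "integrable lborel (left_part c Y)"
  proof (rule Bochner_Integration.integrable_bound)
    show "integrable lborel Y" using Y cl1_def by blast
    then show "left_part c Y \<in> borel_measurable lborel" unfolding left_part_def by measurable
  qed (auto simp: left_part_def)
  then show ?thesis using Y unfolding cl1_def by (auto simp: left_part_def)
qed

lemma l1_left_part: "cl1 Y \<Longrightarrow> l1 (left_part c Y) \<le> l1 Y"
  unfolding l1_def using cl1_left_part[of Y c]
  by (intro integral_mono) (auto simp: cl1_def left_part_def)

lemma cl1_add: "cl1 X \<Longrightarrow> cl1 Y \<Longrightarrow> cl1 (\<lambda>s. X s + Y s)"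
proof -
  assume "cl1 X" "cl1 Y"
  then obtain S T where "\<And>s. \<bar>s\<bar> > S \<Longrightarrow> X s = 0" "\<And>s. \<bar>s\<bar> > T \<Longrightarrow> Y s = 0"
    unfolding cl1_def by metis
  then have "\<forall>s. \<bar>s\<bar> > max S T \<longrightarrow> X s + Y s = 0" by simp
  then show ?thesis using \<open>cl1 X\<close> \<open>cl1 Y\<close> unfolding cl1_def by blast
qed

lemma cl1_cmult: "cl1 Y \<Longrightarrow> cl1 (\<lambda>s. a * Y s)"
  unfolding cl1_def by auto

lemma cl1_diff: "cl1 X \<Longrightarrow> cl1 Y \<Longrightarrow> cl1 (\<lambda>s. X s - Y s)"
  using cl1_add[of X "\<lambda>s. - 1 * Y s"] cl1_cmult[of Y "- 1"] by simp

lemma ft_diff: "cl1 X \<Longrightarrow> cl1 Y \<Longrightarrow> ft (\<lambda>s. X s - Y s) z = ft X z - ft Y z"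
  unfolding ft_def using integrable_ft[of X z] integrable_ft[of Y z] by (simp add: right_diff_distrib)

lemma l1_diff: "cl1 X \<Longrightarrow> cl1 Y \<Longrightarrow> l1 (\<lambda>s. X s - Y s) \<le> l1 X + l1 Y"
proof -
  assume X: "cl1 X" and Y: "cl1 Y"
  have "l1 (\<lambda>s. X s - Y s) \<le> (LINT s|lborel. norm (X s) + norm (Y s))"
    unfolding l1_def using X Y
    by (intro integral_mono) (auto simp: cl1_def norm_triangle_ineq4)
  also have "\<dots> = l1 X + l1 Y"
    unfolding l1_def using X Y by (intro Bochner_Integration.integral_add) (auto simp: cl1_def)
  finally show ?thesis .
qed

section \<open>Bounds and holomorphy of the transform\<close>

lemma ft_bound:
  assumes "cl1 Y" and K: "\<And>s. Y s \<noteq> 0 \<Longrightarrow> - (Im z * s) \<le> K"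
  shows "norm (ft Y z) \<le> l1 Y * exp K"
proof -
  have "norm (ft Y z) \<le> (LINT s|lborel. norm (exp (\<i> * z * of_real s) * Y s))"
    unfolding ft_def by (rule integral_norm_bound)
  also have "\<dots> \<le> (LINT s|lborel. norm (Y s) * exp K)"
  proof (intro integral_mono)
    show "integrable lborel (\<lambda>s. norm (exp (\<i> * z * of_real s) * Y s))"
      using integrable_ft[OF assms(1)] by (rule integrable_norm)
    show "integrable lborel (\<lambda>s. norm (Y s) * exp K)" using assms(1) by (auto simp: cl1_def)
    show "norm (exp (\<i> * z * of_real s) * Y s) \<le> norm (Y s) * exp K" for s
      using K[of s] by (cases "Y s = 0") (auto simp: norm_mult)
  qed
  also have "\<dots> = l1 Y * exp K" by (simp add: l1_def)
  finally show ?thesis .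
qed

lemma ft_real_bound: "cl1 Y \<Longrightarrow> norm (ft Y (of_real x)) \<le> l1 Y"
  using ft_bound[of Y "of_real x" 0] by simp

lemma norm_exp_taylor2:
  fixes w :: complex
  shows "norm (exp w - 1 - w) \<le> (norm w)\<^sup>2 * exp (norm w)"
proof -
  have "norm (exp w - (\<Sum>i\<le>1. w ^ i / fact i)) \<le> exp \<bar>Re w\<bar> * (norm w) ^ Suc 1 / fact 1"
    by (rule Taylor_exp)
  also have "\<dots> \<le> exp (norm w) * (norm w)\<^sup>2"
    using abs_Re_le_cmod[of w] by (simp add: power2_eq_square mult_right_mono)
  finally show ?thesis by (simp add: mult.commute diff_diff_eq)
qed

lemma ft_has_derivative:
  assumes Y: "cl1 Y"
  shows "(ft Y has_field_derivative ft (\<lambda>s. \<i> * of_real s * Y s) z) (at z)"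
proof -
  obtain T where T: "\<And>s. \<bar>s\<bar> > T \<Longrightarrow> Y s = 0" and iY: "integrable lborel Y"
    using Y unfolding cl1_def by blast
  define T' where "T' = max T 0"
  have T': "T' \<ge> 0" "\<And>s. \<bar>s\<bar> > T' \<Longrightarrow> Y s = 0" using T by (auto simp: T'_def)
  define Y' where "Y' = (\<lambda>s. \<i> * of_real s * Y s)"
  have Y': "cl1 Y'" unfolding Y'_def by (intro cl1_mult_continuous[OF Y] continuous_intros)
  define K where "K = l1 Y * (exp (norm z * T') * (T'\<^sup>2 * exp T'))"
  have bound: "norm (ft Y (z + h) - ft Y z - ft Y' z * h) \<le> K * (norm h)\<^sup>2" if h: "norm h \<le> 1" for h
  proof -
    have "ft Y (z + h) - ft Y z - ft Y' z * h = (LINT s|lborel. exp (\<i> * (z + h) * of_real s) * Y s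
        - exp (\<i> * z * of_real s) * Y s - exp (\<i> * z * of_real s) * Y' s * h)"
      unfolding ft_def using integrable_ft[OF Y] integrable_ft[OF Y'] by simp
    also have "norm \<dots> \<le> (LINT s|lborel. norm (Y s) * (exp (norm z * T') * (T'\<^sup>2 * exp T') * (norm h)\<^sup>2))"
    proof (rule order_trans[OF integral_norm_bound], rule integral_mono)
      show "integrable lborel (\<lambda>s. norm (exp (\<i> * (z + h) * of_real s) * Y s
        - exp (\<i> * z * of_real s) * Y s - exp (\<i> * z * of_real s) * Y' s * h))"
        using integrable_ft[OF Y] integrable_ft[OF Y'] by simp
      show "integrable lborel (\<lambda>s. norm (Y s) * (exp (norm z * T') * (T'\<^sup>2 * exp T') * (norm h)\<^sup>2))"
        using iY by simp
      fix s :: real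
      show "norm (exp (\<i> * (z + h) * of_real s) * Y s
        - exp (\<i> * z * of_real s) * Y s - exp (\<i> * z * of_real s) * Y' s * h)
        \<le> norm (Y s) * (exp (norm z * T') * (T'\<^sup>2 * exp T') * (norm h)\<^sup>2)"
      proof (cases "\<bar>s\<bar> > T'")
        case False
        define w where "w = \<i> * h * of_real s"
        have "norm w = norm h * \<bar>s\<bar>" by (simp add: w_def norm_mult)
        then have w: "norm w \<le> norm h * T'" "norm w \<le> T'"
          using False h mult_mono[of "norm h" 1 "\<bar>s\<bar>" T'] by (auto simp: mult_left_mono)
        have "norm (exp w - 1 - w) \<le> (norm w)\<^sup>2 * exp (norm w)" by (rule norm_exp_taylor2)
        also have "\<dots> \<le> (norm h * T')\<^sup>2 * exp T'"
          using w by (intro mult_mono power_mono) auto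
        finally have 1: "norm (exp w - 1 - w) \<le> T'\<^sup>2 * exp T' * (norm h)\<^sup>2"
          by (simp add: power_mult_distrib mult_ac)
        have "- (Im z * s) \<le> norm z * T'"
          using False abs_Im_le_cmod[of z] mult_mono[of "\<bar>Im z\<bar>" "norm z" "\<bar>s\<bar>" T']
          by (simp add: abs_mult[symmetric] abs_le_iff not_less)
        then have 2: "norm (exp (\<i> * z * of_real s)) \<le> exp (norm z * T')" by simp
        have "exp (\<i> * (z + h) * of_real s) * Y s - exp (\<i> * z * of_real s) * Y s - exp (\<i> * z * of_real s) * Y' s * h
          = exp (\<i> * z * of_real s) * (exp w - 1 - w) * Y s"
          by (simp add: w_def Y'_def algebra_simps exp_add)
        also have "norm \<dots> \<le> exp (norm z * T') * (T'\<^sup>2 * exp T' * (norm h)\<^sup>2) * norm (Y s)"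
          unfolding norm_mult using 1 2 by (intro mult_mono) auto
        finally show ?thesis by (simp add: mult_ac)
      qed (simp add: T' Y'_def)
    qed
    also have "\<dots> = K * (norm h)\<^sup>2" by (simp add: K_def l1_def mult_ac)
    finally show ?thesis .
  qed
  have "((\<lambda>h. (ft Y (z + h) - ft Y z) / h) \<longlongrightarrow> ft Y' z) (at 0)"
  proof (rule LIM_zero_cancel, rule Lim_null_comparison)
    show "eventually (\<lambda>h. norm ((ft Y (z + h) - ft Y z) / h - ft Y' z) \<le> K * norm h) (at 0)"
    proof -
      have "eventually (\<lambda>h. h \<noteq> 0 \<and> norm h < 1) (at (0::complex))"
        by (auto simp: eventually_at intro!: exI[of _ 1])
      then show ?thesis
      proof eventually_elim
        case (elim h)
        have "(ft Y (z + h) - ft Y z) / h - ft Y' z = (ft Y (z + h) - ft Y z - ft Y' z * h) / h"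
          using elim by (simp add: field_simps)
        also have "norm \<dots> \<le> K * (norm h)\<^sup>2 / norm h"
          using bound[of h] elim by (simp add: norm_divide divide_right_mono)
        finally show ?case using elim by (simp add: power2_eq_square)
      qed
    qed
    show "((\<lambda>h. K * norm (h::complex)) \<longlongrightarrow> 0) (at 0)"
      by (rule tendsto_eq_intros refl | simp)+
  qed
  then show ?thesis by (simp add: DERIV_def Y'_def)
qed

lemma ft_holomorphic: "cl1 Y \<Longrightarrow> ft Y holomorphic_on UNIV"
  using ft_has_derivative by (auto simp: holomorphic_on_open)

lemma cl1_continuous:
  assumes "continuous_on UNIV Y" "\<And>s. \<bar>s\<bar> > T \<Longrightarrow> Y s = 0"
  shows "cl1 Y"
proof -
  have "integrable lborel (\<lambda>s. indicator {-T..T} s *\<^sub>R Y s)"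
    using borel_integrable_compact[OF compact_Icc continuous_on_subset[OF assms(1) subset_UNIV]] .
  moreover have "(\<lambda>s. indicator {-T..T} s *\<^sub>R Y s) = Y"
    using assms(2) by (auto simp: fun_eq_iff indicator_def)
  ultimately show ?thesis unfolding cl1_def using assms(2) by auto
qed

text \<open>The general scalar type allows application to the functions and also to their norms; the
  latter gives the estimate of \<open>l1\<close> for convolutions.\<close>

lemma convolution_integral:
  fixes X Y :: "real \<Rightarrow> 'a :: {real_normed_field, banach, second_countable_topology}"
  assumes X: "integrable lborel X" and Y: "integrable lborel Y"
  shows "integrable (lborel \<Otimes>\<^sub>M lborel) (\<lambda>(t, s). X t * Y (s - t))"
    "integrable lborel (\<lambda>s. LINT t|lborel. X t * Y (s - t))"
    "(LINT s|lborel. LINT t|lborel. X t * Y (s - t)) = (LINT t|lborel. X t) * (LINT s|lborel. Y s)"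
proof -
  have shift: "integrable lborel (\<lambda>s. Y (s - t))" "(LINT s|lborel. Y (s - t)) = (LINT s|lborel. Y s)"
    "(LINT s|lborel. norm (Y (s - t))) = (LINT s|lborel. norm (Y s))" for t
    using lborel_integrable_real_affine[OF Y, of 1 "- t"] lborel_integral_real_affine[of 1 Y "- t"]
      lborel_integral_real_affine[of 1 "\<lambda>s. norm (Y s)" "- t"] by auto
  have [measurable]: "X \<in> borel_measurable borel" "Y \<in> borel_measurable borel"
    using X Y by auto
  show 1: "integrable (lborel \<Otimes>\<^sub>M lborel) (\<lambda>(t, s). X t * Y (s - t))"
  proof (rule lborel_pair.Fubini_integrable)
    show "(\<lambda>(t, s). X t * Y (s - t)) \<in> borel_measurable (lborel \<Otimes>\<^sub>M lborel)" by measurable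
    show "integrable lborel (\<lambda>t. LINT s|lborel. norm (case (t, s) of (t, s) \<Rightarrow> X t * Y (s - t)))"
      using X by (simp add: norm_mult shift)
    show "AE t in lborel. integrable lborel (\<lambda>s. case (t, s) of (t, s) \<Rightarrow> X t * Y (s - t))"
      using shift by simp
  qed
  show "integrable lborel (\<lambda>s. LINT t|lborel. X t * Y (s - t))"
    using lborel_pair.integrable_snd[OF 1] by simp
  show "(LINT s|lborel. LINT t|lborel. X t * Y (s - t)) = (LINT t|lborel. X t) * (LINT s|lborel. Y s)"
    using lborel_pair.Fubini_integral[OF 1] by (simp add: shift)
qed

lemma ft_convolution:
  assumes X: "cl1 X" and Y: "cl1 Y"
  obtains W where "cl1 W" "l1 W \<le> l1 X * l1 Y" "\<And>z. ft W z = ft X z * ft Y z"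
proof -
  define W where "W s = (LINT t|lborel. X t * Y (s - t))" for s
  obtain S where S: "\<And>s. \<bar>s\<bar> > S \<Longrightarrow> X s = 0" and iX: "integrable lborel X"
    using X unfolding cl1_def by blast
  obtain T where T: "\<And>s. \<bar>s\<bar> > T \<Longrightarrow> Y s = 0" and iY: "integrable lborel Y"
    using Y unfolding cl1_def by blast
  have "W s = 0" if "\<bar>s\<bar> > S + T" for s
  proof -
    have eq: "X t * Y (s - t) = 0" for t
      using S[of t] T[of "s - t"] that by (cases "\<bar>t\<bar> > S") auto
    have "W s = (LINT t|(lborel :: real measure). 0)" unfolding W_def eq ..
    then show ?thesis by simp
  qed
  then have W: "cl1 W"
    unfolding cl1_def W_def using convolution_integral(2)[OF iX iY] by blast
  have "l1 W \<le> (LINT s|lborel. LINT t|lborel. norm (X t) * norm (Y (s - t)))"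
    unfolding l1_def
  proof (rule integral_mono)
    show "integrable lborel (\<lambda>s. norm (W s))" using W by (auto simp: cl1_def)
    show "integrable lborel (\<lambda>s. LINT t|lborel. norm (X t) * norm (Y (s - t)))"
      using convolution_integral(2)[of "\<lambda>s. norm (X s)" "\<lambda>s. norm (Y s)"] iX iY by simp
    show "norm (W s) \<le> (LINT t|lborel. norm (X t) * norm (Y (s - t)))" for s
      unfolding W_def norm_mult[symmetric] by (rule integral_norm_bound)
  qed
  also have "\<dots> = l1 X * l1 Y"
    unfolding l1_def using convolution_integral(3)[of "\<lambda>s. norm (X s)" "\<lambda>s. norm (Y s)"] iX iY by simp
  finally have "l1 W \<le> l1 X * l1 Y" .
  moreover have "ft W z = ft X z * ft Y z" for z
  proof -
    have "ft W z = (LINT s|lborel. LINT t|lborel. (exp (\<i> * z * of_real t) * X t) * (exp (\<i> * z * of_real (s - t)) * Y (s - t)))"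
      unfolding ft_def W_def
      by (intro Bochner_Integration.integral_cong refl)
        (auto simp: algebra_simps exp_diff simp flip: integral_mult_right_zero)
    also have "\<dots> = ft X z * ft Y z"
      unfolding ft_def using convolution_integral(3)[OF integrable_ft[OF X] integrable_ft[OF Y]] by simp
    finally show ?thesis .
  qed
  ultimately show ?thesis using that W by blast
qed

text \<open>The difference of the two sides, multiplied by \<open>e\<^sup>-\<^sup>i\<^sup>c\<^sup>z\<close>, is of zero type and bounded on
  the imaginary axis: below by its first expression, above by its second one.\<close>

theorem ft_separation:
  assumes Y: "cl1 Y" and hol: "\<Theta> holomorphic_on UNIV" "\<Xi> holomorphic_on UNIV"
    and sum: "\<And>z. \<Theta> z + \<Xi> z = ft Y z"
    and lower: "\<And>\<epsilon>. \<epsilon> > 0 \<Longrightarrow> \<exists>C. \<forall>z. Im z \<le> 0 \<longrightarrow> norm (\<Theta> z) \<le> C * exp (\<epsilon> * norm z - a * Im z)"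
    and upper: "\<And>\<epsilon>. \<epsilon> > 0 \<Longrightarrow> \<exists>C. \<forall>z. Im z \<ge> 0 \<longrightarrow> norm (\<Xi> z) \<le> C * exp (\<epsilon> * norm z - b * Im z)"
    and ac: "a < c" and cb: "c < b"
  shows "\<Theta> z = ft (left_part c Y) z"
proof -
  define Y1 where "Y1 = left_part c Y"
  define Y2 where "Y2 = (\<lambda>s. Y s - Y1 s)"
  have Y1: "cl1 Y1" unfolding Y1_def by (rule cl1_left_part[OF Y])
  have Y2: "cl1 Y2" unfolding Y2_def by (rule cl1_diff[OF Y Y1])
  have s1: "s < c" if "Y1 s \<noteq> 0" for s using that by (auto simp: Y1_def left_part_def split: if_splits)
  have s2: "s \<ge> c" if "Y2 s \<noteq> 0" for s using that by (auto simp: Y2_def Y1_def left_part_def split: if_splits)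
  \<comment> \<open>The factor moves the cut to the origin: its modulus
    \<open>exp (c * Im z)\<close> cancels the growth of the transforms of both pieces
    \<open>Y1\<close> and \<open>Y2\<close>.\<close>
  define F where "F z = (\<Theta> z - ft Y1 z) * exp (- \<i> * of_real c * z)" for z
  have F2: "F z = (ft Y2 z - \<Xi> z) * exp (- \<i> * of_real c * z)" for z
  proof -
    have eq: "\<Theta> z = ft Y z - \<Xi> z" using sum[of z] by (metis add_diff_cancel_right')
    show ?thesis unfolding F_def Y2_def ft_diff[OF Y Y1] eq by (simp add: algebra_simps)
  qed
  have ne: "norm (exp (- \<i> * of_real c * z)) = exp (c * Im z)" for z by simp
  have ft1: "norm (ft Y1 z) \<le> l1 Y1 * exp (- c * Im z)" if "Im z \<le> 0" for z
  proof (rule ft_bound[OF Y1])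
    show "- (Im z * s) \<le> - c * Im z" if "Y1 s \<noteq> 0" for s
      using mult_right_mono_neg[of s c "Im z"] s1[OF that] \<open>Im z \<le> 0\<close> by (simp add: mult.commute)
  qed
  have ft2: "norm (ft Y2 z) \<le> l1 Y2 * exp (- c * Im z)" if "Im z \<ge> 0" for z
  proof (rule ft_bound[OF Y2])
    show "- (Im z * s) \<le> - c * Im z" if "Y2 s \<noteq> 0" for s
      using mult_right_mono[of c s "Im z"] s2[OF that] \<open>Im z \<ge> 0\<close> by (simp add: mult.commute)
  qed
  have low: "\<exists>C\<ge>0. \<forall>z. Im z \<le> 0 \<longrightarrow> norm (F z) \<le> C * exp (\<epsilon> * norm z + (c - a) * Im z) + l1 Y1" if \<epsilon>: "\<epsilon> > 0" for \<epsilon>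
  proof -
    obtain C where C: "\<And>z. Im z \<le> 0 \<Longrightarrow> norm (\<Theta> z) \<le> C * exp (\<epsilon> * norm z - a * Im z)"
      using lower[OF \<epsilon>] by blast
    have "C \<ge> 0" using order_trans[OF norm_ge_zero C[of 0]] by simp
    moreover have "norm (F z) \<le> C * exp (\<epsilon> * norm z + (c - a) * Im z) + l1 Y1" if z: "Im z \<le> 0" for z
    proof -
      have "norm (F z) \<le> (norm (\<Theta> z) + norm (ft Y1 z)) * exp (c * Im z)"
        unfolding F_def norm_mult ne by (intro mult_right_mono norm_triangle_ineq4) auto
      also have "\<dots> \<le> (C * exp (\<epsilon> * norm z - a * Im z) + l1 Y1 * exp (- c * Im z)) * exp (c * Im z)"
        using C[OF z] ft1[OF z] by (intro mult_right_mono add_mono) auto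
      also have "\<dots> = C * exp (\<epsilon> * norm z + (c - a) * Im z) + l1 Y1"
        by (simp add: algebra_simps flip: exp_add)
      finally show ?thesis .
    qed
    ultimately show ?thesis by blast
  qed
  have up: "\<exists>C\<ge>0. \<forall>z. Im z \<ge> 0 \<longrightarrow> norm (F z) \<le> C * exp (\<epsilon> * norm z - (b - c) * Im z) + l1 Y2" if \<epsilon>: "\<epsilon> > 0" for \<epsilon>
  proof -
    obtain C where C: "\<And>z. Im z \<ge> 0 \<Longrightarrow> norm (\<Xi> z) \<le> C * exp (\<epsilon> * norm z - b * Im z)"
      using upper[OF \<epsilon>] by blast
    have "C \<ge> 0" using order_trans[OF norm_ge_zero C[of 0]] by simp
    moreover have "norm (F z) \<le> C * exp (\<epsilon> * norm z - (b - c) * Im z) + l1 Y2" if z: "Im z \<ge> 0" for z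
    proof -
      have "norm (F z) \<le> (norm (ft Y2 z) + norm (\<Xi> z)) * exp (c * Im z)"
        unfolding F2 norm_mult ne by (intro mult_right_mono norm_triangle_ineq4) auto
      also have "\<dots> \<le> (l1 Y2 * exp (- c * Im z) + C * exp (\<epsilon> * norm z - b * Im z)) * exp (c * Im z)"
        using C[OF z] ft2[OF z] by (intro mult_right_mono add_mono) auto
      also have "\<dots> = C * exp (\<epsilon> * norm z - (b - c) * Im z) + l1 Y2"
        by (simp add: algebra_simps flip: exp_add)
      finally show ?thesis .
    qed
    ultimately show ?thesis by blast
  qed
  have F: "zero_type F"
    unfolding zero_type_def
  proof (intro conjI allI impI)
    show "F holomorphic_on UNIV"
      unfolding F_def by (intro holomorphic_intros hol ft_holomorphic Y1)
    fix \<epsilon> :: real assume \<epsilon>: "\<epsilon> > 0"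
    obtain C1 where C1: "C1 \<ge> 0" "\<And>z. Im z \<le> 0 \<Longrightarrow> norm (F z) \<le> C1 * exp (\<epsilon> * norm z + (c - a) * Im z) + l1 Y1"
      using low[OF \<epsilon>] by blast
    obtain C2 where C2: "C2 \<ge> 0" "\<And>z. Im z \<ge> 0 \<Longrightarrow> norm (F z) \<le> C2 * exp (\<epsilon> * norm z - (b - c) * Im z) + l1 Y2"
      using up[OF \<epsilon>] by blast
    have "norm (F z) \<le> (C1 + C2 + l1 Y1 + l1 Y2) * exp (\<epsilon> * norm z)" for z
    proof -
      have 1: "1 \<le> exp (\<epsilon> * norm z)" using \<epsilon> by simp
      have l: "l1 Y1 \<le> l1 Y1 * exp (\<epsilon> * norm z)" "l1 Y2 \<le> l1 Y2 * exp (\<epsilon> * norm z)"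
        using mult_left_mono[OF 1 l1_nonneg[of Y1]] mult_left_mono[OF 1 l1_nonneg[of Y2]] by auto
      have nn: "0 \<le> l1 Y1 * exp (\<epsilon> * norm z)" "0 \<le> l1 Y2 * exp (\<epsilon> * norm z)"
        "0 \<le> C1 * exp (\<epsilon> * norm z)" "0 \<le> C2 * exp (\<epsilon> * norm z)"
        using l1_nonneg C1 C2 by simp_all
      show ?thesis
      proof (cases "Im z \<le> 0")
        case True
        have "C1 * exp (\<epsilon> * norm z + (c - a) * Im z) \<le> C1 * exp (\<epsilon> * norm z)"
          using True ac C1(1) by (intro mult_left_mono) (auto simp: mult_le_0_iff)
        then show ?thesis using C1(2)[OF True] l nn unfolding distrib_right by linarith
      next
        case False
        then have z: "Im z \<ge> 0" by simp
        have "C2 * exp (\<epsilon> * norm z - (b - c) * Im z) \<le> C2 * exp (\<epsilon> * norm z)"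
          using z cb C2(1) by (intro mult_left_mono) auto
        then show ?thesis using C2(2)[OF z] l nn unfolding distrib_right by linarith
      qed
    qed
    then show "\<exists>C. \<forall>z. norm (F z) \<le> C * exp (\<epsilon> * norm z)" by blast
  qed
  \<comment> \<open>With \<open>\<epsilon> = c - a\<close> the exponent vanishes on the negative
    imaginary axis, where \<open>norm z = - Im z\<close>; in the same way \<open>b - c\<close>
    serves the positive one.\<close>
  obtain C1 where C1: "C1 \<ge> 0" "\<And>z. Im z \<le> 0 \<Longrightarrow> norm (F z) \<le> C1 * exp ((c - a) * norm z + (c - a) * Im z) + l1 Y1"
    using low[of "c - a"] ac by auto
  obtain C2 where C2: "C2 \<ge> 0" "\<And>z. Im z \<ge> 0 \<Longrightarrow> norm (F z) \<le> C2 * exp ((b - c) * norm z - (b - c) * Im z) + l1 Y2"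
    using up[of "b - c"] cb by auto
  have "norm (F (\<i> * of_real y)) \<le> C1 + C2 + l1 Y1 + l1 Y2" for y
  proof (cases "y \<le> 0")
    case True
    have "norm (F (\<i> * of_real y)) \<le> C1 + l1 Y1"
      using C1(2)[of "\<i> * of_real y"] True by (simp add: norm_mult)
    then show ?thesis using C2(1) l1_nonneg[of Y2] by linarith
  next
    case False
    have "norm (F (\<i> * of_real y)) \<le> C2 + l1 Y2"
      using C2(2)[of "\<i> * of_real y"] False by (simp add: norm_mult)
    then show ?thesis using C1(1) l1_nonneg[of Y1] by linarith
  qed
  then obtain k where k: "\<And>z. F z = k" using zero_type_bounded_imaginary_axis[OF F] by blast
  \<comment> \<open>Along \<open>z = - \<i> y\<close> both terms of \<open>F\<close> tend to 0: the
    first by \<open>lower\<close> with \<epsilon> equal to half of \<open>c - a\<close>, the second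
    by dominated convergence, because \<open>Y1\<close> lives strictly to the left of
    \<open>c\<close>.\<close>
  have "k = 0"
  proof -
    obtain C where C: "\<And>z. Im z \<le> 0 \<Longrightarrow> norm (\<Theta> z) \<le> C * exp ((c - a) / 2 * norm z - a * Im z)"
      using lower[of "(c - a) / 2"] ac by auto
    have int: "((\<lambda>y. LINT s|lborel. of_real (exp (- (y * (c - s)))) * Y1 s) \<longlongrightarrow> (LINT s|(lborel::real measure). 0)) at_top"
    proof (rule integral_dominated_convergence_at_top[where w = "\<lambda>s. norm (Y1 s)"])
      show "integrable lborel (\<lambda>s. norm (Y1 s))" using Y1 by (auto simp: cl1_def)
      show "(\<lambda>s. of_real (exp (- (y * (c - s)))) * Y1 s) \<in> borel_measurable lborel" for y
      proof -
        have "Y1 \<in> borel_measurable lborel" using Y1 by (auto simp: cl1_def)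
        then show ?thesis by measurable
      qed
      show "eventually (\<lambda>y. AE s in lborel. norm (of_real (exp (- (y * (c - s)))) * Y1 s) \<le> norm (Y1 s)) at_top"
        using eventually_ge_at_top[of 0]
      proof eventually_elim
        case (elim y)
        have "norm (of_real (exp (- (y * (c - s)))) * Y1 s) \<le> norm (Y1 s)" for s
          using s1[of s] elim by (cases "Y1 s = 0") (auto simp: norm_mult intro!: mult_left_le_one_le)
        then show ?case by simp
      qed
      have "((\<lambda>y. of_real (exp (- (y * (c - s)))) * Y1 s) \<longlongrightarrow> 0) at_top" for s
      proof (cases "Y1 s = 0")
        case False
        then have "c - s > 0" using s1[of s] by simp
        then have "((\<lambda>y. exp (- (y * (c - s)))) \<longlongrightarrow> 0) at_top" by real_asymp
        then have "((\<lambda>y. of_real (exp (- (y * (c - s)))) * Y1 s) \<longlongrightarrow> of_real 0 * Y1 s) at_top"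
          by (intro tendsto_intros)
        then show ?thesis by simp
      qed simp
      then show "AE s in lborel. ((\<lambda>y. of_real (exp (- (y * (c - s)))) * Y1 s) \<longlongrightarrow> 0) at_top" by simp
    qed simp
    have "norm k \<le> C * exp (- ((c - a) / 2 * y)) + norm (LINT s|lborel. of_real (exp (- (y * (c - s)))) * Y1 s)"
      if "y \<ge> 0" for y
    proof -
      define z where "z = - (\<i> * of_real y)"
      have z: "Im z = - y" "norm z = y" using that by (auto simp: z_def norm_mult)
      have "ft Y1 z * exp (- \<i> * of_real c * z) = (LINT s|lborel. exp (- \<i> * of_real c * z) * (exp (\<i> * z * of_real s) * Y1 s))"
        unfolding ft_def by (simp add: mult.commute)
      also have "\<dots> = (LINT s|lborel. of_real (exp (- (y * (c - s)))) * Y1 s)"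
      proof (intro Bochner_Integration.integral_cong refl)
        fix s
        have "- \<i> * of_real c * z + \<i> * z * of_real s = of_real (- (y * (c - s)))"
          by (simp add: z_def complex_eq_iff algebra_simps)
        then show "exp (- \<i> * of_real c * z) * (exp (\<i> * z * of_real s) * Y1 s) = of_real (exp (- (y * (c - s)))) * Y1 s"
          unfolding mult.assoc[symmetric] exp_add[symmetric] by (simp only: exp_of_real)
      qed
      finally have eq: "ft Y1 z * exp (- \<i> * of_real c * z) = (LINT s|lborel. of_real (exp (- (y * (c - s)))) * Y1 s)" .
      have "norm (\<Theta> z * exp (- \<i> * of_real c * z)) \<le> (C * exp ((c - a) / 2 * norm z - a * Im z)) * exp (c * Im z)"
        unfolding norm_mult ne using C[of z] that by (intro mult_right_mono) (auto simp: z)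
      also have "\<dots> = C * exp (((c - a) / 2 * norm z - a * Im z) + c * Im z)"
        by (simp only: exp_add mult.assoc)
      also have "((c - a) / 2 * norm z - a * Im z) + c * Im z = - ((c - a) / 2 * y)"
        by (simp add: z field_simps)
      finally have 1: "norm (\<Theta> z * exp (- \<i> * of_real c * z)) \<le> C * exp (- ((c - a) / 2 * y))" .
      have "k = \<Theta> z * exp (- \<i> * of_real c * z) - ft Y1 z * exp (- \<i> * of_real c * z)"
        using k[of z] by (simp add: F_def left_diff_distrib)
      also have "norm \<dots> \<le> norm (\<Theta> z * exp (- \<i> * of_real c * z)) + norm (ft Y1 z * exp (- \<i> * of_real c * z))"
        by (rule norm_triangle_ineq4)
      finally show ?thesis using 1 unfolding eq by linarith
    qed
    moreover have "((\<lambda>y. C * exp (- ((c - a) / 2 * y)) + norm (LINT s|lborel. of_real (exp (- (y * (c - s)))) * Y1 s)) \<longlongrightarrow> 0) at_top"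
    proof -
      have d: "(c - a) / 2 > 0" using ac by simp
      have "((\<lambda>y. exp (- ((c - a) / 2 * y))) \<longlongrightarrow> 0) at_top" using d by real_asymp
      from tendsto_add[OF tendsto_mult[OF tendsto_const[of C] this] tendsto_norm[OF int]] show ?thesis by simp
    qed
    ultimately have "norm k \<le> 0"
      by (intro tendsto_lowerbound[of _ 0 at_top]) (auto intro: eventually_mono[OF eventually_ge_at_top[of 0]])
    then show ?thesis by simp
  qed
  then show ?thesis using k[of z] by (simp add: F_def Y1_def)
qed

text \<open>At \<open>z = 0\<close> the transform of a left part is the integral of \<open>Y\<close>
  up to \<open>c\<close>. If this does not depend on \<open>c\<close>, the integrals over all
  subintervals vanish, and so does a continuous integrand.\<close>

lemma left_part_locally_constant:
  assumes Y: "continuous_on UNIV Y" "cl1 Y"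
    and const: "\<And>c. a < c \<Longrightarrow> c < b \<Longrightarrow> ft (left_part c Y) 0 = k" and p: "a < p" "p < b"
  shows "Y p = 0"
proof (rule ccontr)
  assume "Y p \<noteq> 0"
  define e where "e = norm (Y p) / 2"
  have e: "e > 0" using \<open>Y p \<noteq> 0\<close> by (simp add: e_def)
  obtain d where d: "d > 0" "\<And>s. \<bar>s - p\<bar> < d \<Longrightarrow> norm (Y s - Y p) < e"
    using Y(1) e unfolding continuous_on_iff dist_norm by (metis UNIV_I real_norm_def)
  define h where "h = min (d / 2) ((b - p) / 2)"
  have h: "h > 0" "h < d" "p + h < b" using d p by (auto simp: h_def min_def field_simps)
  define Z where "Z = (\<lambda>s. left_part (p + h) Y s - left_part p Y s)"
  have Z: "cl1 Z" unfolding Z_def by (intro cl1_diff cl1_left_part Y)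
  have "ft Z 0 = 0"
    unfolding Z_def using ft_diff[OF cl1_left_part[OF Y(2)] cl1_left_part[OF Y(2)]]
      const[of p] const[of "p + h"] h p by simp
  then have Z0: "(LINT s|lborel. Z s) = 0" by (simp add: ft_def)
  have iI: "integrable lborel (\<lambda>s. of_real (indicator {p..<p+h} s) * Y p)"
    using h by (intro integrable_mult_left integrable_of_real integrable_real_indicator) auto
  have "norm (of_real h * Y p) = norm (LINT s|lborel. Z s - of_real (indicator {p..<p+h} s) * Y p)"
    using Z iI Z0 h by (simp add: cl1_def)
  also have "\<dots> \<le> (LINT s|lborel. indicator {p..<p+h} s * e)"
  proof (rule order_trans[OF integral_norm_bound], rule integral_mono)
    show "integrable lborel (\<lambda>s. norm (Z s - of_real (indicator {p..<p+h} s) * Y p))"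
      using Z iI by (auto simp: cl1_def)
    show "integrable lborel (\<lambda>s. indicator {p..<p+h} s * e)"
      using h by (intro integrable_mult_left integrable_real_indicator) auto
    show "norm (Z s - of_real (indicator {p..<p+h} s) * Y p) \<le> indicator {p..<p+h} s * e" for s
      using d(2)[of s] h by (auto simp: Z_def left_part_def indicator_def less_imp_le)
  qed
  also have "\<dots> = h * e" using h by simp
  finally have "h * norm (Y p) \<le> h * e" using h by (simp add: norm_mult)
  then show False using h e by (simp add: e_def)
qed

text \<open>Injectivity of the transform, from \<open>ft_separation\<close> with both summands zero:
  every left part of \<open>Y\<close> then has integral 0.\<close>

corollary ft_eq_0D:
  assumes Y: "continuous_on UNIV Y" "cl1 Y" and "\<And>z. ft Y z = 0"
  shows "Y s = 0"
proof (rule left_part_locally_constant[OF Y])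
  fix c assume "s - 1 < c" "c < s + 1"
  have "(\<lambda>_. 0) 0 = ft (left_part c Y) 0"
  proof (rule ft_separation[OF Y(2), where a = "c - 1" and b = "c + 1" and \<Theta> = "\<lambda>_. 0" and \<Xi> = "\<lambda>_. 0"])
    show "\<exists>C. \<forall>z. Im z \<le> 0 \<longrightarrow> norm (0::complex) \<le> C * exp (\<epsilon> * norm z - (c - 1) * Im z)" for \<epsilon>
      by (rule exI[of _ 0]) simp
    show "\<exists>C. \<forall>z. Im z \<ge> 0 \<longrightarrow> norm (0::complex) \<le> C * exp (\<epsilon> * norm z - (c + 1) * Im z)" for \<epsilon>
      by (rule exI[of _ 0]) simp
  qed (use assms in auto)
  then show "ft (left_part c Y) 0 = 0" by simp
qed auto

section \<open>Quotients of functions of zero type\<close>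

text \<open>The n-th difference with step \<open>h\<close> equals \<open>c * h ^ n\<close> and is a
  signed sum of \<open>2 ^ n\<close> values of \<open>g 0\<close>, so one of these is at least
  \<open>(h / 2) ^ n\<close> times \<open>\<bar>c\<bar>\<close> in modulus. The induction peels off
  one difference at a time.\<close>

lemma finite_difference_lower_bound:
  fixes g :: "nat \<Rightarrow> real \<Rightarrow> real"
  assumes "\<And>j y. j < n \<Longrightarrow> (g j has_real_derivative g (Suc j) y) (at y)" and "\<And>y. g n y = c" and "h > 0"
  shows "\<exists>\<rho>\<in>{x..x + real n * h}. \<bar>g 0 \<rho>\<bar> \<ge> \<bar>c\<bar> * (h / 2) ^ n"
  using assms(1,2)
proof (induction n arbitrary: g c)
  case 0
  then show ?case by auto
next
  case (Suc n)
  define f where "f j y = g j (y + h) - g j y" for j y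
  have der: "(f j has_real_derivative f (Suc j) y) (at y)" if "j < n" for j y
  proof -
    have "((\<lambda>y. g j (y + h)) has_real_derivative g (Suc j) (y + h)) (at y)"
      using Suc.prems(1)[of j "y + h"] that by (simp add: DERIV_shift)
    then show ?thesis
      unfolding f_def using Suc.prems(1)[of j y] that by (intro DERIV_diff) auto
  qed
  have "f n y = h * c" for y
  proof -
    have "\<exists>z>y. z < y + h \<and> g n (y + h) - g n y = (y + h - y) * g (Suc n) z"
      using \<open>h > 0\<close> Suc.prems(1)[of n] by (intro MVT2) auto
    then show ?thesis unfolding f_def using Suc.prems(2) by auto
  qed
  from Suc.IH[OF der this]
  obtain \<rho> where \<rho>: "\<rho> \<in> {x..x + real n * h}" "\<bar>h * c\<bar> * (h / 2) ^ n \<le> \<bar>f 0 \<rho>\<bar>" by blast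
  have "\<bar>c\<bar> * (h / 2) ^ Suc n = (\<bar>h * c\<bar> * (h / 2) ^ n) / 2"
    using \<open>h > 0\<close> by (simp add: abs_mult)
  also have "\<dots> \<le> (\<bar>g 0 (\<rho> + h)\<bar> + \<bar>g 0 \<rho>\<bar>) / 2"
    using order_trans[OF \<rho>(2)[unfolded f_def] abs_triangle_ineq4] by (intro divide_right_mono) auto
  finally have "\<bar>c\<bar> * (h / 2) ^ Suc n \<le> (\<bar>g 0 (\<rho> + h)\<bar> + \<bar>g 0 \<rho>\<bar>) / 2" .
  moreover have "t \<le> (u + v) / 2 \<Longrightarrow> t \<le> u \<or> t \<le> v" for t u v :: real by (cases "t \<le> u") auto
  ultimately have "\<bar>c\<bar> * (h / 2) ^ Suc n \<le> \<bar>g 0 (\<rho> + h)\<bar> \<or> \<bar>c\<bar> * (h / 2) ^ Suc n \<le> \<bar>g 0 \<rho>\<bar>"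
    by blast
  moreover have "\<rho> + h \<in> {x..x + real (Suc n) * h}" "\<rho> \<in> {x..x + real (Suc n) * h}"
    using \<rho>(1) \<open>h > 0\<close> by (auto simp: algebra_simps)
  ultimately show ?case by blast
qed

text \<open>A substitute for Cartan's estimate: the n-th derivative is the constant
  \<open>n!\<close>, so the polynomial cannot be small throughout an interval, wherever its zeros
  lie.\<close>

lemma monic_poly_lower_bound:
  fixes p :: "real poly"
  assumes "degree p = n" "lead_coeff p = 1" "h > 0"
  shows "\<exists>\<rho>\<in>{x..x + real n * h}. \<bar>poly p \<rho>\<bar> \<ge> fact n * (h / 2) ^ n"
proof -
  define g where "g j = poly ((pderiv ^^ j) p)" for j
  have "(g j has_real_derivative g (Suc j) y) (at y)" for j y
    unfolding g_def by (simp add: poly_DERIV)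
  moreover have "g n y = fact n" for y
  proof -
    have "(pderiv ^^ n) p = [:fact n:]"
    proof (rule poly_eqI)
      fix i
      show "coeff ((pderiv ^^ n) p) i = coeff [:fact n:] i"
        using assms by (cases i) (auto simp: coeff_higher_pderiv coeff_eq_0 pochhammer_fact)
    qed
    then show ?thesis by (simp add: g_def)
  qed
  ultimately show ?thesis
    using finite_difference_lower_bound[of n g "fact n" h x] assms(3) by (simp add: g_def)
qed

text \<open>A crude Stirling bound from \<open>(1 + 1/k)^k \<le> e \<le> 4\<close>; it turns
  \<open>n! / (n + 1)^n\<close> into a geometric factor.\<close>

lemma power_le_4_power_fact: "(real n + 1) ^ n \<le> 4 ^ n * fact n"
proof (induction n)
  case (Suc n)
  have "(1 + 1 / real (Suc n)) ^ Suc n \<le> exp 1"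
    using exp_ge_one_plus_x_over_n_power_n[where n = "Suc n" and x = 1] by simp
  also have "\<dots> \<le> 4" using exp_le by simp
  finally have e: "(1 + 1 / real (Suc n)) ^ Suc n \<le> 4" .
  have "real (Suc n) + 1 = (real n + 1) * (1 + 1 / real (Suc n))" by (simp add: field_simps)
  then have "(real (Suc n) + 1) ^ Suc n = (real n + 1) ^ Suc n * (1 + 1 / real (Suc n)) ^ Suc n"
    by (simp only: power_mult_distrib)
  also have "(real n + 1) ^ Suc n = (real n + 1) ^ n * (real n + 1)" by (simp only: power_Suc mult.commute)
  also have "(real n + 1) ^ n * (real n + 1) * (1 + 1 / real (Suc n)) ^ Suc n \<le> (4 ^ n * fact n) * (real n + 1) * 4"
    using Suc.IH e by (intro mult_mono) auto
  also have "\<dots> = 4 ^ Suc n * fact (Suc n)" by (simp add: algebra_simps)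
  finally show ?case .
qed simp

text \<open>The point \<open>w\<close> certifies at every stage that the remaining factor is not
  identically zero, so that a zero at the next point has finite order.\<close>

lemma factor_out_zeros:
  assumes "finite Z" "\<phi> holomorphic_on UNIV" "\<phi> w \<noteq> 0"
  shows "\<exists>m h. h holomorphic_on UNIV \<and> (\<forall>a\<in>Z. h a \<noteq> 0) \<and>
    (\<forall>z. \<phi> z = h z * (\<Prod>a\<in>Z. (z - a) ^ m a)) \<and> h w \<noteq> 0"
  using assms
proof (induction Z arbitrary: rule: finite_induct)
  case empty
  then show ?case by auto
next
  case (insert a Z)
  obtain m h where h: "h holomorphic_on UNIV" "\<And>b. b \<in> Z \<Longrightarrow> h b \<noteq> 0"
    "\<And>z. \<phi> z = h z * (\<Prod>b\<in>Z. (z - b) ^ m b)" "h w \<noteq> 0"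
    using insert.IH[OF insert.prems] by metis
  have "\<exists>n k. k holomorphic_on UNIV \<and> k a \<noteq> 0 \<and> (\<forall>z. h z = (z - a) ^ n * k z)"
  proof (cases "h a = 0")
    case False
    then show ?thesis using h(1) by (intro exI[of _ 0] exI[of _ h]) auto
  next
    case True
    obtain g r n where g: "0 < n" "0 < r" "g holomorphic_on ball a r"
      "\<And>z. z \<in> ball a r \<Longrightarrow> h z = (z - a) ^ n * g z" "\<And>z. z \<in> ball a r \<Longrightarrow> g z \<noteq> 0"
    proof -
      have nc: "\<not> h constant_on UNIV" using True h(4) by (force simp: constant_on_def)
      show ?thesis
        by (rule holomorphic_factor_zero_nonconstant[OF h(1) open_UNIV connected_UNIV UNIV_I True nc])
          (rule that, assumption+)
    qed
    define k where "k z = (if z = a then g a else h z / (z - a) ^ n)" for z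
    have kg: "k z = g z" if "z \<in> ball a r" for z
      using g(4)[OF that] by (auto simp: k_def)
    have "k holomorphic_on ball a r"
      by (rule holomorphic_transform[OF g(3)]) (simp add: kg)
    moreover have "k holomorphic_on - {a}"
      unfolding k_def by (rule holomorphic_transform[of "\<lambda>z. h z / (z - a) ^ n"])
        (auto intro!: holomorphic_intros holomorphic_on_subset[OF h(1)])
    ultimately have "k holomorphic_on ball a r \<union> - {a}"
      by (intro holomorphic_on_Un) auto
    moreover have "ball a r \<union> - {a} = UNIV" using g(2) by auto
    moreover have "k a \<noteq> 0" using kg[of a] g(2) g(5)[of a] by auto
    moreover have "h z = (z - a) ^ n * k z" for z
      using True g(1) by (auto simp: k_def)
    ultimately show ?thesis by metis
  qed
  then obtain n k where k: "k holomorphic_on UNIV" "k a \<noteq> 0" "\<And>z. h z = (z - a) ^ n * k z" by blast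
  have "\<phi> z = k z * (\<Prod>b\<in>insert a Z. (z - b) ^ (m(a := n)) b)" for z
  proof -
    have "(\<Prod>b\<in>Z. (z - b) ^ (m(a := n)) b) = (\<Prod>b\<in>Z. (z - b) ^ m b)"
      using insert.hyps(2) by (intro prod.cong) auto
    then show ?thesis using insert.hyps h(3)[of z] k(3)[of z] by (simp add: mult_ac)
  qed
  moreover have "\<forall>b\<in>insert a Z. k b \<noteq> 0" using k h(2) by auto
  moreover have "k w \<noteq> 0" using h(4) k(3)[of w] by auto
  ultimately show ?case using k(1) by blast
qed

text \<open>Harnack's inequality for the positive harmonic function \<open>B - Re g\<close>, by the
  Schwarz lemma for a Moebius image of it. On the disc of half the radius the factor is
  \<open>(1 + 1/2) / (1 - 1/2) = 3\<close>.\<close>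

lemma harnack_exp:
  assumes g: "g holomorphic_on ball 0 R" and B: "\<And>z. z \<in> ball 0 R \<Longrightarrow> Re (g z) < B"
    and z: "norm z \<le> R / 2" and "R > 0"
  shows "Re (g z) \<ge> B - 3 * (B - Re (g 0))"
proof -
  define F where "F w = of_real B - (g (of_real R * w) - \<i> * of_real (Im (g 0)))" for w
  define F0 where "F0 = B - Re (g 0)"
  have F0: "F0 > 0" using B[of 0] \<open>R > 0\<close> by (simp add: F0_def)
  have F00: "F 0 = of_real F0" by (simp add: F_def F0_def complex_eq_iff)
  have in_ball: "of_real R * w \<in> ball 0 R" if "norm w < 1" for w :: complex
    using that \<open>R > 0\<close> by (simp add: norm_mult)
  have ReF: "Re (F w) > 0" if "norm w < 1" for w
    using B[OF in_ball[OF that]] by (simp add: F_def)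
  define f where "f w = (F w - of_real F0) / (F w + of_real F0)" for w
  have den: "F w + of_real F0 \<noteq> 0" if "norm w < 1" for w
  proof
    assume "F w + of_real F0 = 0"
    then have "Re (F w + of_real F0) = 0" by simp
    then show False using ReF[OF that] F0 by simp
  qed
  have "F holomorphic_on ball 0 1"
    unfolding F_def using in_ball
    by (intro holomorphic_intros holomorphic_on_compose_gen[OF _ g, unfolded o_def]) auto
  then have f_hol: "f holomorphic_on ball 0 1"
    unfolding f_def using den by (intro holomorphic_intros) auto
  have f1: "norm (f w) < 1" if "norm w < 1" for w
  proof -
    have "(norm (F w - of_real F0))\<^sup>2 < (norm (F w + of_real F0))\<^sup>2"
      unfolding cmod_power2 using ReF[OF that] F0 by (simp add: power2_eq_square algebra_simps)
    then have "norm (F w - of_real F0) < norm (F w + of_real F0)"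
      by (rule power2_less_imp_less) simp
    then show ?thesis using den[OF that] by (simp add: f_def norm_divide)
  qed
  define w where "w = z / of_real R"
  have w: "norm w \<le> 1 / 2" using z \<open>R > 0\<close> by (simp add: w_def norm_divide field_simps)
  have fw: "norm (f w) \<le> 1 / 2"
    using Schwarz_Lemma(1)[OF f_hol _ f1, of w] w by (simp add: f_def F00)
  have "norm (F w - of_real F0) \<le> 1 / 2 * norm (F w + of_real F0)"
    using fw den[of w] w by (simp add: f_def norm_divide field_simps)
  moreover have "norm (F w + of_real F0) \<le> norm (F w) + F0"
    using norm_triangle_ineq[of "F w" "of_real F0"] F0 by simp
  moreover have "norm (F w) - F0 \<le> norm (F w - of_real F0)"
    using norm_triangle_ineq2[of "F w" "of_real F0"] F0 by simp
  ultimately have "norm (F w) \<le> 3 * F0" by simp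
  then have "Re (F w) \<le> 3 * F0" using complex_Re_le_cmod[of "F w"] by simp
  then show ?thesis using \<open>R > 0\<close> by (simp add: F_def F0_def w_def)
qed

text \<open>Divided by its zeros in the disc of radius \<open>4 r\<close>, the function has a
  logarithm there, and Harnack's inequality bounds it from below. The polynomial of the zeros is
  bounded below on a suitable circle only, hence the freedom in \<rho>; Jensen's argument limits its
  degree.\<close>

theorem zero_type_minimum_modulus:
  assumes \<phi>: "zero_type \<phi>" and \<phi>0: "\<phi> 0 \<noteq> 0" and \<epsilon>: "\<epsilon> > 0"
  obtains c where "c > 0" "\<And>r. r > 0 \<Longrightarrow> \<exists>\<rho>\<in>{r..2 * r}. \<forall>z. norm z = \<rho> \<longrightarrow> norm (\<phi> z) \<ge> c * exp (- \<epsilon> * r)"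
proof -
  \<comment> \<open>The final bound is \<open>N ^ 9 / M ^ 8\<close>, where \<open>M\<close> contains
    \<open>exp (12 * \<delta> * r)\<close>; hence 96 = 8 * 12.\<close>
  define \<delta> where "\<delta> = \<epsilon> / 96"
  have \<delta>: "\<delta> > 0" using \<epsilon> by (simp add: \<delta>_def)
  obtain C where C: "C > 0" "\<And>z. norm (\<phi> z) \<le> C * exp (\<delta> * norm z)"
    using zero_typeD[OF \<phi> \<delta>] by blast
  have hol: "\<phi> holomorphic_on UNIV" using \<phi> by (simp add: zero_type_def)
  define N where "N = norm (\<phi> 0)"
  have N: "N > 0" using \<phi>0 by (simp add: N_def)
  define c where "c = N ^ 9 / (2 * C) ^ 8"
  have "c > 0" using N C by (simp add: c_def)
  moreover have "\<exists>\<rho>\<in>{r..2 * r}. \<forall>z. norm z = \<rho> \<longrightarrow> norm (\<phi> z) \<ge> c * exp (- \<epsilon> * r)" if r: "r > 0" for r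
  proof -
    \<comment> \<open>Twice the bound of \<phi> on the circle of radius \<open>12 r\<close>, so that
      \<open>k_bound\<close> is strict, as \<open>harnack_exp\<close> requires.\<close>
    define M where "M = 2 * C * exp (\<delta> * (12 * r))"
    have M: "M > 0" using C by (simp add: M_def)
    define Z where "Z = {z \<in> cball 0 (4 * r). \<phi> z = 0}"
    have finZ: "finite Z"
    proof (cases "\<phi> constant_on UNIV")
      case True
      then have "Z = {}" using \<phi>0 by (auto simp: Z_def constant_on_def)
      then show ?thesis by simp
    next
      case False
      then show ?thesis
        unfolding Z_def by (intro holomorphic_compact_finite_zeros[OF hol]) auto
    qed
    obtain m h where h: "h holomorphic_on UNIV" "\<And>a. a \<in> Z \<Longrightarrow> h a \<noteq> 0"
      "\<And>z. \<phi> z = h z * (\<Prod>a\<in>Z. (z - a) ^ m a)"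
      using factor_out_zeros[OF finZ hol \<phi>0] by blast
    define n where "n = (\<Sum>a\<in>Z. m a)"
    have Z4: "norm a \<le> 4 * r" if "a \<in> Z" for a using that by (auto simp: Z_def)
    have pow: "K ^ n = (\<Prod>a\<in>Z. K ^ m a)" for K :: real
      unfolding n_def by (simp add: power_sum)
    \<comment> \<open>Each zero factor is normalised to \<open>(z - a) / (8 r)\<close>, which has
      modulus at least 1 on the circle of radius \<open>12 r\<close> and at most 1/2 at the
      origin.\<close>
    define k where "k z = h z * of_real ((8 * r) ^ n)" for z
    have k_hol: "k holomorphic_on UNIV" unfolding k_def by (intro holomorphic_intros h)
    have \<phi>k: "norm (\<phi> z) * (8 * r) ^ n = norm (k z) * (\<Prod>a\<in>Z. norm (z - a) ^ m a)" for z
      using r by (simp add: h(3)[of z] k_def norm_mult prod_norm[symmetric] norm_power)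
    have k_bound: "norm (k z) < M" if "norm z \<le> 12 * r" for z
    proof -
      have "norm (k z) \<le> M / 2"
      proof (rule maximum_modulus_frontier[where f = k and S = "cball 0 (12 * r)"])
        fix w :: complex assume "w \<in> frontier (cball 0 (12 * r))"
        then have w: "norm w = 12 * r" using r by (simp add: frontier_cball)
        have "(8 * r) ^ n \<le> (\<Prod>a\<in>Z. norm (w - a) ^ m a)"
          unfolding pow
        proof (intro prod_mono conjI power_mono)
          fix a assume "a \<in> Z"
          then show "8 * r \<le> norm (w - a)" using Z4[of a] w norm_triangle_ineq2[of w a] by simp
        qed (use r in auto)
        then have "norm (k w) * (8 * r) ^ n \<le> norm (\<phi> w) * (8 * r) ^ n"
          unfolding \<phi>k by (rule mult_left_mono) simp
        then have "norm (k w) \<le> norm (\<phi> w)" using r by simp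
        also have "\<dots> \<le> M / 2" using C(2)[of w] w by (simp add: M_def)
        finally show "norm (k w) \<le> M / 2" .
      qed (use that r k_hol in \<open>auto intro: holomorphic_on_subset holomorphic_on_imp_continuous_on\<close>)
      then show ?thesis using M by simp
    qed
    have k_nz: "k z \<noteq> 0" if "norm z \<le> 4 * r" for z
      using h(2)[of z] h(3)[of z] that r by (auto simp: k_def Z_def)
    \<comment> \<open>Together with \<open>k_bound\<close> this yields
      \<open>2 ^ n \<le> M / N\<close>, Jensen's bound for the number of zeros.\<close>
    have k0: "norm (k 0) \<ge> N * 2 ^ n"
    proof -
      have "(\<Prod>a\<in>Z. norm (0 - a) ^ m a) \<le> (4 * r) ^ n"
        unfolding pow by (intro prod_mono conjI power_mono) (use Z4 in auto)
      then have "norm (k 0) * (\<Prod>a\<in>Z. norm (0 - a) ^ m a) \<le> norm (k 0) * (4 * r) ^ n"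
        by (rule mult_left_mono) simp
      then have "N * (8 * r) ^ n \<le> norm (k 0) * (4 * r) ^ n"
        using \<phi>k[of 0] by (simp add: N_def)
      moreover have "(8 * r) ^ n = 2 ^ n * (4 * r) ^ n" using power_mult_distrib[of 2 "4 * r" n] by simp
      ultimately show ?thesis using r by simp
    qed
    obtain g where g: "g holomorphic_on ball 0 (4 * r)" "\<And>z. z \<in> ball 0 (4 * r) \<Longrightarrow> exp (g z) = k z"
      using holomorphic_logarithm_exists[of "ball 0 (4 * r)" k 0] k_hol k_nz r
      by (auto intro: holomorphic_on_subset)
    have Reg: "Re (g z) = ln (norm (k z))" if "z \<in> ball 0 (4 * r)" for z
      using g(2)[OF that] by (metis ln_exp norm_exp_eq_Re)
    have k_lower: "norm (k z) \<ge> N ^ 3 / M ^ 2" if z: "norm z \<le> 2 * r" for z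
    proof -
      have zb: "z \<in> ball 0 (4 * r)" using z r by auto
      have "Re (g w) < ln M" if "w \<in> ball 0 (4 * r)" for w
        using Reg[OF that] k_bound[of w] k_nz[of w] that r M by (simp add: ln_less_cancel_iff)
      from harnack_exp[OF g(1) this, of z] z r
      have 1: "Re (g z) \<ge> ln M - 3 * (ln M - Re (g 0))" by simp
      have "N * 1 \<le> N * 2 ^ n" using N by (intro mult_left_mono) auto
      then have "N \<le> norm (k 0)" using k0 by simp
      then have "ln N \<le> Re (g 0)" using Reg[of 0] N r by (simp add: ln_mono)
      then have "3 * ln N - 2 * ln M \<le> ln (norm (k z))" using 1 Reg[OF zb] by simp
      then have "exp (3 * ln N - 2 * ln M) \<le> exp (ln (norm (k z)))" by simp
      also have "\<dots> = norm (k z)" using k_nz[of z] z r by simp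
      finally have "exp (3 * ln N - 2 * ln M) \<le> norm (k z)" .
      moreover have "exp (3 * ln N - 2 * ln M) = N ^ 3 / M ^ 2"
        using N M by (simp add: exp_diff exp_of_nat_mult[of 3, simplified] exp_of_nat_mult[of 2, simplified])
      ultimately show ?thesis by simp
    qed
    \<comment> \<open>As \<open>norm (z - a) \<ge> \<bar>norm z - norm a\<bar>\<close>, it suffices
      to find a radius at which the real polynomial with zeros \<open>norm a\<close> is not
      small.\<close>
    define p where "p = (\<Prod>a\<in>Z. [:- norm a, 1:] ^ m a)"
    have "degree p = n" unfolding p_def n_def
      by (subst degree_prod_eq_sum_degree) (auto simp: degree_power_eq)
    moreover have "lead_coeff p = 1" unfolding p_def
      by (simp add: lead_coeff_prod lead_coeff_power)
    moreover have pp: "poly p \<rho> = (\<Prod>a\<in>Z. (\<rho> - norm a) ^ m a)" for \<rho>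
      unfolding p_def by (simp add: poly_prod)
    \<comment> \<open>The step \<open>r / (n + 1)\<close> keeps all \<open>n\<close> steps inside
      \<open>[r;2r]\<close>.\<close>
    ultimately have "\<exists>\<rho>\<in>{r..r + real n * (r / (real n + 1))}. \<bar>poly p \<rho>\<bar> \<ge> fact n * (r / (real n + 1) / 2) ^ n"
      using r by (intro monic_poly_lower_bound) auto
    then obtain \<rho> where \<rho>: "\<rho> \<ge> r" "\<rho> \<le> r + real n * (r / (real n + 1))"
      "\<bar>poly p \<rho>\<bar> \<ge> fact n * (r / (real n + 1) / 2) ^ n" by auto
    have "real n * (r / (real n + 1)) \<le> r" using r by (simp add: field_simps)
    then have \<rho>2: "\<rho> \<le> 2 * r" using \<rho>(2) by simp
    have poly_lower: "\<bar>poly p \<rho>\<bar> \<ge> (8 * r) ^ n / 64 ^ n"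
    proof -
      have "(8 * r) ^ n / 64 ^ n = (r / (real n + 1) / 2) ^ n * ((real n + 1) ^ n / 4 ^ n)"
      proof -
        have "8 * r / 64 = (r / (real n + 1) / 2) * ((real n + 1) / 4)" by (simp add: field_simps)
        then show ?thesis by (metis power_divide power_mult_distrib)
      qed
      also have "\<dots> \<le> (r / (real n + 1) / 2) ^ n * fact n"
        using power_le_4_power_fact[of n] r by (intro mult_left_mono) (auto simp: field_simps)
      finally show ?thesis using \<rho>(3) by (simp add: mult.commute)
    qed
    have two: "2 ^ n \<le> M / N"
      using k0 k_bound[of 0] r N by (simp add: field_simps)
    have "norm (\<phi> z) \<ge> c * exp (- \<epsilon> * r)" if z: "norm z = \<rho>" for z
    proof -
      have "\<bar>poly p \<rho>\<bar> \<le> (\<Prod>a\<in>Z. norm (z - a) ^ m a)"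
        unfolding pp abs_prod power_abs
      proof (intro prod_mono conjI power_mono)
        show "\<bar>\<rho> - norm a\<bar> \<le> norm (z - a)" for a
          using norm_triangle_ineq3[of z a] z by simp
      qed auto
      then have "(8 * r) ^ n / 64 ^ n \<le> (\<Prod>a\<in>Z. norm (z - a) ^ m a)" using poly_lower by linarith
      then have "N ^ 3 / M ^ 2 * ((8 * r) ^ n / 64 ^ n) \<le> norm (\<phi> z) * (8 * r) ^ n"
        unfolding \<phi>k using k_lower[of z] z \<rho>2 N M r by (intro mult_mono) auto
      then have "N ^ 3 / M ^ 2 / 64 ^ n * (8 * r) ^ n \<le> norm (\<phi> z) * (8 * r) ^ n"
        by (simp only: times_divide_eq_left times_divide_eq_right)
      then have "N ^ 3 / M ^ 2 / 64 ^ n \<le> norm (\<phi> z)"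
        by (rule mult_right_le_imp_le) (use r in simp)
      moreover have "N ^ 9 / M ^ 8 \<le> N ^ 3 / M ^ 2 / 64 ^ n"
      proof -
        have "(64::real) ^ n = (2 ^ 6) ^ n" by simp
        also have "\<dots> = (2 ^ n) ^ 6" by (simp only: power_mult[symmetric] mult.commute)
        also have "\<dots> \<le> (M / N) ^ 6" using two by (rule power_mono) simp
        finally have "N ^ 6 * 64 ^ n \<le> M ^ 6" using N by (simp add: power_divide field_simps)
        then have "N ^ 6 * 64 ^ n * (N ^ 3 * M ^ 2) \<le> M ^ 6 * (N ^ 3 * M ^ 2)"
          using N M by (intro mult_right_mono) auto
        moreover have "N ^ 9 = N ^ 6 * N ^ 3" "M ^ 8 = M ^ 6 * M ^ 2" by (simp_all flip: power_add)
        ultimately have "N ^ 9 * 64 ^ n * M ^ 2 \<le> N ^ 3 * M ^ 8" by (simp only: mult_ac)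
        then show ?thesis using N M by (simp add: field_simps)
      qed
      moreover have "N ^ 9 / M ^ 8 = c * exp (- \<epsilon> * r)"
      proof -
        have "M ^ 8 = (2 * C) ^ 8 * exp (\<epsilon> * r)"
          unfolding M_def power_mult_distrib exp_of_nat_mult[symmetric] by (simp add: \<delta>_def)
        then show ?thesis by (simp add: c_def exp_minus field_simps)
      qed
      ultimately show ?thesis by linarith
    qed
    then show ?thesis using \<rho>(1) \<rho>2 by (intro bexI[of _ \<rho>]) auto
  qed
  ultimately show ?thesis using that by blast
qed

lemma zero_type_shift:
  assumes "zero_type F"
  shows "zero_type (\<lambda>z. F (z + p))"
  unfolding zero_type_def
proof (intro conjI allI impI)
  show "(\<lambda>z. F (z + p)) holomorphic_on UNIV"
    using assms holomorphic_on_compose_gen[OF holomorphic_on_add[OF holomorphic_on_ident holomorphic_on_const], of F UNIV]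
    by (simp add: zero_type_def o_def)
  fix \<epsilon> :: real assume \<epsilon>: "\<epsilon> > 0"
  obtain C where C: "C > 0" "\<And>z. norm (F z) \<le> C * exp (\<epsilon> * norm z)"
    using zero_typeD[OF assms \<epsilon>] by blast
  have "norm (F (z + p)) \<le> C * exp (\<epsilon> * norm p) * exp (\<epsilon> * norm z)" for z
  proof -
    have "norm (F (z + p)) \<le> C * exp (\<epsilon> * norm (z + p))" by (rule C)
    also have "\<dots> \<le> C * exp (\<epsilon> * norm p + \<epsilon> * norm z)"
      using \<epsilon> C(1) mult_left_mono[OF norm_triangle_ineq[of z p], of \<epsilon>] by (simp add: algebra_simps)
    finally show ?thesis by (simp add: exp_add)
  qed
  then show "\<exists>C. \<forall>z. norm (F (z + p)) \<le> C * exp (\<epsilon> * norm z)" by blast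
qed

text \<open>The minimum modulus theorem gives the estimate on suitable circles, and the maximum
  principle carries it inside. The shift moves a point with \<open>\<phi> p \<noteq> 0\<close> to
  the origin.\<close>

theorem zero_type_quotient:
  assumes \<phi>: "zero_type \<phi>" and H: "zero_type H" and p: "\<phi> p \<noteq> 0" and G: "G holomorphic_on UNIV"
    and eq: "\<And>z. \<phi> z * G z = H z"
  shows "zero_type G"
proof -
  define G' where "G' z = G (z + p)" for z
  have G': "G' holomorphic_on UNIV"
    unfolding G'_def
    using G holomorphic_on_compose_gen[OF holomorphic_on_add[OF holomorphic_on_ident holomorphic_on_const], of G UNIV]
    by (simp add: o_def)
  have "\<exists>C. \<forall>z. norm (G' z) \<le> C * exp (\<epsilon> * norm z)" if \<epsilon>: "\<epsilon> > 0" for \<epsilon>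
  proof -
    have \<epsilon>3: "\<epsilon> / 4 > 0" using \<epsilon> by simp
    obtain c where c: "c > 0" "\<And>r. r > 0 \<Longrightarrow> \<exists>\<rho>\<in>{r..2 * r}. \<forall>z. norm z = \<rho> \<longrightarrow> norm (\<phi> (z + p)) \<ge> c * exp (- (\<epsilon> / 4) * r)"
      using zero_type_minimum_modulus[OF zero_type_shift[OF \<phi>, of p] _ \<epsilon>3] p by auto
    obtain C where C: "C > 0" "\<And>z. norm (H (z + p)) \<le> C * exp (\<epsilon> / 4 * norm z)"
      using zero_typeD[OF zero_type_shift[OF H, of p] \<epsilon>3] by blast
    have bound: "norm (G' z) \<le> C / c * exp (3 / 4 * \<epsilon> * r)" if r: "r > 0" "norm z \<le> r" for z r
    proof -
      obtain \<rho> where \<rho>: "r \<le> \<rho>" "\<rho> \<le> 2 * r" "\<And>z. norm z = \<rho> \<Longrightarrow> norm (\<phi> (z + p)) \<ge> c * exp (- (\<epsilon> / 4) * r)"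
        using c(2)[OF r(1)] by auto
      show ?thesis
      proof (rule maximum_modulus_frontier[where f = G' and S = "cball 0 \<rho>"])
        fix w :: complex assume "w \<in> frontier (cball 0 \<rho>)"
        then have w: "norm w = \<rho>" using r \<rho> by (simp add: frontier_cball)
        have "norm (G' w) * (c * exp (- (\<epsilon> / 4) * r)) \<le> norm (G' w) * norm (\<phi> (w + p))"
          using \<rho>(3)[OF w] by (intro mult_left_mono) auto
        also have "\<dots> = norm (H (w + p))"
          using eq[of "w + p"] by (simp add: G'_def mult.commute flip: norm_mult)
        also have "\<dots> \<le> C * exp (\<epsilon> / 4 * (2 * r))"
          using C(2)[of w] mult_left_mono[of \<rho> "2 * r" "C * 1"] w \<rho> \<epsilon> C(1)
          by (elim order_trans) (auto intro!: mult_left_mono)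
        finally have "norm (G' w) \<le> C * exp (\<epsilon> / 4 * (2 * r)) / (c * exp (- (\<epsilon> / 4) * r))"
          using c(1) by (simp add: le_divide_eq)
        also have "\<dots> = C / c * (exp (\<epsilon> / 4 * (2 * r)) * exp (\<epsilon> / 4 * r))"
          by (simp add: exp_minus field_simps)
        also have "exp (\<epsilon> / 4 * (2 * r)) * exp (\<epsilon> / 4 * r) = exp (3 / 4 * \<epsilon> * r)"
          unfolding exp_add[symmetric] by (rule arg_cong[where f = exp]) simp
        finally show "norm (G' w) \<le> C / c * exp (3 / 4 * \<epsilon> * r)" .
      qed (use r \<rho> G' in \<open>auto intro: holomorphic_on_subset holomorphic_on_imp_continuous_on\<close>)
    qed
    have "norm (G' z) \<le> C / c * exp (3 / 4 * \<epsilon>) * exp (\<epsilon> * norm z)" for z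
    proof -
      have "norm (G' z) \<le> C / c * exp (3 / 4 * \<epsilon> * (norm z + 1))"
        by (rule bound) (auto intro: add_nonneg_pos)
      also have "\<dots> \<le> C / c * exp (3 / 4 * \<epsilon> + \<epsilon> * norm z)"
        using C(1) c(1) \<epsilon> by (intro mult_left_mono) (auto simp: algebra_simps)
      finally show ?thesis by (simp add: exp_add)
    qed
    then show ?thesis by blast
  qed
  then have "zero_type G'" unfolding zero_type_def using G' by blast
  from zero_type_shift[OF this, of "- p"] show ?thesis by (simp add: G'_def)
qed

section \<open>The quotient attached to a local convolution equation\<close>

lemma zero_type_mult:
  assumes "zero_type F" "zero_type G"
  shows "zero_type (\<lambda>z. F z * G z)"
  unfolding zero_type_def
proof (intro conjI allI impI)
  show "(\<lambda>z. F z * G z) holomorphic_on UNIV"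
    using assms unfolding zero_type_def by (intro holomorphic_intros) auto
  fix \<epsilon> :: real assume "\<epsilon> > 0"
  then have \<epsilon>: "\<epsilon> / 2 > 0" by simp
  obtain C1 where C1: "C1 > 0" "\<And>z. norm (F z) \<le> C1 * exp (\<epsilon> / 2 * norm z)"
    using zero_typeD[OF assms(1) \<epsilon>] by blast
  obtain C2 where C2: "C2 > 0" "\<And>z. norm (G z) \<le> C2 * exp (\<epsilon> / 2 * norm z)"
    using zero_typeD[OF assms(2) \<epsilon>] by blast
  have "norm (F z * G z) \<le> (C1 * C2) * exp (\<epsilon> * norm z)" for z
  proof -
    have "norm (F z * G z) \<le> (C1 * exp (\<epsilon> / 2 * norm z)) * (C2 * exp (\<epsilon> / 2 * norm z))"
      unfolding norm_mult using C1 C2 by (intro mult_mono) auto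
    also have "\<dots> = (C1 * C2) * exp (\<epsilon> / 2 * norm z + \<epsilon> / 2 * norm z)"
      by (simp only: exp_add mult_ac)
    finally show ?thesis by simp
  qed
  then show "\<exists>C. \<forall>z. norm (F z * G z) \<le> C * exp (\<epsilon> * norm z)" by blast
qed

lemma zero_type_power: "zero_type F \<Longrightarrow> zero_type (\<lambda>z. F z ^ n)"
proof (induction n)
  case 0
  have "\<forall>\<epsilon>>0. \<forall>z. (1::real) \<le> 1 * exp (\<epsilon> * norm (z::complex))" by auto
  then show ?case unfolding zero_type_def by (auto intro: exI[of _ 1])
next
  case (Suc n)
  then show ?case using zero_type_mult[of F "\<lambda>z. F z ^ n"] by simp
qed

text \<open>Integration by parts, with a boundary term from the cut. For \<open>Y\<close> this term
  vanishes, since \<open>c\<close> lies in an interval of zeros; for \<kappa>, cut at 0, it is the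
  value of \<kappa> at 0, the quantity to be shown to vanish.\<close>

lemma ft_left_part_derivative:
  assumes der: "\<And>s. (Y has_vector_derivative Y' s) (at s)" and cont: "continuous_on UNIV Y'"
    and supp: "\<And>s. \<bar>s\<bar> > T \<Longrightarrow> Y s = 0" "\<And>s. \<bar>s\<bar> > T \<Longrightarrow> Y' s = 0"
  shows "ft (left_part c Y') z = exp (\<i> * z * of_real c) * Y c - \<i> * z * ft (left_part c Y) z"
proof -
  have contY: "continuous_on UNIV Y"
    by (rule continuous_on_vector_derivative) (use der has_vector_derivative_at_within in blast)
  have clY: "cl1 Y" "cl1 Y'" using cl1_continuous contY cont supp by blast+
  define f where "f s = exp (\<i> * z * of_real s) * (Y' s + \<i> * z * Y s)" for s
  define a where "a = min (- \<bar>T\<bar> - 1) c"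
  have Ya: "s \<le> a \<Longrightarrow> s \<noteq> c \<Longrightarrow> Y s = 0 \<and> Y' s = 0" for s
    using supp[of s] by (auto simp: a_def)
  have derE: "((\<lambda>s. exp (\<i> * z * of_real s) * Y s) has_vector_derivative f s) (at s)" for s
  proof -
    have "((\<lambda>s. exp (\<i> * z * of_real s)) has_vector_derivative (\<i> * z * exp (\<i> * z * of_real s))) (at s)"
      by (auto intro!: derivative_eq_intros has_vector_derivative_real_field simp: mult_ac)
    from has_vector_derivative_mult[OF this der[of s]] show ?thesis
      by (simp add: f_def algebra_simps)
  qed
  have contf: "continuous_on UNIV f"
    unfolding f_def by (intro continuous_intros cont contY)
  have int: "(LINT s|lborel. indicator {a..c} s *\<^sub>R f s) = exp (\<i> * z * of_real c) * Y c - exp (\<i> * z * of_real a) * Y a"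
    by (rule integral_FTC_atLeastAtMost)
      (auto simp: a_def intro: has_vector_derivative_at_within derE continuous_on_subset[OF contf])
  have "ft (left_part c Y') z + \<i> * z * ft (left_part c Y) z =
      (LINT s|lborel. exp (\<i> * z * of_real s) * left_part c Y' s + \<i> * z * (exp (\<i> * z * of_real s) * left_part c Y s))"
    unfolding ft_def using integrable_ft[OF cl1_left_part[OF clY(1), of c], of z] integrable_ft[OF cl1_left_part[OF clY(2), of c], of z]
    by simp
  also have "\<dots> = (LINT s|lborel. indicator {a..c} s *\<^sub>R f s)"
  proof (rule integral_cong_AE)
    have "AE s in lborel. s \<noteq> c" by (rule AE_lborel_singleton)
    then show "AE s in lborel. exp (\<i> * z * of_real s) * left_part c Y' s + \<i> * z * (exp (\<i> * z * of_real s) * left_part c Y s)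
        = indicator {a..c} s *\<^sub>R f s"
    proof eventually_elim
      case (elim s)
      then show ?case using Ya[of s]
        by (cases "s < a") (auto simp: left_part_def f_def indicator_def distrib_left mult_ac)
    qed
    show "(\<lambda>s. exp (\<i> * z * of_real s) * left_part c Y' s + \<i> * z * (exp (\<i> * z * of_real s) * left_part c Y s)) \<in> borel_measurable lborel"
      by (intro borel_measurable_add borel_measurable_times[OF borel_measurable_const]
          borel_measurable_integrable integrable_ft cl1_left_part clY)
    have "f \<in> borel_measurable borel" by (rule borel_measurable_continuous_onI[OF contf])
    then show "(\<lambda>s. indicator {a..c} s *\<^sub>R f s) \<in> borel_measurable lborel" by measurable
  qed
  also have "\<dots> = exp (\<i> * z * of_real c) * Y c"
  proof -
    have "Y a = 0" using supp(1)[of a] by (auto simp: a_def min_def split: if_splits)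
    then show ?thesis by (simp add: int)
  qed
  finally show ?thesis by (simp add: eq_diff_eq)
qed

text \<open>\<open>G\<close> is of zero type. It is bounded on the real axis because \<open>G\<^sup>n ft Y\<close> is, for every \<open>n\<close>, the
  transform of a function with integral norm at most \<open>B\<^sup>n l1 Y\<close>.\<close>

lemma spectral_quotient_constant:
  assumes \<phi>: "zero_type \<phi>" "\<phi> p \<noteq> 0" and \<psi>: "\<psi> holomorphic_on UNIV" and F: "F holomorphic_on UNIV"
    and Y: "cl1 Y" and \<kappa>: "cl1 \<kappa>"
    and \<phi>F: "\<And>z. \<phi> z * F z = ft Y z" and \<psi>F: "\<And>z. \<psi> z * F z = ft \<kappa> z"
    and c: "\<alpha> < c" "c < \<beta>" and Y0: "\<And>s. \<alpha> \<le> s \<Longrightarrow> s \<le> \<beta> \<Longrightarrow> Y s = 0"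
    and up: "\<And>\<epsilon>. \<epsilon> > 0 \<Longrightarrow> \<exists>C. \<forall>z. Im z \<ge> 0 \<longrightarrow> norm (\<psi> z) \<le> C * exp (\<epsilon> * norm z + \<beta> * Im z)"
    and low: "\<And>\<epsilon>. \<epsilon> > 0 \<Longrightarrow> \<exists>C. \<forall>z. Im z \<le> 0 \<longrightarrow> norm (\<psi> z) \<le> C * exp (\<epsilon> * norm z + \<alpha> * Im z)"
    and G: "G holomorphic_on UNIV"
    and eq: "\<And>z. \<phi> z * G z = \<phi> z * ft (left_part 0 \<kappa>) z - \<psi> z * ft (left_part c Y) z"
  shows "\<exists>k. \<forall>z. G z = k"
proof -
  define K where "K = left_part 0 \<kappa>"
  define K' where "K' = (\<lambda>s. \<kappa> s - K s)"
  define v where "v = left_part c Y"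
  define w where "w = (\<lambda>s. Y s - v s)"
  have K: "cl1 K" unfolding K_def by (rule cl1_left_part[OF \<kappa>])
  have K': "cl1 K'" unfolding K'_def by (rule cl1_diff[OF \<kappa> K])
  have v: "cl1 v" unfolding v_def by (rule cl1_left_part[OF Y])
  have w: "cl1 w" unfolding w_def by (rule cl1_diff[OF Y v])
  have ftK': "ft K' z = ft \<kappa> z - ft K z" for z unfolding K'_def by (rule ft_diff[OF \<kappa> K])
  have ftw: "ft w z = ft Y z - ft v z" for z unfolding w_def by (rule ft_diff[OF Y v])
  have sK: "s \<le> 0" if "K s \<noteq> 0" for s using that by (auto simp: K_def left_part_def split: if_splits)
  have sK': "s \<ge> 0" if "K' s \<noteq> 0" for s using that by (auto simp: K'_def K_def left_part_def split: if_splits)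
  have sv: "s \<le> \<alpha>" if "v s \<noteq> 0" for s
    using that Y0[of s] c by (cases "s < c"; cases "s \<le> \<alpha>") (auto simp: v_def left_part_def)
  have sw: "s \<ge> \<beta>" if "w s \<noteq> 0" for s
    using that Y0[of s] c by (cases "s < c"; cases "s \<ge> \<beta>") (auto simp: w_def v_def left_part_def)
  have bK: "norm (ft K z) \<le> l1 K" if "Im z \<le> 0" for z
    using ft_bound[OF K, of z 0] sK that by (auto simp: mult_le_0_iff zero_le_mult_iff)
  have bK': "norm (ft K' z) \<le> l1 K'" if "Im z \<ge> 0" for z
    using ft_bound[OF K', of z 0] sK' that by (auto simp: mult_le_0_iff zero_le_mult_iff)
  have bv: "norm (ft v z) \<le> l1 v * exp (- \<alpha> * Im z)" if "Im z \<le> 0" for z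
    using that by (intro ft_bound[OF v]) (use mult_right_mono_neg[OF sv, of _ "Im z"] in \<open>simp add: mult.commute\<close>)
  have bw: "norm (ft w z) \<le> l1 w * exp (- \<beta> * Im z)" if "Im z \<ge> 0" for z
    using that by (intro ft_bound[OF w]) (use mult_right_mono[OF sw, of _ "Im z"] in \<open>simp add: mult.commute\<close>)
  define H where "H z = \<phi> z * ft K z - \<psi> z * ft v z" for z
  \<comment> \<open>The definition of \<open>H\<close> is used in the lower half-plane, this form in
    the upper one. The growth of \<psi> is compensated because \<open>v\<close> lives to the left of
    \<alpha> and \<open>w\<close> to the right of \<beta>.\<close>
  have H2: "H z = \<psi> z * ft w z - \<phi> z * ft K' z" for z
  proof -
    have "\<phi> z * ft \<kappa> z = \<psi> z * ft Y z" using \<phi>F[of z] \<psi>F[of z] by (metis mult.left_commute)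
    then show ?thesis unfolding H_def ftK' ftw by (simp add: algebra_simps)
  qed
  have "zero_type H"
    unfolding zero_type_def
  proof (intro conjI allI impI)
    show "H holomorphic_on UNIV"
      unfolding H_def using \<phi> by (intro holomorphic_intros \<psi> ft_holomorphic K v) (auto simp: zero_type_def)
    fix \<epsilon> :: real assume \<epsilon>: "\<epsilon> > 0"
    obtain A where A: "A > 0" "\<And>z. norm (\<phi> z) \<le> A * exp (\<epsilon> * norm z)"
      using zero_typeD[OF \<phi>(1) \<epsilon>] by blast
    obtain C1 where C1: "\<And>z. Im z \<ge> 0 \<Longrightarrow> norm (\<psi> z) \<le> C1 * exp (\<epsilon> * norm z + \<beta> * Im z)"
      using up[OF \<epsilon>] by blast
    obtain C2 where C2: "\<And>z. Im z \<le> 0 \<Longrightarrow> norm (\<psi> z) \<le> C2 * exp (\<epsilon> * norm z + \<alpha> * Im z)"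
      using low[OF \<epsilon>] by blast
    have C0: "C1 \<ge> 0" "C2 \<ge> 0"
      using order_trans[OF norm_ge_zero C1[of 0]] order_trans[OF norm_ge_zero C2[of 0]] by simp_all
    define L where "L = A * l1 K + A * l1 K' + C1 * l1 w + C2 * l1 v"
    have "norm (H z) \<le> L * exp (\<epsilon> * norm z)" for z
    proof -
      have nn: "0 \<le> A * l1 K * exp (\<epsilon> * norm z)" "0 \<le> A * l1 K' * exp (\<epsilon> * norm z)"
        "0 \<le> C1 * l1 w * exp (\<epsilon> * norm z)" "0 \<le> C2 * l1 v * exp (\<epsilon> * norm z)"
        using A C0 l1_nonneg by simp_all
      show ?thesis
      proof (cases "Im z \<le> 0")
        case True
        have "norm (H z) \<le> norm (\<phi> z) * norm (ft K z) + norm (\<psi> z) * norm (ft v z)"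
          unfolding H_def norm_mult[symmetric] by (rule norm_triangle_ineq4)
        also have "\<dots> \<le> (A * exp (\<epsilon> * norm z)) * l1 K + (C2 * exp (\<epsilon> * norm z + \<alpha> * Im z)) * (l1 v * exp (- \<alpha> * Im z))"
          using A C0 bK[OF True] bv[OF True] C2[OF True] by (intro add_mono mult_mono) auto
        also have "(C2 * exp (\<epsilon> * norm z + \<alpha> * Im z)) * (l1 v * exp (- \<alpha> * Im z)) = C2 * l1 v * exp (\<epsilon> * norm z)"
          by (simp add: exp_add exp_minus)
        finally show ?thesis using nn unfolding L_def by (simp add: algebra_simps)
      next
        case False
        then have z: "Im z \<ge> 0" by simp
        have "norm (H z) \<le> norm (\<psi> z) * norm (ft w z) + norm (\<phi> z) * norm (ft K' z)"
          unfolding H2 norm_mult[symmetric] by (rule norm_triangle_ineq4)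
        also have "\<dots> \<le> (C1 * exp (\<epsilon> * norm z + \<beta> * Im z)) * (l1 w * exp (- \<beta> * Im z)) + (A * exp (\<epsilon> * norm z)) * l1 K'"
          using A C0 bK'[OF z] bw[OF z] C1[OF z] by (intro add_mono mult_mono) auto
        also have "(C1 * exp (\<epsilon> * norm z + \<beta> * Im z)) * (l1 w * exp (- \<beta> * Im z)) = C1 * l1 w * exp (\<epsilon> * norm z)"
          by (simp add: exp_add exp_minus)
        finally show ?thesis using nn unfolding L_def by (simp add: algebra_simps)
      qed
    qed
    then show "\<exists>C. \<forall>z. norm (H z) \<le> C * exp (\<epsilon> * norm z)" by blast
  qed
  then have G0: "zero_type G"
    using zero_type_quotient[OF \<phi>(1) _ \<phi>(2) G] eq by (simp add: H_def K_def v_def)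
  \<comment> \<open>The equation for \<open>G\<close>, multiplied by \<open>F * G ^ n\<close>,
    writes the next transform as \<open>ft K\<close> times \<open>ft W\<close> minus
    \<open>ft \<kappa>\<close> times the transform of the left part of \<open>W\<close>. So each
    step costs the factor \<open>l1 K + l1 \<kappa>\<close>.\<close>
  define B where "B = l1 K + l1 \<kappa>"
  have B: "B \<ge> 0" unfolding B_def using l1_nonneg by simp
  have iterate: "\<exists>W. cl1 W \<and> l1 W \<le> B ^ n * l1 Y \<and> (\<forall>z. ft W z = G z ^ n * ft Y z)" for n
  proof (induction n)
    case 0
    then show ?case using Y by auto
  next
    case (Suc n)
    then obtain W where W: "cl1 W" "l1 W \<le> B ^ n * l1 Y" "\<And>z. ft W z = G z ^ n * ft Y z" by blast
    have Gn: "zero_type (\<lambda>z. G z ^ n)" by (rule zero_type_power[OF G0])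
    \<comment> \<open>\<open>G ^ n\<close> has zero type, so multiplication by it keeps the two
      summands separated: the left one is again the transform of a left part.\<close>
    have sep: "G z ^ n * ft v z = ft (left_part c W) z" for z
    proof (rule ft_separation[OF W(1), where \<Theta> = "\<lambda>z. G z ^ n * ft v z" and \<Xi> = "\<lambda>z. G z ^ n * ft w z" and a = \<alpha> and b = \<beta>])
      show "(\<lambda>z. G z ^ n * ft v z) holomorphic_on UNIV" "(\<lambda>z. G z ^ n * ft w z) holomorphic_on UNIV"
        by (intro holomorphic_intros G ft_holomorphic v w)+
      show "G z ^ n * ft v z + G z ^ n * ft w z = ft W z" for z
        by (simp add: W(3) ftw algebra_simps)
      fix \<epsilon> :: real assume \<epsilon>: "\<epsilon> > 0"
      obtain C where C: "C > 0" "\<And>z. norm (G z ^ n) \<le> C * exp (\<epsilon> * norm z)"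
        using zero_typeD[OF Gn \<epsilon>] by blast
      have "norm (G z ^ n * ft v z) \<le> (C * l1 v) * exp (\<epsilon> * norm z - \<alpha> * Im z)" if "Im z \<le> 0" for z
      proof -
        have "norm (G z ^ n * ft v z) \<le> (C * exp (\<epsilon> * norm z)) * (l1 v * exp (- \<alpha> * Im z))"
          unfolding norm_mult[of "G z ^ n"] using C bv[OF that] by (intro mult_mono) auto
        then show ?thesis by (simp add: exp_diff exp_minus field_simps)
      qed
      then show "\<exists>C. \<forall>z. Im z \<le> 0 \<longrightarrow> norm (G z ^ n * ft v z) \<le> C * exp (\<epsilon> * norm z - \<alpha> * Im z)" by blast
      have "norm (G z ^ n * ft w z) \<le> (C * l1 w) * exp (\<epsilon> * norm z - \<beta> * Im z)" if "Im z \<ge> 0" for z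
      proof -
        have "norm (G z ^ n * ft w z) \<le> (C * exp (\<epsilon> * norm z)) * (l1 w * exp (- \<beta> * Im z))"
          unfolding norm_mult[of "G z ^ n"] using C bw[OF that] by (intro mult_mono) auto
        then show ?thesis by (simp add: exp_diff exp_minus field_simps)
      qed
      then show "\<exists>C. \<forall>z. Im z \<ge> 0 \<longrightarrow> norm (G z ^ n * ft w z) \<le> C * exp (\<epsilon> * norm z - \<beta> * Im z)" by blast
    qed (use c in auto)
    obtain W1 where W1: "cl1 W1" "l1 W1 \<le> l1 K * l1 W" "\<And>z. ft W1 z = ft K z * ft W z"
      using ft_convolution[OF K W(1)] by blast
    obtain W2 where W2: "cl1 W2" "l1 W2 \<le> l1 \<kappa> * l1 (left_part c W)" "\<And>z. ft W2 z = ft \<kappa> z * ft (left_part c W) z"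
      using ft_convolution[OF \<kappa> cl1_left_part[OF W(1)]] by blast
    have "l1 W2 \<le> l1 \<kappa> * l1 W"
      using W2(2) mult_left_mono[OF l1_left_part[OF W(1)] l1_nonneg[of \<kappa>]] by (rule order_trans)
    then have "l1 (\<lambda>s. W1 s - W2 s) \<le> B * l1 W"
      using l1_diff[OF W1(1) W2(1)] W1(2) by (simp add: B_def distrib_right)
    also have "\<dots> \<le> B ^ Suc n * l1 Y" using mult_left_mono[OF W(2) B] by (simp add: mult_ac)
    finally have "l1 (\<lambda>s. W1 s - W2 s) \<le> B ^ Suc n * l1 Y" .
    moreover have "ft (\<lambda>s. W1 s - W2 s) z = G z ^ Suc n * ft Y z" for z
    proof -
      have "G z ^ Suc n * ft Y z = G z ^ n * F z * (\<phi> z * G z)"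
        by (simp add: \<phi>F[symmetric] mult_ac)
      also have "\<dots> = ft K z * (G z ^ n * (\<phi> z * F z)) - \<psi> z * F z * (G z ^ n * ft v z)"
        unfolding eq K_def[symmetric] v_def[symmetric] by (simp add: algebra_simps)
      also have "\<dots> = ft (\<lambda>s. W1 s - W2 s) z"
        unfolding ft_diff[OF W1(1) W2(1)] W1(3) W2(3) sep W(3) \<phi>F \<psi>F ..
      finally show ?thesis ..
    qed
    ultimately show ?case using cl1_diff[OF W1(1) W2(1)] by blast
  qed
  \<comment> \<open>Comparison of n-th powers: the fixed factors \<open>m\<close> and
    \<open>L\<close> lose their influence as n tends to infinity.\<close>
  have pow: "norm (G (of_real x)) \<le> B" if "m > 0" "\<And>n. norm (G (of_real x)) ^ n * m \<le> B ^ n * L" for x m L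
  proof (rule ccontr)
    assume "\<not> ?thesis"
    then have gB: "norm (G (of_real x)) > B" by simp
    define q where "q = B / norm (G (of_real x))"
    have q: "0 \<le> q" "q < 1" using gB B by (auto simp: q_def divide_less_eq)
    have "m \<le> q ^ n * L" for n
    proof -
      have "norm (G (of_real x)) ^ n > 0" using gB B by (intro zero_less_power) linarith
      then show ?thesis using that(2)[of n] by (simp add: q_def power_divide le_divide_eq mult_ac)
    qed
    moreover have "(\<lambda>n. q ^ n * L) \<longlonglongrightarrow> 0 * L" using q by (intro tendsto_intros LIMSEQ_power_zero) auto
    ultimately have "m \<le> 0 * L" by (intro LIMSEQ_le_const) auto
    then show False using \<open>m > 0\<close> by simp
  qed
  \<comment> \<open>The bound holds off the zeros of an entire function \<open>q\<close> that is not
    identically zero: \<open>ft Y\<close>, or \<phi> if \<open>ft Y\<close> is zero. Continuity of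
    \<open>G\<close> then fills the gaps.\<close>
  have "\<exists>q p. q holomorphic_on UNIV \<and> q p \<noteq> 0 \<and> (\<forall>x. q (of_real x) \<noteq> 0 \<longrightarrow> norm (G (of_real x)) \<le> B)"
  proof (cases "\<forall>z. ft Y z = 0")
    case False
    have "norm (G (of_real x)) \<le> B" if "ft Y (of_real x) \<noteq> 0" for x
    proof (rule pow[of "norm (ft Y (of_real x))" x "l1 Y"])
      show "norm (G (of_real x)) ^ n * norm (ft Y (of_real x)) \<le> B ^ n * l1 Y" for n
      proof -
        obtain W where W: "cl1 W" "l1 W \<le> B ^ n * l1 Y" "\<And>z. ft W z = G z ^ n * ft Y z"
          using iterate[of n] by blast
        show ?thesis using ft_real_bound[OF W(1), of x] W(2) by (simp add: W(3) norm_mult norm_power)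
      qed
    qed (use that in simp)
    then show ?thesis using False ft_holomorphic[OF Y] by blast
  next
    case True
    have "0 = ft v z" for z
      unfolding v_def
    proof (rule ft_separation[OF Y, where \<Theta> = "\<lambda>_. 0" and \<Xi> = "\<lambda>_. 0" and a = "c - 1" and b = "c + 1"])
      show "\<exists>C. \<forall>z. Im z \<le> 0 \<longrightarrow> norm (0::complex) \<le> C * exp (\<epsilon> * norm z - (c - 1) * Im z)" for \<epsilon>
        by (rule exI[of _ 0]) simp
      show "\<exists>C. \<forall>z. Im z \<ge> 0 \<longrightarrow> norm (0::complex) \<le> C * exp (\<epsilon> * norm z - (c + 1) * Im z)" for \<epsilon>
        by (rule exI[of _ 0]) simp
    qed (use True in auto)
    then have GK: "\<phi> z * G z = \<phi> z * ft K z" for z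
      using eq[of z] by (simp add: K_def v_def)
    have "norm (G (of_real x)) \<le> B" if "\<phi> (of_real x) \<noteq> 0" for x
      using GK[of "of_real x"] that ft_real_bound[OF K, of x] l1_nonneg[of \<kappa>] by (simp add: B_def)
    then show ?thesis using \<phi> by (auto simp: zero_type_def)
  qed
  then obtain q p where q: "q holomorphic_on UNIV" "q p \<noteq> 0" "\<And>x. q (of_real x) \<noteq> 0 \<Longrightarrow> norm (G (of_real x)) \<le> B"
    by blast
  have "norm (G (of_real x)) \<le> B" for x
  proof -
    have "eventually (\<lambda>w. q w \<noteq> 0 \<and> w \<in> UNIV) (at (of_real x))"
      using q by (intro non_zero_neighbour_alt[where \<beta> = p]) auto
    moreover have "filterlim (of_real :: real \<Rightarrow> complex) (at (of_real x)) (at x)"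
      by (intro filterlim_atI tendsto_of_real tendsto_ident_at) (auto simp: eventually_at_filter)
    ultimately have "eventually (\<lambda>t. q (of_real t) \<noteq> 0) (at x)"
      unfolding filterlim_iff by (auto elim: eventually_mono)
    then have ev: "eventually (\<lambda>t. norm (G (of_real t)) \<le> B) (at x)"
      using q(3) by (auto elim: eventually_mono)
    have "isCont G (of_real x)"
      using holomorphic_on_imp_continuous_on[OF G] continuous_on_eq_continuous_at[OF open_UNIV] by blast
    then have "((\<lambda>t. norm (G (of_real t))) \<longlongrightarrow> norm (G (of_real x))) (at x)"
      by (intro tendsto_norm isCont_tendsto_compose[of _ G] tendsto_of_real tendsto_ident_at)
    then show ?thesis by (rule tendsto_upperbound[OF _ ev]) simp
  qed
  then show ?thesis using zero_type_bounded_real_axis[OF G0] by metis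
qed

text \<open>Passing to derivatives turns \<open>G\<close> into \<open>\<kappa> 0 0 - \<i> z G\<close>, which is constant as well.\<close>

lemma spectral_quotient_vanish:
  fixes Y \<kappa> :: "nat \<Rightarrow> real \<Rightarrow> complex"
  assumes \<phi>: "zero_type \<phi>" "\<phi> p \<noteq> 0" and \<psi>: "\<psi> holomorphic_on UNIV" and F: "F holomorphic_on UNIV"
    and derY: "\<And>j s. (Y j has_vector_derivative Y (Suc j) s) (at s)"
    and der\<kappa>: "\<And>j s. (\<kappa> j has_vector_derivative \<kappa> (Suc j) s) (at s)"
    and supp: "\<And>j s. \<bar>s\<bar> > T \<Longrightarrow> Y j s = 0" "\<And>j s. \<bar>s\<bar> > T \<Longrightarrow> \<kappa> j s = 0"
    and \<phi>F: "\<And>z. \<phi> z * F z = ft (Y 0) z" and \<psi>F: "\<And>z. \<psi> z * F z = ft (\<kappa> 0) z"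
    and c: "\<alpha> < c" "c < \<beta>" and Y0: "\<And>j s. \<alpha> \<le> s \<Longrightarrow> s \<le> \<beta> \<Longrightarrow> Y j s = 0"
    and up: "\<And>\<epsilon>. \<epsilon> > 0 \<Longrightarrow> \<exists>C. \<forall>z. Im z \<ge> 0 \<longrightarrow> norm (\<psi> z) \<le> C * exp (\<epsilon> * norm z + \<beta> * Im z)"
    and low: "\<And>\<epsilon>. \<epsilon> > 0 \<Longrightarrow> \<exists>C. \<forall>z. Im z \<le> 0 \<longrightarrow> norm (\<psi> z) \<le> C * exp (\<epsilon> * norm z + \<alpha> * Im z)"
    and G: "G holomorphic_on UNIV"
    and eq: "\<And>z. \<phi> z * G z = \<phi> z * ft (left_part 0 (\<kappa> 0)) z - \<psi> z * ft (left_part c (Y 0)) z"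
  shows "\<kappa> 0 0 = 0"
proof -
  have contY: "continuous_on UNIV (Y j)" and cont\<kappa>: "continuous_on UNIV (\<kappa> j)" for j
    by (rule continuous_on_vector_derivative, use derY der\<kappa> has_vector_derivative_at_within in blast)+
  have clY: "cl1 (Y j)" and cl\<kappa>: "cl1 (\<kappa> j)" for j
    using cl1_continuous[OF contY] cl1_continuous[OF cont\<kappa>] supp by blast+
  have lY: "ft (left_part c (Y (Suc j))) z = - \<i> * z * ft (left_part c (Y j)) z" for j z
    using ft_left_part_derivative[OF derY[where j = j] contY supp(1)[where j = j] supp(1)[where j = "Suc j"], where c = c and z = z] Y0[of c j] c by simp
  have l\<kappa>: "ft (left_part 0 (\<kappa> (Suc j))) z = \<kappa> j 0 - \<i> * z * ft (left_part 0 (\<kappa> j)) z" for j z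
    using ft_left_part_derivative[OF der\<kappa>[where j = j] cont\<kappa> supp(2)[where j = j] supp(2)[where j = "Suc j"], where c = 0 and z = z] by simp
  have full: "ft (left_part (\<bar>T\<bar> + 1) X) = ft X" if "\<And>s. \<bar>s\<bar> > T \<Longrightarrow> X s = 0" for X
  proof -
    have "left_part (\<bar>T\<bar> + 1) X = X" using that by (auto simp: left_part_def fun_eq_iff)
    then show ?thesis by simp
  qed
  have fY: "ft (Y (Suc j)) z = - \<i> * z * ft (Y j) z" for j z
    using ft_left_part_derivative[OF derY[where j = j] contY supp(1)[where j = j] supp(1)[where j = "Suc j"], where c = "\<bar>T\<bar> + 1" and z = z] supp(1)[of "\<bar>T\<bar> + 1" j]
    by (simp add: full supp)
  have f\<kappa>: "ft (\<kappa> (Suc j)) z = - \<i> * z * ft (\<kappa> j) z" for j z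
    using ft_left_part_derivative[OF der\<kappa>[where j = j] cont\<kappa> supp(2)[where j = j] supp(2)[where j = "Suc j"], where c = "\<bar>T\<bar> + 1" and z = z] supp(2)[of "\<bar>T\<bar> + 1" j]
    by (simp add: full supp)
  define FF where "FF j z = (- \<i> * z) ^ j * F z" for j :: nat and z
  have FFhol: "FF j holomorphic_on UNIV" for j unfolding FF_def by (intro holomorphic_intros F)
  have \<phi>FF: "\<phi> z * FF j z = ft (Y j) z" and \<psi>FF: "\<psi> z * FF j z = ft (\<kappa> j) z" for j z
    by (induction j) (use \<phi>F \<psi>F in \<open>auto simp: FF_def fY f\<kappa> mult_ac\<close>)
  define GG where "GG = rec_nat G (\<lambda>j g z. \<kappa> j 0 - \<i> * z * g z)"
  have GG0: "GG 0 = G" and GGS: "GG (Suc j) = (\<lambda>z. \<kappa> j 0 - \<i> * z * GG j z)" for j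
    by (simp_all add: GG_def)
  have GGhol: "GG j holomorphic_on UNIV" for j
    by (induction j) (auto simp: GG0 GGS intro!: holomorphic_intros G)
  have GGeq: "\<phi> z * GG j z = \<phi> z * ft (left_part 0 (\<kappa> j)) z - \<psi> z * ft (left_part c (Y j)) z" for j z
  proof (induction j)
    case (Suc j)
    have "\<phi> z * GG (Suc j) z = \<phi> z * \<kappa> j 0 - \<i> * z * (\<phi> z * GG j z)"
      by (simp add: GGS algebra_simps)
    then show ?case unfolding Suc.IH lY l\<kappa> by (simp add: algebra_simps)
  qed (simp add: GG0 eq)
  have const: "\<exists>k. \<forall>z. GG j z = k" for j
    by (rule spectral_quotient_constant[OF \<phi> \<psi> FFhol clY cl\<kappa> \<phi>FF \<psi>FF c Y0 up low GGhol GGeq])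
  \<comment> \<open>\<open>GG (Suc j) z = \<kappa> j 0 - \<i> * z * GG j z\<close> with both
    \<open>GG j\<close> and \<open>GG (Suc j)\<close> constant forces \<open>GG j = 0\<close>. The
    same one index further gives \<open>\<kappa> j 0 = 0\<close>.\<close>
  have zero: "GG j z = 0" and "GG (Suc j) z = \<kappa> j 0" for j z
  proof -
    obtain k where k: "\<And>z. GG j z = k" using const by blast
    obtain k' where k': "\<And>z. GG (Suc j) z = k'" using const by blast
    have e: "k' = \<kappa> j 0 - \<i> * z * k" for z using GGS[of j] k k' by metis
    have "k' = \<kappa> j 0" using e[of 0] by simp
    then have "k = 0" using e[of 1] by simp
    then show "GG j z = 0" "GG (Suc j) z = \<kappa> j 0" using k k' \<open>k' = \<kappa> j 0\<close> by auto
  qed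
  then show ?thesis by metis
qed

section \<open>The weight sequences\<close>

text \<open>The constants of the semi-norms: \<open>Mw \<omega> q j = sup {x\<^sup>j e\<^sup>-\<^sup>q\<^sup>\<omega>\<^sup>(\<^sup>x\<^sup>) | x \<ge> 1}\<close>.\<close>

definition Mw :: "(real \<Rightarrow> real) \<Rightarrow> real \<Rightarrow> nat \<Rightarrow> real" where
  "Mw \<omega> q j = exp (q * young_conj \<omega> (real j / q))"

locale ultra_weight =
  fixes \<omega> :: "real \<Rightarrow> real"
  assumes weight: "weight \<omega>"
begin

abbreviation M :: "real \<Rightarrow> nat \<Rightarrow> real" where "M \<equiv> Mw \<omega>"

lemma weight_nonneg: "x \<ge> 0 \<Longrightarrow> \<omega> x \<ge> 0"
  using weight by (simp add: weight_def)

lemma weight_mono: "0 \<le> x \<Longrightarrow> x \<le> y \<Longrightarrow> \<omega> x \<le> \<omega> y"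
  using weight by (auto simp: weight_def mono_on_def)

lemma weight_sublinear:
  assumes "\<eta> > 0"
  obtains C where "C > 0" "\<And>x. x \<ge> 0 \<Longrightarrow> \<omega> x \<le> \<eta> * x + C"
proof -
  have "\<omega> \<in> o[at_top](\<lambda>x. x)" using weight by (simp add: weight_def)
  then have "eventually (\<lambda>x. norm (\<omega> x) \<le> \<eta> * norm x) at_top"
    using assms by (auto dest: landau_o.smallD)
  then obtain X where X: "\<And>x. x \<ge> X \<Longrightarrow> \<bar>\<omega> x\<bar> \<le> \<eta> * \<bar>x\<bar>"
    by (auto simp: eventually_at_top_linorder)
  have "\<omega> x \<le> \<eta> * x + (\<omega> (max X 0) + 1)" if "x \<ge> 0" for x
  proof (cases "x \<ge> X")
    case True
    then show ?thesis using X[of x] that weight_nonneg[of "max X 0"] by simp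
  next
    case False
    then show ?thesis using weight_mono[of x "max X 0"] that assms
      by (smt (verit) mult_nonneg_nonneg max.cobounded1)
  qed
  moreover have "\<omega> (max X 0) + 1 > 0" using weight_nonneg[of "max X 0"] by simp
  ultimately show ?thesis using that by blast
qed

lemma weight_dominates_ln:
  assumes "K > 0"
  obtains C where "C > 0" "\<And>x. x \<ge> 1 \<Longrightarrow> K * ln x \<le> \<omega> x + C"
proof -
  have "ln \<in> o[at_top](\<omega>)" using weight by (simp add: weight_def)
  then have "eventually (\<lambda>x. norm (ln x) \<le> 1 / K * norm (\<omega> x)) at_top"
    using assms by (intro landau_o.smallD) auto
  then obtain X where X: "\<And>x. x \<ge> X \<Longrightarrow> \<bar>ln x\<bar> \<le> 1 / K * \<bar>\<omega> x\<bar>"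
    by (auto simp: eventually_at_top_linorder)
  define C where "C = K * ln (max X 1) + 1"
  have C: "C > 0" using assms by (simp add: C_def add_nonneg_pos)
  have "K * ln x \<le> \<omega> x + C" if "x \<ge> 1" for x
  proof (cases "x \<ge> X")
    case True
    then show ?thesis using X[of x] that weight_nonneg[of x] assms C by (simp add: field_simps)
  next
    case False
    then have "K * ln x \<le> K * ln (max X 1)" using that assms by (intro mult_left_mono) auto
    then show ?thesis using weight_nonneg[of x] that by (simp add: C_def)
  qed
  then show ?thesis using that C by blast
qed

text \<open>Keeps the supremum in \<open>young_conj\<close> meaningful: over an unbounded set of
  reals \<open>SUP\<close> has no useful value.\<close>

lemma young_conj_bdd: "bdd_above ((\<lambda>t. s * t - \<omega> (exp t)) ` {0..})"
proof -
  obtain C where C: "\<And>x. x \<ge> 1 \<Longrightarrow> (\<bar>s\<bar> + 1) * ln x \<le> \<omega> x + C"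
    using weight_dominates_ln[of "\<bar>s\<bar> + 1"] by (metis abs_ge_zero add_nonneg_pos zero_less_one)
  have "s * t - \<omega> (exp t) \<le> C" if "t \<ge> 0" for t
  proof -
    have "s * t \<le> (\<bar>s\<bar> + 1) * t" using that by (intro mult_right_mono) auto
    then show ?thesis using C[of "exp t"] that by simp
  qed
  then show ?thesis by (auto intro!: bdd_aboveI)
qed

section \<open>The weight sequence as a supremum\<close>

lemma M_pos: "M q j > 0"
  by (simp add: Mw_def)

lemma M_ge:
  assumes "q > 0" "x \<ge> 1"
  shows "x ^ j * exp (- q * \<omega> x) \<le> M q j"
proof -
  have "real j / q * ln x - \<omega> (exp (ln x)) \<le> young_conj \<omega> (real j / q)"
    unfolding young_conj_def using assms by (intro cSUP_upper young_conj_bdd) auto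
  then have "q * (real j / q * ln x - \<omega> x) \<le> q * young_conj \<omega> (real j / q)"
    using assms by (intro mult_left_mono) auto
  then have "real j * ln x - q * \<omega> x \<le> q * young_conj \<omega> (real j / q)"
    using assms by (simp add: right_diff_distrib)
  then have "exp (real j * ln x - q * \<omega> x) \<le> M q j" unfolding Mw_def by simp
  then show ?thesis using assms by (simp add: exp_diff exp_minus divide_inverse exp_of_nat_mult)
qed

text \<open>With \<open>M_ge\<close> this characterises \<open>M q j\<close> as a supremum over
  \<open>x \<ge> 1\<close>; the comparisons of the sequences below rest on this pair instead of the
  conjugate function.\<close>

lemma M_le:
  assumes "q > 0" and le: "\<And>x. x \<ge> 1 \<Longrightarrow> x ^ j * exp (- q * \<omega> x) \<le> B"
  shows "M q j \<le> B"
proof -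
  have B: "B > 0" using le[of 1] by (smt (verit) exp_gt_zero mult_pos_pos power_one)
  have "young_conj \<omega> (real j / q) \<le> ln B / q"
    unfolding young_conj_def
  proof (rule cSUP_least)
    fix t :: real assume t: "t \<in> {0..}"
    have "exp (real j * t - q * \<omega> (exp t)) \<le> B"
      using le[of "exp t"] t by (simp add: exp_diff exp_minus divide_inverse exp_of_nat_mult)
    then have "real j * t - q * \<omega> (exp t) \<le> ln B" using B by (simp add: ln_ge_iff)
    then have "(real j * t - q * \<omega> (exp t)) / q \<le> ln B / q"
      using assms(1) by (intro divide_right_mono) auto
    then show "real j / q * t - \<omega> (exp t) \<le> ln B / q" using assms(1) by (simp add: diff_divide_distrib)
  qed simp
  then have "q * young_conj \<omega> (real j / q) \<le> ln B" using assms(1) by (simp add: field_simps)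
  then show ?thesis unfolding Mw_def using B by (metis exp_le_cancel_iff exp_ln)
qed

lemma M_antimono:
  assumes "0 < q" "q \<le> q'"
  shows "M q' j \<le> M q j"
proof (rule M_le)
  fix x :: real assume x: "x \<ge> 1"
  have "x ^ j * exp (- q' * \<omega> x) \<le> x ^ j * exp (- q * \<omega> x)"
    using x assms weight_nonneg[of x] by (intro mult_left_mono) (auto intro: mult_right_mono)
  also have "\<dots> \<le> M q j" by (rule M_ge) (use assms x in auto)
  finally show "x ^ j * exp (- q' * \<omega> x) \<le> M q j" .
qed (use assms in auto)

lemma M_Suc:
  assumes "0 < q"
  shows "M q j \<le> M q (Suc j)"
proof (rule M_le)
  fix x :: real assume x: "x \<ge> 1"
  have "x ^ j * exp (- q * \<omega> x) \<le> x ^ Suc j * exp (- q * \<omega> x)"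
    using x by (intro mult_right_mono power_increasing) auto
  also have "\<dots> \<le> M q (Suc j)" by (rule M_ge) (use assms x in auto)
  finally show "x ^ j * exp (- q * \<omega> x) \<le> M q (Suc j)" .
qed (use assms in auto)

text \<open>Enlarging \<open>q\<close> frees the factor
  \<open>exp (- (q' - q) * \<omega> x)\<close>, which absorbs \<open>x ^ K\<close>: a fixed number
  of extra derivatives costs an arbitrarily small change of \<open>q\<close>.\<close>

lemma M_shift:
  assumes "0 < q" "q < q'"
  shows "M q' (j + K) \<le> M (q' - q) K * M q j"
proof (rule M_le)
  fix x :: real assume x: "x \<ge> 1"
  have "x ^ (j + K) * exp (- q' * \<omega> x) = (x ^ K * exp (- (q' - q) * \<omega> x)) * (x ^ j * exp (- q * \<omega> x))"
    by (simp add: power_add algebra_simps flip: exp_add)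
  also have "\<dots> \<le> M (q' - q) K * M q j"
    using assms x M_pos by (intro mult_mono M_ge) (auto intro: less_imp_le)
  finally show "x ^ (j + K) * exp (- q' * \<omega> x) \<le> M (q' - q) K * M q j" .
qed (use assms in auto)

text \<open>Sublinearity of \<omega> puts analytic functions into the class. The supremum is tested
  at \<open>x = 2 n / r\<close>, and \<eta> is chosen such that
  \<open>q * \<eta> * 2 n / r = n * ln 2\<close>: the weight then costs \<open>2 ^ n\<close>, just
  what the 2 in \<open>x\<close> has gained.\<close>

lemma M_factorial:
  assumes "r > 0" "q > 0"
  obtains C where "C > 0" "\<And>n. fact n / r ^ n \<le> C * M q n"
proof -
  define \<eta> where "\<eta> = r * ln 2 / (2 * q)"
  have \<eta>: "\<eta> > 0" using assms by (simp add: \<eta>_def)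
  obtain C where C: "C > 0" "\<And>x. x \<ge> 0 \<Longrightarrow> \<omega> x \<le> \<eta> * x + C"
    using weight_sublinear[OF \<eta>] by blast
  define C' where "C' = exp (q * (\<eta> + C))"
  have "fact n / r ^ n \<le> C' * M q n" for n
  proof -
    define x where "x = max 1 (2 * real n / r)"
    have x: "x \<ge> 1" "x \<ge> 2 * real n / r" "x \<le> 1 + 2 * real n / r" using assms by (auto simp: x_def)
    have "q * \<omega> x \<le> q * (\<eta> * (1 + 2 * real n / r) + C)"
      using C(2)[of x] x \<eta> assms by (intro mult_left_mono) (auto intro: order_trans mult_left_mono)
    also have "\<dots> = q * (\<eta> + C) + real n * ln 2"
      using assms by (simp add: \<eta>_def field_simps)
    finally have "exp (- (q * (\<eta> + C) + real n * ln 2)) \<le> exp (- q * \<omega> x)" by simp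
    then have e: "inverse C' * inverse (2 ^ n) \<le> exp (- q * \<omega> x)"
      by (simp add: C'_def exp_add exp_diff exp_minus exp_of_nat_mult divide_inverse)
    have "fact n / r ^ n \<le> real n ^ n / r ^ n"
      using assms fact_le_power[of n] by (intro divide_right_mono) auto
    also have "\<dots> = (2 * real n / r) ^ n * inverse (2 ^ n)"
      by (simp add: power_divide power_mult_distrib)
    also have "\<dots> \<le> x ^ n * inverse (2 ^ n)"
      using x assms by (intro mult_right_mono power_mono) auto
    also have "\<dots> = C' * (x ^ n * (inverse C' * inverse (2 ^ n)))"
      by (simp add: C'_def)
    also have "\<dots> \<le> C' * (x ^ n * exp (- q * \<omega> x))"
      using e x by (intro mult_left_mono) (auto simp: C'_def)
    also have "\<dots> \<le> C' * M q n"
      using x assms by (intro mult_left_mono M_ge) (auto simp: C'_def)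
    finally show ?thesis .
  qed
  then show ?thesis using that[of C'] by (simp add: C'_def)
qed

text \<open>For \<open>x \<ge> n\<close> the factor is at most \<open>2 x\<close>, and the gap
  \<open>q' - q\<close> absorbs it because \<open>ln\<close> is \<open>o(\<omega>)\<close>. For
  \<open>x < n\<close> one passes to \<open>2 x\<close>: this gains \<open>2 ^ n\<close>, while
  \<open>\<omega> (2 x)\<close> costs only about \<open>2 ^ (n / 2)\<close> by the choice of
  \<eta>.\<close>

lemma M_linear_factor:
  assumes "0 < q" "q < q'"
  obtains C where "C > 0" "\<And>n. (real n + 1) * M q' n \<le> C * M q n"
proof -
  define K where "K = 1 / (q' - q)"
  have K: "K > 0" using assms by (simp add: K_def)
  obtain C1 where C1: "C1 > 0" "\<And>x. x \<ge> 1 \<Longrightarrow> K * ln x \<le> \<omega> x + C1"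
    using weight_dominates_ln[OF K] by blast
  define \<eta> where "\<eta> = ln 2 / (4 * q)"
  have \<eta>: "\<eta> > 0" using assms by (simp add: \<eta>_def)
  obtain C2 where C2: "C2 > 0" "\<And>x. x \<ge> 0 \<Longrightarrow> \<omega> x \<le> \<eta> * x + C2"
    using weight_sublinear[OF \<eta>] by blast
  define C3 where "C3 = 2 * exp ((q' - q) * C1)"
  define C4 where "C4 = 4 * exp (q * C2)"
  have C34: "C3 > 0" "C4 > 0" by (auto simp: C3_def C4_def)
  have "(real n + 1) * M q' n \<le> (C3 + C4) * M q n" for n
  proof -
    have "M q' n \<le> (C3 + C4) * M q n / (real n + 1)"
    proof (rule M_le)
      fix x :: real assume x: "x \<ge> 1"
      have "(real n + 1) * (x ^ n * exp (- q' * \<omega> x)) \<le> (C3 + C4) * M q n"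
      proof (cases "x \<ge> real n")
        case True
        have "(q' - q) * (K * ln x) \<le> (q' - q) * (\<omega> x + C1)"
          using C1(2)[OF x] assms by (intro mult_left_mono) auto
        then have "ln x \<le> (q' - q) * \<omega> x + (q' - q) * C1" using assms by (simp add: K_def distrib_left)
        then have "exp (ln x) \<le> exp ((q' - q) * \<omega> x) * exp ((q' - q) * C1)"
          unfolding exp_add[symmetric] by simp
        then have "real n + 1 \<le> C3 * exp ((q' - q) * \<omega> x)"
          using x True by (simp add: C3_def mult_ac)
        then have "(real n + 1) * (x ^ n * exp (- q' * \<omega> x)) \<le> C3 * exp ((q' - q) * \<omega> x) * (x ^ n * exp (- q' * \<omega> x))"
          using x by (intro mult_right_mono) auto
        also have "\<dots> = C3 * (x ^ n * (exp ((q' - q) * \<omega> x) * exp (- q' * \<omega> x)))" by (simp only: mult_ac)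
        also have "exp ((q' - q) * \<omega> x) * exp (- q' * \<omega> x) = exp (- q * \<omega> x)"
          by (simp add: algebra_simps flip: exp_add)
        also have "C3 * (x ^ n * exp (- q * \<omega> x)) \<le> C3 * M q n"
          using assms x C34 by (intro mult_left_mono M_ge) auto
        also have "\<dots> \<le> (C3 + C4) * M q n" using C34 M_pos[of q n] by simp
        finally show ?thesis .
      next
        case False
        have "q * \<omega> (2 * x) \<le> q * (\<eta> * (2 * real n) + C2)"
          using C2(2)[of "2 * x"] x False \<eta> assms
          by (intro mult_left_mono) (auto intro: order_trans mult_left_mono)
        also have "\<dots> = real n * (ln 2 / 2) + q * C2" using assms by (simp add: \<eta>_def field_simps)
        finally have e1: "exp (- (real n * (ln 2 / 2) + q * C2)) \<le> exp (- q * \<omega> (2 * x))" by simp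
        have e2: "exp (- (real n * (ln 2 / 2) + q * C2)) = exp (ln 2 / 2) ^ n * inverse (2 ^ n) * inverse (exp (q * C2))"
        proof -
          have "- (real n * (ln 2 / 2) + q * C2) = real n * (ln 2 / 2) + (- (real n * ln 2)) + (- (q * C2))" by simp
          then show ?thesis by (simp only: exp_add exp_minus exp_of_nat_mult) simp
        qed
        have e3: "real n + 1 \<le> 4 * exp (ln 2 / 2) ^ n"
        proof -
          have "exp (ln 2 / 2) \<ge> 1 + ln 2 / (2::real)" by (rule exp_ge_add_one_self)
          then have "1 + real n * (ln 2 / 2) \<le> exp (ln 2 / 2) ^ n"
          proof -
            have l2: "ln 2 \<ge> (0::real)" by simp
            have "1 + real n * (ln 2 / 2) \<le> (1 + ln 2 / 2) ^ n"
              using l2 by (intro Bernoulli_inequality) linarith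
            also have "\<dots> \<le> exp (ln 2 / 2) ^ n"
              using l2 by (intro power_mono exp_ge_add_one_self) linarith
            finally show ?thesis .
          qed
          moreover have "ln 2 / 2 \<ge> (1 / 4 :: real)" using ln2_ge_two_thirds by simp
          then have "real n * (1 / 4) \<le> real n * (ln 2 / 2)" by (intro mult_left_mono) auto
          ultimately show ?thesis by simp
        qed
        have e: "(real n + 1) * inverse (2 ^ n) \<le> C4 * exp (- q * \<omega> (2 * x))"
        proof -
          have "(real n + 1) * inverse (2 ^ n) \<le> 4 * exp (ln 2 / 2) ^ n * inverse (2 ^ n)"
            by (rule mult_right_mono[OF e3]) simp
          also have "\<dots> = C4 * (exp (ln 2 / 2) ^ n * inverse (2 ^ n) * inverse (exp (q * C2)))"
            by (simp add: C4_def)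
          also have "\<dots> \<le> C4 * exp (- q * \<omega> (2 * x))"
            using e1 C34 unfolding e2 by (intro mult_left_mono) auto
          finally show ?thesis .
        qed
        have "(real n + 1) * (x ^ n * exp (- q' * \<omega> x)) \<le> (real n + 1) * (x ^ n * 1)"
          using x assms weight_nonneg[of x] by (intro mult_left_mono) auto
        also have "\<dots> = ((real n + 1) * inverse (2 ^ n)) * (2 * x) ^ n"
          by (simp add: power_mult_distrib)
        also have "\<dots> \<le> (C4 * exp (- q * \<omega> (2 * x))) * (2 * x) ^ n"
          using e x by (intro mult_right_mono) auto
        also have "\<dots> = C4 * ((2 * x) ^ n * exp (- q * \<omega> (2 * x)))" by (simp only: mult_ac)
        also have "\<dots> \<le> C4 * M q n" using C34 assms x by (intro mult_left_mono M_ge) auto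
        also have "\<dots> \<le> (C3 + C4) * M q n" using C34 M_pos[of q n] by simp
        finally show ?thesis .
      qed
      then show "x ^ n * exp (- q' * \<omega> x) \<le> (C3 + C4) * M q n / (real n + 1)"
        by (simp add: field_simps)
    qed (use assms in auto)
    then show ?thesis by (simp add: field_simps)
  qed
  then show ?thesis using that[of "C3 + C4"] C34 by simp
qed

text \<open>The two suprema multiply: \<open>(n choose i) x^i y^(n-i) \<le> (x + y)^n\<close>, and
  almost subadditivity with \<open>\<sigma> = q' / p\<close> compares the exponentials at
  \<open>x\<close> and \<open>y\<close> with the one at \<open>x + y\<close>. The number
  \<open>n + 1\<close> of terms is paid for by passing from \<open>p\<close> to
  \<open>q\<close>.\<close>

lemma M_binomial:
  assumes "0 < q" "q < q'"
  obtains C where "C > 0" "\<And>n. (\<Sum>i\<le>n. real (n choose i) * M q' i * M q' (n - i)) \<le> C * M q n"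
proof -
  define p where "p = (q + q') / 2"
  have p: "q < p" "p < q'" "p > 0" using assms by (auto simp: p_def)
  define \<sigma> where "\<sigma> = q' / p"
  have \<sigma>: "\<sigma> > 1" using p by (simp add: \<sigma>_def)
  then obtain C1 where C1: "\<And>x y. x \<ge> 0 \<Longrightarrow> y \<ge> 0 \<Longrightarrow> \<omega> (x + y) \<le> \<sigma> * (\<omega> x + \<omega> y) + C1"
    using weight unfolding weight_def by metis
  obtain C2 where C2: "C2 > 0" "\<And>n. (real n + 1) * M p n \<le> C2 * M q n"
    using M_linear_factor[OF assms(1) p(1)] by blast
  have summand: "real (n choose i) * M q' i * M q' (n - i) \<le> exp (p * C1) * M p n" if i: "i \<le> n" for n i
  proof -
    have c: "real (n choose i) > 0" using i by simp
    have "M q' i \<le> exp (p * C1) * M p n / (real (n choose i) * M q' (n - i))"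
    proof (rule M_le)
      fix x :: real assume x: "x \<ge> 1"
      have xp: "x ^ i * exp (- q' * \<omega> x) > 0" using x by simp
      have "M q' (n - i) \<le> exp (p * C1) * M p n / (real (n choose i) * (x ^ i * exp (- q' * \<omega> x)))"
      proof (rule M_le)
        fix y :: real assume y: "y \<ge> 1"
        have a: "real (n choose i) * x ^ i * y ^ (n - i) \<le> (x + y) ^ n"
          unfolding binomial_ring using i x y by (intro member_le_sum) auto
        have b: "exp (- q' * \<omega> x) * exp (- q' * \<omega> y) \<le> exp (p * C1) * exp (- p * \<omega> (x + y))"
        proof -
          have "p * \<omega> (x + y) \<le> p * (\<sigma> * (\<omega> x + \<omega> y) + C1)"
            using C1[of x y] x y p by (intro mult_left_mono) auto
          also have "\<dots> = q' * \<omega> x + q' * \<omega> y + p * C1"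
            using p by (simp add: \<sigma>_def field_simps)
          finally show ?thesis by (simp flip: exp_add)
        qed
        have "(real (n choose i) * x ^ i * y ^ (n - i)) * (exp (- q' * \<omega> x) * exp (- q' * \<omega> y))
            \<le> (x + y) ^ n * (exp (p * C1) * exp (- p * \<omega> (x + y)))"
          by (rule mult_mono[OF a b]) (use x y in auto)
        also have "\<dots> = exp (p * C1) * ((x + y) ^ n * exp (- p * \<omega> (x + y)))" by (simp only: mult_ac)
        also have "\<dots> \<le> exp (p * C1) * M p n" using x y p by (intro mult_left_mono M_ge) auto
        finally show "y ^ (n - i) * exp (- q' * \<omega> y) \<le> exp (p * C1) * M p n / (real (n choose i) * (x ^ i * exp (- q' * \<omega> x)))"
          unfolding pos_le_divide_eq[OF mult_pos_pos[OF c xp]] by (simp add: mult_ac)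
      qed (use assms in auto)
      then show "x ^ i * exp (- q' * \<omega> x) \<le> exp (p * C1) * M p n / (real (n choose i) * M q' (n - i))"
        unfolding pos_le_divide_eq[OF mult_pos_pos[OF c M_pos]] pos_le_divide_eq[OF mult_pos_pos[OF c xp]]
        by (simp add: mult_ac)
    qed (use assms in auto)
    then show ?thesis
      unfolding pos_le_divide_eq[OF mult_pos_pos[OF c M_pos]] by (simp add: mult_ac)
  qed
  have "(\<Sum>i\<le>n. real (n choose i) * M q' i * M q' (n - i)) \<le> (exp (p * C1) * C2) * M q n" for n
  proof -
    have "(\<Sum>i\<le>n. real (n choose i) * M q' i * M q' (n - i)) \<le> (\<Sum>i\<le>n. exp (p * C1) * M p n)"
      by (intro sum_mono summand) auto
    also have "\<dots> = exp (p * C1) * ((real n + 1) * M p n)" by (simp add: algebra_simps)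
    also have "\<dots> \<le> exp (p * C1) * (C2 * M q n)" by (intro mult_left_mono C2) auto
    finally show ?thesis by (simp add: mult_ac)
  qed
  then show ?thesis using that[of "exp (p * C1) * C2"] C2(1) by simp
qed

text \<open>Condensation of the integral condition: on the n-th dyadic interval, of length
  \<open>2 ^ n\<close>, the integrand is at least \<open>\<omega> (2 ^ n) / 4 ^ (n + 1)\<close>,
  whence the factor 4.\<close>

lemma weight_dyadic_summable: "summable (\<lambda>l. \<omega> (2 ^ l) / 2 ^ l)"
proof -
  have wi: "integrable lborel (\<lambda>x. indicator {1..} x *\<^sub>R (\<omega> x / x\<^sup>2))"
    using weight by (simp add: weight_def set_integrable_def)
  define g where "g x = indicator {1..} x * (\<omega> x / x\<^sup>2)" for x :: real
  have gi: "integrable lborel g" using wi by (simp add: g_def[abs_def])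
  have g0: "g x \<ge> 0" for x using weight_nonneg[of x] by (auto simp: g_def indicator_def)
  have gc: "integrable lborel (\<lambda>x. indicator A x * g x)" if "A \<in> sets borel" for A
    using integrable_mult_indicator[OF _ gi, of A] that by simp
  have step: "(LINT x|lborel. indicator {(1::real)..<2 ^ n} x * g x) \<ge> (\<Sum>l<n. \<omega> (2 ^ l) / 2 ^ l / 4)" for n :: nat
  proof (induction n)
    case (Suc n)
    have "(\<Sum>l<Suc n. \<omega> (2 ^ l) / 2 ^ l / 4) \<le> (LINT x|lborel. indicator {(1::real)..<2 ^ n} x * g x) + \<omega> (2 ^ n) / 2 ^ n / 4"
      using Suc by simp
    also have "\<omega> (2 ^ n) / 2 ^ n / 4 = (LINT x|lborel. indicator {(2::real) ^ n..<2 ^ Suc n} x * (\<omega> (2 ^ n) / (2 ^ Suc n)\<^sup>2))"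
      by (simp add: power2_eq_square field_simps)
    also have "\<dots> \<le> (LINT x|lborel. indicator {(2::real) ^ n..<2 ^ Suc n} x * g x)"
    proof (rule integral_mono)
      show "integrable lborel (\<lambda>x. indicator {(2::real) ^ n..<2 ^ Suc n} x * (\<omega> (2 ^ n) / (2 ^ Suc n)\<^sup>2))"
        by (intro integrable_mult_left integrable_real_indicator) auto
      show "integrable lborel (\<lambda>x. indicator {(2::real) ^ n..<2 ^ Suc n} x * g x)" by (rule gc) simp
      fix x :: real
      show "indicator {(2::real) ^ n..<2 ^ Suc n} x * (\<omega> (2 ^ n) / (2 ^ Suc n)\<^sup>2) \<le> indicator {(2::real) ^ n..<2 ^ Suc n} x * g x"
      proof (cases "x \<in> {2 ^ n..<2 ^ Suc n}")
        case True
        then have x: "2 ^ n \<le> x" "x \<le> 2 ^ Suc n" "1 \<le> x"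
          using order_trans[of 1 "2 ^ n" x] by auto
        have "\<omega> (2 ^ n) / (2 ^ Suc n)\<^sup>2 \<le> \<omega> x / x\<^sup>2"
          using x weight_mono[of "2 ^ n" x] weight_nonneg[of "2 ^ n"]
          by (intro frac_le power_mono) auto
        then show ?thesis using True x by (simp add: g_def)
      qed simp
    qed
    also have "(LINT x|lborel. indicator {(1::real)..<2 ^ n} x * g x) + (LINT x|lborel. indicator {(2::real) ^ n..<2 ^ Suc n} x * g x)
       = (LINT x|lborel. indicator {(1::real)..<2 ^ Suc n} x * g x)"
    proof -
      have "(LINT x|lborel. indicator {(1::real)..<2 ^ n} x * g x) + (LINT x|lborel. indicator {(2::real) ^ n..<2 ^ Suc n} x * g x)
        = (LINT x|lborel. indicator {(1::real)..<2 ^ n} x * g x + indicator {(2::real) ^ n..<2 ^ Suc n} x * g x)"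
        by (rule Bochner_Integration.integral_add[symmetric]; rule gc) simp_all
      also have "\<dots> = (LINT x|lborel. indicator {(1::real)..<2 ^ Suc n} x * g x)"
      proof (intro Bochner_Integration.integral_cong refl)
        fix x :: real
        have p: "(1::real) \<le> 2 ^ n" "(2::real) ^ n \<le> 2 ^ Suc n" by auto
        show "indicator {(1::real)..<2 ^ n} x * g x + indicator {(2::real) ^ n..<2 ^ Suc n} x * g x = indicator {(1::real)..<2 ^ Suc n} x * g x"
        proof (cases "x < 2 ^ n")
          case True
          then have "x < 2 ^ Suc n" using p by linarith
          then show ?thesis using True by (simp add: indicator_def)
        next
          case False
          then have "x \<ge> 1" using p by linarith
          then show ?thesis using False by (simp add: indicator_def)
        qed
      qed
      finally show ?thesis .
    qed
    finally show ?case by simp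
  qed simp
  have bound: "(\<Sum>l<n. \<omega> (2 ^ l) / 2 ^ l) \<le> 4 * (LINT x|lborel. g x)" for n
  proof -
    have "(LINT x|lborel. indicator {(1::real)..<2 ^ n} x * g x) \<le> (LINT x|lborel. g x)"
      using g0 by (intro integral_mono gc gi) (auto simp: indicator_def)
    moreover have "(\<Sum>l<n. \<omega> (2 ^ l) / 2 ^ l) = 4 * (\<Sum>l<n. \<omega> (2 ^ l) / 2 ^ l / 4)"
      by (simp add: sum_distrib_left)
    ultimately show ?thesis using step[of n] by linarith
  qed
  show ?thesis
    by (rule summableI_nonneg_bounded[OF _ bound]) (simp add: weight_nonneg)
qed

text \<open>The numbers \<open>2 / a k\<close> are powers of \<open>2\<close>; about \<open>\<omega> (2\<^sup>l\<^sup>+\<^sup>1)\<close> of them are at most \<open>2\<^sup>l\<close>. Then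
  \<open>\<Prod>k<j. 2 / a k \<le> x\<^sup>j e\<^sup>-\<^sup>\<omega>\<^sup>(\<^sup>x\<^sup>)\<close> for the last factor \<open>x\<close>, and \<open>a\<close> is summable by
  non-quasianalyticity.\<close>

lemma averaging_widths:
  obtains a :: "nat \<Rightarrow> real" and C where "\<And>k. a k > 0" "summable a" "C > 0"
    "\<And>j. (\<Prod>k<j. 2 / a k) \<le> C * M 1 j"
proof -
  \<comment> \<open>\<open>g l\<close> prescribes, up to one, the number of \<open>k\<close> with
    \<open>i k \<le> l\<close>. The summand \<open>real l\<close> makes \<open>g\<close> unbounded,
    so that the minimum defining \<open>i\<close> exists, and adds only a convergent series.\<close>
  define g where "g l = real l + \<omega> (2 ^ Suc l) / ln 2" for l :: nat
  have g_mono: "g l \<le> g l'" if "l \<le> l'" for l l'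
    unfolding g_def using that by (intro add_mono divide_right_mono weight_mono power_increasing) auto
  have g_nat: "real l \<le> g l" for l
    unfolding g_def using weight_nonneg[of "2 ^ Suc l"] by simp
  define i where "i k = (LEAST l. real k \<le> g l)" for k :: nat
  have i_le: "real k \<le> g l \<longleftrightarrow> i k \<le> l" for k l
  proof
    show "real k \<le> g l \<Longrightarrow> i k \<le> l" unfolding i_def by (rule Least_le)
    have "real k \<le> g (i k)" unfolding i_def by (rule LeastI[of _ k]) (rule g_nat)
    then show "i k \<le> l \<Longrightarrow> real k \<le> g l" using g_mono order_trans by blast
  qed
  have i_mono: "i k \<le> i k'" if "k \<le> k'" for k k'
    using i_le[of k "i k'"] i_le[of k' "i k'"] that by simp
  define a :: "nat \<Rightarrow> real" where "a k = 2 / 2 ^ i k" for k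
  have a0: "a k > 0" for k by (simp add: a_def)
  have "summable (\<lambda>l. (1 / 2) ^ l * (g l + 1))"
  proof -
    have s1: "summable (\<lambda>l. \<omega> (2 ^ Suc l) / 2 ^ Suc l)"
      using weight_dyadic_summable by (subst summable_Suc_iff)
    have s2: "summable (\<lambda>l. (2 / ln 2) * (\<omega> (2 ^ Suc l) / 2 ^ Suc l))"
      by (rule summable_mult[OF s1])
    have s3: "summable (\<lambda>l. real l * (1 / 2) ^ l)"
    proof -
      have "summable (\<lambda>l. real (Suc l) * (1 / 2) ^ l)"
        using geometric_deriv_sums[of "1 / 2 :: real"] by (auto intro: sums_summable)
      then have "summable (\<lambda>l. real (Suc l) * (1 / 2) ^ l - (1 / 2) ^ l)"
        by (intro summable_diff summable_geometric) auto
      then show ?thesis by (simp add: algebra_simps)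
    qed
    have s4: "summable (\<lambda>l. (1 / 2 :: real) ^ l)" by (rule summable_geometric) simp
    have "(\<lambda>l. (1 / 2) ^ l * (g l + 1)) = (\<lambda>l. real l * (1 / 2) ^ l + (2 / ln 2) * (\<omega> (2 ^ Suc l) / 2 ^ Suc l) + (1 / 2) ^ l)"
      by (auto simp: g_def fun_eq_iff field_simps power_divide)
    then show ?thesis using summable_add[OF summable_add[OF s3 s2] s4] by simp
  qed
  moreover define S where "S = (\<Sum>l. (1 / 2) ^ l * (g l + 1))"
  moreover have "0 \<le> (1 / 2) ^ l * (g l + 1)" for l using g_nat[of l] by simp
  ultimately have S: "(\<Sum>l<L. (1 / 2) ^ l * (g l + 1)) \<le> S" for L
    using sum_le_suminf by auto
  have bound: "(\<Sum>k<n. a k) \<le> 2 * S" for n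
  proof -
    define L where "L = Suc (i n)"
    have "a k \<le> (\<Sum>l<L. 2 * ((1 / 2 :: real) ^ l * of_bool (real k \<le> g l)))" if "k < n" for k
    proof -
      have "i k < L" using i_mono[of k n] that by (simp add: L_def)
      then have "2 * ((1 / 2 :: real) ^ i k * of_bool (real k \<le> g (i k))) \<le> (\<Sum>l<L. 2 * ((1 / 2 :: real) ^ l * of_bool (real k \<le> g l)))"
        by (intro member_le_sum) auto
      then show ?thesis using i_le[of k "i k"] by (simp add: a_def power_divide)
    qed
    then have "(\<Sum>k<n. a k) \<le> (\<Sum>k<n. \<Sum>l<L. 2 * ((1 / 2 :: real) ^ l * of_bool (real k \<le> g l)))"
      by (intro sum_mono) auto
    also have "\<dots> = (\<Sum>l<L. \<Sum>k<n. 2 * ((1 / 2 :: real) ^ l * of_bool (real k \<le> g l)))"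
      by (rule sum.swap)
    also have "\<dots> \<le> (\<Sum>l<L. 2 * ((1 / 2) ^ l * (g l + 1)))"
    proof (rule sum_mono)
      fix l
      have "(\<Sum>k<n. of_bool (real k \<le> g l) :: real) \<le> g l + 1"
      proof -
        have "(\<Sum>k<n. of_bool (real k \<le> g l) :: real) = real (card {k. k < n \<and> real k \<le> g l})"
          by (simp add: of_bool_def sum.If_cases lessThan_def Collect_conj_eq)
        also have "\<dots> \<le> real (card {..nat \<lfloor>g l\<rfloor>})"
          by (intro of_nat_mono card_mono) (auto simp: le_nat_floor)
        also have "\<dots> \<le> g l + 1" using g_nat[of l] by simp
        finally show ?thesis .
      qed
      then have "2 * (1 / 2) ^ l * (\<Sum>k<n. of_bool (real k \<le> g l) :: real) \<le> 2 * (1 / 2) ^ l * (g l + 1)"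
        by (intro mult_left_mono) auto
      then show "(\<Sum>k<n. 2 * ((1 / 2 :: real) ^ l * of_bool (real k \<le> g l))) \<le> 2 * ((1 / 2) ^ l * (g l + 1))"
        by (simp only: sum_distrib_left mult.assoc)
    qed
    also have "\<dots> \<le> 2 * S" using S[of L] by (simp flip: sum_distrib_left)
    finally show ?thesis .
  qed
  have summ: "summable a"
    by (rule summableI_nonneg_bounded[OF _ bound]) (use a0 less_imp_le in blast)
  \<comment> \<open>The constant covers the case where all factors are 1: testing
    \<open>M 1 j\<close> at \<open>x = 1\<close> gives no more than
    \<open>exp (- \<omega> 1)\<close>.\<close>
  have prod: "(\<Prod>k<j. 2 / a k) \<le> exp (\<omega> 1) * M 1 j" for j
  proof (cases "j = 0 \<or> i (j - 1) = 0")
    case True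
    have "(\<Prod>k<j. 2 / a k) = 1"
    proof (rule prod.neutral, rule ballI)
      fix k assume "k \<in> {..<j}"
      then have "i k = 0" using True i_mono[of k "j - 1"] by auto
      then show "2 / a k = 1" by (simp add: a_def)
    qed
    moreover have "exp (- \<omega> 1) \<le> M 1 j" using M_ge[of 1 1 j] by simp
    then have "exp (\<omega> 1) * exp (- \<omega> 1) \<le> exp (\<omega> 1) * M 1 j" by (intro mult_left_mono) auto
    then have "1 \<le> exp (\<omega> 1) * M 1 j" by (simp flip: exp_add)
    ultimately show ?thesis by simp
  next
    case False
    define N where "N = i (j - 1)"
    have N: "N > 0" "j > 0" using False by (auto simp: N_def)
    define B where "B = {k. k < j \<and> i k \<le> N - 1}"
    have "{..nat \<lfloor>g (N - 1)\<rfloor>} \<subseteq> B"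
    proof
      fix k assume "k \<in> {..nat \<lfloor>g (N - 1)\<rfloor>}"
      then have "real k \<le> real (nat \<lfloor>g (N - 1)\<rfloor>)" by simp
      also have "\<dots> \<le> g (N - 1)" using g_nat[of "N - 1"] by (intro of_nat_floor) simp
      finally have "real k \<le> g (N - 1)" .
      then have ik: "i k \<le> N - 1" by (simp add: i_le)
      moreover have "k < j"
      proof (rule ccontr)
        assume "\<not> k < j"
        then have "N \<le> i k" using i_mono[of "j - 1" k] by (simp add: N_def)
        then show False using ik N by simp
      qed
      ultimately show "k \<in> B" by (simp add: B_def)
    qed
    moreover have "finite B" by (simp add: B_def)
    ultimately have "card {..nat \<lfloor>g (N - 1)\<rfloor>} \<le> card B" by (rule card_mono[rotated])
    then have cB: "g (N - 1) \<le> real (card B)" using g_nat[of "N - 1"] by (simp; linarith)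
    \<comment> \<open>Each index in \<open>B\<close> falls short of \<open>N\<close> by at least
      one, and \<open>card B \<ge> \<omega> (2 ^ N) / ln 2\<close>. So the product is smaller than
      \<open>(2 ^ N) ^ j\<close> by at least the factor \<open>exp (\<omega> (2 ^ N))\<close>, as in
      \<open>M_ge\<close> at \<open>x = 2 ^ N\<close>.\<close>
    have "(\<Sum>k<j. i k) + card B \<le> j * N"
    proof -
      have "(\<Sum>k<j. i k) + card B = (\<Sum>k<j. i k + of_bool (i k \<le> N - 1))"
        by (simp add: sum.distrib B_def of_bool_def sum.If_cases lessThan_def Collect_conj_eq)
      also have "\<dots> \<le> (\<Sum>k<j. N)"
      proof (rule sum_mono)
        fix k assume "k \<in> {..<j}"
        then have "i k \<le> N" using i_mono[of k "j - 1"] by (simp add: N_def)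
        then show "i k + of_bool (i k \<le> N - 1) \<le> N" using N by auto
      qed
      finally show ?thesis by simp
    qed
    then have "(2::real) ^ (\<Sum>k<j. i k) * 2 ^ card B \<le> (2 ^ N) ^ j"
      unfolding power_add[symmetric] power_mult[symmetric] by (intro power_increasing) (auto simp: mult.commute)
    moreover have "exp (\<omega> (2 ^ N)) \<le> 2 ^ card B"
    proof -
      have "\<omega> (2 ^ N) / ln 2 \<le> g (N - 1)" using N by (simp add: g_def)
      then have "\<omega> (2 ^ N) / ln 2 \<le> real (card B)" using cB by linarith
      then have "\<omega> (2 ^ N) \<le> real (card B) * ln 2" by (simp add: divide_le_eq)
      then have "exp (\<omega> (2 ^ N)) \<le> exp (real (card B) * ln 2)" by simp
      then show ?thesis by (simp add: exp_of_nat_mult)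
    qed
    then have "(2::real) ^ (\<Sum>k<j. i k) * exp (\<omega> (2 ^ N)) \<le> 2 ^ (\<Sum>k<j. i k) * 2 ^ card B"
      by (intro mult_left_mono) auto
    ultimately have "(2::real) ^ (\<Sum>k<j. i k) * exp (\<omega> (2 ^ N)) \<le> (2 ^ N) ^ j" by linarith
    then have "(2::real) ^ (\<Sum>k<j. i k) \<le> (2 ^ N) ^ j * exp (- 1 * \<omega> (2 ^ N))"
      by (simp add: exp_minus field_simps)
    also have "\<dots> \<le> M 1 j" by (rule M_ge) auto
    also have "\<dots> \<le> exp (\<omega> 1) * M 1 j" using M_pos[of 1 j] weight_nonneg[of 1] by simp
    finally show ?thesis by (simp add: a_def power_sum)
  qed
  show ?thesis by (rule that[OF a0 summ _ prod]) simp
qed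

text \<open>Dropping the first \<open>K\<close> widths makes the sum small. The index of the product
  is then shifted by \<open>K\<close>, which \<open>M_shift\<close> pays for by lowering
  \<open>q\<close> below 1.\<close>

lemma small_averaging_widths:
  assumes "\<delta> > 0"
  obtains a :: "nat \<Rightarrow> real" where "\<And>k. a k > 0" "summable a" "suminf a < \<delta>"
    "\<And>q. 0 < q \<Longrightarrow> q < 1 \<Longrightarrow> \<exists>C>0. \<forall>j. (\<Prod>k<j. 2 / a k) \<le> C * M q j"
proof -
  obtain b C where b: "\<And>k. b k > 0" "summable b" "C > 0" "\<And>j. (\<Prod>k<j. 2 / b k) \<le> C * M 1 j"
    using averaging_widths by metis
  obtain K where K: "\<And>k. k \<ge> K \<Longrightarrow> norm (\<Sum>i. b (i + k)) < \<delta>"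
    using suminf_exist_split[OF assms b(2)] by blast
  define a where "a k = b (k + K)" for k
  define P where "P = (\<Prod>k<K. 2 / b k)"
  have P: "P > 0" unfolding P_def using b(1) by (intro prod_pos) auto
  have "\<exists>C>0. \<forall>j. (\<Prod>k<j. 2 / a k) \<le> C * M q j" if q: "0 < q" "q < 1" for q
  proof (intro exI conjI allI)
    show "C * M (1 - q) K / P > 0" using b(3) P M_pos by simp
    fix j
    have "P * (\<Prod>k<j. 2 / a k) = (\<Prod>k<j + K. 2 / b k)"
      unfolding P_def a_def
      by (induction j) (simp_all add: mult_ac)
    also have "\<dots> \<le> C * M 1 (j + K)" by (rule b)
    also have "\<dots> \<le> C * (M (1 - q) K * M q j)"
      using b(3) M_shift[of q 1 j K] q by (intro mult_left_mono) auto
    finally show "(\<Prod>k<j. 2 / a k) \<le> C * M (1 - q) K / P * M q j"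
      using P by (simp add: field_simps)
  qed
  note bound = this
  have "suminf a < \<delta>" using K[of K] by (simp add: a_def[abs_def] abs_less_iff)
  moreover have "summable a" unfolding a_def using b(2) by (rule summable_ignore_initial_segment)
  moreover have "a k > 0" for k by (simp add: a_def b(1))
  ultimately show ?thesis using bound by (intro that[of a])
qed

end

section \<open>Ultradifferentiable functions on open sets\<close>

definition vd :: "(real \<Rightarrow> complex) \<Rightarrow> real \<Rightarrow> complex" where
  "vd f = (\<lambda>x. vector_derivative f (at x))"

abbreviation nd :: "nat \<Rightarrow> (real \<Rightarrow> complex) \<Rightarrow> real \<Rightarrow> complex" where
  "nd j f \<equiv> (vd ^^ j) f"

definition smooth_fun :: "real set \<Rightarrow> (real \<Rightarrow> complex) \<Rightarrow> bool" where
  "smooth_fun S f \<longleftrightarrow> (\<forall>j. \<forall>x\<in>S. nd j f differentiable (at x))"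

section \<open>Calculus of iterated derivatives\<close>

lemma smooth_fun_has_derivative:
  "smooth_fun S f \<Longrightarrow> x \<in> S \<Longrightarrow> (nd j f has_vector_derivative nd (Suc j) f x) (at x)"
  unfolding smooth_fun_def by (auto simp: vd_def vector_derivative_works)

lemma nd_Suc_at: "nd (Suc j) f x = vector_derivative (nd j f) (at x)"
  by (simp only: funpow.simps o_apply vd_def)

text \<open>The device by which iterated derivatives are computed below: propose the whole sequence
  and check a single differentiation step. Openness of \<open>S\<close> makes the induction
  local.\<close>

lemma nd_eq_sequence:
  assumes "open S" and der: "\<And>j x. x \<in> S \<Longrightarrow> (g j has_vector_derivative g (Suc j) x) (at x)" and "x \<in> S"
  shows "nd j (g 0) x = g j x"
  using \<open>x \<in> S\<close>
proof (induction j arbitrary: x)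
  case (Suc j)
  have "(nd j (g 0) has_vector_derivative g (Suc j) x) (at x)"
    by (rule has_vector_derivative_transform_within_open[OF der[OF Suc.prems] \<open>open S\<close> Suc.prems]) (simp add: Suc.IH)
  then show ?case unfolding nd_Suc_at by (rule vector_derivative_at)
qed simp

lemma smooth_fun_sequence:
  assumes "open S" and der: "\<And>j x. x \<in> S \<Longrightarrow> (g j has_vector_derivative g (Suc j) x) (at x)"
  shows "smooth_fun S (g 0)"
  unfolding smooth_fun_def
proof (intro allI ballI)
  fix j x assume x: "x \<in> S"
  have "(nd j (g 0) has_vector_derivative g (Suc j) x) (at x)"
    by (rule has_vector_derivative_transform_within_open[OF der[OF x] \<open>open S\<close> x]) (rule nd_eq_sequence[of S g, OF assms, symmetric])
  then show "nd j (g 0) differentiable at x" by (rule differentiableI_vector)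
qed

lemma nd_cong:
  assumes "open S" "\<And>y. y \<in> S \<Longrightarrow> f y = g y" "x \<in> S"
  shows "nd j f x = nd j g x"
  using \<open>x \<in> S\<close>
proof (induction j arbitrary: x)
  case (Suc j)
  have "eventually (\<lambda>y. y \<in> UNIV \<longrightarrow> nd j f y = nd j g y) (nhds x)"
    using eventually_nhds_in_open[OF assms(1) Suc.prems] by eventually_elim (simp add: Suc.IH)
  then show ?case unfolding nd_Suc_at by (intro vector_derivative_cong_eq) auto
qed (use assms in auto)

lemma smooth_fun_cong:
  assumes "open S" "\<And>y. y \<in> S \<Longrightarrow> f y = g y" "smooth_fun S f"
  shows "smooth_fun S g"
  unfolding smooth_fun_def
proof (intro allI ballI)
  fix j x assume x: "x \<in> S"
  have "(nd j g has_vector_derivative nd (Suc j) f x) (at x)"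
    by (rule has_vector_derivative_transform_within_open[OF smooth_fun_has_derivative[OF assms(3) x] \<open>open S\<close> x])
      (use nd_cong[OF assms(1,2)] in auto)
  then show "nd j g differentiable at x" by (rule differentiableI_vector)
qed

lemma nd_0: "nd j (\<lambda>_. 0) = (\<lambda>_. 0)"
  by (induction j) (auto simp: vd_def)

lemma nd_eq_0:
  assumes "open S" "\<And>y. y \<in> S \<Longrightarrow> f y = 0" "x \<in> S"
  shows "nd j f x = 0"
  using nd_cong[OF assms(1), of f "\<lambda>_. 0" x j] assms by (simp add: nd_0)

lemma nd_add:
  assumes "open S" "smooth_fun S f" "smooth_fun S g" "x \<in> S"
  shows "nd j (\<lambda>t. f t + g t) x = nd j f x + nd j g x"
  using nd_eq_sequence[OF assms(1), of "\<lambda>j x. nd j f x + nd j g x" x j] assms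
  by (auto intro: has_vector_derivative_add smooth_fun_has_derivative simp del: funpow.simps)

lemma smooth_fun_add:
  assumes "open S" "smooth_fun S f" "smooth_fun S g"
  shows "smooth_fun S (\<lambda>t. f t + g t)"
  using smooth_fun_sequence[OF assms(1), of "\<lambda>j x. nd j f x + nd j g x"] assms
  by (auto intro: has_vector_derivative_add smooth_fun_has_derivative simp del: funpow.simps)

lemma nd_mult:
  assumes "open S" "smooth_fun S f" "smooth_fun S g"
  shows "x \<in> S \<Longrightarrow> nd n (\<lambda>t. f t * g t) x = (\<Sum>i\<le>n. of_nat (n choose i) * nd i f x * nd (n - i) g x)"
    and "smooth_fun S (\<lambda>t. f t * g t)"
proof -
  define s where "s n x = (\<Sum>i\<le>n. of_nat (n choose i) * nd i f x * nd (n - i) g x)" for n x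
  have "(s n has_vector_derivative s (Suc n) x) (at x)" if x: "x \<in> S" for n x
  proof -
    have 1: "(s n has_vector_derivative (\<Sum>i\<le>n. of_nat (n choose i) * (nd i f x * nd (Suc (n - i)) g x + nd (Suc i) f x * nd (n - i) g x))) (at x)"
      unfolding s_def[abs_def] mult.assoc
      by (intro has_vector_derivative_sum has_vector_derivative_mult_right has_vector_derivative_mult
          smooth_fun_has_derivative[OF _ x] assms)
    have "s (Suc n) x = (\<Sum>i\<le>Suc n. of_nat (Suc n choose i) * (nd i f x * nd (Suc n - i) g x))"
      by (simp add: s_def mult.assoc)
    also have "\<dots> = nd 0 f x * nd (Suc n) g x + (\<Sum>i\<le>n. of_nat (Suc n choose Suc i) * (nd (Suc i) f x * nd (n - i) g x))"
      by (subst sum.atMost_Suc_shift) (simp del: funpow.simps)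
    also have "(\<Sum>i\<le>n. of_nat (Suc n choose Suc i) * (nd (Suc i) f x * nd (n - i) g x))
        = (\<Sum>i\<le>n. of_nat (n choose i) * (nd (Suc i) f x * nd (n - i) g x))
        + (\<Sum>i\<le>n. of_nat (n choose Suc i) * (nd (Suc i) f x * nd (n - i) g x))"
      by (simp add: sum.distrib algebra_simps del: funpow.simps)
    also have "nd 0 f x * nd (Suc n) g x + (\<dots>) = (\<Sum>i\<le>n. of_nat (n choose i) * (nd (Suc i) f x * nd (n - i) g x))
        + (nd 0 f x * nd (Suc n) g x + (\<Sum>i\<le>n. of_nat (n choose Suc i) * (nd (Suc i) f x * nd (Suc n - Suc i) g x)))"
      by (simp add: algebra_simps del: funpow.simps)
    also have "nd 0 f x * nd (Suc n) g x + (\<Sum>i\<le>n. of_nat (n choose Suc i) * (nd (Suc i) f x * nd (Suc n - Suc i) g x))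
        = (\<Sum>i\<le>Suc n. of_nat (n choose i) * (nd i f x * nd (Suc n - i) g x))"
      by (subst sum.atMost_Suc_shift) (simp del: funpow.simps)
    also have "\<dots> = (\<Sum>i\<le>n. of_nat (n choose i) * (nd i f x * nd (Suc (n - i)) g x))"
      by (simp add: Suc_diff_le del: funpow.simps)
    finally show ?thesis using 1 by (simp add: distrib_left sum.distrib add.commute del: funpow.simps)
  qed
  from nd_eq_sequence[of S s, OF assms(1) this] smooth_fun_sequence[of S s, OF assms(1) this]
  show "x \<in> S \<Longrightarrow> nd n (\<lambda>t. f t * g t) x = (\<Sum>i\<le>n. of_nat (n choose i) * nd i f x * nd (n - i) g x)"
    and "smooth_fun S (\<lambda>t. f t * g t)"
    by (auto simp: s_def[abs_def])
qed

lemma nd_translate: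
  assumes "smooth_fun UNIV f"
  shows "nd j (\<lambda>t. f (t + y)) x = nd j f (x + y)" "smooth_fun UNIV (\<lambda>t. f (t + y))"
proof -
  have "((\<lambda>x. nd j f (x + y)) has_vector_derivative nd (Suc j) f (x + y)) (at x)" for j x
    using vector_diff_chain_at[of "\<lambda>x. x + y" 1 x "nd j f" "nd (Suc j) f (x + y)"]
      smooth_fun_has_derivative[OF assms, of "x + y" j]
    by (simp add: o_def has_vector_derivative_add_const)
  from nd_eq_sequence[of UNIV "\<lambda>j x. nd j f (x + y)", OF open_UNIV this, of x j]
    smooth_fun_sequence[of UNIV "\<lambda>j x. nd j f (x + y)", OF open_UNIV this]
  show "nd j (\<lambda>t. f (t + y)) x = nd j f (x + y)" "smooth_fun UNIV (\<lambda>t. f (t + y))" by auto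
qed

lemma nd_entire:
  assumes "F holomorphic_on UNIV"
  shows "nd j (\<lambda>t. F (of_real t)) x = (deriv ^^ j) F (of_real x)" "smooth_fun S (\<lambda>t. F (of_real t))"
proof -
  have "((\<lambda>t. (deriv ^^ j) F (of_real t)) has_vector_derivative (deriv ^^ Suc j) F (of_real x)) (at x)" for j x
  proof -
    have "((deriv ^^ j) F has_field_derivative (deriv ^^ Suc j) F (of_real x)) (at (of_real x))"
      using holomorphic_derivI[OF holomorphic_higher_deriv[OF assms open_UNIV] open_UNIV UNIV_I] by simp
    then show ?thesis by (rule has_vector_derivative_real_field)
  qed
  from nd_eq_sequence[of UNIV "\<lambda>j x. (deriv ^^ j) F (of_real x)", OF open_UNIV this, of x j]
    smooth_fun_sequence[of UNIV "\<lambda>j x. (deriv ^^ j) F (of_real x)", OF open_UNIV this]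
  show "nd j (\<lambda>t. F (of_real t)) x = (deriv ^^ j) F (of_real x)" "smooth_fun S (\<lambda>t. F (of_real t))"
    by (auto simp: smooth_fun_def)
qed

lemma smooth_fun_subset: "smooth_fun S f \<Longrightarrow> T \<subseteq> S \<Longrightarrow> smooth_fun T f"
  unfolding smooth_fun_def by blast

lemma nd_vd: "nd j (vd f) = nd (Suc j) f"
  by (simp add: funpow_swap1)

context ultra_weight
begin

text \<open>The class with compact subsets of \<open>S\<close> in place of the intervals
  \<open>[-c k;c k]\<close>. Over \<open>UNIV\<close> its members can be translated freely;
  \<open>U_iff\<close> links it to \<open>U\<close>.\<close>

definition udf :: "real set \<Rightarrow> (real \<Rightarrow> complex) \<Rightarrow> bool" where
  "udf S f \<longleftrightarrow> smooth_fun S f \<and>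
     (\<forall>q K. 0 < q \<longrightarrow> q < 1 \<longrightarrow> compact K \<longrightarrow> K \<subseteq> S \<longrightarrow> (\<exists>C. \<forall>j. \<forall>x\<in>K. norm (nd j f x) \<le> C * M q j))"

section \<open>Stability of the class\<close>

lemma udf_smooth: "udf S f \<Longrightarrow> smooth_fun S f"
  by (simp add: udf_def)

lemma udf_bound:
  assumes "udf S f" "0 < q" "q < 1" "compact K" "K \<subseteq> S"
  obtains C where "C > 0" "\<And>j x. x \<in> K \<Longrightarrow> norm (nd j f x) \<le> C * M q j"
proof -
  obtain C where C: "\<And>j x. x \<in> K \<Longrightarrow> norm (nd j f x) \<le> C * M q j"
    using assms unfolding udf_def by meson
  have "norm (nd j f x) \<le> max C 1 * M q j" if "x \<in> K" for j x
    using C[OF that, of j] M_pos[of q j] by (smt (verit, best) mult_right_mono max.cobounded1)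
  then show ?thesis using that[of "max C 1"] by auto
qed

lemma udf_cong: 
  assumes "open S" "\<And>y. y \<in> S \<Longrightarrow> f y = g y" "udf S f"
  shows "udf S g"
  unfolding udf_def
proof (intro conjI allI impI)
  show "smooth_fun S g" by (rule smooth_fun_cong[OF assms(1,2) udf_smooth[OF assms(3)]])
  fix q :: real and K :: "real set" assume *: "0 < q" "q < 1" "compact K" "K \<subseteq> S"
  obtain C where C: "C > 0" "\<And>j x. x \<in> K \<Longrightarrow> norm (nd j f x) \<le> C * M q j"
    using udf_bound[OF assms(3) *] by blast
  have "norm (nd j g x) \<le> C * M q j" if "x \<in> K" for j x
    using nd_cong[OF assms(1,2), where x = x and j = j] C(2)[OF that, of j] that * by auto
  then show "\<exists>C. \<forall>j. \<forall>x\<in>K. norm (nd j g x) \<le> C * M q j" by blast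
qed

lemma udf_subset: "udf S f \<Longrightarrow> T \<subseteq> S \<Longrightarrow> udf T f"
  unfolding udf_def using smooth_fun_subset by (meson subset_trans)

lemma udf_0: "udf S (\<lambda>_. 0)"
  unfolding udf_def smooth_fun_def by (auto simp: nd_0 intro!: exI[of _ 0])

lemma udf_add:
  assumes "open S" "udf S f" "udf S g"
  shows "udf S (\<lambda>t. f t + g t)"
  unfolding udf_def
proof (intro conjI allI impI)
  show "smooth_fun S (\<lambda>t. f t + g t)" by (intro smooth_fun_add assms udf_smooth)
  fix q :: real and K :: "real set" assume *: "0 < q" "q < 1" "compact K" "K \<subseteq> S"
  obtain C1 where C1: "C1 > 0" "\<And>j x. x \<in> K \<Longrightarrow> norm (nd j f x) \<le> C1 * M q j"
    using udf_bound[OF assms(2) *] by blast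
  obtain C2 where C2: "C2 > 0" "\<And>j x. x \<in> K \<Longrightarrow> norm (nd j g x) \<le> C2 * M q j"
    using udf_bound[OF assms(3) *] by blast
  have "norm (nd j (\<lambda>t. f t + g t) x) \<le> (C1 + C2) * M q j" if "x \<in> K" for j x
    using nd_add[OF assms(1) assms(2)[THEN udf_smooth] assms(3)[THEN udf_smooth], of x j] that *
      norm_triangle_mono[OF C1(2)[OF that, of j] C2(2)[OF that, of j]]
    by (auto simp: distrib_right)
  then show "\<exists>C. \<forall>j. \<forall>x\<in>K. norm (nd j (\<lambda>t. f t + g t) x) \<le> C * M q j" by blast
qed

text \<open>The constant is fixed before the functions, so that multiplication by a cut-off is
  continuous and not merely well defined. The bounds refer to one point \<open>x\<close> and are
  therefore usable on any set.\<close>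

definition product_const :: "real \<Rightarrow> real \<Rightarrow> real \<Rightarrow> bool" where
  "product_const q q' C \<longleftrightarrow> C > 0 \<and> (\<forall>S f g A B x n. open S \<longrightarrow> smooth_fun S f \<longrightarrow> smooth_fun S g \<longrightarrow> x \<in> S \<longrightarrow> A \<ge> 0 \<longrightarrow>
     (\<forall>j. norm (nd j f x) \<le> A * M q' j) \<longrightarrow> (\<forall>j. norm (nd j g x) \<le> B * M q' j) \<longrightarrow>
     norm (nd n (\<lambda>t. f t * g t) x) \<le> C * A * B * M q n)"

lemma product_constD:
  assumes "product_const q q' C" "open S" "smooth_fun S f" "smooth_fun S g" "x \<in> S" "A \<ge> 0"
    "\<And>j. norm (nd j f x) \<le> A * M q' j" "\<And>j. norm (nd j g x) \<le> B * M q' j"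
  shows "norm (nd n (\<lambda>t. f t * g t) x) \<le> C * A * B * M q n"
  using assms unfolding product_const_def by blast

lemma product_const_exists:
  assumes "0 < q" "q < q'"
  obtains C where "product_const q q' C"
proof -
  obtain C where C: "C > 0" "\<And>n. (\<Sum>i\<le>n. real (n choose i) * M q' i * M q' (n - i)) \<le> C * M q n"
    using M_binomial[OF assms] by blast
  have "norm (nd n (\<lambda>t. f t * g t) x) \<le> C * A * B * M q n"
    if "open S" "smooth_fun S f" "smooth_fun S g" "x \<in> S" "A \<ge> 0"
      and f: "\<And>j. norm (nd j f x) \<le> A * M q' j" and g: "\<And>j. norm (nd j g x) \<le> B * M q' j" for S f g A B x n
  proof -
    have B: "B \<ge> 0" using order_trans[OF norm_ge_zero g[of 0]] M_pos[of q' 0] by (simp add: zero_le_mult_iff)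
    have "norm (nd n (\<lambda>t. f t * g t) x) \<le> (\<Sum>i\<le>n. norm (of_nat (n choose i) * nd i f x * nd (n - i) g x))"
      unfolding nd_mult(1)[OF that(1-4)] by (rule norm_sum)
    also have "\<dots> \<le> (\<Sum>i\<le>n. real (n choose i) * (A * M q' i) * (B * M q' (n - i)))"
      unfolding norm_mult norm_of_nat using f g M_pos that(5) B
      by (intro sum_mono mult_mono mult_nonneg_nonneg) (auto intro: less_imp_le)
    also have "\<dots> = A * B * (\<Sum>i\<le>n. real (n choose i) * M q' i * M q' (n - i))"
      by (simp add: sum_distrib_left mult_ac)
    also have "\<dots> \<le> A * B * (C * M q n)" using C(2)[of n] that(5) B by (intro mult_left_mono) auto
    finally show ?thesis by (simp add: mult_ac)
  qed
  then have "product_const q q' C" unfolding product_const_def using C(1) by blast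
  then show ?thesis by (rule that)
qed

lemma udf_mult:
  assumes "open S" "udf S f" "udf S g"
  shows "udf S (\<lambda>t. f t * g t)"
  unfolding udf_def
proof (intro conjI allI impI)
  show "smooth_fun S (\<lambda>t. f t * g t)" by (intro nd_mult assms udf_smooth)
  fix q :: real and K :: "real set" assume *: "0 < q" "q < 1" "compact K" "K \<subseteq> S"
  define q' where "q' = (q + 1) / 2"
  have q': "q < q'" "q' < 1" "0 < q'" using * by (auto simp: q'_def)
  obtain C where C: "product_const q q' C" using product_const_exists[OF *(1) q'(1)] .
  obtain A where A: "A > 0" "\<And>j x. x \<in> K \<Longrightarrow> norm (nd j f x) \<le> A * M q' j"
    using udf_bound[OF assms(2) q'(3,2) *(3,4)] by blast
  obtain B where B: "B > 0" "\<And>j x. x \<in> K \<Longrightarrow> norm (nd j g x) \<le> B * M q' j"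
    using udf_bound[OF assms(3) q'(3,2) *(3,4)] by blast
  have "norm (nd n (\<lambda>t. f t * g t) x) \<le> C * A * B * M q n" if "x \<in> K" for n x
    using A B that * assms udf_smooth by (intro product_constD[OF C, of S]) auto
  then show "\<exists>C. \<forall>j. \<forall>x\<in>K. norm (nd j (\<lambda>t. f t * g t) x) \<le> C * M q j" by blast
qed

lemma udf_translate:
  assumes "udf UNIV f"
  shows "udf UNIV (\<lambda>t. f (t + y))"
  unfolding udf_def
proof (intro conjI allI impI)
  show "smooth_fun UNIV (\<lambda>t. f (t + y))" using assms by (intro nd_translate udf_smooth)
  fix q :: real and K :: "real set" assume *: "0 < q" "q < 1" "compact K"
  have "compact ((\<lambda>t. t + y) ` K)" using *(3) by (intro compact_continuous_image continuous_intros)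
  then obtain C where C: "C > 0" "\<And>j x. x \<in> (\<lambda>t. t + y) ` K \<Longrightarrow> norm (nd j f x) \<le> C * M q j"
    using udf_bound[OF assms *(1,2) _ subset_UNIV] by blast
  have "norm (nd j (\<lambda>t. f (t + y)) x) \<le> C * M q j" if "x \<in> K" for j x
    unfolding nd_translate(1)[OF assms[THEN udf_smooth]] using that by (intro C) auto
  then show "\<exists>C. \<forall>j. \<forall>x\<in>K. norm (nd j (\<lambda>t. f (t + y)) x) \<le> C * M q j" by blast
qed

lemma udf_vd:
  assumes "udf S f"
  shows "udf S (vd f)"
  unfolding udf_def
proof (intro conjI allI impI)
  show "smooth_fun S (vd f)"
    using udf_smooth[OF assms] unfolding smooth_fun_def nd_vd by blast
  fix q :: real and K :: "real set" assume *: "0 < q" "q < 1" "compact K" "K \<subseteq> S"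
  define q' where "q' = (q + 1) / 2"
  have q': "q < q'" "q' < 1" "0 < q'" using * by (auto simp: q'_def)
  obtain C where C: "C > 0" "\<And>j x. x \<in> K \<Longrightarrow> norm (nd j f x) \<le> C * M q' j"
    using udf_bound[OF assms q'(3,2) *(3,4)] by blast
  have "norm (nd j (vd f) x) \<le> C * M (q' - q) 1 * M q j" if "x \<in> K" for j x
  proof -
    have "norm (nd j (vd f) x) \<le> C * M q' (j + 1)" using C(2)[OF that, of "Suc j"] by (simp add: nd_vd del: funpow.simps)
    also have "\<dots> \<le> C * (M (q' - q) 1 * M q j)" using C(1) *(1) q'(1) by (intro mult_left_mono M_shift) auto
    finally show ?thesis by (simp add: mult_ac)
  qed
  then show "\<exists>C. \<forall>j. \<forall>x\<in>K. norm (nd j (vd f) x) \<le> C * M q j" by blast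
qed

text \<open>Derivatives move down by one index, which is harmless as \<open>M q\<close> is
  non-decreasing; \<open>F\<close> itself is bounded on compact sets by continuity.\<close>

lemma udf_antiderivative:
  assumes "open S" "udf S f" and der: "\<And>x. x \<in> S \<Longrightarrow> (F has_vector_derivative f x) (at x)"
  shows "udf S F"
proof -
  define g where "g j = (case j of 0 \<Rightarrow> F | Suc i \<Rightarrow> nd i f)" for j
  have g: "(g j has_vector_derivative g (Suc j) x) (at x)" if "x \<in> S" for j x
    using der[OF that] smooth_fun_has_derivative[OF udf_smooth[OF assms(2)] that]
    by (cases j) (auto simp: g_def simp del: funpow.simps intro: der that)
  have sm: "smooth_fun S F" using smooth_fun_sequence[of S g, OF assms(1) g] by (simp add: g_def)
  have nd: "nd j F x = g j x" if "x \<in> S" for j x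
    using nd_eq_sequence[of S g, OF assms(1) g that] by (simp add: g_def)
  show ?thesis
    unfolding udf_def
  proof (intro conjI allI impI)
    fix q :: real and K :: "real set" assume *: "0 < q" "q < 1" "compact K" "K \<subseteq> S"
    obtain C where C: "C > 0" "\<And>j x. x \<in> K \<Longrightarrow> norm (nd j f x) \<le> C * M q j"
      using udf_bound[OF assms(2) *] by blast
    have "continuous_on K F"
      by (rule continuous_on_vector_derivative) (use der * has_vector_derivative_at_within in blast)
    then obtain B where B: "\<And>x. x \<in> K \<Longrightarrow> norm (F x) \<le> B"
      by (metis *(3) bounded_iff compact_continuous_image compact_imp_bounded imageI)
    define D where "D = max C (\<bar>B\<bar> / M q 0)"
    have "norm (nd j F x) \<le> D * M q j" if x: "x \<in> K" for j x
    proof (cases j)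
      case 0
      have "\<bar>B\<bar> / M q 0 * M q 0 \<le> D * M q 0" using M_pos[of q 0] by (intro mult_right_mono) (auto simp: D_def)
      then have "\<bar>B\<bar> \<le> D * M q 0" using M_pos[of q 0] by simp
      then show ?thesis using 0 B[OF x] by simp
    next
      case (Suc i)
      have "norm (nd j F x) = norm (nd i f x)" using nd[of x j] x *(4) by (auto simp: g_def Suc simp del: funpow.simps)
      also have "\<dots> \<le> C * M q i" by (rule C(2)[OF x])
      also have "\<dots> \<le> D * M q j"
        using M_Suc[OF *(1), of i] C(1) M_pos[of q i] unfolding Suc by (intro mult_mono) (auto simp: D_def less_max_iff_disj)
      finally show ?thesis .
    qed
    then show "\<exists>C. \<forall>j. \<forall>x\<in>K. norm (nd j F x) \<le> C * M q j" by blast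
  qed (rule sm)
qed

definition entire_const :: "real \<Rightarrow> real \<Rightarrow> real \<Rightarrow> bool" where
  "entire_const r q C \<longleftrightarrow> C > 0 \<and> (\<forall>F A x j. F holomorphic_on UNIV \<longrightarrow> (\<forall>w\<in>cball (of_real x) r. norm (F w) \<le> A) \<longrightarrow>
      norm (nd j (\<lambda>t. F (of_real t)) x) \<le> C * A * M q j)"

lemma entire_constD:
  assumes "entire_const r q C" "F holomorphic_on UNIV" "\<And>w. w \<in> cball (of_real x) r \<Longrightarrow> norm (F w) \<le> A"
  shows "norm (nd j (\<lambda>t. F (of_real t)) x) \<le> C * A * M q j"
  using assms unfolding entire_const_def by blast

text \<open>Cauchy's inequality on discs of radius \<open>r\<close>, with \<open>n! / r^n\<close>
  absorbed by \<open>M_factorial\<close>. One constant for all entire functions is what estimates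
  with a parameter \<open>z\<close> need.\<close>

lemma entire_const_exists:
  assumes "r > 0" "q > 0"
  obtains C where "entire_const r q C"
proof -
  obtain C where C: "C > 0" "\<And>n. fact n / r ^ n \<le> C * M q n" using M_factorial[OF assms] by blast
  have "norm (nd j (\<lambda>t. F (of_real t)) x) \<le> C * A * M q j"
    if F: "F holomorphic_on UNIV" and A: "\<And>w. w \<in> cball (of_real x) r \<Longrightarrow> norm (F w) \<le> A" for F A x j
  proof -
    have "A \<ge> 0" using order_trans[OF norm_ge_zero A[of "of_real x"]] assms by simp
    have "norm (nd j (\<lambda>t. F (of_real t)) x) \<le> fact j * A / r ^ j"
      unfolding nd_entire(1)[OF F]
    proof (rule Cauchy_inequality)
      show "F holomorphic_on ball (of_real x) r" using F holomorphic_on_subset by blast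
      show "continuous_on (cball (of_real x) r) F" using F holomorphic_on_imp_continuous_on continuous_on_subset by blast
      show "norm (F w) \<le> A" if "norm (of_real x - w) = r" for w
        using A[of w] that by (simp add: dist_norm)
    qed (use assms in auto)
    also have "\<dots> = A * (fact j / r ^ j)" by simp
    also have "\<dots> \<le> A * (C * M q j)" using \<open>A \<ge> 0\<close> C(2) by (intro mult_left_mono)
    finally show ?thesis by (simp add: mult_ac)
  qed
  then have "entire_const r q C" unfolding entire_const_def using C(1) by blast
  then show ?thesis by (rule that)
qed

lemma udf_entire:
  assumes "F holomorphic_on UNIV"
  shows "udf S (\<lambda>t. F (of_real t))"
  unfolding udf_def
proof (intro conjI allI impI)
  show "smooth_fun S (\<lambda>t. F (of_real t))" by (rule nd_entire(2)[OF assms])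
  fix q :: real and K :: "real set" assume *: "0 < q" "q < 1" "compact K" "K \<subseteq> S"
  obtain C where C: "entire_const 1 q C" using entire_const_exists[OF zero_less_one *(1)] .
  obtain L where L: "\<And>x. x \<in> K \<Longrightarrow> \<bar>x\<bar> \<le> L"
    using compact_imp_bounded[OF *(3)] by (auto simp: bounded_iff)
  obtain A where A: "\<And>w. norm w \<le> L + 1 \<Longrightarrow> norm (F w) \<le> A"
  proof -
    have "compact (F ` cball 0 (L + 1))"
      using compact_continuous_image[OF continuous_on_subset[OF holomorphic_on_imp_continuous_on[OF assms] subset_UNIV]] by simp
    then show ?thesis using that
      by (metis (no_types, lifting) bounded_iff compact_imp_bounded imageI mem_cball_0)
  qed
  have "norm (nd j (\<lambda>t. F (of_real t)) x) \<le> C * A * M q j" if "x \<in> K" for j x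
  proof (rule entire_constD[OF C assms])
    fix w :: complex assume "w \<in> cball (of_real x) 1"
    then have "norm w \<le> \<bar>x\<bar> + 1"
      using norm_triangle_ineq[of "of_real x" "w - of_real x"] by (simp add: dist_norm norm_minus_commute)
    then show "norm (F w) \<le> A" using L[OF that] by (intro A) simp
  qed
  then show "\<exists>C. \<forall>j. \<forall>x\<in>K. norm (nd j (\<lambda>t. F (of_real t)) x) \<le> C * M q j" by blast
qed

lemma udf_const: "udf S (\<lambda>_. c)"
  using udf_entire[of "\<lambda>_. c" S] by simp

lemma udf_cmult: "open S \<Longrightarrow> udf S f \<Longrightarrow> udf S (\<lambda>t. c * f t)"
  using udf_mult[OF _ udf_const] by blast

lemma udf_diff:
  assumes "open S" "udf S f" "udf S g"
  shows "udf S (\<lambda>t. f t - g t)"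
  using udf_add[OF assms(1,2) udf_cmult[OF assms(1,3), of "- 1"]] by simp

lemma udf_extend:
  assumes "open S" "udf S f" "compact K" "K \<subseteq> S" and zero: "\<And>x. x \<notin> K \<Longrightarrow> f x = 0"
  shows "udf UNIV f"
  unfolding udf_def
proof (intro conjI allI impI)
  have oK: "open (- K)" using assms(3) by (simp add: compact_imp_closed open_Compl)
  have nz: "nd j f x = 0" if "x \<notin> K" for j x
    using nd_eq_0[OF oK, of f x j] zero that by auto
  show "smooth_fun UNIV f"
    unfolding smooth_fun_def
  proof (intro allI ballI)
    fix j x
    show "nd j f differentiable at x"
    proof (cases "x \<in> K")
      case True
      then show ?thesis using udf_smooth[OF assms(2)] assms(4) unfolding smooth_fun_def by blast
    next
      case False
      have "(nd j f has_vector_derivative 0) (at x)"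
        using False by (intro has_vector_derivative_transform_within_open[OF has_vector_derivative_const oK]) (auto simp: nz)
      then show ?thesis by (rule differentiableI_vector)
    qed
  qed
  fix q :: real and K' :: "real set" assume *: "0 < q" "q < 1"
  obtain C where C: "C > 0" "\<And>j x. x \<in> K \<Longrightarrow> norm (nd j f x) \<le> C * M q j"
    using udf_bound[OF assms(2) * assms(3,4)] by blast
  have "norm (nd j f x) \<le> C * M q j" for j x
    using C nz[of x j] M_pos[of q j] by (cases "x \<in> K") (auto simp: less_imp_le)
  then show "\<exists>C. \<forall>j. \<forall>x\<in>K'. norm (nd j f x) \<le> C * M q j" by blast
qed

end

section \<open>Cut-off functions\<close>

text \<open>Convolution with a normalised box. Each averaging yields one more derivative, a
  difference quotient with step \<open>h\<close>, at the price of a factor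
  \<open>2 / h\<close>.\<close>

definition window_mean :: "real \<Rightarrow> (real \<Rightarrow> real) \<Rightarrow> real \<Rightarrow> real" where
  "window_mean h g x = integral {x..x + h} g / h"

lemma window_mean_derivative:
  assumes g: "continuous_on UNIV g" and h: "h > 0"
  shows "(window_mean h g has_real_derivative (g (x + h) - g x) / h) (at x)"
proof -
  have cont: "continuous_on {a..b} g" for a b using g continuous_on_subset by blast
  define P where "P u = integral {x - 1..u} g" for u
  have P: "(P has_real_derivative g u) (at u)" if "x - 1 < u" for u
  proof -
    have "(P has_real_derivative g u) (at u within {x - 1..u + 1})"
      unfolding P_def using that by (intro integral_has_real_derivative cont) auto
    then show ?thesis using that by (simp add: at_within_Icc_at)
  qed
  have "((\<lambda>y. (P (y + h) - P y) / h) has_real_derivative (g (x + h) - g x) / h) (at x)"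
    using P[of x] P[of "x + h"] h by (auto intro!: derivative_eq_intros simp: DERIV_shift)
  moreover have "(P (y + h) - P y) / h = window_mean h g y" if "y \<in> {x - 1<..<x + 1}" for y
  proof -
    have "integral {x - 1..y} g + integral {y..y + h} g = integral {x - 1..y + h} g"
      using that h by (intro Henstock_Kurzweil_Integration.integral_combine integrable_continuous_real cont) auto
    then show ?thesis by (simp add: P_def window_mean_def)
  qed
  ultimately show ?thesis
    using has_field_derivative_transform_within_open[of _ _ x "{x - 1<..<x + 1}"] by auto
qed

lemma window_mean_continuous:
  assumes "continuous_on UNIV g" "h > 0"
  shows "continuous_on UNIV (window_mean h g)"
  using window_mean_derivative[OF assms] by (intro DERIV_continuous_on) (auto intro: has_field_derivative_at_within)

lemma window_mean_diff:
  assumes g: "continuous_on UNIV g" and g': "continuous_on UNIV g'" and h: "h > 0"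
    and le: "\<And>y. y \<in> {x..x + h} \<Longrightarrow> \<bar>g y - g' y\<bar> \<le> B"
  shows "\<bar>window_mean h g x - window_mean h g' x\<bar> \<le> B"
proof -
  have int: "g integrable_on {x..x + h}" "g' integrable_on {x..x + h}"
    using g g' by (auto intro!: integrable_continuous_real intro: continuous_on_subset)
  have "\<bar>integral {x..x + h} (\<lambda>y. g y - g' y)\<bar> \<le> B * (x + h - x)"
    using h le g g' integral_bound[of x "x + h" "\<lambda>y. g y - g' y" B]
    by (auto intro!: continuous_intros intro: continuous_on_subset)
  then have "\<bar>integral {x..x + h} g - integral {x..x + h} g'\<bar> \<le> B * h"
    by (simp add: Henstock_Kurzweil_Integration.integral_diff[OF int])
  then have "\<bar>(integral {x..x + h} g - integral {x..x + h} g') / h\<bar> \<le> B"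
    using h by (simp add: abs_divide pos_divide_le_eq)
  then show ?thesis by (simp add: window_mean_def diff_divide_distrib)
qed

lemma window_mean_const: "h > 0 \<Longrightarrow> window_mean h (\<lambda>_. c) x = c"
  by (simp add: window_mean_def)

lemma window_mean_const_on:
  assumes "continuous_on UNIV g" "h > 0" "\<And>y. y \<in> {x..x + h} \<Longrightarrow> g y = c"
  shows "window_mean h g x = c"
  using window_mean_diff[OF assms(1) continuous_on_const assms(2), of x c 0] assms by (simp add: window_mean_const)

text \<open>Finite stages of an infinite convolution of boxes of widths \<open>a m\<close>,
  \<open>a (m + 1)\<close>, and so on. The starting index is kept because the derivative of a stage
  with index \<open>m\<close> is a difference quotient of one with index
  \<open>m + 1\<close>.\<close>

primrec iterated_mean :: "(nat \<Rightarrow> real) \<Rightarrow> (real \<Rightarrow> real) \<Rightarrow> nat \<Rightarrow> nat \<Rightarrow> real \<Rightarrow> real" where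
  "iterated_mean a g 0 m = g"
| "iterated_mean a g (Suc n) m = window_mean (a m) (iterated_mean a g n (Suc m))"

text \<open>The windows look to the right, so the plateau on \<open>x \<ge> \<delta>\<close> is
  preserved exactly, while the zero region of the ramp \<open>g\<close> loses at most the total
  width \<open>suminf a \<le> \<delta>\<close>. The Lipschitz constant \<open>1 / \<delta>\<close>
  of the ramp makes the stages converge uniformly.\<close>

lemma smooth_step_sequence:
  fixes a :: "nat \<Rightarrow> real"
  assumes a: "\<And>k. a k > 0" "summable a" "suminf a \<le> \<delta>" and \<delta>: "\<delta> > 0"
  obtains \<theta> :: "nat \<Rightarrow> real \<Rightarrow> real" where
    "\<And>m. continuous_on UNIV (\<theta> m)" "\<And>m. \<theta> m = window_mean (a m) (\<theta> (Suc m))"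
    "\<And>m x. \<bar>\<theta> m x\<bar> \<le> 1" "\<And>m x. x \<ge> \<delta> \<Longrightarrow> \<theta> m x = 1" "\<And>x. x \<le> - \<delta> \<Longrightarrow> \<theta> 0 x = 0"
proof -
  define g where "g x = max 0 (min 1 (x / \<delta>))" for x
  define T where "T = iterated_mean a g"
  have g_cont: "continuous_on UNIV g" unfolding g_def using \<delta> by (intro continuous_intros) auto
  have T_cont: "continuous_on UNIV (T n m)" for n m
    unfolding T_def by (induction n arbitrary: m) (auto intro: g_cont window_mean_continuous a)
  have T_Suc: "T (Suc n) m = window_mean (a m) (T n (Suc m))" for n m by (simp add: T_def)
  have lip: "\<bar>g y - g x\<bar> \<le> \<bar>y - x\<bar> / \<delta>" for x y
  proof -
    have "\<bar>g y - g x\<bar> \<le> \<bar>y / \<delta> - x / \<delta>\<bar>" unfolding g_def by (auto simp: max_def min_def abs_if)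
    then show ?thesis using \<delta> by (simp add: diff_divide_distrib[symmetric] abs_divide)
  qed
  have T_diff: "\<bar>T (Suc n) m x - T n m x\<bar> \<le> a (m + n) / \<delta>" for n m x
  proof (induction n arbitrary: m x)
    case 0
    have "\<bar>window_mean (a m) g x - window_mean (a m) (\<lambda>_. g x) x\<bar> \<le> a m / \<delta>"
    proof (rule window_mean_diff[OF g_cont continuous_on_const a(1)])
      fix y assume "y \<in> {x..x + a m}"
      then show "\<bar>g y - g x\<bar> \<le> a m / \<delta>"
        using lip[of y x] \<delta> by (auto elim!: order_trans intro!: divide_right_mono)
    qed
    then show ?case by (simp add: T_def window_mean_const a)
  next
    case (Suc n)
    show ?case
      unfolding T_Suc[of "Suc n"] T_Suc[of n m]
      by (rule window_mean_diff[OF T_cont T_cont a(1)]) (use Suc.IH[of "Suc m"] in simp)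
  qed
  have T_bound: "\<bar>T n m x\<bar> \<le> 1" for n m x
  proof (induction n arbitrary: m x)
    case 0
    then show ?case by (simp add: T_def g_def)
  next
    case (Suc n)
    have "\<bar>window_mean (a m) (T n (Suc m)) x - window_mean (a m) (\<lambda>_. 0) x\<bar> \<le> 1"
      by (rule window_mean_diff[OF T_cont continuous_on_const a(1)]) (use Suc.IH in simp)
    then show ?case by (simp add: T_Suc window_mean_const a)
  qed
  have T_one: "T n m x = 1" if "x \<ge> \<delta>" for n m x
    using that
  proof (induction n arbitrary: m x)
    case 0
    then show ?case using \<delta> by (simp add: T_def g_def min_def)
  next
    case (Suc n)
    then show ?case unfolding T_Suc by (intro window_mean_const_on[OF T_cont a(1)]) auto
  qed
  have T_zero: "T n m x = 0" if "x \<le> - (\<Sum>k<n. a (m + k))" for n m x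
    using that
  proof (induction n arbitrary: m x)
    case 0
    then have "x / \<delta> \<le> 0" using \<delta> by (simp add: divide_le_0_iff)
    then show ?case by (simp add: T_def g_def)
  next
    case (Suc n)
    have "(\<Sum>k<Suc n. a (m + k)) = a m + (\<Sum>k<n. a (Suc m + k))"
      by (subst sum.lessThan_Suc_shift) simp
    with Suc show ?case unfolding T_Suc by (intro window_mean_const_on[OF T_cont a(1)]) auto
  qed
  have unif: "uniformly_convergent_on UNIV (\<lambda>n x. T n m x)" for m
  proof -
    have "uniformly_convergent_on UNIV (\<lambda>n x. \<Sum>i<n. T (Suc i) m x - T i m x)"
    proof (rule Weierstrass_m_test')
      show "norm (T (Suc n) m x - T n m x) \<le> a (n + m) / \<delta>" for n x
        using T_diff[of n m x] by (simp add: add.commute)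
      show "summable (\<lambda>n. a (n + m) / \<delta>)"
        using summable_ignore_initial_segment[OF a(2)] by (rule summable_divide)
    qed
    then have "uniformly_convergent_on UNIV (\<lambda>n x. (\<Sum>i<n. T (Suc i) m x - T i m x) + T 0 m x)"
      by (intro uniformly_convergent_add uniformly_convergent_on_const) 
    moreover have "(\<Sum>i<n. T (Suc i) m x - T i m x) + T 0 m x = T n m x" for n x
      by (induction n) auto
    ultimately show ?thesis by (simp only:)
  qed
  define \<theta> where "\<theta> m x = lim (\<lambda>n. T n m x)" for m x
  have ul: "uniform_limit UNIV (\<lambda>n. T n m) (\<theta> m) sequentially" for m
    using unif[of m] unfolding uniformly_convergent_uniform_limit_iff \<theta>_def[abs_def] .
  have pl: "(\<lambda>n. T n m x) \<longlonglongrightarrow> \<theta> m x" for m x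
    using tendsto_uniform_limitI[OF ul] by simp
  have \<theta>_cont: "continuous_on UNIV (\<theta> m)" for m
    by (rule uniform_limit_theorem[OF always_eventually ul]) (simp_all add: T_cont)
  have "\<theta> m x = window_mean (a m) (\<theta> (Suc m)) x" for m x
  proof -
    have "(\<lambda>n. T (Suc n) m x) \<longlonglongrightarrow> window_mean (a m) (\<theta> (Suc m)) x"
    proof (rule LIMSEQ_I)
      fix e :: real assume "e > 0"
      then have "eventually (\<lambda>n. \<forall>y\<in>UNIV. dist (T n (Suc m) y) (\<theta> (Suc m) y) < e / 2) sequentially"
        using ul[of "Suc m"] unfolding uniform_limit_iff by (meson half_gt_zero)
      then obtain N where N: "\<And>n y. n \<ge> N \<Longrightarrow> \<bar>T n (Suc m) y - \<theta> (Suc m) y\<bar> < e / 2"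
        by (auto simp: eventually_sequentially dist_real_def)
      have "norm (T (Suc n) m x - window_mean (a m) (\<theta> (Suc m)) x) < e" if "n \<ge> N" for n
      proof -
        have "\<bar>window_mean (a m) (T n (Suc m)) x - window_mean (a m) (\<theta> (Suc m)) x\<bar> \<le> e / 2"
          by (rule window_mean_diff[OF T_cont \<theta>_cont a(1)]) (use N[OF that] in \<open>auto intro: less_imp_le\<close>)
        then show ?thesis using \<open>e > 0\<close> by (simp add: T_Suc)
      qed
      then show "\<exists>N. \<forall>n\<ge>N. norm (T (Suc n) m x - window_mean (a m) (\<theta> (Suc m)) x) < e" by blast
    qed
    moreover have "(\<lambda>n. T (Suc n) m x) \<longlonglongrightarrow> \<theta> m x" using pl by (rule LIMSEQ_Suc)
    ultimately show ?thesis using LIMSEQ_unique by blast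
  qed
  moreover have "\<bar>\<theta> m x\<bar> \<le> 1" for m x
    using tendsto_rabs[OF pl[of m x]] by (rule LIMSEQ_le_const2) (use T_bound in auto)
  moreover have "\<theta> m x = 1" if "x \<ge> \<delta>" for m x
    using pl[of m x] T_one[OF that] by (simp add: LIMSEQ_const_iff)
  moreover have "\<theta> 0 x = 0" if "x \<le> - \<delta>" for x
  proof -
    have "T n 0 x = 0" for n
    proof (rule T_zero)
      have "(\<Sum>k<n. a k) \<le> suminf a" using a by (intro sum_le_suminf) (auto intro: less_imp_le)
      then show "x \<le> - (\<Sum>k<n. a (0 + k))" using a(3) that by simp
    qed
    then show ?thesis using pl[of 0 x] by (simp add: LIMSEQ_const_iff)
  qed
  ultimately show ?thesis using that \<theta>_cont by (metis ext)
qed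

context ultra_weight
begin

text \<open>The j-th derivative of \<open>\<theta> 0\<close> is a j-fold difference quotient of
  \<open>\<theta> j\<close>, hence bounded by the product of the \<open>2 / a k\<close>, which the
  widths were built to control.\<close>

lemma udf_step:
  assumes "\<delta> > 0"
  obtains \<theta> where "udf UNIV \<theta>" "\<And>x. x \<ge> \<delta> \<Longrightarrow> \<theta> x = 1" "\<And>x. x \<le> - \<delta> \<Longrightarrow> \<theta> x = 0"
proof -
  obtain a :: "nat \<Rightarrow> real" where a: "\<And>k. a k > 0" "summable a" "suminf a < \<delta>"
    and M: "\<And>q. 0 < q \<Longrightarrow> q < 1 \<Longrightarrow> \<exists>C>0. \<forall>j. (\<Prod>k<j. 2 / a k) \<le> C * M q j"
    using small_averaging_widths[OF assms] by blast
  obtain \<theta> :: "nat \<Rightarrow> real \<Rightarrow> real" where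
    \<theta>: "\<And>m. continuous_on UNIV (\<theta> m)" "\<And>m. \<theta> m = window_mean (a m) (\<theta> (Suc m))"
    "\<And>m x. \<bar>\<theta> m x\<bar> \<le> 1" "\<And>m x. x \<ge> \<delta> \<Longrightarrow> \<theta> m x = 1" "\<And>x. x \<le> - \<delta> \<Longrightarrow> \<theta> 0 x = 0"
    using smooth_step_sequence[OF a(1,2) less_imp_le[OF a(3)] assms] by blast
  define d where "d = rec_nat \<theta> (\<lambda>j g m x. (g (Suc m) (x + a m) - g (Suc m) x) / a m)"
  have d0: "d 0 = \<theta>" and dS: "d (Suc j) m x = (d j (Suc m) (x + a m) - d j (Suc m) x) / a m" for j m x
    by (simp_all add: d_def)
  have der: "(d j m has_real_derivative d (Suc j) m x) (at x)" for j m x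
  proof (induction j arbitrary: m x)
    case 0
    show ?case
      using window_mean_derivative[OF \<theta>(1)[of "Suc m"] a(1)[of m], of x] \<theta>(2)[of m] by (simp add: d0 dS)
  next
    case (Suc j)
    have "((\<lambda>x. (d j (Suc m) (x + a m) - d j (Suc m) x) / a m) has_real_derivative d (Suc (Suc j)) m x) (at x)"
      unfolding dS[of "Suc j" m]
      using Suc.IH[of "Suc m" x] Suc.IH[of "Suc m" "x + a m"] a(1)[of m]
      by (auto intro!: derivative_eq_intros simp: DERIV_shift)
    then show ?case unfolding dS[symmetric] .
  qed
  have bound: "\<bar>d j m x\<bar> \<le> (\<Prod>k<j. 2 / a (m + k))" for j m x
  proof (induction j arbitrary: m x)
    case 0
    then show ?case using \<theta>(3) by (simp add: d0)
  next
    case (Suc j)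
    define P where "P = (\<Prod>k<j. 2 / a (Suc m + k))"
    have "\<bar>d (Suc j) m x\<bar> \<le> (P + P) / a m"
      unfolding dS using Suc.IH[of "Suc m" "x + a m"] Suc.IH[of "Suc m" x] a(1)[of m]
      by (simp add: abs_divide P_def divide_right_mono) linarith?
    also have "\<dots> = 2 / a m * P" by simp
    also have "\<dots> = (\<Prod>k<Suc j. 2 / a (m + k))"
      unfolding P_def prod.lessThan_Suc_shift by simp
    finally show ?case .
  qed
  define g where "g j x = complex_of_real (d j 0 x)" for j x
  have derg: "(g j has_vector_derivative g (Suc j) x) (at x)" for j x
    unfolding g_def[abs_def] using der[of j 0 x]
    by (intro has_vector_derivative_of_real) (simp add: has_real_derivative_iff_has_vector_derivative)
  have "udf UNIV (g 0)"
    unfolding udf_def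
  proof (intro conjI allI impI)
    show "smooth_fun UNIV (g 0)" by (rule smooth_fun_sequence[of UNIV g, OF open_UNIV derg])
    fix q :: real and K :: "real set" assume "0 < q" "q < 1"
    then obtain C where C: "C > 0" "\<And>j. (\<Prod>k<j. 2 / a k) \<le> C * M q j" using M by blast
    have "norm (nd j (g 0) x) \<le> C * M q j" for j x
      using nd_eq_sequence[of UNIV g, OF open_UNIV derg, of x j] order_trans[OF bound[of j 0 x] _] C(2)[of j]
      by (simp add: g_def)
    then show "\<exists>C. \<forall>j. \<forall>x\<in>K. norm (nd j (g 0) x) \<le> C * M q j" by blast
  qed
  then show ?thesis using that[of "g 0"] \<theta>(4,5) by (simp add: g_def d0)
qed

lemma udf_plateau:
  assumes "l \<le> r" "\<delta> > 0"
  obtains \<theta> where "udf UNIV \<theta>" "\<And>x. l - \<delta> \<le> x \<Longrightarrow> x \<le> r + \<delta> \<Longrightarrow> \<theta> x = 1"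
    "\<And>x. x \<le> l - 2 * \<delta> \<Longrightarrow> \<theta> x = 0" "\<And>x. x \<ge> r + 2 * \<delta> \<Longrightarrow> \<theta> x = 0"
proof -
  obtain s where s: "udf UNIV s" "\<And>x. x \<ge> \<delta> / 2 \<Longrightarrow> s x = 1" "\<And>x. x \<le> - (\<delta> / 2) \<Longrightarrow> s x = 0"
    using udf_step[of "\<delta> / 2"] assms(2) by auto
  \<comment> \<open>The two transitions, each of width \<delta>, occupy
    \<open>[l-2\<delta>;l-\<delta>]\<close> and \<open>[r+\<delta>;r+2\<delta>]\<close>.\<close>
  define \<theta> where "\<theta> x = s (x + (- l + 3 / 2 * \<delta>)) - s (x + (- r - 3 / 2 * \<delta>))" for x
  have "udf UNIV \<theta>" unfolding \<theta>_def by (intro udf_diff udf_translate s open_UNIV)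
  moreover have "\<theta> x = 1" if "l - \<delta> \<le> x" "x \<le> r + \<delta>" for x
    using that assms(2) by (simp add: \<theta>_def s)
  moreover have "\<theta> x = 0" if "x \<le> l - 2 * \<delta>" for x
    using that assms by (simp add: \<theta>_def s)
  moreover have "\<theta> x = 0" if "x \<ge> r + 2 * \<delta>" for x
    using that assms by (simp add: \<theta>_def s)
  ultimately show ?thesis by (rule that)
qed

end

section \<open>Continuous functionals\<close>

context ultra_weight
begin

definition functional_bound :: "((real \<Rightarrow> complex) \<Rightarrow> complex) \<Rightarrow> real \<Rightarrow> real \<Rightarrow> real \<Rightarrow> bool" where
  "functional_bound S q L C \<longleftrightarrow> 0 < q \<and> q < 1 \<and> 0 \<le> L \<and> 0 \<le> C \<and> (\<forall>h A. udf UNIV h \<longrightarrow>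
     (\<forall>j x. \<bar>x\<bar> \<le> L \<longrightarrow> norm (nd j h x) \<le> A * M q j) \<longrightarrow> norm (S h) \<le> C * A)"

lemma functional_boundD:
  assumes "functional_bound S q L C"
  shows "0 < q" "q < 1" "0 \<le> L" "0 \<le> C"
    "udf UNIV h \<Longrightarrow> (\<And>j x. \<bar>x\<bar> \<le> L \<Longrightarrow> norm (nd j h x) \<le> A * M q j) \<Longrightarrow> norm (S h) \<le> C * A"
  using assms unfolding functional_bound_def by blast+

text \<open>Functionals on the test functions of the whole line, where every translate stays in the
  space. The estimate over \<open>[-L;L]\<close> expresses continuity and a compact carrier at
  once.\<close>

definition ufunctional :: "((real \<Rightarrow> complex) \<Rightarrow> complex) \<Rightarrow> bool" where
  "ufunctional S \<longleftrightarrow>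
     (\<forall>f g. udf UNIV f \<longrightarrow> udf UNIV g \<longrightarrow> S (\<lambda>t. f t + g t) = S f + S g) \<and>
     (\<forall>f c. udf UNIV f \<longrightarrow> S (\<lambda>t. c * f t) = c * S f) \<and>
     (\<exists>q L C. functional_bound S q L C)"

lemma ufunctional_add: "ufunctional S \<Longrightarrow> udf UNIV f \<Longrightarrow> udf UNIV g \<Longrightarrow> S (\<lambda>t. f t + g t) = S f + S g"
  unfolding ufunctional_def by blast

lemma ufunctional_cmult: "ufunctional S \<Longrightarrow> udf UNIV f \<Longrightarrow> S (\<lambda>t. c * f t) = c * S f"
  unfolding ufunctional_def by blast

lemma ufunctional_diff:
  assumes "ufunctional S" "udf UNIV f" "udf UNIV g"
  shows "S (\<lambda>t. f t - g t) = S f - S g"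
  using ufunctional_add[OF assms(1,2) udf_cmult[OF open_UNIV assms(3), of "- 1"]]
    ufunctional_cmult[OF assms(1,3), of "- 1"] by simp

lemma ufunctional_compact:
  assumes "ufunctional S"
  obtains L where "L > 0" "\<And>h. udf UNIV h \<Longrightarrow> (\<And>x. \<bar>x\<bar> < L \<Longrightarrow> h x = 0) \<Longrightarrow> S h = 0"
proof -
  obtain q L C where b: "functional_bound S q L C"
    using assms unfolding ufunctional_def by blast
  have "S h = 0" if "udf UNIV h" "\<And>x. \<bar>x\<bar> < L + 1 \<Longrightarrow> h x = 0" for h
  proof -
    have "norm (S h) \<le> C * 0"
    proof (rule functional_boundD(5)[OF b that(1)])
      fix j x assume "\<bar>x\<bar> \<le> L"
      then show "norm (nd j h x) \<le> 0 * M q j"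
        using nd_eq_0[of "{- (L + 1)<..<L + 1}" h x j] that(2) by (fastforce simp: abs_less_iff)
    qed
    then show ?thesis by simp
  qed
  then show ?thesis using that[of "L + 1"] functional_boundD(3)[OF b] by auto
qed

lemma ufunctional_cong:
  assumes "ufunctional S" and zero: "\<And>h. udf UNIV h \<Longrightarrow> (\<And>x. x \<in> V \<Longrightarrow> h x = 0) \<Longrightarrow> S h = 0"
    and "udf UNIV f" "udf UNIV g" "\<And>x. x \<in> V \<Longrightarrow> f x = g x"
  shows "S f = S g"
proof -
  have "S (\<lambda>t. f t - g t) = 0" by (rule zero) (use assms in \<open>auto intro: udf_diff\<close>)
  then show ?thesis using ufunctional_diff[OF assms(1,3,4)] by simp
qed

section \<open>Functionals applied to translates\<close>

lemma second_difference_bound: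
  assumes sm: "smooth_fun UNIV u" and B: "\<And>s. \<bar>s - t\<bar> \<le> \<bar>h\<bar> \<Longrightarrow> norm (nd (Suc (Suc j)) u s) \<le> B"
  shows "norm (nd j u (t + h) - nd j u t - of_real h * nd (Suc j) u t) \<le> B * h\<^sup>2"
proof -
  let ?S = "closed_segment t (t + h)"
  have seg: "\<bar>s - t\<bar> \<le> \<bar>h\<bar>" if "s \<in> ?S" for s
    using that by (auto simp: closed_segment_eq_real_ivl split: if_splits)
  have 1: "norm (nd (Suc j) u s - nd (Suc j) u t) \<le> B * \<bar>h\<bar>" if s: "s \<in> ?S" for s
  proof -
    have "norm (nd (Suc j) u s - nd (Suc j) u t) \<le> B * norm (s - t)"
    proof (rule differentiable_bound[of ?S])
      show "(nd (Suc j) u has_derivative (\<lambda>y. y *\<^sub>R nd (Suc (Suc j)) u x)) (at x within ?S)" for x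
        using has_vector_derivative_at_within[OF smooth_fun_has_derivative[OF sm UNIV_I, of "Suc j" x], of ?S]
        unfolding has_vector_derivative_def by simp
      show "onorm (\<lambda>y. y *\<^sub>R nd (Suc (Suc j)) u x) \<le> B" if "x \<in> ?S" for x
        using B[OF seg[OF that]] by (simp add: onorm_scaleR_left onorm_id)
    qed (use s in auto)
    also have "\<dots> \<le> B * \<bar>h\<bar>"
      using seg[OF s] order_trans[OF norm_ge_zero B[of t]] by (intro mult_left_mono) auto
    finally show ?thesis .
  qed
  have "norm (nd j u (t + h) - nd j u t - ((t + h) - t) *\<^sub>R nd (Suc j) u t) \<le> norm ((t + h) - t) * (B * \<bar>h\<bar>)"
  proof (rule vector_differentiable_bound_linearization[where S = ?S])
    show "(nd j u has_vector_derivative nd (Suc j) u x) (at x within ?S)" for x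
      by (rule has_vector_derivative_at_within, rule smooth_fun_has_derivative[OF sm UNIV_I])
  qed (use 1 in auto)
  then show ?thesis by (simp add: scaleR_conv_of_real power2_eq_square mult_ac)
qed

text \<open>The difference quotients converge in the seminorm that controls \<open>S\<close>. The
  second-order remainder costs two more derivatives, hence the passage from \<open>q\<close> to
  \<open>q'\<close>.\<close>

lemma translate_derivative:
  assumes S: "ufunctional S" and u: "udf UNIV u"
  shows "((\<lambda>x. S (\<lambda>t. u (t + x))) has_vector_derivative S (\<lambda>t. vd u (t + x))) (at x)"
proof -
  obtain q L C where b: "functional_bound S q L C"
    using S unfolding ufunctional_def by blast
  note q = functional_boundD(1,2)[OF b]
  define q' where "q' = (q + 1) / 2"
  have q': "q < q'" "q' < 1" "0 < q'" using q by (auto simp: q'_def)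
  obtain D where D: "D > 0" "\<And>j s. s \<in> {- (L + \<bar>x\<bar> + 1)..L + \<bar>x\<bar> + 1} \<Longrightarrow> norm (nd j u s) \<le> D * M q' j"
    using udf_bound[OF u q'(3,2) compact_Icc subset_UNIV] by blast
  have su: "smooth_fun UNIV u" by (rule udf_smooth[OF u])
  define B where "B = D * M (q' - q) 2"
  have est: "norm (S (\<lambda>t. u (t + (x + h))) - S (\<lambda>t. u (t + x)) - of_real h * S (\<lambda>t. vd u (t + x))) \<le> (C * B) * h\<^sup>2"
    if h: "\<bar>h\<bar> \<le> 1" for h
  proof -
    define k where "k t = u (t + (x + h)) - u (t + x) - of_real h * vd u (t + x)" for t
    have udfs: "udf UNIV (\<lambda>t. u (t + (x + h)))" "udf UNIV (\<lambda>t. u (t + x))" "udf UNIV (\<lambda>t. of_real h * vd u (t + x))"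
      "udf UNIV (\<lambda>t. vd u (t + x))"
      by (intro udf_translate udf_cmult udf_vd u open_UNIV)+
    have k: "udf UNIV k" unfolding k_def by (intro udf_diff udfs open_UNIV)
    have nk: "nd j k t = nd j u (t + x + h) - nd j u (t + x) - of_real h * nd (Suc j) u (t + x)" for j t
    proof -
      have "((\<lambda>t. nd j u (t + (x + h)) - nd j u (t + x) - of_real h * nd (Suc j) u (t + x)) has_vector_derivative
        nd (Suc j) u (s + (x + h)) - nd (Suc j) u (s + x) - of_real h * nd (Suc (Suc j)) u (s + x)) (at s)" for j s
      proof -
        have d: "((\<lambda>t. nd j u (t + y)) has_vector_derivative nd (Suc j) u (s + y)) (at s)" for j y
          using vector_diff_chain_at[of "\<lambda>t. t + y" 1 s "nd j u" "nd (Suc j) u (s + y)"] smooth_fun_has_derivative[OF su, of "s + y" j]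
          by (simp add: o_def has_vector_derivative_add_const)
        show ?thesis by (intro has_vector_derivative_diff has_vector_derivative_mult_right d)
      qed
      from nd_eq_sequence[of UNIV "\<lambda>j t. nd j u (t + (x + h)) - nd j u (t + x) - of_real h * nd (Suc j) u (t + x)", OF open_UNIV this, of t j]
      show ?thesis by (simp add: k_def[abs_def] add.assoc)
    qed
    have "norm (S k) \<le> C * (B * h\<^sup>2)"
    proof (rule functional_boundD(5)[OF b k])
      fix j t assume t: "\<bar>t\<bar> \<le> L"
      have "norm (nd j u (t + x + h) - nd j u (t + x) - of_real h * nd (Suc j) u (t + x)) \<le> (D * M q' (j + 2)) * h\<^sup>2"
      proof (rule second_difference_bound[OF su])
        fix s assume "\<bar>s - (t + x)\<bar> \<le> \<bar>h\<bar>"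
        then have "s \<in> {- (L + \<bar>x\<bar> + 1)..L + \<bar>x\<bar> + 1}" using t h by (auto simp: abs_le_iff) 
        then show "norm (nd (Suc (Suc j)) u s) \<le> D * M q' (j + 2)" using D(2)[of s "Suc (Suc j)"] by simp
      qed
      also have "\<dots> \<le> (D * (M (q' - q) 2 * M q j)) * h\<^sup>2"
        using D(1) q q' by (intro mult_right_mono mult_left_mono M_shift) auto
      finally show "norm (nd j k t) \<le> B * h\<^sup>2 * M q j" unfolding nk by (simp add: B_def mult_ac)
    qed
    moreover have "S k = S (\<lambda>t. u (t + (x + h))) - S (\<lambda>t. u (t + x)) - of_real h * S (\<lambda>t. vd u (t + x))"
      unfolding k_def using udfs
      by (simp add: ufunctional_diff[OF S] ufunctional_cmult[OF S] udf_diff)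
    ultimately show ?thesis by (simp add: mult_ac)
  qed
  show ?thesis
    unfolding has_vector_derivative_def has_derivative_at
  proof (intro conjI)
    show "bounded_linear (\<lambda>y. y *\<^sub>R S (\<lambda>t. vd u (t + x)))" by (rule bounded_linear_scaleR_left)
    show "((\<lambda>h. norm (S (\<lambda>t. u (t + (x + h))) - S (\<lambda>t. u (t + x)) - h *\<^sub>R S (\<lambda>t. vd u (t + x))) / norm h) \<longlongrightarrow> 0) (at 0)"
    proof (rule Lim_null_comparison)
      have "eventually (\<lambda>h. h \<noteq> 0 \<and> \<bar>h\<bar> < 1) (at (0::real))"
        by (auto simp: eventually_at intro!: exI[of _ 1])
      then show "eventually (\<lambda>h. norm (norm (S (\<lambda>t. u (t + (x + h))) - S (\<lambda>t. u (t + x)) - h *\<^sub>R S (\<lambda>t. vd u (t + x))) / norm h) \<le> (C * B) * \<bar>h\<bar>) (at 0)"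
      proof eventually_elim
        case (elim h)
        have "norm (S (\<lambda>t. u (t + (x + h))) - S (\<lambda>t. u (t + x)) - h *\<^sub>R S (\<lambda>t. vd u (t + x))) / norm h \<le> (C * B) * h\<^sup>2 / norm h"
          using est[of h] elim by (intro divide_right_mono) (auto simp: scaleR_conv_of_real)
        also have "\<dots> = (C * B) * \<bar>h\<bar>" using elim by (simp add: power2_eq_square abs_if)
        finally show ?case by simp
      qed
      show "((\<lambda>h. (C * B) * \<bar>h\<bar>) \<longlongrightarrow> 0) (at 0)"
        by (rule tendsto_eq_intros refl | simp)+
    qed
  qed
qed

lemma translate_continuous:
  assumes "ufunctional S" "udf UNIV u"
  shows "continuous_on UNIV (\<lambda>x. S (\<lambda>t. u (t + x)))"
  by (rule continuous_on_vector_derivative)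
    (rule has_vector_derivative_at_within, rule translate_derivative[OF assms])

definition transform :: "((real \<Rightarrow> complex) \<Rightarrow> complex) \<Rightarrow> complex \<Rightarrow> complex" where
  "transform S z = S (\<lambda>t. exp (- \<i> * of_real t * z))"

lemma udf_exp: "udf V (\<lambda>t. exp (- \<i> * of_real t * z))"
  by (rule udf_entire[of "\<lambda>w. exp (- \<i> * w * z)"]) (intro holomorphic_intros)

lemma translate_support:
  assumes S: "ufunctional S" and u: "udf UNIV u" "\<And>t. \<bar>t\<bar> > T \<Longrightarrow> u t = 0"
  obtains R where "\<And>x. \<bar>x\<bar> > R \<Longrightarrow> S (\<lambda>t. u (t + x)) = 0"
proof -
  obtain L where L: "L > 0" "\<And>h. udf UNIV h \<Longrightarrow> (\<And>x. \<bar>x\<bar> < L \<Longrightarrow> h x = 0) \<Longrightarrow> S h = 0"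
    using ufunctional_compact[OF S] by blast
  have "S (\<lambda>t. u (t + x)) = 0" if "\<bar>x\<bar> > T + L" for x
    by (rule L(2)[OF udf_translate[OF u(1)]]) (use u(2) that in auto)
  then show ?thesis by (rule that)
qed

text \<open>The function \<open>g(t) = \<integral>\<^sub>-\<^sub>\<infinity>\<^sup>t e\<^sup>-\<^sup>i\<^sup>z\<^sup>(\<^sup>t\<^sup>-\<^sup>s\<^sup>) u(s) ds\<close> solves \<open>g' + i z g = u\<close>, vanishes to the left and is
  a multiple of \<open>e\<^sup>-\<^sup>i\<^sup>z\<^sup>t\<close> to the right of the support of \<open>u\<close>; applying \<open>S\<close> to its translates
  reduces the claim to the fundamental theorem of calculus.\<close>

theorem ft_translate:
  assumes S: "ufunctional S" and u: "udf UNIV u" "\<And>t. \<bar>t\<bar> > T \<Longrightarrow> u t = 0"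
  shows "ft (\<lambda>x. S (\<lambda>t. u (t + x))) z = transform S z * ft u z"
proof -
  obtain L where L: "L > 0" "\<And>h. udf UNIV h \<Longrightarrow> (\<And>x. \<bar>x\<bar> < L \<Longrightarrow> h x = 0) \<Longrightarrow> S h = 0"
    using ufunctional_compact[OF S] by blast
  define T' where "T' = \<bar>T\<bar> + 1"
  have uz: "u t = 0" if "\<bar>t\<bar> \<ge> T'" for t using u(2)[of t] that by (auto simp: T'_def)
  have T': "T' > 0" by (simp add: T'_def)
  define p where "p t = exp (\<i> * z * of_real t) * u t" for t
  have contu: "continuous_on A u" for A
    by (rule continuous_on_vector_derivative, rule has_vector_derivative_at_within)
      (use smooth_fun_has_derivative[OF udf_smooth[OF u(1)] UNIV_I, of 0] in simp)
  have contp: "continuous_on A p" for A unfolding p_def by (intro continuous_intros contu)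
  have p: "udf UNIV p"
    unfolding p_def using udf_exp[of UNIV "- z"]
    by (intro udf_mult u open_UNIV) (simp add: mult_ac)
  define E where "E t = integral {- T' - 1..t} p" for t
  have E0: "E t = 0" if "t \<le> - T'" for t
  proof -
    have "E t = integral {- T' - 1..t} (\<lambda>_. 0)"
      unfolding E_def by (intro integral_cong) (use that uz T' in \<open>auto simp: p_def\<close>)
    then show ?thesis by simp
  qed
  have derE: "(E has_vector_derivative p t) (at t)" for t
  proof (cases "t < - T'")
    case True
    have "(E has_vector_derivative 0) (at t)"
      by (rule has_vector_derivative_transform_within_open[OF has_vector_derivative_const, of "{..<- T'}"])
        (use True in \<open>auto simp: E0\<close>)
    then show ?thesis using True uz[of t] T' by (simp add: p_def)
  next
    case False
    have "(E has_vector_derivative p t) (at t within {- T' - 1..t + 1})"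
      unfolding E_def using False by (intro integral_has_vector_derivative contp) auto
    then show ?thesis using False by (simp add: at_within_Icc_at)
  qed
  have E1: "E t = ft u z" if "t \<ge> T'" for t
  proof -
    have "(LINT s|lborel. indicator {- T'..t} s *\<^sub>R p s) = E t - E (- T')"
      using that T' by (intro integral_FTC_atLeastAtMost contp) (auto intro: has_vector_derivative_at_within derE)
    moreover have "(\<lambda>s. indicator {- T'..t} s *\<^sub>R p s) = p"
      using uz that by (auto simp: fun_eq_iff indicator_def p_def)
    ultimately show ?thesis by (simp add: E0 ft_def p_def[abs_def])
  qed
  have E: "udf UNIV E" by (rule udf_antiderivative[OF open_UNIV p]) (rule derE)
  define g where "g t = exp (- \<i> * of_real t * z) * E t" for t
  have g: "udf UNIV g" unfolding g_def by (intro udf_mult udf_exp E open_UNIV)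
  have vdg: "vd g t = - (\<i> * z) * g t + u t" for t
  proof -
    have "((\<lambda>t. exp (- \<i> * of_real t * z)) has_vector_derivative (- (\<i> * z) * exp (- \<i> * of_real t * z))) (at t)"
      by (rule has_vector_derivative_real_field) (auto intro!: derivative_eq_intros)
    from has_vector_derivative_mult[OF this derE[of t]]
    have "(g has_vector_derivative (exp (- \<i> * of_real t * z) * p t + - (\<i> * z) * exp (- \<i> * of_real t * z) * E t)) (at t)"
      by (simp add: g_def[abs_def])
    moreover have "exp (- \<i> * of_real t * z) * p t = u t"
      unfolding p_def mult.assoc[symmetric] exp_add[symmetric] by simp
    ultimately show ?thesis unfolding vd_def by (simp add: vector_derivative_at g_def)
  qed
  define \<kappa> where "\<kappa> x = S (\<lambda>t. u (t + x))" for x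
  define \<gamma> where "\<gamma> x = S (\<lambda>t. g (t + x))" for x
  have der\<gamma>: "(\<gamma> has_vector_derivative (- (\<i> * z) * \<gamma> x + \<kappa> x)) (at x)" for x
  proof -
    have "S (\<lambda>t. vd g (t + x)) = - (\<i> * z) * \<gamma> x + \<kappa> x"
      unfolding vdg \<gamma>_def \<kappa>_def
      by (subst ufunctional_add[OF S udf_cmult[OF open_UNIV udf_translate[OF g]] udf_translate[OF u(1)]])
        (simp only: ufunctional_cmult[OF S udf_translate[OF g]])
    then show ?thesis using translate_derivative[OF S g, of x] by (simp add: \<gamma>_def[abs_def])
  qed
  \<comment> \<open>Integrating factor for \<open>\<gamma>' = - \<i> z \<gamma> + \<kappa>\<close>:
    \<open>W\<close> is a primitive of the integrand of \<open>ft \<kappa>\<close>, with value 0 at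
    \<open>- R\<close> and the asserted product at \<open>R\<close>.\<close>
  define W where "W x = exp (\<i> * z * of_real x) * \<gamma> x" for x
  have derW: "(W has_vector_derivative exp (\<i> * z * of_real x) * \<kappa> x) (at x)" for x
  proof -
    have "((\<lambda>t. exp (\<i> * z * of_real t)) has_vector_derivative (\<i> * z * exp (\<i> * z * of_real x))) (at x)"
      by (rule has_vector_derivative_real_field) (auto intro!: derivative_eq_intros)
    from has_vector_derivative_mult[OF this der\<gamma>[of x]] show ?thesis
      by (simp add: W_def[abs_def] algebra_simps)
  qed
  have cont\<kappa>: "continuous_on A \<kappa>" for A
    using translate_continuous[OF S u(1)] continuous_on_subset unfolding \<kappa>_def by blast
  have \<kappa>0: "\<kappa> x = 0" if "\<bar>x\<bar> \<ge> T' + L" for x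
    unfolding \<kappa>_def by (rule L(2)[OF udf_translate[OF u(1)]]) (use uz that in auto)
  define R where "R = T' + L"
  have R: "R > 0" using T' L by (simp add: R_def)
  have "(LINT s|lborel. indicator {- R..R} s *\<^sub>R (exp (\<i> * z * of_real s) * \<kappa> s)) = W R - W (- R)"
    using R by (intro integral_FTC_atLeastAtMost continuous_intros cont\<kappa>)
      (auto intro: has_vector_derivative_at_within derW)
  moreover have "(\<lambda>s. indicator {- R..R} s *\<^sub>R (exp (\<i> * z * of_real s) * \<kappa> s)) = (\<lambda>s. exp (\<i> * z * of_real s) * \<kappa> s)"
    using \<kappa>0 by (auto simp: fun_eq_iff indicator_def R_def)
  moreover have "\<gamma> (- R) = 0"
    unfolding \<gamma>_def by (rule L(2)[OF udf_translate[OF g]]) (auto simp: g_def R_def E0)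
  moreover have "W R = transform S z * ft u z"
  proof -
    have "\<gamma> R = S (\<lambda>t. (exp (- \<i> * of_real R * z) * ft u z) * exp (- \<i> * of_real t * z))"
      unfolding \<gamma>_def
    proof (rule ufunctional_cong[OF S, where V = "{- L<..<L}"])
      show "udf UNIV (\<lambda>t. (exp (- \<i> * of_real R * z) * ft u z) * exp (- \<i> * of_real t * z))"
        by (intro udf_cmult udf_exp open_UNIV)
      show "g (t + R) = (exp (- \<i> * of_real R * z) * ft u z) * exp (- \<i> * of_real t * z)" if "t \<in> {- L<..<L}" for t
        using that E1[of "t + R"] by (simp add: g_def R_def algebra_simps exp_diff exp_add exp_minus divide_inverse)
      show "S h = 0" if "udf UNIV h" "\<And>x. x \<in> {- L<..<L} \<Longrightarrow> h x = 0" for h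
        using that by (intro L(2)) (auto simp: abs_less_iff)
    qed (intro udf_translate g)
    also have "\<dots> = (exp (- \<i> * of_real R * z) * ft u z) * transform S z"
      unfolding transform_def by (rule ufunctional_cmult[OF S udf_exp])
    finally have "W R = (exp (\<i> * z * of_real R) * exp (- \<i> * of_real R * z)) * ft u z * transform S z"
      by (simp add: W_def)
    also have "exp (\<i> * z * of_real R) * exp (- \<i> * of_real R * z) = 1"
      unfolding exp_add[symmetric] by simp
    finally show ?thesis by simp
  qed
  ultimately show ?thesis by (simp add: ft_def \<kappa>_def[symmetric] W_def)
qed

end

section \<open>Transforms of functionals\<close>

text \<open>In use, \<open>P\<close> describes a half-plane and \<open>- k\<close> is the edge of
  the half-line that contains the support of \<open>X\<close>.\<close>

lemma zero_type_ft_bound: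
  assumes zt: "zero_type \<phi>" and X: "cl1 X"
    and P: "\<And>z s. P z \<Longrightarrow> X s \<noteq> 0 \<Longrightarrow> - (Im z * s) \<le> k * Im z" and \<epsilon>: "\<epsilon> > 0"
  shows "\<exists>C. \<forall>z. P z \<longrightarrow> norm (\<phi> z * ft X z) \<le> C * exp (\<epsilon> * norm z + k * Im z)"
proof -
  obtain C where C: "C > 0" "\<And>z. norm (\<phi> z) \<le> C * exp (\<epsilon> * norm z)"
    using zero_typeD[OF zt \<epsilon>] by blast
  have "norm (\<phi> z * ft X z) \<le> (C * l1 X) * exp (\<epsilon> * norm z + k * Im z)" if "P z" for z
  proof -
    have "norm (\<phi> z * ft X z) \<le> (C * exp (\<epsilon> * norm z)) * (l1 X * exp (k * Im z))"
      unfolding norm_mult using C by (intro mult_mono ft_bound X P[OF that] C(2)) auto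
    then show ?thesis by (simp add: exp_add mult_ac)
  qed
  then show ?thesis by blast
qed

context ultra_weight
begin

lemma ufunctional_truncate:
  assumes S: "ufunctional S"
  obtains \<theta> L where "udf UNIV \<theta>" "\<forall>x. \<bar>x\<bar> > L \<longrightarrow> \<theta> x = 0" "\<forall>h. udf UNIV h \<longrightarrow> S (\<lambda>t. \<theta> t * h t) = S h"
proof -
  obtain L where L: "L > 0" "\<And>h. udf UNIV h \<Longrightarrow> (\<And>x. \<bar>x\<bar> < L \<Longrightarrow> h x = 0) \<Longrightarrow> S h = 0"
    using ufunctional_compact[OF S] by blast
  have "- L \<le> L" using L by simp
  then obtain \<theta> where \<theta>: "udf UNIV \<theta>" "\<And>x. - L - 1 \<le> x \<Longrightarrow> x \<le> L + 1 \<Longrightarrow> \<theta> x = 1"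
    "\<And>x. x \<le> - L - 2 * 1 \<Longrightarrow> \<theta> x = 0" "\<And>x. x \<ge> L + 2 * 1 \<Longrightarrow> \<theta> x = 0"
    using udf_plateau[of "- L" L 1, OF _ zero_less_one] by blast
  have 1: "\<theta> x = 0" if "\<bar>x\<bar> > L + 2" for x
    using \<theta>(3)[of x] \<theta>(4)[of x] that by (cases "x > 0") auto
  have 2: "S (\<lambda>t. \<theta> t * h t) = S h" if h: "udf UNIV h" for h
  proof -
    have "S (\<lambda>t. \<theta> t * h t - h t) = 0"
      by (rule L(2)) (use \<theta>(1,2) h in \<open>auto intro!: udf_diff udf_mult\<close>)
    then show ?thesis using ufunctional_diff[OF S udf_mult[OF open_UNIV \<theta>(1) h] h] by simp
  qed
  show ?thesis using that[of \<theta> "L + 2"] \<theta>(1) 1 2 by blast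
qed

text \<open>Cauchy estimates on discs of radius \<epsilon> and the Leibniz rule bound
  \<open>S\<close> by the size of \<open>F\<close> near the support of the cut-off. \<open>C\<close>
  is chosen before \<open>F\<close>, so it serves all exponentials \<open>exp (- \<i> t z)\<close>
  at once.\<close>

lemma cutoff_entire_bound:
  assumes S: "ufunctional S" and \<theta>: "udf UNIV \<theta>" "\<And>x. x \<notin> {l..r} \<Longrightarrow> \<theta> x = 0" and \<epsilon>: "\<epsilon> > 0"
  obtains C where "C \<ge> 0" "\<forall>F A. F holomorphic_on UNIV \<longrightarrow> A \<ge> 0 \<longrightarrow>
    (\<forall>x w. x \<in> {l..r} \<longrightarrow> dist (of_real x) w \<le> \<epsilon> \<longrightarrow> norm (F w) \<le> A) \<longrightarrow>
    norm (S (\<lambda>t. \<theta> t * F (of_real t))) \<le> C * A"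
proof -
  obtain q L C where b: "functional_bound S q L C"
    using S unfolding ufunctional_def by blast
  note q = functional_boundD(1,2)[OF b]
  define q' where "q' = (q + 1) / 2"
  have q': "q < q'" "q' < 1" "0 < q'" using q by (auto simp: q'_def)
  obtain P where P: "product_const q q' P" using product_const_exists[OF q(1) q'(1)] .
  obtain E where E: "entire_const \<epsilon> q' E" using entire_const_exists[OF \<epsilon> q'(3)] .
  have pos: "P > 0" "E > 0" using P E unfolding product_const_def entire_const_def by auto
  obtain T where T: "T > 0" "\<And>j x. x \<in> {l..r} \<Longrightarrow> norm (nd j \<theta> x) \<le> T * M q' j"
    using udf_bound[OF \<theta>(1) q'(3,2) compact_Icc subset_UNIV] by blast
  have main: "norm (S (\<lambda>t. \<theta> t * F (of_real t))) \<le> (C * (P * T * E)) * A"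
    if F: "F holomorphic_on UNIV" and A: "A \<ge> 0"
      "\<And>x w. x \<in> {l..r} \<Longrightarrow> dist (of_real x) w \<le> \<epsilon> \<Longrightarrow> norm (F w) \<le> A" for F A
  proof -
    have "norm (S (\<lambda>t. \<theta> t * F (of_real t))) \<le> C * (P * T * (E * A))"
    proof (rule functional_boundD(5)[OF b])
      show "udf UNIV (\<lambda>t. \<theta> t * F (of_real t))"
        by (intro udf_mult \<theta> udf_entire F open_UNIV)
      fix j x
      show "norm (nd j (\<lambda>t. \<theta> t * F (of_real t)) x) \<le> P * T * (E * A) * M q j"
      proof (cases "x \<in> {l..r}")
        case True
        show ?thesis
        proof (rule product_constD[OF P open_UNIV udf_smooth[OF \<theta>(1)] _ UNIV_I])
          show "smooth_fun UNIV (\<lambda>t. F (of_real t))" by (rule udf_smooth[OF udf_entire[OF F]])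
          show "norm (nd j (\<lambda>t. F (of_real t)) x) \<le> E * A * M q' j" for j
            by (rule entire_constD[OF E F]) (use A(2)[OF True] in simp)
        qed (use T True in auto)
      next
        case False
        have "open (- {l..r})" by (simp add: open_Compl)
        from nd_eq_0[OF this, of "\<lambda>t. \<theta> t * F (of_real t)" x j]
        show ?thesis using \<theta>(2) False pos T(1) A(1) M_pos[of q j] by simp
      qed
    qed
    then show ?thesis by (simp add: mult_ac)
  qed
  have "C * (P * T * E) \<ge> 0" using functional_boundD(4)[OF b] pos T(1) by simp
  then show ?thesis using that main by blast
qed

lemma norm_exp_kernel_le:
  assumes "norm w \<le> L" shows "norm (exp (- \<i> * w * z)) \<le> exp (L * norm z)"
proof -
  have "norm (exp (- \<i> * w * z)) \<le> exp (norm (- \<i> * w * z))" by (rule norm_exp)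
  also have "\<dots> \<le> exp (L * norm z)" using assms by (simp add: norm_mult mult_right_mono)
  finally show ?thesis .
qed

text \<open>Differentiation under \<open>S\<close>. The power of \<open>t\<close> is included so
  that higher derivatives of the transform follow by induction; the Taylor remainder is estimated on
  a complex neighbourhood, as \<open>cutoff_entire_bound\<close> asks.\<close>

lemma transform_moment_derivative:
  assumes S: "ufunctional S"
  shows "((\<lambda>z. S (\<lambda>t. (- \<i> * of_real t) ^ n * exp (- \<i> * of_real t * z))) has_field_derivative
    S (\<lambda>t. (- \<i> * of_real t) ^ Suc n * exp (- \<i> * of_real t * z))) (at z)"
proof -
  define e where "e n z = (\<lambda>w. (- \<i> * w) ^ n * exp (- \<i> * w * z))" for n :: nat and z
  have e: "e n z holomorphic_on UNIV" for n z unfolding e_def by (intro holomorphic_intros)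
  obtain \<theta> L where \<theta>: "udf UNIV \<theta>" "\<forall>x. \<bar>x\<bar> > L \<longrightarrow> \<theta> x = 0" "\<forall>h. udf UNIV h \<longrightarrow> S (\<lambda>t. \<theta> t * h t) = S h"
    using ufunctional_truncate[OF S] .
  have \<theta>0: "\<theta> x = 0" if "x \<notin> {- L..L}" for x using \<theta>(2) that by auto
  obtain C where C: "C \<ge> 0" "\<forall>F A. F holomorphic_on UNIV \<longrightarrow> A \<ge> 0 \<longrightarrow>
    (\<forall>x w. x \<in> {- L..L} \<longrightarrow> dist (of_real x) w \<le> 1 \<longrightarrow> norm (F w) \<le> A) \<longrightarrow>
    norm (S (\<lambda>t. \<theta> t * F (of_real t))) \<le> C * A"
    using cutoff_entire_bound[OF S \<theta>(1) \<theta>0 zero_less_one] .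
  define K where "K = \<bar>L\<bar> + 1"
  have K: "K > 0" by (simp add: K_def)
  define g where "g n z = S (\<lambda>t. e n z (of_real t))" for n z
  define B where "B = C * (K ^ n * exp (K * norm z) * (K\<^sup>2 * exp K))"
  have bound: "norm (g n (z + h) - g n z - g (Suc n) z * h) \<le> B * (norm h)\<^sup>2" if h: "norm h \<le> 1" for h
  proof -
    define F where "F w = e n (z + h) w - e n z w - h * e (Suc n) z w" for w
    have F: "F holomorphic_on UNIV" unfolding F_def by (intro holomorphic_intros e)
    have Feq: "F w = (- \<i> * w) ^ n * exp (- \<i> * w * z) * (exp (- \<i> * w * h) - 1 - (- \<i> * w * h))" for w
      unfolding F_def e_def by (simp add: algebra_simps exp_add[symmetric])
    have "norm (S (\<lambda>t. \<theta> t * F (of_real t))) \<le> C * (K ^ n * exp (K * norm z) * ((norm h * K)\<^sup>2 * exp K))"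
    proof (rule C(2)[rule_format, OF F])
      fix x and w :: complex assume "x \<in> {- L..L}" and w: "dist (of_real x) w \<le> 1"
      then have "norm w \<le> K"
        using norm_triangle_ineq[of "of_real x" "w - of_real x"] by (auto simp: K_def dist_norm norm_minus_commute)
      have 1: "norm (- \<i> * w * h) \<le> norm h * K"
        using mult_left_mono[OF \<open>norm w \<le> K\<close>, of "norm h"] by (simp add: norm_mult mult.commute)
      also have "\<dots> \<le> K" using h K by (simp add: mult_left_le_one_le)
      finally have 2: "norm (- \<i> * w * h) \<le> K" .
      have "norm (exp (- \<i> * w * h) - 1 - (- \<i> * w * h)) \<le> (norm (- \<i> * w * h))\<^sup>2 * exp (norm (- \<i> * w * h))"
        by (rule norm_exp_taylor2)
      also have "\<dots> \<le> (norm h * K)\<^sup>2 * exp K" using 1 2 by (intro mult_mono power_mono) auto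
      finally have 3: "norm (exp (- \<i> * w * h) - 1 - (- \<i> * w * h)) \<le> (norm h * K)\<^sup>2 * exp K" .
      have 4: "norm ((- \<i> * w) ^ n) \<le> K ^ n"
        using \<open>norm w \<le> K\<close> by (simp add: norm_power norm_mult power_mono)
      show "norm (F w) \<le> K ^ n * exp (K * norm z) * ((norm h * K)\<^sup>2 * exp K)"
        unfolding Feq norm_mult[of "_ ^ n * exp _"] norm_mult[of "_ ^ n"]
        by (intro mult_mono 3 4 norm_exp_kernel_le \<open>norm w \<le> K\<close>) (use K in auto)
    qed (use K in simp)
    moreover have "S (\<lambda>t. \<theta> t * F (of_real t)) = g n (z + h) - g n z - g (Suc n) z * h"
    proof -
      have "S (\<lambda>t. \<theta> t * F (of_real t)) = S (\<lambda>t. F (of_real t))"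
        by (rule \<theta>(3)[rule_format, OF udf_entire[OF F]])
      also have "\<dots> = g n (z + h) - g n z - g (Suc n) z * h"
        unfolding F_def g_def
        by (simp add: ufunctional_diff[OF S] ufunctional_cmult[OF S] udf_diff udf_cmult udf_entire[OF e])
      finally show ?thesis .
    qed
    ultimately show ?thesis by (simp add: B_def power_mult_distrib mult_ac)
  qed
  have "((\<lambda>h. (g n (z + h) - g n z) / h) \<longlongrightarrow> g (Suc n) z) (at 0)"
  proof (rule LIM_zero_cancel, rule Lim_null_comparison)
    show "eventually (\<lambda>h. norm ((g n (z + h) - g n z) / h - g (Suc n) z) \<le> B * norm h) (at 0)"
    proof -
      have "eventually (\<lambda>h. h \<noteq> 0 \<and> norm h < 1) (at (0::complex))"
        by (auto simp: eventually_at intro!: exI[of _ 1])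
      then show ?thesis
      proof eventually_elim
        case (elim h)
        have "(g n (z + h) - g n z) / h - g (Suc n) z = (g n (z + h) - g n z - g (Suc n) z * h) / h"
          using elim by (simp add: field_simps)
        also have "norm \<dots> \<le> B * (norm h)\<^sup>2 / norm h"
          using bound[of h] elim by (simp add: norm_divide divide_right_mono)
        finally show ?case using elim by (simp add: power2_eq_square)
      qed
    qed
    show "((\<lambda>h. B * norm (h::complex)) \<longlongrightarrow> 0) (at 0)"
      by (rule tendsto_eq_intros refl | simp)+
  qed
  then show ?thesis by (simp add: DERIV_def g_def[abs_def] e_def)
qed

lemma transform_higher_derivative:
  assumes S: "ufunctional S"
  shows "(deriv ^^ n) (transform S) z = S (\<lambda>t. (- \<i> * of_real t) ^ n * exp (- \<i> * of_real t * z))"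
proof (induction n arbitrary: z)
  case (Suc n)
  have "(deriv ^^ n) (transform S) = (\<lambda>z. S (\<lambda>t. (- \<i> * of_real t) ^ n * exp (- \<i> * of_real t * z)))"
    using Suc by blast
  then show ?case using DERIV_imp_deriv[OF transform_moment_derivative[OF S, of n z]] by simp
qed (simp add: transform_def)

lemma transform_holomorphic:
  assumes S: "ufunctional S"
  shows "transform S holomorphic_on UNIV"
  using transform_moment_derivative[OF S, of 0] by (auto simp: transform_def[abs_def] holomorphic_on_open)

text \<open>The direct half of a Paley-Wiener theorem for a functional carried by
  \<open>[\<alpha>;\<beta>]\<close>.\<close>

lemma transform_growth:
  assumes S: "ufunctional S" and ab: "\<alpha> < \<beta>"
    and carrier: "\<And>h. udf UNIV h \<Longrightarrow> (\<And>x. \<alpha> \<le> x \<Longrightarrow> x \<le> \<beta> \<Longrightarrow> h x = 0) \<Longrightarrow> S h = 0" and \<epsilon>: "\<epsilon> > 0"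
  shows "\<exists>C. \<forall>z. Im z \<ge> 0 \<longrightarrow> norm (transform S z) \<le> C * exp (\<epsilon> * norm z + \<beta> * Im z)"
    and "\<exists>C. \<forall>z. Im z \<le> 0 \<longrightarrow> norm (transform S z) \<le> C * exp (\<epsilon> * norm z + \<alpha> * Im z)"
proof -
  \<comment> \<open>The cut-off widens the carrier by \<open>2 \<delta>\<close>, the Cauchy discs by
    one more \<delta>, and the term \<open>Im w * Re z\<close> contributes the fourth.\<close>
  define \<delta> where "\<delta> = \<epsilon> / 4"
  have \<delta>: "\<delta> > 0" using \<epsilon> by (simp add: \<delta>_def)
  obtain \<theta> where \<theta>: "udf UNIV \<theta>" "\<And>x. \<alpha> - \<delta> \<le> x \<Longrightarrow> x \<le> \<beta> + \<delta> \<Longrightarrow> \<theta> x = 1"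
    "\<And>x. x \<le> \<alpha> - 2 * \<delta> \<Longrightarrow> \<theta> x = 0" "\<And>x. x \<ge> \<beta> + 2 * \<delta> \<Longrightarrow> \<theta> x = 0"
    using udf_plateau[of \<alpha> \<beta> \<delta>] ab \<delta> by (metis less_imp_le)
  have \<theta>0: "\<theta> x = 0" if "x \<notin> {\<alpha> - 2 * \<delta>..\<beta> + 2 * \<delta>}" for x
    using \<theta>(3)[of x] \<theta>(4)[of x] that by (cases "x \<le> \<alpha> - 2 * \<delta>") auto
  obtain C where C: "C \<ge> 0" "\<forall>F A. F holomorphic_on UNIV \<longrightarrow> A \<ge> 0 \<longrightarrow>
    (\<forall>x w. x \<in> {\<alpha> - 2 * \<delta>..\<beta> + 2 * \<delta>} \<longrightarrow> dist (of_real x) w \<le> \<delta> \<longrightarrow> norm (F w) \<le> A) \<longrightarrow>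
    norm (S (\<lambda>t. \<theta> t * F (of_real t))) \<le> C * A"
    using cutoff_entire_bound[OF S \<theta>(1) \<theta>0 \<delta>] .
  have eq: "transform S z = S (\<lambda>t. \<theta> t * exp (- \<i> * of_real t * z))" for z
    unfolding transform_def
    by (rule ufunctional_cong[OF S, where V = "{\<alpha>..\<beta>}"])
      (use carrier \<theta> \<delta> in \<open>auto intro!: udf_mult udf_exp[simplified]\<close>)
  have main: "norm (transform S z) \<le> C * exp (\<epsilon> * norm z + B)"
    if B: "\<And>s. \<alpha> - 3 * \<delta> \<le> s \<Longrightarrow> s \<le> \<beta> + 3 * \<delta> \<Longrightarrow> s * Im z \<le> 3 * \<delta> * norm z + B" for z B
    unfolding eq
  proof (rule C(2)[rule_format, of "\<lambda>w. exp (- \<i> * w * z)"])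
    fix x and w :: complex assume x: "x \<in> {\<alpha> - 2 * \<delta>..\<beta> + 2 * \<delta>}" and w: "dist (of_real x) w \<le> \<delta>"
    have im: "\<bar>Im w\<bar> \<le> \<delta>" and re: "\<bar>Re w - x\<bar> \<le> \<delta>"
      using w abs_Im_le_cmod[of "of_real x - w"] abs_Re_le_cmod[of "of_real x - w"] by (auto simp: dist_norm)
    have "norm (exp (- \<i> * w * z)) = exp (Im w * Re z + Re w * Im z)" by (simp add: algebra_simps)
    also have "\<dots> \<le> exp (\<delta> * norm z + (3 * \<delta> * norm z + B))"
    proof -
      have "Im w * Re z \<le> \<bar>Im w\<bar> * \<bar>Re z\<bar>" by (metis abs_ge_self abs_mult)
      also have "\<dots> \<le> \<delta> * norm z" using im abs_Re_le_cmod[of z] by (intro mult_mono) auto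
      finally show ?thesis using B[of "Re w"] re x by (simp add: abs_le_iff)
    qed
    finally show "norm (exp (- \<i> * w * z)) \<le> exp (\<epsilon> * norm z + B)" by (simp add: \<delta>_def)
  qed (auto intro!: holomorphic_intros)
  have lin: "3 * \<delta> * \<bar>Im z\<bar> \<le> 3 * \<delta> * norm z" for z using \<delta> abs_Im_le_cmod[of z] by simp
  have "norm (transform S z) \<le> C * exp (\<epsilon> * norm z + \<beta> * Im z)" if "Im z \<ge> 0" for z
  proof (rule main)
    fix s assume "s \<le> \<beta> + 3 * \<delta>"
    then have "s * Im z \<le> (\<beta> + 3 * \<delta>) * Im z" using that by (rule mult_right_mono)
    then show "s * Im z \<le> 3 * \<delta> * norm z + \<beta> * Im z" using lin[of z] that by (simp add: algebra_simps)
  qed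
  then show "\<exists>C. \<forall>z. Im z \<ge> 0 \<longrightarrow> norm (transform S z) \<le> C * exp (\<epsilon> * norm z + \<beta> * Im z)" by blast
  have "norm (transform S z) \<le> C * exp (\<epsilon> * norm z + \<alpha> * Im z)" if "Im z \<le> 0" for z
  proof (rule main)
    fix s assume "\<alpha> - 3 * \<delta> \<le> s"
    then have "s * Im z \<le> (\<alpha> - 3 * \<delta>) * Im z" using that by (rule mult_right_mono_neg)
    then show "s * Im z \<le> 3 * \<delta> * norm z + \<alpha> * Im z" using lin[of z] that by (simp add: algebra_simps)
  qed
  then show "\<exists>C. \<forall>z. Im z \<le> 0 \<longrightarrow> norm (transform S z) \<le> C * exp (\<epsilon> * norm z + \<alpha> * Im z)" by blast
qed

section \<open>Injectivity of the transform of functionals, and localization\<close>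

lemma udf_continuous: "udf UNIV u \<Longrightarrow> continuous_on V u"
  by (rule continuous_on_vector_derivative, rule has_vector_derivative_at_within)
    (use smooth_fun_has_derivative[OF udf_smooth UNIV_I, of u 0] in simp)

lemma udf_cl1: "udf UNIV u \<Longrightarrow> (\<And>t. \<bar>t\<bar> > T \<Longrightarrow> u t = 0) \<Longrightarrow> cl1 u"
  using udf_continuous cl1_continuous by blast

lemma translate_cl1:
  assumes "ufunctional S" "udf UNIV u" "\<And>t. \<bar>t\<bar> > T \<Longrightarrow> u t = 0"
  shows "cl1 (\<lambda>x. S (\<lambda>t. u (t + x)))"
proof -
  obtain R where "\<And>x. \<bar>x\<bar> > R \<Longrightarrow> S (\<lambda>t. u (t + x)) = 0" using translate_support[OF assms] by blast
  then show ?thesis using translate_continuous[OF assms(1,2)] cl1_continuous by blast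
qed

text \<open>For a cut-off \<open>u\<close> of \<open>h\<close> the function
  \<open>x \<mapsto> S (u (\<cdot> + x))\<close> has transform zero by the product formula, so it
  vanishes, in particular at 0.\<close>

lemma transform_eq_0D:
  assumes S: "ufunctional S" and zero: "\<And>z. transform S z = 0" and h: "udf UNIV h"
  shows "S h = 0"
proof -
  obtain \<theta> L where \<theta>: "udf UNIV \<theta>" "\<forall>x. \<bar>x\<bar> > L \<longrightarrow> \<theta> x = 0" "\<forall>h. udf UNIV h \<longrightarrow> S (\<lambda>t. \<theta> t * h t) = S h"
    using ufunctional_truncate[OF S] .
  define u where "u t = \<theta> t * h t" for t
  have u: "udf UNIV u" unfolding u_def by (intro udf_mult \<theta> h open_UNIV)
  have u0: "\<And>t. \<bar>t\<bar> > L \<Longrightarrow> u t = 0" by (simp add: u_def \<theta>)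
  have "S (\<lambda>t. u (t + 0)) = 0"
    by (rule ft_eq_0D[of "\<lambda>x. S (\<lambda>t. u (t + x))"])
      (use translate_continuous[OF S u] translate_cl1[OF S u u0] ft_translate[OF S u u0] zero in auto)
  then show ?thesis using \<theta>(3)[rule_format, OF h] by (simp add: u_def)
qed

text \<open>Zero type means carried by \<open>{0}\<close>. Since \<open>u\<close> vanishes on
  \<open>(-\<delta>;\<delta>)\<close>, it has a left and a right part, and zero type makes
  \<open>transform S\<close> times the transform of the left part the left summand of
  \<open>ft \<kappa>\<close> for every cut in \<open>(-\<delta>;\<delta>)\<close>. So \<kappa> has
  no mass there.\<close>

theorem zero_type_local:
  assumes S: "ufunctional S" and zt: "zero_type (transform S)" and \<delta>: "\<delta> > 0"
    and h: "udf UNIV h" "\<And>x. \<bar>x\<bar> < \<delta> \<Longrightarrow> h x = 0"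
  shows "S h = 0"
proof -
  obtain \<theta> L where \<theta>: "udf UNIV \<theta>" "\<forall>x. \<bar>x\<bar> > L \<longrightarrow> \<theta> x = 0" "\<forall>h. udf UNIV h \<longrightarrow> S (\<lambda>t. \<theta> t * h t) = S h"
    using ufunctional_truncate[OF S] .
  define u where "u t = \<theta> t * h t" for t
  have u: "udf UNIV u" unfolding u_def by (intro udf_mult \<theta> h open_UNIV)
  have u0: "\<And>t. \<bar>t\<bar> > L \<Longrightarrow> u t = 0" by (simp add: u_def \<theta>)
  have u\<delta>: "\<And>t. \<bar>t\<bar> < \<delta> \<Longrightarrow> u t = 0" by (simp add: u_def h)
  define \<kappa> where "\<kappa> x = S (\<lambda>t. u (t + x))" for x
  have cl: "cl1 u" by (rule udf_cl1[OF u u0])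
  have cl\<kappa>: "cl1 \<kappa>" unfolding \<kappa>_def by (rule translate_cl1[OF S u u0])
  define v where "v t = u t - left_part 0 u t" for t
  have clv: "cl1 v" unfolding v_def by (intro cl1_diff cl cl1_left_part)
  define \<Theta> where "\<Theta> z = transform S z * ft (left_part 0 u) z" for z
  define \<Xi> where "\<Xi> z = transform S z * ft v z" for z
  have sep: "\<Theta> 0 = ft (left_part c \<kappa>) 0" if c: "- \<delta> < c" "c < \<delta>" for c
  proof (rule ft_separation[OF cl\<kappa>, where \<Theta> = \<Theta> and \<Xi> = \<Xi> and a = "- \<delta>" and b = \<delta>])
    show "\<Theta> holomorphic_on UNIV" "\<Xi> holomorphic_on UNIV" unfolding \<Theta>_def \<Xi>_def
      by (intro holomorphic_intros transform_holomorphic[OF S] ft_holomorphic cl1_left_part cl clv)+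
    show "\<Theta> z + \<Xi> z = ft \<kappa> z" for z
    proof -
      have "ft v z = ft u z - ft (left_part 0 u) z"
        unfolding v_def by (rule ft_diff[OF cl cl1_left_part[OF cl]])
      moreover have "ft \<kappa> z = transform S z * ft u z"
        unfolding \<kappa>_def by (rule ft_translate[OF S u u0])
      ultimately show ?thesis by (simp add: \<Theta>_def \<Xi>_def right_diff_distrib)
    qed
    show "\<exists>C. \<forall>z. Im z \<le> 0 \<longrightarrow> norm (\<Theta> z) \<le> C * exp (\<epsilon> * norm z - (- \<delta>) * Im z)" if \<epsilon>: "\<epsilon> > 0" for \<epsilon>
    proof -
      have "- (Im z * s) \<le> \<delta> * Im z" if "Im z \<le> 0" "left_part 0 u s \<noteq> 0" for z s
      proof -
        have "s \<le> - \<delta>" using that u\<delta>[of s] by (cases "s < 0"; cases "\<bar>s\<bar> < \<delta>") (auto simp: left_part_def)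
        then show ?thesis using mult_left_mono[of s "- \<delta>" "- Im z"] that(1) by (simp add: mult.commute)
      qed
      then show ?thesis using zero_type_ft_bound[OF zt cl1_left_part[OF cl], where P = "\<lambda>z. Im z \<le> 0" and k = \<delta> and \<epsilon> = \<epsilon>] \<epsilon> by (simp add: \<Theta>_def)
    qed
    show "\<exists>C. \<forall>z. Im z \<ge> 0 \<longrightarrow> norm (\<Xi> z) \<le> C * exp (\<epsilon> * norm z - \<delta> * Im z)" if \<epsilon>: "\<epsilon> > 0" for \<epsilon>
    proof -
      have "- (Im z * s) \<le> - \<delta> * Im z" if "Im z \<ge> 0" "v s \<noteq> 0" for z s
      proof -
        have "s \<ge> \<delta>" using that u\<delta>[of s] by (cases "s < 0"; cases "\<bar>s\<bar> < \<delta>") (auto simp: v_def left_part_def)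
        then show ?thesis using mult_left_mono[of \<delta> s "Im z"] that(1) by (simp add: mult.commute)
      qed
      then show ?thesis using zero_type_ft_bound[OF zt clv, where P = "\<lambda>z. Im z \<ge> 0" and k = "- \<delta>" and \<epsilon> = \<epsilon>] \<epsilon> by (simp add: \<Xi>_def)
    qed
  qed (use c in auto)
  have "\<kappa> 0 = 0"
  proof (rule left_part_locally_constant[OF _ cl\<kappa>, where a = "- \<delta>" and b = \<delta>])
    show "continuous_on UNIV \<kappa>" unfolding \<kappa>_def by (rule translate_continuous[OF S u])
    show "ft (left_part c \<kappa>) 0 = \<Theta> 0" if "- \<delta> < c" "c < \<delta>" for c using sep[OF that] by simp
  qed (use \<delta> in auto)
  then show ?thesis using \<theta>(3)[rule_format, OF h(1)] by (simp add: \<kappa>_def u_def)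
qed

end

section \<open>Annihilators\<close>

text \<open>Translates \<open>zorder\<close> into vanishing derivatives and a global factorisation,
  through the power series at \<open>l\<close>. The point \<open>w\<close> excludes the zero
  function, for which \<open>zorder\<close> says nothing.\<close>

lemma entire_order:
  assumes F: "F holomorphic_on UNIV" "F w \<noteq> 0"
  shows "zorder F l \<ge> 0" "j < nat (zorder F l) \<Longrightarrow> (deriv ^^ j) F l = 0" "(deriv ^^ nat (zorder F l)) F l \<noteq> 0"
    and "\<exists>h. h holomorphic_on UNIV \<and> h l \<noteq> 0 \<and> (\<forall>z. F z = h z * (z - l) ^ nat (zorder F l))"
proof -
  define P where "P = fps_expansion F l"
  have P: "(\<lambda>x. F (l + x)) has_fps_expansion P"
    unfolding P_def by (rule analytic_at_imp_has_fps_expansion) (use F(1) in \<open>auto simp: analytic_at\<close>)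
  have "P \<noteq> 0"
  proof
    assume "P = 0"
    then have "eventually (\<lambda>x. 0 = F (l + x)) (nhds 0)" using P by (simp add: has_fps_expansion_def)
    then have "eventually (\<lambda>x. F (l + x) = 0) (at 0)"
      unfolding eventually_at_filter by (rule eventually_mono) simp
    then have "eventually (\<lambda>x. F x = 0) (at l)" by (subst at_to_0) (simp add: eventually_filtermap add.commute)
    moreover have "eventually (\<lambda>x. F x \<noteq> 0 \<and> x \<in> UNIV) (at l)"
      by (rule non_zero_neighbour_alt[OF F(1) open_UNIV connected_UNIV UNIV_I UNIV_I F(2)])
    ultimately have "eventually (\<lambda>x. False) (at l)" by eventually_elim auto
    then show False by simp
  qed
  have z: "zorder F l = int (subdegree P)" by (rule has_fps_expansion_zorder[OF P \<open>P \<noteq> 0\<close>])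
  have nth: "(deriv ^^ j) F l = fact j * fps_nth P j" for j by (simp add: P_def fps_expansion_def)
  show "zorder F l \<ge> 0" using z by simp
  show "j < nat (zorder F l) \<Longrightarrow> (deriv ^^ j) F l = 0" unfolding nth z by (auto intro: nth_less_subdegree_zero)
  show "(deriv ^^ nat (zorder F l)) F l \<noteq> 0" unfolding nth z using \<open>P \<noteq> 0\<close> by simp
  obtain m h where h: "h holomorphic_on UNIV" "h l \<noteq> 0" "\<And>z. F z = h z * (z - l) ^ m l"
    using factor_out_zeros[OF _ F, of "{l}"] by auto
  have "zorder F l = int (m l)"
    by (rule zorder_eqI[OF open_UNIV UNIV_I h(1,2)]) (simp add: h(3))
  then show "\<exists>h. h holomorphic_on UNIV \<and> h l \<noteq> 0 \<and> (\<forall>z. F z = h z * (z - l) ^ nat (zorder F l))"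
    using h by auto
qed

text \<open>The local quotients agree off the zeros of \<phi>, which are isolated, and hence
  everywhere by continuity. So the diagonal values \<open>g l l\<close> form one entire
  function.\<close>

lemma entire_quotient_local:
  assumes \<phi>: "\<phi> holomorphic_on UNIV" "\<phi> p \<noteq> 0"
    and local: "\<And>l. \<exists>g r. r > 0 \<and> g holomorphic_on ball l r \<and> (\<forall>z\<in>ball l r. \<phi> z * g z = N z)"
  shows "\<exists>H. H holomorphic_on UNIV \<and> (\<forall>z. \<phi> z * H z = N z)"
proof -
  obtain g r where r: "\<And>l. r l > 0" and g: "\<And>l. g l holomorphic_on ball l (r l)"
    and eq: "\<And>l z. z \<in> ball l (r l) \<Longrightarrow> \<phi> z * g l z = N z"
    using local by metis
  define H where "H l = g l l" for l
  have H: "H z = g l z" if z: "z \<in> ball l (r l)" for l z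
  proof -
    have lim: "g k \<midarrow>z\<rightarrow> g k z" if "z \<in> ball k (r k)" for k
      using continuous_on_interior[OF holomorphic_on_imp_continuous_on[OF g[of k]], of z] that
      by (simp add: isCont_def interior_open)
    have ev: "eventually (\<lambda>w. w \<in> ball z (r z) \<and> w \<in> ball l (r l)) (at z)"
      using eventually_at_in_open'[of "ball z (r z) \<inter> ball l (r l)" z] r[of z] z by auto
    have "eventually (\<lambda>w. g z w = g l w) (at z)"
      using ev non_zero_neighbour_alt[OF \<phi>(1) open_UNIV connected_UNIV UNIV_I UNIV_I \<phi>(2), of z]
    proof eventually_elim
      case (elim w)
      then show ?case using eq[of w z] eq[of w l] by (metis mult_left_cancel)
    qed
    moreover have "g z \<midarrow>z\<rightarrow> g z z" using r[of z] by (intro lim) auto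
    ultimately have "g l \<midarrow>z\<rightarrow> g z z" by (rule Lim_transform_eventually[rotated])
    then show ?thesis unfolding H_def using lim[OF z] tendsto_unique[OF at_neq_bot] by blast
  qed
  have "H holomorphic_on UNIV"
    unfolding holomorphic_on_def
  proof
    fix l
    have "H holomorphic_on ball l (r l)" by (rule holomorphic_transform[OF g]) (simp add: H)
    then have "H field_differentiable at l"
      using holomorphic_on_imp_differentiable_at[OF _ open_ball] r[of l] by auto
    then show "H field_differentiable at l within UNIV" by simp
  qed
  moreover have "\<phi> z * H z = N z" for z using eq[of z z] r[of z] by (simp add: H_def)
  ultimately show ?thesis by blast
qed

text \<open>The end points are included: there the one-sided derivative along the interval
  decides.\<close>

lemma derivatives_vanish_on_interval:
  assumes der: "\<And>j s. (Y j has_vector_derivative Y (Suc j) s) (at s)"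
    and zero: "\<And>s. \<alpha> \<le> s \<Longrightarrow> s \<le> \<beta> \<Longrightarrow> Y 0 s = (0 :: 'a :: real_normed_vector)" and "\<alpha> < \<beta>" "\<alpha> \<le> s" "s \<le> \<beta>"
  shows "Y j s = 0"
  using assms(4,5)
proof (induction j arbitrary: s)
  case (Suc j)
  have 0: "((\<lambda>_. 0) has_vector_derivative 0) (at s within cbox \<alpha> \<beta>)" by (rule has_vector_derivative_const)
  have "(Y j has_vector_derivative 0) (at s within cbox \<alpha> \<beta>)"
    by (rule has_vector_derivative_transform[OF _ _ 0]) (use Suc in auto)
  moreover have "(Y j has_vector_derivative Y (Suc j) s) (at s within cbox \<alpha> \<beta>)"
    by (rule has_vector_derivative_at_within[OF der])
  ultimately show ?case
    using vector_derivative_unique_within_closed_interval[of \<alpha> \<beta> s] Suc.prems \<open>\<alpha> < \<beta>\<close> by auto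
qed (use zero in auto)

text \<open>\<open>\<phi>' * ft Y\<close> and \<open>\<phi> * ft Y'\<close> are both
  \<open>\<phi> * \<phi>' * F\<close>. Their difference is the transform of the zero function, and
  separating that at \<open>c\<close> shows that the difference of the left summands is the left
  part of zero.\<close>

lemma left_parts_proportional:
  assumes \<phi>: "zero_type \<phi>" "zero_type \<phi>'" and Y: "cl1 Y" "cl1 Y'" and c: "\<alpha> < c" "c < \<beta>"
    and zero: "\<And>s. \<alpha> \<le> s \<Longrightarrow> s \<le> \<beta> \<Longrightarrow> Y s = 0" "\<And>s. \<alpha> \<le> s \<Longrightarrow> s \<le> \<beta> \<Longrightarrow> Y' s = 0"
    and F: "\<And>z. \<phi> z * F z = ft Y z" "\<And>z. \<phi>' z * F z = ft Y' z"
  shows "\<phi>' z * ft (left_part c Y) z = \<phi> z * ft (left_part c Y') z"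
proof -
  define r where "r X s = X s - left_part c X s" for X :: "real \<Rightarrow> complex" and s
  have r: "cl1 (r X)" "ft (r X) z = ft X z - ft (left_part c X) z" if "cl1 X" for X z
    unfolding r_def using that by (auto intro!: cl1_diff cl1_left_part ft_diff)
  define \<Theta> where "\<Theta> z = \<phi>' z * ft (left_part c Y) z - \<phi> z * ft (left_part c Y') z" for z
  define \<Xi> where "\<Xi> z = \<phi>' z * ft (r Y) z - \<phi> z * ft (r Y') z" for z
  have hol: "\<phi> holomorphic_on UNIV" "\<phi>' holomorphic_on UNIV" using \<phi> by (auto simp: zero_type_def)
  have zero_cl: "cl1 (\<lambda>_. 0)" by (simp add: cl1_def)
  have ft0: "ft (\<lambda>_. 0) w = 0" for w by (simp add: ft_def)
  have diff: "\<exists>C. \<forall>z. P z \<longrightarrow> norm (\<phi>' z * ft X z - \<phi> z * ft X' z) \<le> C * exp (\<epsilon> * norm z - k * Im z)"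
    if X: "cl1 X" "cl1 X'" and P: "\<And>z s. P z \<Longrightarrow> X s \<noteq> 0 \<Longrightarrow> - (Im z * s) \<le> (- k) * Im z"
      "\<And>z s. P z \<Longrightarrow> X' s \<noteq> 0 \<Longrightarrow> - (Im z * s) \<le> (- k) * Im z" and \<epsilon>: "\<epsilon> > 0" for X X' P \<epsilon> k
  proof -
    obtain C where C: "\<And>z. P z \<Longrightarrow> norm (\<phi>' z * ft X z) \<le> C * exp (\<epsilon> * norm z + (- k) * Im z)"
      using zero_type_ft_bound[OF \<phi>(2) X(1) P(1) \<epsilon>] by blast
    obtain C' where C': "\<And>z. P z \<Longrightarrow> norm (\<phi> z * ft X' z) \<le> C' * exp (\<epsilon> * norm z + (- k) * Im z)"
      using zero_type_ft_bound[OF \<phi>(1) X(2) P(2) \<epsilon>] by blast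
    have "norm (\<phi>' z * ft X z - \<phi> z * ft X' z) \<le> (C + C') * exp (\<epsilon> * norm z - k * Im z)" if "P z" for z
      using norm_triangle_ineq4[of "\<phi>' z * ft X z" "\<phi> z * ft X' z"] C[OF that] C'[OF that]
      by (simp add: distrib_right)
    then show ?thesis by blast
  qed
  have "\<Theta> z = ft (left_part c (\<lambda>_. 0)) z"
  proof (rule ft_separation[OF zero_cl, where \<Theta> = \<Theta> and \<Xi> = \<Xi> and a = \<alpha> and b = \<beta>])
    show "\<Theta> holomorphic_on UNIV" "\<Xi> holomorphic_on UNIV" unfolding \<Theta>_def \<Xi>_def
      by (intro holomorphic_intros hol ft_holomorphic cl1_left_part Y r)+
    show "\<Theta> z + \<Xi> z = ft (\<lambda>_. 0) z" for z
    proof -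
      have "\<Theta> z + \<Xi> z = \<phi>' z * ft Y z - \<phi> z * ft Y' z"
        unfolding \<Theta>_def \<Xi>_def r(2)[OF Y(1)] r(2)[OF Y(2)] by (simp add: algebra_simps)
      then show ?thesis by (simp add: F[symmetric] ft0)
    qed
    show "\<exists>C. \<forall>z. Im z \<le> 0 \<longrightarrow> norm (\<Theta> z) \<le> C * exp (\<epsilon> * norm z - \<alpha> * Im z)" if \<epsilon>: "\<epsilon> > 0" for \<epsilon>
    proof -
      have "- (Im z * s) \<le> (- \<alpha>) * Im z" if "Im z \<le> 0" "left_part c X s \<noteq> 0" and X: "\<And>s. \<alpha> \<le> s \<Longrightarrow> s \<le> \<beta> \<Longrightarrow> X s = 0"
        for z s and X :: "real \<Rightarrow> complex"
      proof -
        have "s \<le> \<alpha>" using that(2) X[of s] c by (cases "s \<le> \<alpha>") (auto simp: left_part_def split: if_splits)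
        then show ?thesis using mult_left_mono[of s \<alpha> "- Im z"] that(1) by (simp add: mult.commute)
      qed
      then show ?thesis unfolding \<Theta>_def using zero by (intro diff cl1_left_part Y \<epsilon>) blast+
    qed
    show "\<exists>C. \<forall>z. Im z \<ge> 0 \<longrightarrow> norm (\<Xi> z) \<le> C * exp (\<epsilon> * norm z - \<beta> * Im z)" if \<epsilon>: "\<epsilon> > 0" for \<epsilon>
    proof -
      have "- (Im z * s) \<le> (- \<beta>) * Im z" if "Im z \<ge> 0" "r X s \<noteq> 0" and X: "\<And>s. \<alpha> \<le> s \<Longrightarrow> s \<le> \<beta> \<Longrightarrow> X s = 0"
        for z s and X :: "real \<Rightarrow> complex"
      proof -
        have "s \<ge> \<beta>" using that(2) X[of s] c by (cases "s \<ge> \<beta>") (auto simp: r_def left_part_def split: if_splits)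
        then show ?thesis using mult_left_mono[of \<beta> s "Im z"] that(1) by (simp add: mult.commute)
      qed
      then show ?thesis unfolding \<Xi>_def using zero by (intro diff r Y \<epsilon>) blast+
    qed
  qed (use c in auto)
  also have "\<dots> = 0" using ft0 by (simp add: left_part_def)
  finally show ?thesis by (simp add: \<Theta>_def)
qed

context ultra_weight
begin

lemma udf_nd: "udf V f \<Longrightarrow> udf V (nd j f)"
  by (induction j) (auto intro: udf_vd)

text \<open>The zeros of \<open>\<psi>\<close> forced by the spectrum are exactly what is needed to continue
  \<open>\<psi> v\<^sub>i / \<phi>\<^sub>i\<close> across a common zero, where \<open>v\<^sub>i / \<phi>\<^sub>i\<close> does not depend on \<open>i\<close>:
  take for \<open>i\<close> an index of minimal multiplicity.\<close>

theorem functional_vanishes: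
  assumes Sa: "\<And>i. i \<in> A \<Longrightarrow> ufunctional (Sa i)" "\<And>i. i \<in> A \<Longrightarrow> zero_type (transform (Sa i))"
    and k: "k \<in> A" "transform (Sa k) p \<noteq> 0" and \<alpha>\<beta>: "\<alpha> < \<beta>"
    and f: "udf UNIV f" "\<And>t. \<bar>t\<bar> > T \<Longrightarrow> f t = 0"
    and conv: "\<And>i y. i \<in> A \<Longrightarrow> \<alpha> \<le> y \<Longrightarrow> y \<le> \<beta> \<Longrightarrow> Sa i (\<lambda>t. f (t + y)) = 0"
    and S: "ufunctional S" and carrier: "\<And>h. udf UNIV h \<Longrightarrow> (\<And>x. \<alpha> \<le> x \<Longrightarrow> x \<le> \<beta> \<Longrightarrow> h x = 0) \<Longrightarrow> S h = 0"
    and spec: "\<And>l n. (\<And>i j. i \<in> A \<Longrightarrow> j \<le> n \<Longrightarrow> (deriv ^^ j) (transform (Sa i)) l = 0) \<Longrightarrow> (deriv ^^ n) (transform S) l = 0"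
  shows "S f = 0"
proof -
  define \<phi> where "\<phi> i = transform (Sa i)" for i
  define \<psi> where "\<psi> = transform S"
  define Y where "Y i j s = Sa i (\<lambda>t. nd j f (t + s))" for i j s
  define \<kappa> where "\<kappa> j s = S (\<lambda>t. nd j f (t + s))" for j s
  define F where "F = ft f"
  define c where "c = (\<alpha> + \<beta>) / 2"
  have c: "\<alpha> < c" "c < \<beta>" using \<alpha>\<beta> by (auto simp: c_def)
  have uf: "udf UNIV (nd j f)" for j by (rule udf_nd[OF f(1)])
  have f0: "nd j f t = 0" if "\<bar>t\<bar> > T" for j t
  proof -
    have "{s. \<bar>s\<bar> > T} = {T<..} \<union> {..<- T}" by (auto simp: abs_if)
    then have "open {s. \<bar>s\<bar> > T}" by auto
    then show ?thesis using nd_eq_0[of "{s. \<bar>s\<bar> > T}" f t j] f(2) that by auto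
  qed
  have derY: "(Y i j has_vector_derivative Y i (Suc j) s) (at s)" if "i \<in> A" for i j s
    using translate_derivative[OF Sa(1)[OF that] uf[of j], of s] by (simp add: Y_def[abs_def])
  have der\<kappa>: "(\<kappa> j has_vector_derivative \<kappa> (Suc j) s) (at s)" for j s
    using translate_derivative[OF S uf[of j], of s] by (simp add: \<kappa>_def[abs_def])
  have F: "F holomorphic_on UNIV" unfolding F_def by (rule ft_holomorphic[OF udf_cl1[OF f]])
  have \<phi>F: "\<phi> i z * F z = ft (Y i 0) z" if "i \<in> A" for i z
    unfolding \<phi>_def F_def Y_def using ft_translate[OF Sa(1)[OF that] f, symmetric] by simp
  have \<psi>F: "\<psi> z * F z = ft (\<kappa> 0) z" for z
    unfolding \<psi>_def F_def \<kappa>_def using ft_translate[OF S f, symmetric] by simp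
  have clY: "cl1 (Y i 0)" if "i \<in> A" for i
    unfolding Y_def using translate_cl1[OF Sa(1)[OF that] f] by simp
  have cl\<kappa>: "cl1 (\<kappa> 0)" unfolding \<kappa>_def using translate_cl1[OF S f] by simp
  have Y0: "Y i j s = 0" if "i \<in> A" "\<alpha> \<le> s" "s \<le> \<beta>" for i j s
    by (rule derivatives_vanish_on_interval[of "Y i" \<alpha> \<beta>])
      (use derY conv \<alpha>\<beta> that in \<open>auto simp: Y_def\<close>)
  have zt: "zero_type (\<phi> i)" if "i \<in> A" for i using Sa(2)[OF that] by (simp add: \<phi>_def)
  have hol: "\<phi> i holomorphic_on UNIV" if "i \<in> A" for i using zt[OF that] by (simp add: zero_type_def)
  have hol\<psi>: "\<psi> holomorphic_on UNIV" unfolding \<psi>_def by (rule transform_holomorphic[OF S])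
  define v where "v i = ft (left_part c (Y i 0))" for i
  have hv: "v i holomorphic_on UNIV" if "i \<in> A" for i
    unfolding v_def by (intro ft_holomorphic cl1_left_part clY that)
  have proportional: "\<phi> j z * v i z = \<phi> i z * v j z" if "i \<in> A" "j \<in> A" for i j z
    unfolding v_def
    by (rule left_parts_proportional[OF zt zt clY clY c Y0 Y0 \<phi>F \<phi>F]) (use that in auto)
  have kp: "\<phi> k p \<noteq> 0" using k by (simp add: \<phi>_def)
  have "\<exists>H. H holomorphic_on UNIV \<and> (\<forall>z. \<phi> k z * H z = \<psi> z * v k z)"
  proof (rule entire_quotient_local[OF hol[OF k(1)] kp])
    fix l
    \<comment> \<open>Its least element is the minimal order at \<open>l\<close> over all indices;
      it exists because \<open>\<phi> k\<close> is not identically zero.\<close>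
    define Q where "Q n \<longleftrightarrow> (\<exists>i\<in>A. (deriv ^^ n) (\<phi> i) l \<noteq> 0)" for n
    have "Q (nat (zorder (\<phi> k) l))"
      unfolding Q_def using entire_order(3)[OF hol[OF k(1)] kp] k(1) by blast
    define m where "m = (LEAST n. Q n)"
    have "Q m" unfolding m_def by (rule LeastI) fact
    then obtain i where i: "i \<in> A" "(deriv ^^ m) (\<phi> i) l \<noteq> 0" by (auto simp: Q_def)
    have low: "(deriv ^^ n) (\<phi> j) l = 0" if "j \<in> A" "n < m" for j n
      using not_less_Least[of n Q] that by (auto simp: m_def Q_def)
    have "\<exists>w. \<phi> i w \<noteq> 0"
    proof (rule ccontr)
      assume "\<not> ?thesis"
      then have "\<phi> i = (\<lambda>_. 0)" by auto
      then show False using i(2) by (simp add: higher_deriv_const)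
    qed
    then obtain w where w: "\<phi> i w \<noteq> 0" ..
    have "nat (zorder (\<phi> i) l) = m"
      using entire_order(2)[OF hol[OF i(1)] w, where l = l and j = m] i(2)
        entire_order(3)[OF hol[OF i(1)] w, where l = l] low[OF i(1), of "nat (zorder (\<phi> i) l)"]
      by (cases "nat (zorder (\<phi> i) l)" m rule: linorder_cases) auto
    then obtain h where h: "h holomorphic_on UNIV" "h l \<noteq> 0" "\<And>z. \<phi> i z = h z * (z - l) ^ m"
      using entire_order(4)[OF hol[OF i(1)] w, where l = l] by auto
    \<comment> \<open>All \<open>\<phi> j\<close> vanish at \<open>l\<close> to order
      \<open>m\<close>, and \<open>spec\<close> hands this order on to \<psi>.\<close>
    have \<psi>0: "(deriv ^^ n) \<psi> l = 0" if "n < m" for n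
      unfolding \<psi>_def by (rule spec) (use low that in \<open>auto simp: \<phi>_def\<close>)
    obtain g where g: "g holomorphic_on UNIV" "\<And>z. \<psi> z = g z * (z - l) ^ m"
    proof (cases "\<exists>w. \<psi> w \<noteq> 0")
      case True
      then obtain w where w: "\<psi> w \<noteq> 0" ..
      obtain g where g: "g holomorphic_on UNIV" "\<And>z. \<psi> z = g z * (z - l) ^ nat (zorder \<psi> l)"
        using entire_order(4)[OF hol\<psi> w, where l = l] by auto
      have "m \<le> nat (zorder \<psi> l)"
        using entire_order(3)[OF hol\<psi> w, where l = l] \<psi>0 by (meson not_le)
      then have "\<psi> z = (g z * (z - l) ^ (nat (zorder \<psi> l) - m)) * (z - l) ^ m" for z
        by (simp add: g(2) mult.assoc flip: power_add)
      moreover have "(\<lambda>z. g z * (z - l) ^ (nat (zorder \<psi> l) - m)) holomorphic_on UNIV"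
        by (intro holomorphic_intros g)
      ultimately show ?thesis by (rule that[rotated])
    next
      case False
      then show ?thesis using that[of "\<lambda>_. 0"] by simp
    qed
    have "isCont h l" using holomorphic_on_imp_continuous_on[OF h(1)] by (simp add: continuous_on_eq_continuous_at)
    then obtain r where r: "r > 0" "\<And>z. dist l z < r \<Longrightarrow> h z \<noteq> 0"
      using continuous_at_avoid[of l h 0] h(2) by auto
    \<comment> \<open>This is \<open>\<psi> * v i / \<phi> i\<close> after cancelling
      \<open>(z - l) ^ m\<close>; by \<open>proportional\<close> it is a local quotient for the
      index \<open>k\<close> as well.\<close>
    define q where "q z = g z * v i z / h z" for z
    have "q holomorphic_on ball l r"
      unfolding q_def by (intro holomorphic_intros) 
        (use r g(1) hv[OF i(1)] h(1) holomorphic_on_subset in auto)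
    moreover have "\<phi> k z * q z = \<psi> z * v k z" if "z \<in> ball l r" for z
    proof -
      have "h z \<noteq> 0" using r(2)[of z] that by simp
      have "(\<phi> k z * q z) * h z = g z * (\<phi> k z * v i z)" using \<open>h z \<noteq> 0\<close> by (simp add: q_def)
      also have "\<dots> = (\<psi> z * v k z) * h z"
        unfolding proportional[OF i(1) k(1)] h(3) g(2) by (simp add: mult_ac)
      finally show ?thesis using \<open>h z \<noteq> 0\<close> by simp
    qed
    ultimately show "\<exists>g r. r > 0 \<and> g holomorphic_on ball l r \<and> (\<forall>z\<in>ball l r. \<phi> k z * g z = \<psi> z * v k z)"
      using r(1) by blast
  qed
  then obtain H where H: "H holomorphic_on UNIV" "\<And>z. \<phi> k z * H z = \<psi> z * v k z" by blast
  obtain L where L: "L > 0" "\<And>h. udf UNIV h \<Longrightarrow> (\<And>x. \<bar>x\<bar> < L \<Longrightarrow> h x = 0) \<Longrightarrow> Sa k h = 0"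
    using ufunctional_compact[OF Sa(1)[OF k(1)]] by blast
  obtain L' where L': "L' > 0" "\<And>h. udf UNIV h \<Longrightarrow> (\<And>x. \<bar>x\<bar> < L' \<Longrightarrow> h x = 0) \<Longrightarrow> S h = 0"
    using ufunctional_compact[OF S] by blast
  define T' where "T' = \<bar>T\<bar> + L + L'"
  have "\<kappa> 0 0 = 0"
  proof (rule spectral_quotient_vanish[of "\<phi> k" p \<psi> F "Y k" \<kappa> T' \<alpha> c \<beta> "\<lambda>z. ft (left_part 0 (\<kappa> 0)) z - H z"])
    show "Y k j s = 0" if "\<bar>s\<bar> > T'" for j s
      unfolding Y_def
      by (rule L(2)[OF udf_translate[OF uf]], rule f0) (use that L(1) L'(1) in \<open>auto simp: T'_def\<close>)
    show "\<kappa> j s = 0" if "\<bar>s\<bar> > T'" for j s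
      unfolding \<kappa>_def
      by (rule L'(2)[OF udf_translate[OF uf]], rule f0) (use that L(1) L'(1) in \<open>auto simp: T'_def\<close>)
    show "(\<lambda>z. ft (left_part 0 (\<kappa> 0)) z - H z) holomorphic_on UNIV"
      by (intro holomorphic_intros H ft_holomorphic cl1_left_part cl\<kappa>)
    show "\<phi> k z * (ft (left_part 0 (\<kappa> 0)) z - H z) = \<phi> k z * ft (left_part 0 (\<kappa> 0)) z - \<psi> z * ft (left_part c (Y k 0)) z" for z
      using H(2)[of z] by (simp add: right_diff_distrib v_def)
    show "\<exists>C. \<forall>z. Im z \<ge> 0 \<longrightarrow> norm (\<psi> z) \<le> C * exp (\<epsilon> * norm z + \<beta> * Im z)" if "\<epsilon> > 0" for \<epsilon>
      unfolding \<psi>_def by (rule transform_growth(1)[OF S \<alpha>\<beta> carrier that])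
    show "\<exists>C. \<forall>z. Im z \<le> 0 \<longrightarrow> norm (\<psi> z) \<le> C * exp (\<epsilon> * norm z + \<alpha> * Im z)" if "\<epsilon> > 0" for \<epsilon>
      unfolding \<psi>_def by (rule transform_growth(2)[OF S \<alpha>\<beta> carrier that])
  qed (use zt[OF k(1)] kp hol\<psi> F derY[OF k(1)] der\<kappa> \<phi>F[OF k(1)] \<psi>F c Y0[OF k(1)] in auto)
  then show ?thesis by (simp add: \<kappa>_def)
qed

end

section \<open>Separation by a linear functional\<close>

text \<open>Setting for a real Hahn-Banach argument. The scalar multiplication is a parameter
  because a complex function space will be regarded as a real one.\<close>

locale sublinear_space = vector_space scale for scale :: "real \<Rightarrow> 'a :: ab_group_add \<Rightarrow> 'a" (infixr \<open>\<cdot>\<close> 75) +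
  fixes V :: "'a set"
  assumes V: "subspace V"
begin

definition sublinear :: "('a \<Rightarrow> real) \<Rightarrow> bool" where
  "sublinear q \<longleftrightarrow> (\<forall>x\<in>V. \<forall>y\<in>V. q (x + y) \<le> q x + q y) \<and> (\<forall>x\<in>V. \<forall>r\<ge>0. q (r \<cdot> x) = r * q x)"

lemma sublinearD:
  assumes "sublinear q" "x \<in> V" "y \<in> V"
  shows "q (x + y) \<le> q x + q y" "r \<ge> 0 \<Longrightarrow> q (r \<cdot> x) = r * q x" "q 0 = 0" "- q (- x) \<le> q x"
proof -
  have *: "q (x + y) \<le> q x + q y" if "x \<in> V" "y \<in> V" for x y using assms that unfolding sublinear_def by blast
  then show "q (x + y) \<le> q x + q y" using assms by blast
  show "r \<ge> 0 \<Longrightarrow> q (r \<cdot> x) = r * q x" using assms unfolding sublinear_def by blast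
  have "q (0 \<cdot> x) = 0 * q x" using assms unfolding sublinear_def by blast
  then show "q 0 = 0" by simp
  then show "- q (- x) \<le> q x" using *[OF assms(2) subspace_neg[OF V assms(2)]] by simp
qed

text \<open>A minorant of \<open>q\<close> that is as small at \<open>- x\<close> as sublinearity
  permits: \<open>t = 0\<close> gives \<open>lower q x v \<le> q v\<close>, and \<open>t = 1\<close>
  gives \<open>lower q x (- x) \<le> - q x\<close>.\<close>

definition lower :: "('a \<Rightarrow> real) \<Rightarrow> 'a \<Rightarrow> 'a \<Rightarrow> real" where
  "lower q x v = (INF t\<in>{0..}. q (v + t \<cdot> x) - t * q x)"

lemma lower_bdd:
  assumes q: "sublinear q" and v: "v \<in> V" "x \<in> V"
  shows "bdd_below ((\<lambda>t. q (v + t \<cdot> x) - t * q x) ` {0..})"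
proof (rule bdd_belowI2)
  fix t :: real assume "t \<in> {0..}"
  have "q ((v + t \<cdot> x) + - v) \<le> q (v + t \<cdot> x) + q (- v)"
    using v by (intro sublinearD(1)[OF q] subspace_add[OF V] subspace_neg[OF V] subspace_scale[OF V])
  moreover have "q (t \<cdot> x) = t * q x" using sublinearD(2)[OF q v(2,1)] \<open>t \<in> {0..}\<close> by simp
  ultimately show "- q (- v) \<le> q (v + t \<cdot> x) - t * q x" by simp
qed

lemma lower_le:
  assumes "sublinear q" "v \<in> V" "x \<in> V" "t \<ge> 0"
  shows "lower q x v \<le> q (v + t \<cdot> x) - t * q x"
  unfolding lower_def by (rule cINF_lower[OF lower_bdd]) (use assms in auto)

lemma lower_sublinear:
  assumes q: "sublinear q" and x: "x \<in> V"
  shows "sublinear (lower q x)"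
proof -
  have 1: "lower q x (v + w) \<le> lower q x v + lower q x w" if vw: "v \<in> V" "w \<in> V" for v w
  proof -
    have *: "lower q x (v + w) \<le> (q (v + s \<cdot> x) - s * q x) + (q (w + t \<cdot> x) - t * q x)"
      if st: "s \<ge> 0" "t \<ge> 0" for s t
    proof -
      have "lower q x (v + w) \<le> q ((v + w) + (s + t) \<cdot> x) - (s + t) * q x"
        using st vw x by (intro lower_le q subspace_add[OF V]) auto
      also have "(v + w) + (s + t) \<cdot> x = (v + s \<cdot> x) + (w + t \<cdot> x)" by (simp add: scale_left_distrib)
      also have "q \<dots> \<le> q (v + s \<cdot> x) + q (w + t \<cdot> x)"
        using vw x by (intro sublinearD(1)[OF q] subspace_add[OF V] subspace_scale[OF V])
      finally show ?thesis by (simp add: algebra_simps)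
    qed
    have "lower q x (v + w) - (q (w + t \<cdot> x) - t * q x) \<le> lower q x v" if "t \<ge> 0" for t
      unfolding lower_def[of q x v] by (rule cINF_greatest) (use *[OF _ that] in \<open>auto simp: algebra_simps\<close>)
    then have "lower q x (v + w) - lower q x v \<le> lower q x w"
      unfolding lower_def[of q x w] by (intro cINF_greatest) (auto simp: algebra_simps)
    then show ?thesis by simp
  qed
  have le: "lower q x (r \<cdot> v) \<le> r * lower q x v" if r: "r > 0" and v: "v \<in> V" for r v
  proof -
    have "lower q x (r \<cdot> v) / r \<le> lower q x v"
      unfolding lower_def[of q x v]
    proof (rule cINF_greatest)
      fix t :: real assume t: "t \<in> {0..}"
      have "lower q x (r \<cdot> v) \<le> q (r \<cdot> v + (r * t) \<cdot> x) - (r * t) * q x"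
        using r t v x by (intro lower_le q subspace_scale[OF V]) auto
      also have "r \<cdot> v + (r * t) \<cdot> x = r \<cdot> (v + t \<cdot> x)" by (simp add: scale_right_distrib)
      also have "q \<dots> = r * q (v + t \<cdot> x)"
        using v x r by (intro sublinearD(2)[OF q _ x] subspace_add[OF V] subspace_scale[OF V]) auto
      finally show "lower q x (r \<cdot> v) / r \<le> q (v + t \<cdot> x) - t * q x"
        using r by (simp add: field_simps)
    qed auto
    then show ?thesis using r by (simp add: field_simps)
  qed
  have 2: "lower q x (r \<cdot> v) = r * lower q x v" if v: "v \<in> V" and r: "r \<ge> 0" for r v
  proof (cases "r = 0")
    case True
    have "lower q x 0 \<le> 0" using lower_le[OF q subspace_0[OF V] x, of 0] sublinearD(3)[OF q x x] by simp
    moreover have "0 \<le> lower q x 0"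
      unfolding lower_def
      by (rule cINF_greatest) (use sublinearD(2)[OF q x x] in auto)
    ultimately show ?thesis using True by simp
  next
    case False
    then have r: "r > 0" using that by simp
    have "lower q x (inverse r \<cdot> (r \<cdot> v)) \<le> inverse r * lower q x (r \<cdot> v)"
      using r v by (intro le subspace_scale[OF V]) auto
    then have "r * lower q x v \<le> lower q x (r \<cdot> v)" using r by (simp add: field_simps)
    then show ?thesis using le[OF r v] by simp
  qed
  show ?thesis unfolding sublinear_def using 1 2 by blast
qed

text \<open>A minimal sublinear functional is linear, because \<^term>\<open>lower q x\<close> is a sublinear minorant.\<close>

lemma sublinear_minorant:
  assumes p: "sublinear p"
  obtains u where "\<And>v. v \<in> V \<Longrightarrow> u v \<le> p v" "\<And>v w. v \<in> V \<Longrightarrow> w \<in> V \<Longrightarrow> u (v + w) = u v + u w"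
    "\<And>r v. v \<in> V \<Longrightarrow> u (r \<cdot> v) = r * u v"
proof -
  \<comment> \<open>Values off \<open>V\<close> are fixed to 0; otherwise a chain could be unbounded
    below there.\<close>
  define A where "A = {q. sublinear q \<and> (\<forall>v\<in>V. q v \<le> p v) \<and> (\<forall>v. v \<notin> V \<longrightarrow> q v = 0)}"
  define P where "P q q' \<longleftrightarrow> (\<forall>v. q' v \<le> q v)" for q q' :: "'a \<Rightarrow> real"
  have A: "sublinear q" "\<And>v. v \<in> V \<Longrightarrow> q v \<le> p v" "\<And>v. v \<notin> V \<Longrightarrow> q v = 0" if "q \<in> A" for q
    using that by (auto simp: A_def)
  have cut: "(\<lambda>v. if v \<in> V then q v else 0) \<in> A" if "sublinear q" "\<And>v. v \<in> V \<Longrightarrow> q v \<le> p v" for q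
    using that subspace_add[OF V] subspace_scale[OF V] by (auto simp: A_def sublinear_def)
  have "\<exists>m\<in>A. \<forall>q\<in>A. P m q \<longrightarrow> q = m"
  proof (rule predicate_Zorn)
    show "partial_order_on A (relation_of P A)"
      unfolding partial_order_on_def preorder_on_def refl_on_def trans_def antisym_def relation_of_def P_def
      by (auto intro: order_trans intro!: ext order_antisym)
    fix C assume C: "C \<in> Chains (relation_of P A)"
    then have CA: "C \<subseteq> A" and tot: "\<And>q q'. q \<in> C \<Longrightarrow> q' \<in> C \<Longrightarrow> P q q' \<or> P q' q"
      by (auto simp: Chains_def relation_of_def)
    show "\<exists>u\<in>A. \<forall>q\<in>C. P q u"
    proof (cases "C = {}")
      case True
      then show ?thesis using cut[OF p] by blast
    next
      case False
      define i where "i v = (INF q\<in>C. q v)" for v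
      have bdd: "bdd_below ((\<lambda>q. q v) ` C)" if "v \<in> V" for v
      proof (rule bdd_belowI2)
        fix q assume "q \<in> C"
        then have "q \<in> A" using CA by blast
        have "- p (- v) \<le> - q (- v)" using A(2)[OF \<open>q \<in> A\<close> subspace_neg[OF V that]] by simp
        also have "\<dots> \<le> q v" by (rule sublinearD(4)[OF A(1)[OF \<open>q \<in> A\<close>] that that])
        finally show "- p (- v) \<le> q v" .
      qed
      have i_le: "i v \<le> q v" if "v \<in> V" "q \<in> C" for v q
        unfolding i_def by (rule cINF_lower[OF bdd]) (use that in auto)
      have "sublinear i"
        unfolding sublinear_def
      proof (intro conjI ballI allI impI)
        fix x y assume xy: "x \<in> V" "y \<in> V"
        \<comment> \<open>In a chain the smaller of \<open>q\<close> and \<open>q'\<close> serves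
          both summands.\<close>
        have *: "i (x + y) \<le> q x + q' y" if q: "q \<in> C" "q' \<in> C" for q q'
        proof -
          obtain r where r: "r \<in> C" "r x \<le> q x" "r y \<le> q' y"
            using tot[OF q] q unfolding P_def by blast
          have "i (x + y) \<le> r (x + y)" by (rule i_le[OF subspace_add[OF V xy] r(1)])
          also have "\<dots> \<le> r x + r y" using sublinearD(1)[OF A(1) xy] r(1) CA by blast
          finally show ?thesis using r by simp
        qed
        have "i (x + y) - q' y \<le> i x" if "q' \<in> C" for q'
          unfolding i_def[of x] by (rule cINF_greatest[OF False]) (use *[OF _ that] in \<open>auto simp: algebra_simps\<close>)
        then have "i (x + y) - i x \<le> i y"
          unfolding i_def[of y] by (intro cINF_greatest[OF False]) (auto simp: algebra_simps)
        then show "i (x + y) \<le> i x + i y" by simp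
      next
        fix x and r :: real assume x: "x \<in> V" and r: "r \<ge> 0"
        have hom: "q (r \<cdot> x) = r * q x" if "q \<in> C" for q
          using sublinearD(2)[OF A(1) x x r] CA that by blast
        have "i (r \<cdot> x) = (INF q\<in>C. r * q x)" unfolding i_def by (rule INF_cong) (use hom in auto)
        also have "\<dots> = r * i x"
        proof (cases "r = 0")
          case True
          then show ?thesis using False by simp
        next
          case False
          then have r: "r > 0" using r by simp
          show ?thesis
          proof (rule antisym)
            have "(INF q\<in>C. r * q x) / r \<le> i x"
              unfolding i_def
            proof (rule cINF_greatest[OF \<open>C \<noteq> {}\<close>])
              fix q assume "q \<in> C"
              have "bdd_below ((\<lambda>q. r * q x) ` C)"
                using bdd[OF subspace_scale[OF V x], of r] hom by (simp cong: image_cong_simp)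
              then have "(INF q\<in>C. r * q x) \<le> r * q x" using \<open>q \<in> C\<close> by (rule cINF_lower)
              then show "(INF q\<in>C. r * q x) / r \<le> q x" using r by (simp add: field_simps)
            qed
            then show "(INF q\<in>C. r * q x) \<le> r * i x" using r by (simp add: field_simps)
            show "r * i x \<le> (INF q\<in>C. r * q x)"
              by (rule cINF_greatest[OF \<open>C \<noteq> {}\<close>]) (use i_le[OF x] r in auto)
          qed
        qed
        finally show "i (r \<cdot> x) = r * i x" .
      qed
      moreover have "i v \<le> p v" if "v \<in> V" for v
        using i_le[OF that] A(2)[OF _ that] CA False by (meson all_not_in_conv order_trans subsetD)
      ultimately have "(\<lambda>v. if v \<in> V then i v else 0) \<in> A" by (rule cut)
      moreover have "P q (\<lambda>v. if v \<in> V then i v else 0)" if "q \<in> C" for q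
        unfolding P_def using i_le[OF _ that] A(3)[of q] CA that by auto
      ultimately show ?thesis by blast
    qed
  qed
  then obtain u where u: "u \<in> A" and min: "\<And>q. q \<in> A \<Longrightarrow> P u q \<Longrightarrow> q = u" by blast
  have su: "sublinear u" by (rule A(1)[OF u])
  have super: "u v + u x \<le> u (v + x)" if v: "v \<in> V" and x: "x \<in> V" for v x
  proof -
    have le: "lower u x w \<le> u w" if "w \<in> V" for w using lower_le[OF su that x, of 0] by simp
    have "(\<lambda>v. if v \<in> V then lower u x v else 0) = u"
    proof (rule min)
      show "(\<lambda>v. if v \<in> V then lower u x v else 0) \<in> A"
        using le A(2)[OF u] by (intro cut lower_sublinear su x) (meson order_trans)
      show "P u (\<lambda>v. if v \<in> V then lower u x v else 0)" unfolding P_def using le A(3)[OF u] by simp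
    qed
    from fun_cong[OF this, of v] have "u v = lower u x v" using v by simp
    then show ?thesis using lower_le[OF su v x, of 1] by simp
  qed
  have add: "u (v + w) = u v + u w" if "v \<in> V" "w \<in> V" for v w
    using super[OF that] sublinearD(1)[OF su that] by simp
  have neg: "u (- v) = - u v" if "v \<in> V" for v
    using add[OF that subspace_neg[OF V that]] sublinearD(3)[OF su that that] by simp
  have scale: "u (r \<cdot> v) = r * u v" if v: "v \<in> V" for r v
  proof (cases "r \<ge> 0")
    case False
    then have "u ((- r) \<cdot> v) = (- r) * u v" using sublinearD(2)[OF su v v, of "- r"] by simp
    then show ?thesis using neg[OF subspace_scale[OF V v, of r]] by simp
  qed (use sublinearD(2)[OF su v v] in simp)
  show ?thesis by (rule that[OF A(2)[OF u] add scale])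
qed

text \<open>The distance \<open>d\<close> from \<open>E\<close>, measured by \<open>p\<close>, is
  sublinear and vanishes on \<open>E\<close>. Taking the linear minorant of \<open>lower d f\<close>
  instead of \<open>d\<close> forces \<open>u (- f) \<le> - d f\<close>, so \<open>u\<close> is
  positive at \<open>f\<close> without any extension from a subspace.\<close>

lemma separating_functional:
  assumes p: "sublinear p" and p0: "\<And>v. v \<in> V \<Longrightarrow> 0 \<le> p v"
    and E: "subspace E" "E \<subseteq> V" and f: "f \<in> V" and e: "e > 0" "\<And>g. g \<in> E \<Longrightarrow> e \<le> p (f + g)"
  obtains u where "\<And>v. v \<in> V \<Longrightarrow> u v \<le> p v" "\<And>v w. v \<in> V \<Longrightarrow> w \<in> V \<Longrightarrow> u (v + w) = u v + u w"
    "\<And>r v. v \<in> V \<Longrightarrow> u (r \<cdot> v) = r * u v" "\<And>v. v \<in> E \<Longrightarrow> u v = 0" "u f > 0"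
proof -
  define d where "d v = (INF g\<in>E. p (v + g))" for v
  have E0: "E \<noteq> {}" using subspace_0[OF E(1)] by blast
  have bdd: "bdd_below ((\<lambda>g. p (v + g)) ` E)" if "v \<in> V" for v
    by (rule bdd_belowI2[of _ 0]) (use that E(2) in \<open>auto intro!: p0 subspace_add[OF V]\<close>)
  have d_le: "d v \<le> p (v + g)" if "v \<in> V" "g \<in> E" for v g
    unfolding d_def by (rule cINF_lower[OF bdd]) (use that in auto)
  have d_sub: "d (v + w) \<le> d v + d w" if vw: "v \<in> V" "w \<in> V" for v w
  proof -
    have *: "d (v + w) \<le> p (v + g) + p (w + h)" if gh: "g \<in> E" "h \<in> E" for g h
    proof -
      have "d (v + w) \<le> p ((v + w) + (g + h))"
        by (rule d_le[OF subspace_add[OF V vw] subspace_add[OF E(1) gh]])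
      also have "(v + w) + (g + h) = (v + g) + (w + h)" by simp
      also have "p \<dots> \<le> p (v + g) + p (w + h)"
        using vw gh E(2) by (intro sublinearD(1)[OF p] subspace_add[OF V]) auto
      finally show ?thesis .
    qed
    have "d (v + w) - p (w + h) \<le> d v" if "h \<in> E" for h
      unfolding d_def[of v] by (rule cINF_greatest[OF E0]) (use *[OF _ that] in \<open>auto simp: algebra_simps\<close>)
    then have "d (v + w) - d v \<le> d w"
      unfolding d_def[of w] by (intro cINF_greatest[OF E0]) (auto simp: algebra_simps)
    then show ?thesis by simp
  qed
  have d_pos: "d v \<ge> 0" if "v \<in> V" for v
    unfolding d_def by (rule cINF_greatest[OF E0]) (use that E(2) in \<open>auto intro!: p0 subspace_add[OF V]\<close>)
  have dE: "d g = 0" if "g \<in> E" for g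
    using d_le[of g "- g"] subspace_neg[OF E(1) that] d_pos[of g] that E(2) sublinearD(3)[OF p f f] by auto
  have d_hom: "d (r \<cdot> v) \<le> r * d v" if r: "r > 0" and v: "v \<in> V" for r v
  proof -
    have "d (r \<cdot> v) / r \<le> d v"
      unfolding d_def[of v]
    proof (rule cINF_greatest[OF E0])
      fix g assume g: "g \<in> E"
      have "d (r \<cdot> v) \<le> p (r \<cdot> v + r \<cdot> g)" by (rule d_le[OF subspace_scale[OF V v] subspace_scale[OF E(1) g]])
      also have "r \<cdot> v + r \<cdot> g = r \<cdot> (v + g)" by (simp add: scale_right_distrib)
      also have "p \<dots> = r * p (v + g)"
        using v g E(2) r by (intro sublinearD(2)[OF p _ f] subspace_add[OF V]) auto
      finally show "d (r \<cdot> v) / r \<le> p (v + g)" using r by (simp add: field_simps)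
    qed
    then show ?thesis using r by (simp add: field_simps)
  qed
  have d: "sublinear d"
    unfolding sublinear_def
  proof (intro conjI ballI allI impI)
    fix v and r :: real assume v: "v \<in> V" and "r \<ge> 0"
    show "d (r \<cdot> v) = r * d v"
    proof (cases "r = 0")
      case True
      then show ?thesis using dE[OF subspace_0[OF E(1)]] by simp
    next
      case False
      then have r: "r > 0" using \<open>r \<ge> 0\<close> by simp
      have "d (inverse r \<cdot> (r \<cdot> v)) \<le> inverse r * d (r \<cdot> v)"
        using r by (intro d_hom subspace_scale[OF V v]) auto
      then have "r * d v \<le> d (r \<cdot> v)" using r by (simp add: field_simps)
      then show ?thesis using d_hom[OF r v] by simp
    qed
  qed (rule d_sub)
  have df: "e \<le> d f" unfolding d_def by (rule cINF_greatest[OF E0]) (use e(2) in auto)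
  obtain u where u: "\<And>v. v \<in> V \<Longrightarrow> u v \<le> lower d f v" and add: "\<And>v w. v \<in> V \<Longrightarrow> w \<in> V \<Longrightarrow> u (v + w) = u v + u w"
    and scale: "\<And>r v. v \<in> V \<Longrightarrow> u (r \<cdot> v) = r * u v"
    using sublinear_minorant[OF lower_sublinear[OF d f]] by blast
  have ud: "u v \<le> d v" if "v \<in> V" for v
    using u[OF that] lower_le[OF d that f, of 0] by simp
  have neg: "u (- v) = - u v" if "v \<in> V" for v using scale[OF that, of "- 1"] by simp
  have uE: "u v = 0" if "v \<in> E" for v
    using ud[of v] ud[of "- v"] neg[of v] dE[OF that] dE[OF subspace_neg[OF E(1) that]] that E(2) subspace_neg[OF V]
    by fastforce
  have "u (- f) \<le> - d f"
    using u[OF subspace_neg[OF V f]] lower_le[OF d subspace_neg[OF V f] f, of 1] sublinearD(3)[OF d f f] by simp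
  then have "u f > 0" using neg[OF f] df e(1) by simp
  moreover have "u v \<le> p v" if "v \<in> V" for v
    using ud[OF that] d_le[OF that subspace_0[OF E(1)]] by simp
  ultimately show ?thesis using that add scale uE by blast
qed

end

section \<open>The space of ultradifferentiable functions and its dual\<close>

lemma open_symint: "open (symint a)"
proof -
  have "symint a = {x. ereal (- x) < a} \<inter> {x. ereal x < a}"
    by (cases a) (auto simp: symint_def)
  moreover have "open {x. ereal (- x) < a}" "open {x. ereal x < a}"
    by (intro open_Collect_less continuous_intros continuous_on_ereal)+
  ultimately show ?thesis by auto
qed

lemma symint_iff: "x \<in> symint a \<longleftrightarrow> ereal \<bar>x\<bar> < a"
  by (cases a) (auto simp: symint_def)

locale ultra_setting = ultra_weight \<omega> for \<omega> +
  fixes a :: ereal and c :: "nat \<Rightarrow> real"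
  assumes exhausting: "exhausting a c"
begin

abbreviation UU where "UU \<equiv> U a c \<omega>"
abbreviation TU where "TU \<equiv> U_topology a c \<omega>"
abbreviation sem where "sem q k f \<equiv> useminorm a c \<omega> q k f"

section \<open>Exhaustion of the interval, and the seminorms\<close>

lemma c_pos: "0 < c k" and c_less: "ereal (c k) < a" and c_mono: "i \<le> k \<Longrightarrow> c i \<le> c k"
  using exhausting by (auto simp: exhausting_def incseq_def)

lemma c_symint: "\<bar>x\<bar> \<le> c k \<Longrightarrow> x \<in> symint a"
  unfolding symint_iff using c_less[of k] by (meson ereal_less_eq(3) le_less_trans)

lemma Icc_symint: "{- c k..c k} \<subseteq> symint a"
proof
  fix x assume "x \<in> {- c k..c k}"
  then have "\<bar>x\<bar> \<le> c k" by auto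
  then show "x \<in> symint a" by (rule c_symint)
qed

lemma symint_0: "0 \<in> symint a"
  using c_symint[of 0 0] c_pos[of 0] by simp

lemma exhausts:
  assumes "x \<in> symint a"
  obtains k where "\<bar>x\<bar> < c k"
proof -
  have "(\<lambda>k. ereal (c k)) \<longlonglongrightarrow> a" using exhausting by (simp add: exhausting_def)
  then have "eventually (\<lambda>k. ereal \<bar>x\<bar> < ereal (c k)) sequentially"
    by (rule order_tendstoD(1)) (use assms in \<open>simp add: symint_iff\<close>)
  then show ?thesis using that by (auto simp: eventually_sequentially)
qed

lemma exhausts_compact:
  assumes "compact K" "K \<subseteq> symint a"
  obtains k where "K \<subseteq> {- c k..c k}"
proof (cases "K = {}")
  case False
  obtain x where x: "x \<in> K" "\<forall>y\<in>K. \<bar>y\<bar> \<le> \<bar>x\<bar>"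
    using continuous_attains_sup[OF assms(1) False continuous_on_rabs[OF continuous_on_id]] by blast
  obtain k where k: "\<bar>x\<bar> < c k" using exhausts assms(2) x(1) by blast
  have "y \<in> {- c k..c k}" if "y \<in> K" for y
    using bspec[OF x(2) that] k by auto
  then show ?thesis by (intro that[of k]) blast
qed (use that in auto)

lemma iterated_D:
  assumes "\<And>x. x \<notin> symint a \<Longrightarrow> f x = 0"
  shows "(D a ^^ j) f x = (if x \<in> symint a then nd j f x else 0)"
proof (induction j arbitrary: x)
  case (Suc j)
  have "vd ((D a ^^ j) f) x = vd (nd j f) x" if "x \<in> symint a"
    using nd_cong[OF open_symint _ that, of "(D a ^^ j) f" "nd j f" 1] Suc by simp
  then show ?case
    by (simp add: D_def[of a "(D a ^^ j) f"] restr_def vd_def[of "(D a ^^ j) f", symmetric])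
qed (use assms in auto)

lemma smooth_iff: "f \<in> smooth a \<longleftrightarrow> (\<forall>x. x \<notin> symint a \<longrightarrow> f x = 0) \<and> smooth_fun (symint a) f"
proof (cases "\<forall>x. x \<notin> symint a \<longrightarrow> f x = 0")
  case True
  have "((D a ^^ j) f differentiable (at x)) = (nd j f differentiable (at x))" if "x \<in> symint a" for j x
  proof -
    have eq: "(D a ^^ j) f y = nd j f y" if "y \<in> symint a" for y
      using iterated_D[of f j y] True that by simp
    show ?thesis
      unfolding differentiable_def
      using has_derivative_transform_within_open[OF _ open_symint that, of "(D a ^^ j) f" _ UNIV "nd j f"]
        has_derivative_transform_within_open[OF _ open_symint that, of "nd j f" _ UNIV "(D a ^^ j) f"] eq by metis
  qed
  then show ?thesis using True by (simp add: smooth_def smooth_fun_def)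
qed (auto simp: smooth_def)

lemma useminorm_le:
  assumes "\<And>j x. \<bar>x\<bar> \<le> c k \<Longrightarrow> norm ((D a ^^ j) f x) \<le> r * M q j"
  shows "sem q k f \<le> ereal r"
  unfolding useminorm_def
proof (intro SUP_least)
  fix j x assume "x \<in> {- c k..c k}"
  then have "norm ((D a ^^ j) f x) \<le> r * M q j" by (intro assms) auto
  then show "ereal (norm ((D a ^^ j) f x) * exp (- q * young_conj \<omega> (real j / q))) \<le> ereal r"
    by (simp add: Mw_def exp_minus field_simps)
qed

lemma useminorm_lessD:
  assumes "sem q k f < ereal e"
  obtains r where "0 \<le> r" "r < e" "\<forall>j x. \<bar>x\<bar> \<le> c k \<longrightarrow> norm ((D a ^^ j) f x) \<le> r * M q j"
proof -
  have ge: "ereal (norm ((D a ^^ j) f x) * exp (- q * young_conj \<omega> (real j / q))) \<le> sem q k f"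
    if "\<bar>x\<bar> \<le> c k" for j x
    unfolding useminorm_def using that by (intro SUP_upper2[of j] SUP_upper2[of x]) auto
  have "0 \<le> ereal (norm ((D a ^^ 0) f 0) * exp (- q * young_conj \<omega> (real 0 / q)))" by simp
  also have "\<dots> \<le> sem q k f" using c_pos[of k] by (intro ge) auto
  finally have "0 \<le> sem q k f" .
  then obtain r where r: "sem q k f = ereal r" "0 \<le> r" "r < e"
    using assms by (cases "sem q k f") auto
  have "norm ((D a ^^ j) f x) \<le> r * M q j" if "\<bar>x\<bar> \<le> c k" for j x
    using ge[OF that, of j] r(1) by (simp add: Mw_def exp_minus field_simps)
  then show ?thesis using that r by blast
qed

text \<open>Every compact subset of the interval lies in some \<open>[-c k;c k]\<close>, so the
  sequence of intervals can be replaced by all compact sets; the closure rules of \<open>udf\<close>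
  then apply to \<open>U\<close>.\<close>

lemma U_iff: "f \<in> UU \<longleftrightarrow> (\<forall>x. x \<notin> symint a \<longrightarrow> f x = 0) \<and> udf (symint a) f"
proof
  assume f: "f \<in> UU"
  then have s: "\<forall>x. x \<notin> symint a \<longrightarrow> f x = 0" "smooth_fun (symint a) f"
    by (auto simp: U_def smooth_iff)
  moreover have "udf (symint a) f"
    unfolding udf_def
  proof (intro conjI allI impI s)
    fix q :: real and K :: "real set" assume q: "0 < q" "q < 1" and K: "compact K" "K \<subseteq> symint a"
    obtain k where k: "K \<subseteq> {- c k..c k}" using exhausts_compact[OF K] .
    have "sem q k f < \<infinity>" using f q by (simp add: U_def)
    then obtain e where "sem q k f < ereal e" by (metis less_ereal.simps(2) less_PInf_Ex_of_nat ereal_dense2)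
    then obtain r where r: "\<forall>j x. \<bar>x\<bar> \<le> c k \<longrightarrow> norm ((D a ^^ j) f x) \<le> r * M q j"
      using useminorm_lessD by blast
    have "norm (nd j f x) \<le> r * M q j" if "x \<in> K" for j x
    proof -
      have "\<bar>x\<bar> \<le> c k" using subsetD[OF k that] by auto
      then have "norm ((D a ^^ j) f x) \<le> r * M q j" using r by blast
      then show ?thesis using iterated_D[of f j x] s(1) subsetD[OF K(2) that] by simp
    qed
    then show "\<exists>C. \<forall>j. \<forall>x\<in>K. norm (nd j f x) \<le> C * M q j" by blast
  qed
  ultimately show "(\<forall>x. x \<notin> symint a \<longrightarrow> f x = 0) \<and> udf (symint a) f" by blast
next
  assume f: "(\<forall>x. x \<notin> symint a \<longrightarrow> f x = 0) \<and> udf (symint a) f"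
  have "sem q k f < \<infinity>" if q: "0 < q" "q < 1" for q k
  proof -
    obtain C where "\<And>j x. x \<in> {- c k..c k} \<Longrightarrow> norm (nd j f x) \<le> C * M q j"
      using udf_bound[OF conjunct2[OF f] q compact_Icc Icc_symint] by blast
    then have "sem q k f \<le> ereal C"
      by (intro useminorm_le) (use iterated_D[of f] f c_symint in \<open>auto simp: abs_le_iff\<close>)
    then show ?thesis using order_le_less_trans by fastforce
  qed
  then show "f \<in> UU" using f udf_smooth by (auto simp: U_def smooth_iff)
qed

lemma U_off: "f \<in> UU \<Longrightarrow> x \<notin> symint a \<Longrightarrow> f x = 0"
  and U_udf: "f \<in> UU \<Longrightarrow> udf (symint a) f"
  by (auto simp: U_iff)

lemma iterated_D_U: "f \<in> UU \<Longrightarrow> (D a ^^ j) f x = (if x \<in> symint a then nd j f x else 0)"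
  by (rule iterated_D) (rule U_off)

lemma restr_U: "udf (symint a) h \<Longrightarrow> restr a h \<in> UU"
  unfolding U_iff by (auto simp: restr_def intro: udf_cong[OF open_symint])

lemma restr_UNIV: "udf UNIV h \<Longrightarrow> restr a h \<in> UU"
  by (rule restr_U) (rule udf_subset, auto)

lemma nd_restr: "x \<in> symint a \<Longrightarrow> nd j (restr a h) x = nd j h x"
  by (rule nd_cong[OF open_symint]) (auto simp: restr_def)

lemma U_add: "f \<in> UU \<Longrightarrow> g \<in> UU \<Longrightarrow> f + g \<in> UU"
  and U_diff: "f \<in> UU \<Longrightarrow> g \<in> UU \<Longrightarrow> f - g \<in> UU"
  and U_cscale: "f \<in> UU \<Longrightarrow> cscale z f \<in> UU"
  and U_0: "0 \<in> UU"
  unfolding U_iff by (auto simp: cscale_def plus_fun_def fun_diff_def zero_fun_def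
    intro: udf_add udf_diff udf_cmult udf_0 open_symint)

lemma nd_cscale:
  assumes "f \<in> UU" "x \<in> symint a"
  shows "nd j (cscale z f) x = z * nd j f x"
  unfolding cscale_def
  by (rule nd_eq_sequence[of "symint a" "\<lambda>j t. z * nd j f t", simplified, OF open_symint _ assms(2)])
    (intro has_vector_derivative_mult_right smooth_fun_has_derivative[OF udf_smooth[OF U_udf[OF assms(1)]], unfolded funpow.simps o_apply])

text \<open>\<^term>\<open>ubound q k r f\<close> says that the seminorm with index \<open>(q, k)\<close> of \<open>f\<close> is at most \<open>r\<close>.\<close>

definition ubound :: "real \<Rightarrow> nat \<Rightarrow> real \<Rightarrow> (real \<Rightarrow> complex) \<Rightarrow> bool" where
  "ubound q k r f \<longleftrightarrow> (\<forall>j x. \<bar>x\<bar> \<le> c k \<longrightarrow> norm (nd j f x) \<le> r * M q j)"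

lemma ubound_D: "f \<in> UU \<Longrightarrow> ubound q k r f \<longleftrightarrow> (\<forall>j x. \<bar>x\<bar> \<le> c k \<longrightarrow> norm ((D a ^^ j) f x) \<le> r * M q j)"
  unfolding ubound_def by (auto simp: iterated_D_U c_symint)

lemma ubound_useminorm: "f \<in> UU \<Longrightarrow> ubound q k r f \<Longrightarrow> sem q k f \<le> ereal r"
  using ubound_D useminorm_le by blast

lemma useminorm_ubound:
  assumes "f \<in> UU" "sem q k f < ereal e"
  obtains r where "0 \<le> r" "r < e" "ubound q k r f"
  using useminorm_lessD[OF assms(2)] ubound_D[OF assms(1)] by metis

lemma ubound_exists:
  assumes "f \<in> UU" "0 < q" "q < 1"
  obtains r where "r > 0" "ubound q k r f"
proof -
  obtain r where "r > 0" "\<And>j x. x \<in> {- c k..c k} \<Longrightarrow> norm (nd j f x) \<le> r * M q j"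
    using udf_bound[OF U_udf[OF assms(1)] assms(2,3) compact_Icc Icc_symint] by blast
  then show ?thesis using that[of r] by (auto simp: ubound_def abs_le_iff)
qed

lemma ubound_nonneg: "ubound q k r f \<Longrightarrow> 0 \<le> r"
  unfolding ubound_def using c_pos[of k] M_pos[of q 0] norm_ge_zero
  by (metis abs_zero less_imp_le order_trans zero_le_mult_iff not_less)

lemma ubound_mono:
  assumes "ubound q k r f" "0 < q'" "q' \<le> q" "k' \<le> k" "r \<le> r'"
  shows "ubound q' k' r' f"
  unfolding ubound_def
proof (intro allI impI)
  fix j x assume "\<bar>x\<bar> \<le> c k'"
  then have "norm (nd j f x) \<le> r * M q j"
    using assms(1) c_mono[OF assms(4)] by (auto simp: ubound_def)
  also have "\<dots> \<le> r' * M q' j"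
    using ubound_nonneg[OF assms(1)] assms M_pos[of q j] M_antimono[of q' q j] by (intro mult_mono) auto
  finally show "norm (nd j f x) \<le> r' * M q' j" .
qed

lemma ubound_add:
  assumes "f \<in> UU" "g \<in> UU" "ubound q k r f" "ubound q k s g"
  shows "ubound q k (r + s) (f + g)"
  unfolding ubound_def
proof (intro allI impI)
  fix j x assume x: "\<bar>x\<bar> \<le> c k"
  have "nd j (\<lambda>t. f t + g t) x = nd j f x + nd j g x"
    by (rule nd_add[OF open_symint]) (use assms U_udf udf_smooth c_symint[OF x] in auto)
  then have "norm (nd j (f + g) x) \<le> norm (nd j f x) + norm (nd j g x)"
    using norm_triangle_ineq by (simp add: plus_fun_def)
  also have "\<dots> \<le> (r + s) * M q j"
    using assms(3,4) x by (auto simp: ubound_def distrib_right intro: add_mono)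
  finally show "norm (nd j (f + g) x) \<le> (r + s) * M q j" .
qed

lemma ubound_cscale:
  assumes "f \<in> UU" "ubound q k r f"
  shows "ubound q k (norm z * r) (cscale z f)"
  unfolding ubound_def
  using assms(2) by (auto simp: nd_cscale[OF assms(1) c_symint] ubound_def norm_mult mult.assoc intro: mult_left_mono)

text \<open>The strict inequality \<open>r < e\<close> leaves the room needed to recentre such a
  neighbourhood at any of its points.\<close>

definition unbhd :: "(real \<Rightarrow> complex) \<Rightarrow> real \<Rightarrow> nat \<Rightarrow> real \<Rightarrow> (real \<Rightarrow> complex) set" where
  "unbhd f q k e = {g \<in> UU. \<exists>r<e. ubound q k r (g - f)}"

lemma unbhd_eq:
  assumes "f \<in> UU"
  shows "unbhd f q k e = {g \<in> UU. sem q k (g - f) < ereal e}"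
proof -
  have "(\<exists>r<e. ubound q k r (g - f)) \<longleftrightarrow> sem q k (g - f) < ereal e" if "g \<in> UU" for g
    using useminorm_ubound[OF U_diff[OF that assms], of q k e] ubound_useminorm[OF U_diff[OF that assms], of q k]
    by (metis ereal_less(2) le_less_trans less_ereal.simps(1))
  then show ?thesis unfolding unbhd_def by blast
qed

lemma topspace_TU: "topspace TU = UU"
proof -
  have "f \<in> {g \<in> UU. sem (1/2) 0 (g - f) < ereal 1}" if "f \<in> UU" for f
  proof -
    have "f \<in> unbhd f (1/2) 0 1"
      unfolding unbhd_def using that by (auto simp: ubound_def nd_0 zero_fun_def intro!: exI[of _ 0])
    then show ?thesis unfolding unbhd_eq[OF that] .
  qed
  moreover have "{g \<in> UU. sem (1/2) 0 (g - f) < ereal 1} \<in>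
    {{g \<in> UU. sem q k (g - f) < ereal e} | f q k e. f \<in> UU \<and> 0 < q \<and> q < 1 \<and> 0 < e}" if "f \<in> UU" for f
    using that by (intro CollectI exI[of _ f] exI[of _ "1/2 :: real"] exI[of _ "0 :: nat"] exI[of _ "1 :: real"]) auto
  ultimately have "UU \<subseteq> \<Union> {{g \<in> UU. sem q k (g - f) < ereal e} | f q k e. f \<in> UU \<and> 0 < q \<and> q < 1 \<and> 0 < e}"
    by (meson UnionI subsetI)
  then show ?thesis
    unfolding U_topology_def topology_generated_by_topspace by blast
qed

lemma openin_unbhd: "f \<in> UU \<Longrightarrow> 0 < q \<Longrightarrow> q < 1 \<Longrightarrow> 0 < e \<Longrightarrow> openin TU (unbhd f q k e)"
  unfolding U_topology_def unbhd_eq by (rule topology_generated_by_Basis) auto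

text \<open>The generating sets have arbitrary centres; the triangle inequality recentres them at
  \<open>f\<close>. An intersection is handled by the larger \<open>q\<close> and \<open>k\<close>,
  since the seminorms grow with both.\<close>

lemma openin_TU_nbhd:
  assumes "openin TU N" "f \<in> N"
  shows "\<exists>q k e. 0 < q \<and> q < 1 \<and> 0 < e \<and> unbhd f q k e \<subseteq> N"
  using assms(1) unfolding U_topology_def openin_topology_generated_by_iff
  using assms(2)
proof (induction N rule: generate_topology_on.induct)
  case (Int N P)
  then obtain q k e q' k' e' where *: "0 < q" "q < 1" "0 < e" "unbhd f q k e \<subseteq> N"
    "0 < q'" "q' < 1" "0 < e'" "unbhd f q' k' e' \<subseteq> P" by auto
  have "unbhd f (max q q') (max k k') (min e e') \<subseteq> unbhd f q k e \<inter> unbhd f q' k' e'"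
  proof -
    have "ubound q k r g" "ubound q' k' r g" if "ubound (max q q') (max k k') r g" for r g
      by (rule ubound_mono[OF that]; use *(1,5) in simp)+
    then show ?thesis unfolding unbhd_def by fastforce
  qed
  then show ?case using * by (intro exI[of _ "max q q'"] exI[of _ "max k k'"] exI[of _ "min e e'"]) auto
next
  case (UN K)
  then show ?case by (meson Union_upper UnionE order_trans)
next
  case (Basis s)
  then obtain f0 q k e where s: "s = {g \<in> UU. sem q k (g - f0) < ereal e}" and f0: "f0 \<in> UU"
    and q: "0 < q" "q < 1" "0 < e" by auto
  have s': "s = unbhd f0 q k e" unfolding s unbhd_eq[OF f0] ..
  then obtain r where f: "f \<in> UU" and r: "r < e" "ubound q k r (f - f0)"
    using Basis by (auto simp: unbhd_def)
  have "unbhd f q k (e - r) \<subseteq> s"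
  proof
    fix g assume "g \<in> unbhd f q k (e - r)"
    then obtain r' where g: "g \<in> UU" and r': "r' < e - r" "ubound q k r' (g - f)" by (auto simp: unbhd_def)
    have "ubound q k (r + r') ((f - f0) + (g - f))"
      by (rule ubound_add[OF U_diff[OF f f0] U_diff[OF g f] r(2) r'(2)])
    moreover have "(f - f0) + (g - f) = g - f0" by simp
    ultimately show "g \<in> s" unfolding s' unbhd_def using g r' by (auto intro!: exI[of _ "r + r'"])
  qed
  then show ?case using q r(1) by (intro exI[of _ q] exI[of _ k] exI[of _ "e - r"]) auto
qed auto

section \<open>The dual space: continuity as an estimate by one seminorm\<close>

lemma dual_add: "S \<in> U_dual a c \<omega> \<Longrightarrow> f \<in> UU \<Longrightarrow> g \<in> UU \<Longrightarrow> S (f + g) = S f + S g"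
  and dual_cscale: "S \<in> U_dual a c \<omega> \<Longrightarrow> f \<in> UU \<Longrightarrow> S (cscale z f) = z * S f"
  by (auto simp: U_dual_def)

lemma dual_diff:
  assumes "S \<in> U_dual a c \<omega>" "f \<in> UU" "g \<in> UU"
  shows "S (f - g) = S f - S g"
proof -
  have "f - g = f + cscale (- 1) g" by (simp add: cscale_def fun_eq_iff)
  then show ?thesis using dual_add[OF assms(1,2) U_cscale[OF assms(3), of "- 1"]] dual_cscale[OF assms(1,3), of "- 1"] by simp
qed

definition dual_bound :: "((real \<Rightarrow> complex) \<Rightarrow> complex) \<Rightarrow> real \<Rightarrow> nat \<Rightarrow> real \<Rightarrow> bool" where
  "dual_bound S q k C \<longleftrightarrow> 0 < q \<and> q < 1 \<and> 0 \<le> C \<and> (\<forall>f r. f \<in> UU \<longrightarrow> ubound q k r f \<longrightarrow> norm (S f) \<le> C * r)"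

lemma dual_boundD:
  assumes "dual_bound S q k C"
  shows "0 < q" "q < 1" "0 \<le> C" "f \<in> UU \<Longrightarrow> ubound q k r f \<Longrightarrow> norm (S f) \<le> C * r"
  using assms by (auto simp: dual_bound_def)

lemma dual_bound_exists:
  assumes S: "S \<in> U_dual a c \<omega>"
  obtains q k C where "dual_bound S q k C"
proof -
  define N where "N = {f \<in> topspace TU. S f \<in> ball 0 1}"
  have "openin TU N"
    unfolding N_def by (rule openin_continuous_map_preimage[of _ euclidean]) (use S in \<open>auto simp: U_dual_def\<close>)
  moreover have "S 0 = 0" using dual_cscale[OF S U_0, of 0] by (simp add: cscale_def zero_fun_def)
  then have "0 \<in> N" by (simp add: N_def topspace_TU U_0)
  ultimately obtain q k e where q: "0 < q" "q < 1" "0 < e" and sub: "unbhd 0 q k e \<subseteq> N"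
    using openin_TU_nbhd by blast
  have "norm (S f) \<le> (2 / e) * r" if f: "f \<in> UU" and r: "ubound q k r f" for f r
  proof (rule field_le_epsilon)
    fix d :: real assume d: "d > 0"
    \<comment> \<open>Slightly above \<open>r\<close>, so that one can divide by it even if
      \<open>r = 0\<close>; the surplus contributes \<open>d\<close> to the estimate.\<close>
    define R where "R = r + d * e / 2"
    have R: "R > 0" using ubound_nonneg[OF r] d q by (simp add: R_def add_nonneg_pos)
    have rR: "r \<le> R" using d q by (simp add: R_def)
    define z where "z = complex_of_real (e / (2 * R))"
    have "ubound q k (norm z * R) (cscale z f)"
      by (rule ubound_cscale[OF f ubound_mono[OF r]]) (use q rR in auto)
    moreover have "norm z * R = e / 2" using R q by (simp add: z_def norm_divide norm_mult)
    ultimately have "cscale z f \<in> unbhd 0 q k e"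
      unfolding unbhd_def using q U_cscale[OF f, of z] by (auto intro!: exI[of _ "e / 2"])
    then have "norm (S (cscale z f)) < 1" using sub by (auto simp: N_def)
    then have "norm z * norm (S f) < 1" using dual_cscale[OF S f, of z] by (simp add: norm_mult)
    then have "norm (S f) < (2 / e) * R" using R q by (simp add: z_def norm_divide norm_mult field_simps)
    then show "norm (S f) \<le> (2 / e) * r + d" using q by (simp add: R_def field_simps)
  qed
  then have "dual_bound S q k (2 / e)" using q by (simp add: dual_bound_def)
  then show ?thesis by (rule that)
qed

lemma dual_I:
  assumes b: "dual_bound S q k C" and add: "\<And>f g. f \<in> UU \<Longrightarrow> g \<in> UU \<Longrightarrow> S (f + g) = S f + S g"
    and sc: "\<And>f z. f \<in> UU \<Longrightarrow> S (cscale z f) = z * S f"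
  shows "S \<in> U_dual a c \<omega>"
proof -
  have diff: "S (g - f) = S g - S f" if "f \<in> UU" "g \<in> UU" for f g
  proof -
    have "S ((g - f) + f) = S (g - f) + S f" by (rule add) (use that U_diff in auto)
    then show ?thesis by simp
  qed
  have "continuous_map TU euclidean S"
    unfolding continuous_map
  proof (intro conjI allI impI)
    fix O' :: "complex set" assume O: "openin euclidean O'"
    show "openin TU {f \<in> topspace TU. S f \<in> O'}"
      unfolding topspace_TU
    proof (subst openin_subopen, intro ballI)
      fix f assume f: "f \<in> {f \<in> UU. S f \<in> O'}"
      then obtain d where d: "d > 0" "ball (S f) d \<subseteq> O'" using O openE by (metis mem_Collect_eq open_openin)
      define e where "e = d / (C + 1)"
      have C: "C \<ge> 0" by (rule dual_boundD(3)[OF b])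
      have e: "e > 0" using d C by (simp add: e_def)
      have "unbhd f q k e \<subseteq> {f \<in> UU. S f \<in> O'}"
      proof
        fix g assume "g \<in> unbhd f q k e"
        then obtain r where g: "g \<in> UU" and r: "r < e" "ubound q k r (g - f)" by (auto simp: unbhd_def)
        have "norm (S (g - f)) \<le> C * r" using dual_boundD(4)[OF b U_diff r(2)] f g by auto
        also have "\<dots> \<le> C * e" using r C by (intro mult_left_mono) auto
        also have "\<dots> < d" using d C by (simp add: e_def field_simps)
        finally have "S g \<in> ball (S f) d" using diff[of f g] f g by (simp add: dist_norm norm_minus_commute)
        then show "g \<in> {f \<in> UU. S f \<in> O'}" using d g by auto
      qed
      moreover have "f \<in> unbhd f q k e"
        unfolding unbhd_def using f e by (auto simp: ubound_def nd_0 zero_fun_def intro!: exI[of _ 0])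
      ultimately show "\<exists>T. openin TU T \<and> f \<in> T \<and> T \<subseteq> {f \<in> UU. S f \<in> O'}"
        using openin_unbhd[of f q e k] dual_boundD(1,2)[OF b] e f by blast
    qed
  qed auto
  then show ?thesis unfolding U_dual_def using add sc by blast
qed

end

section \<open>Local convolution with a functional of zero exponential type\<close>

context ultra_setting
begin

text \<open>Carries an element of the dual to the whole line, where all translates are available;
  its transform is the original one.\<close>

definition rest :: "((real \<Rightarrow> complex) \<Rightarrow> complex) \<Rightarrow> (real \<Rightarrow> complex) \<Rightarrow> complex" where
  "rest S h = S (restr a h)"

lemma transform_rest: "transform (rest S) = fourier_laplace a S"
  by (simp add: fun_eq_iff transform_def rest_def fourier_laplace_def)

lemma restr_add: "restr a (\<lambda>t. f t + g t) = restr a f + restr a g"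
  and restr_cmult: "restr a (\<lambda>t. z * f t) = cscale z (restr a f)"
  by (auto simp: restr_def cscale_def fun_eq_iff)

lemma rest_ufunctional:
  assumes S: "S \<in> U_dual a c \<omega>"
  shows "ufunctional (rest S)"
proof -
  obtain q k C where b: "dual_bound S q k C" using dual_bound_exists[OF S] .
  have "norm (rest S h) \<le> C * A" if h: "udf UNIV h" "\<And>j x. \<bar>x\<bar> \<le> c k \<Longrightarrow> norm (nd j h x) \<le> A * M q j" for h A
    unfolding rest_def
    by (rule dual_boundD(4)[OF b restr_UNIV[OF h(1)]]) (use h(2) in \<open>auto simp: ubound_def nd_restr[OF c_symint]\<close>)
  then have "functional_bound (rest S) q (c k) C"
    using dual_boundD[OF b] c_pos[of k] unfolding functional_bound_def by (auto intro: less_imp_le)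
  then show ?thesis
    unfolding ufunctional_def using dual_add[OF S] dual_cscale[OF S] restr_UNIV
    by (auto simp: rest_def restr_add restr_cmult)
qed

section \<open>Cut-offs inside the interval and compact carriers\<close>

lemma symint_cutoff:
  assumes "l \<le> r" "{l..r} \<subseteq> symint a"
  obtains \<theta> \<delta> where "\<delta> > 0" "udf UNIV \<theta>" "\<forall>x. l - \<delta> \<le> x \<longrightarrow> x \<le> r + \<delta> \<longrightarrow> \<theta> x = 1"
    "\<forall>x. x \<notin> {l - 2 * \<delta>..r + 2 * \<delta>} \<longrightarrow> \<theta> x = 0" "{l - 2 * \<delta>..r + 2 * \<delta>} \<subseteq> symint a"
proof -
  obtain k where k: "{l..r} \<subseteq> {- c k..c k}" using exhausts_compact[OF compact_Icc assms(2)] .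
  obtain k' where k': "\<bar>c k\<bar> < c k'" using exhausts[OF c_symint[of "c k" k]] c_pos[of k] by auto
  define \<delta> where "\<delta> = (c k' - c k) / 2"
  have \<delta>: "\<delta> > 0" using k' by (auto simp: \<delta>_def)
  have "- c k \<le> l" "r \<le> c k" using k assms(1) by auto
  moreover have "2 * \<delta> = c k' - c k" by (simp add: \<delta>_def)
  ultimately have "{l - 2 * \<delta>..r + 2 * \<delta>} \<subseteq> {- c k'..c k'}" by auto
  then have sub: "{l - 2 * \<delta>..r + 2 * \<delta>} \<subseteq> symint a" using Icc_symint by blast
  obtain \<theta> where \<theta>: "udf UNIV \<theta>" "\<And>x. l - \<delta> \<le> x \<Longrightarrow> x \<le> r + \<delta> \<Longrightarrow> \<theta> x = 1"
    "\<And>x. x \<le> l - 2 * \<delta> \<Longrightarrow> \<theta> x = 0" "\<And>x. x \<ge> r + 2 * \<delta> \<Longrightarrow> \<theta> x = 0"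
    using udf_plateau[OF assms(1) \<delta>] by blast
  have "\<theta> x = 0" if "x \<notin> {l - 2 * \<delta>..r + 2 * \<delta>}" for x
    using \<theta>(3)[of x] \<theta>(4)[of x] that by (cases "x \<le> l - 2 * \<delta>") auto
  then show ?thesis using that[of \<delta> \<theta>] \<delta> \<theta>(1,2) sub by blast
qed

lemma udf_cutoff:
  assumes "f \<in> UU" "udf UNIV \<theta>" "\<And>x. x \<notin> {l..r} \<Longrightarrow> \<theta> x = 0" "{l..r} \<subseteq> symint a"
  shows "udf UNIV (\<lambda>t. \<theta> t * f t)"
proof (rule udf_extend[OF open_symint _ compact_Icc assms(4)])
  show "udf (symint a) (\<lambda>t. \<theta> t * f t)"
    by (intro udf_mult open_symint udf_subset[OF assms(2)] U_udf[OF assms(1)]) auto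
qed (use assms(3) in simp)

text \<open>\<open>[-c k;c k]\<close> carries \<open>S\<close> in the sense of functions that vanish
  on a neighbourhood, so that derivatives at its end points are of no concern.\<close>

definition local_index :: "((real \<Rightarrow> complex) \<Rightarrow> complex) \<Rightarrow> nat \<Rightarrow> bool" where
  "local_index S k \<longleftrightarrow> (\<forall>f V. f \<in> UU \<longrightarrow> open V \<longrightarrow> {- c k..c k} \<subseteq> V \<longrightarrow> (\<forall>x\<in>V. f x = 0) \<longrightarrow> S f = 0)"

lemma local_indexD:
  "local_index S k \<Longrightarrow> f \<in> UU \<Longrightarrow> open V \<Longrightarrow> {- c k..c k} \<subseteq> V \<Longrightarrow> (\<And>x. x \<in> V \<Longrightarrow> f x = 0) \<Longrightarrow> S f = 0"
  unfolding local_index_def by blast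

lemma local_index_exists:
  assumes S: "S \<in> U_dual a c \<omega>"
  obtains k where "local_index S k"
proof -
  obtain q k C where b: "dual_bound S q k C" using dual_bound_exists[OF S] .
  have "S f = 0" if f: "f \<in> UU" "open V" "{- c k..c k} \<subseteq> V" "\<forall>x\<in>V. f x = 0" for f V
  proof -
    have "ubound q k 0 f"
      unfolding ubound_def
    proof (intro allI impI)
      fix j x assume "\<bar>x\<bar> \<le> c k"
      then have "x \<in> V" by (intro subsetD[OF f(3)]) auto
      then show "norm (nd j f x) \<le> 0 * M q j" using nd_eq_0[OF f(2), of f x j] f(4) by simp
    qed
    then show ?thesis using dual_boundD(4)[OF b f(1)] by fastforce
  qed
  then have "local_index S k" unfolding local_index_def by blast
  then show ?thesis by (rule that)
qed

lemma dual_cutoff: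
  assumes S: "S \<in> U_dual a c \<omega>" and k: "local_index S k" and f: "f \<in> UU" and g: "udf UNIV g"
    and V: "open V" "{- c k..c k} \<subseteq> V" "\<And>x. x \<in> V \<Longrightarrow> g x = f x"
  shows "S f = rest S g"
proof -
  have "S (f - restr a g) = 0"
  proof (rule local_indexD[OF k U_diff[OF f restr_UNIV[OF g]], of "V \<inter> symint a"])
    show "open (V \<inter> symint a)" using V(1) open_symint by auto
    show "(f - restr a g) x = 0" if "x \<in> V \<inter> symint a" for x using that V(3) by (simp add: restr_def)
  qed (use V Icc_symint in auto)
  then show ?thesis using dual_diff[OF S f restr_UNIV[OF g]] by (simp add: rest_def)
qed

lemma dual_local:
  assumes S: "S \<in> U_dual a c \<omega>" and zt: "zero_type (fourier_laplace a S)" and \<delta>: "\<delta> > 0"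
    and f: "f \<in> UU" "\<And>x. \<bar>x\<bar> < \<delta> \<Longrightarrow> f x = 0"
  shows "S f = 0"
proof -
  obtain k where k: "local_index S k" using local_index_exists[OF S] .
  have "- c k \<le> c k" using c_pos[of k] by simp
  obtain \<theta> d where \<theta>: "d > 0" "udf UNIV \<theta>" "\<forall>x. - c k - d \<le> x \<longrightarrow> x \<le> c k + d \<longrightarrow> \<theta> x = 1"
    "\<forall>x. x \<notin> {- c k - 2 * d..c k + 2 * d} \<longrightarrow> \<theta> x = 0" "{- c k - 2 * d..c k + 2 * d} \<subseteq> symint a"
    using symint_cutoff[OF \<open>- c k \<le> c k\<close> Icc_symint] .
  have g: "udf UNIV (\<lambda>t. \<theta> t * f t)" by (rule udf_cutoff[OF f(1) \<theta>(2) _ \<theta>(5)]) (use \<theta>(4) in blast)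
  have "S f = rest S (\<lambda>t. \<theta> t * f t)"
    by (rule dual_cutoff[OF S k f(1) g, of "{- c k - d<..<c k + d}"]) (use \<theta>(1,3) in auto)
  also have "\<dots> = 0"
    by (rule zero_type_local[OF rest_ufunctional[OF S] _ \<delta> g]) (use zt f(2) in \<open>auto simp: transform_rest\<close>)
  finally show ?thesis .
qed

text \<open>Cutting \<open>f\<close> off close to 0 changes it only by a function that vanishes near
  0, which \<open>dual_local\<close> kills.\<close>

lemma dual_nonzero_near_0:
  assumes S: "S \<in> U_dual a c \<omega>" and zt: "zero_type (fourier_laplace a S)" and nz: "\<exists>f\<in>UU. S f \<noteq> 0" and \<delta>: "\<delta> > 0"
  obtains h where "udf UNIV h" "\<forall>x. \<bar>x\<bar> > \<delta> \<longrightarrow> h x = 0" "rest S h \<noteq> 0"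
proof -
  obtain f where f: "f \<in> UU" "S f \<noteq> 0" using nz by blast
  obtain k where k: "\<bar>0\<bar> < c k" using exhausts[OF symint_0] .
  define d where "d = min \<delta> (c k) / 2"
  have d: "d > 0" using \<delta> k by (simp add: d_def)
  obtain \<theta> where \<theta>: "udf UNIV \<theta>" "\<And>x. 0 - d \<le> x \<Longrightarrow> x \<le> 0 + d \<Longrightarrow> \<theta> x = 1"
    "\<And>x. x \<le> 0 - 2 * d \<Longrightarrow> \<theta> x = 0" "\<And>x. x \<ge> 0 + 2 * d \<Longrightarrow> \<theta> x = 0"
    using udf_plateau[OF order_refl d, of 0] by blast
  have \<theta>0: "\<theta> x = 0" if "x \<notin> {- 2 * d..2 * d}" for x
    using \<theta>(3)[of x] \<theta>(4)[of x] that by (cases "x \<le> - 2 * d") auto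
  have "{- 2 * d..2 * d} \<subseteq> {- c k..c k}" by (auto simp: d_def)
  then have sub: "{- 2 * d..2 * d} \<subseteq> symint a" using Icc_symint by blast
  have g: "udf UNIV (\<lambda>t. \<theta> t * f t)" by (rule udf_cutoff[OF f(1) \<theta>(1) \<theta>0 sub])
  have "S (f - restr a (\<lambda>t. \<theta> t * f t)) = 0"
  proof (rule dual_local[OF S zt d U_diff[OF f(1) restr_UNIV[OF g]]])
    fix x :: real assume "\<bar>x\<bar> < d"
    then show "(f - restr a (\<lambda>t. \<theta> t * f t)) x = 0"
      using \<theta>(2)[of x] U_off[OF f(1), of x] by (auto simp: restr_def)
  qed
  then have "rest S (\<lambda>t. \<theta> t * f t) \<noteq> 0"
    using dual_diff[OF S f(1) restr_UNIV[OF g]] f(2) by (simp add: rest_def)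
  moreover have "\<theta> x * f x = 0" if "\<bar>x\<bar> > \<delta>" for x
  proof -
    have "2 * d \<le> \<delta>" by (simp add: d_def)
    then have "\<theta> x = 0" by (intro \<theta>0) (use that in auto)
    then show ?thesis by simp
  qed
  ultimately show ?thesis using that[OF g] by blast
qed

text \<open>Zero type confines the support to \<open>{0}\<close>, and a nonzero \<open>S\<close> is
  nonzero on some bump arbitrarily close to 0. Hence \<open>conv_domain\<close> leaves
  \<open>I\<close> unchanged for such \<open>S\<close>.\<close>

lemma usupp_zero_type:
  assumes S: "S \<in> U_dual a c \<omega>" and zt: "zero_type (fourier_laplace a S)"
  shows "usupp a c \<omega> S = (if \<exists>f\<in>UU. S f \<noteq> 0 then {0} else {})"
proof (cases "\<exists>f\<in>UU. S f \<noteq> 0")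
  case False
  then have "vanishes_on a c \<omega> S (symint a)" by (auto simp: vanishes_on_def)
  then show ?thesis using False open_symint[of a] by (auto simp: usupp_def)
next
  case True
  have "vanishes_on a c \<omega> S (symint a - {0})"
    unfolding vanishes_on_def
  proof (intro ballI impI)
    fix f assume f: "f \<in> UU" and "compact (closure {x. f x \<noteq> 0}) \<and> closure {x. f x \<noteq> 0} \<subseteq> symint a - {0}"
    then have "0 \<in> - closure {x. f x \<noteq> 0}" "open (- closure {x. f x \<noteq> 0})" by auto
    then obtain e where e: "e > 0" "ball 0 e \<subseteq> - closure {x. f x \<noteq> 0}" using openE by blast
    have "f x = 0" if "\<bar>x\<bar> < e" for x
    proof -
      have "x \<in> - closure {x. f x \<noteq> 0}" using e(2) that by (auto simp: dist_norm)
      then show ?thesis using closure_subset[of "{x. f x \<noteq> 0}"] by auto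
    qed
    then show "S f = 0" by (rule dual_local[OF S zt e(1) f])
  qed
  moreover have "open (symint a - {0})" using open_symint by (intro open_Diff) auto
  ultimately have "usupp a c \<omega> S \<subseteq> {0}" unfolding usupp_def by blast
  moreover have "0 \<in> usupp a c \<omega> S"
  proof (rule ccontr)
    assume "0 \<notin> usupp a c \<omega> S"
    then obtain V where V: "open V" "0 \<in> V" "vanishes_on a c \<omega> S V" using symint_0 by (auto simp: usupp_def)
    obtain k where k: "\<bar>0\<bar> < c k" using exhausts[OF symint_0] .
    obtain e where e: "e > 0" "ball 0 e \<subseteq> V" using openE[OF V(1,2)] .
    define \<delta> where "\<delta> = min (e / 2) (c k / 2)"
    have \<delta>: "\<delta> > 0" using e k by (simp add: \<delta>_def)
    obtain h where h: "udf UNIV h" "\<forall>x. \<bar>x\<bar> > \<delta> \<longrightarrow> h x = 0" "rest S h \<noteq> 0"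
      using dual_nonzero_near_0[OF S zt True \<delta>] .
    have "restr a h x = 0" if "x \<notin> {- \<delta>..\<delta>}" for x
      using h(2)[rule_format, of x] that by (cases "\<bar>x\<bar> > \<delta>") (auto simp: restr_def)
    then have "{x. restr a h x \<noteq> 0} \<subseteq> {- \<delta>..\<delta>}" by blast
    then have cl: "closure {x. restr a h x \<noteq> 0} \<subseteq> {- \<delta>..\<delta>}" by (rule closure_minimal) simp
    then have "compact (closure {x. restr a h x \<noteq> 0})"
      by (meson bounded_closed_interval bounded_subset closed_closure compact_eq_bounded_closed)
    moreover have "{- \<delta>..\<delta>} \<subseteq> V" using e by (fastforce simp: \<delta>_def dist_norm)
    ultimately have "S (restr a h) = 0"
      using V(3) cl restr_UNIV[OF h(1)] by (auto simp: vanishes_on_def)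
    then show False using h(3) by (simp add: rest_def)
  qed
  ultimately show ?thesis using True by auto
qed

text \<open>Gives the definite description in \<open>local_conv\<close> its value: two admissible
  \<open>h\<close> agree near 0, which carries \<open>S\<close>. Any test function \<open>g\<close>
  on the line that agrees with \<open>f\<close> near \<open>y\<close> may represent
  \<open>f\<close>.\<close>

lemma local_conv_eq:
  assumes S: "S \<in> U_dual a c \<omega>" and zt: "zero_type (fourier_laplace a S)"
    and g: "udf UNIV g" and \<delta>: "\<delta> > 0" and fg: "\<And>t. \<bar>t - y\<bar> < \<delta> \<Longrightarrow> g t = f t"
  shows "local_conv a c \<omega> S f y = rest S (\<lambda>t. g (t + y))"
proof (cases "\<exists>f\<in>UU. S f \<noteq> 0")
  case True
  have supp: "usupp a c \<omega> S = {0}" using usupp_zero_type[OF S zt] True by simp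
  define h where "h = restr a (\<lambda>t. g (t + y))"
  have h: "h \<in> UU" unfolding h_def by (intro restr_UNIV udf_translate g)
  have "local_conv a c \<omega> S f y = S h"
    unfolding local_conv_def supp
  proof (rule the_equality)
    have "open (ball 0 \<delta> \<inter> symint a) \<and> {0} \<subseteq> ball 0 \<delta> \<inter> symint a \<and> (\<forall>x\<in>ball 0 \<delta> \<inter> symint a. h x = f (x + y))"
      using \<delta> symint_0 open_symint[of a] fg by (auto simp: h_def restr_def dist_norm)
    then show "\<exists>h'\<in>UU. (\<exists>V. open V \<and> {0} \<subseteq> V \<and> (\<forall>x\<in>V. h' x = f (x + y))) \<and> S h = S h'"
      using h by blast
    fix v assume "\<exists>h'\<in>UU. (\<exists>V. open V \<and> {0} \<subseteq> V \<and> (\<forall>x\<in>V. h' x = f (x + y))) \<and> v = S h'"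
    then obtain h' V where h': "h' \<in> UU" "v = S h'" and V: "open V" "0 \<in> V" "\<And>x. x \<in> V \<Longrightarrow> h' x = f (x + y)"
      by auto
    have "0 \<in> V \<inter> symint a" "open (V \<inter> symint a)" using V symint_0 open_symint[of a] by auto
    then obtain e where e: "e > 0" "ball 0 e \<subseteq> V \<inter> symint a" using openE by blast
    have "S (h' - h) = 0"
    proof (rule dual_local[OF S zt, of "min e \<delta>"])
      fix x :: real assume x: "\<bar>x\<bar> < min e \<delta>"
      then have "x \<in> V \<inter> symint a" using e(2) by (auto simp: dist_norm)
      then show "(h' - h) x = 0" using V(3)[of x] fg[of "x + y"] x by (simp add: h_def restr_def)
    qed (use e \<delta> U_diff[OF h'(1) h] in auto)
    then show "v = S h" using dual_diff[OF S h'(1) h] h'(2) by simp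
  qed
  then show ?thesis by (simp add: rest_def h_def)
next
  case False
  have supp: "usupp a c \<omega> S = {}" using usupp_zero_type[OF S zt] False by simp
  \<comment> \<open>With empty support \<open>V = {}\<close> is admissible, hence so is every
    \<open>h\<close>, and \<open>S\<close> sends all of them to 0.\<close>
  have "local_conv a c \<omega> S f y = 0"
    unfolding local_conv_def supp
    by (rule the_equality) (use False U_0 in \<open>auto intro!: bexI[of _ 0] exI[of _ "{}"]\<close>)
  moreover have "rest S (\<lambda>t. g (t + y)) = 0"
    unfolding rest_def using False restr_UNIV[OF udf_translate[OF g]] by blast
  ultimately show ?thesis by simp
qed

text \<open>For \<open>S = 0\<close> the empty support makes \<open>conv_domain\<close> the whole
  line instead of \<open>I\<close>, but then every convolution is 0 and both conditions are
  void.\<close>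

lemma ker_local_conv_eq:
  assumes S: "S \<in> U_dual a c \<omega>" and zt: "zero_type (fourier_laplace a S)"
  shows "ker_local_conv a c \<omega> S I = {f \<in> UU. \<forall>y\<in>I. local_conv a c \<omega> S f y = 0}"
proof (cases "\<exists>f\<in>UU. S f \<noteq> 0")
  case True
  then have "conv_domain a c \<omega> S I = I"
    using usupp_zero_type[OF S zt] by (simp add: conv_domain_def set_quot_def)
  then show ?thesis by (simp add: ker_local_conv_def)
next
  case False
  have supp: "usupp a c \<omega> S = {}" using usupp_zero_type[OF S zt] False by simp
  have "local_conv a c \<omega> S f y = 0" for f y
    unfolding local_conv_def supp
    by (rule the_equality) (use False U_0 in \<open>auto intro!: bexI[of _ 0] exI[of _ "{}"]\<close>)
  then show ?thesis by (simp add: ker_local_conv_def)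
qed

text \<open>\<open>\<omega> x \<le> x + C\<close> bounds both terms of the exponent by multiples of
  \<open>norm z\<close>; halving \<epsilon> leaves room for their sum.\<close>

lemma multiplier_zero_type:
  assumes "\<psi> \<in> multipliers \<omega>"
  shows "zero_type \<psi>"
  unfolding zero_type_def
proof (intro conjI allI impI)
  show "\<psi> holomorphic_on UNIV" using assms by (simp add: multipliers_def)
  fix \<epsilon> :: real assume \<epsilon>: "\<epsilon> > 0"
  define \<eta> where "\<eta> = \<epsilon> / 2"
  have \<eta>: "\<eta> > 0" using \<epsilon> by (simp add: \<eta>_def)
  obtain B where B: "\<And>z. norm (\<psi> z) * exp (- \<eta> * \<omega> (norm z) - \<eta> * \<bar>Im z\<bar>) \<le> B"
    using assms \<eta> unfolding multipliers_def bdd_above_def by auto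
  obtain C where C: "\<And>x. x \<ge> 0 \<Longrightarrow> \<omega> x \<le> 1 * x + C" using weight_sublinear[OF zero_less_one] by blast
  have "B \<ge> 0" using order_trans[OF _ B[of 0]] by simp
  have "norm (\<psi> z) \<le> (B * exp (\<eta> * C)) * exp (\<epsilon> * norm z)" for z
  proof -
    have "norm (\<psi> z) = (norm (\<psi> z) * exp (- \<eta> * \<omega> (norm z) - \<eta> * \<bar>Im z\<bar>)) * exp (\<eta> * \<omega> (norm z) + \<eta> * \<bar>Im z\<bar>)"
      by (simp add: mult.assoc flip: exp_add)
    also have "\<dots> \<le> B * exp (\<eta> * C + \<epsilon> * norm z)"
    proof (intro mult_mono B)
      have "\<eta> * \<omega> (norm z) \<le> \<eta> * (norm z + C)" using C[of "norm z"] \<eta> by (intro mult_left_mono) auto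
      moreover have "\<eta> * \<bar>Im z\<bar> \<le> \<eta> * norm z" using \<eta> abs_Im_le_cmod by (intro mult_left_mono) auto
      ultimately show "exp (\<eta> * \<omega> (norm z) + \<eta> * \<bar>Im z\<bar>) \<le> exp (\<eta> * C + \<epsilon> * norm z)"
        by (simp add: \<eta>_def algebra_simps)
    qed (use \<open>B \<ge> 0\<close> in auto)
    finally show ?thesis by (simp add: exp_add mult_ac)
  qed
  then show "\<exists>C. \<forall>z. norm (\<psi> z) \<le> C * exp (\<epsilon> * norm z)" by blast
qed

text \<open>The way back from the line to \<open>(-a;a)\<close>: with a cut-off, the local
  convolution at a point becomes an element of the dual, which supplies its linearity and continuity
  in \<open>f\<close>.\<close>

lemma cutoff_dual:
  assumes T: "ufunctional T" and \<theta>: "udf UNIV \<theta>" "\<And>x. x \<notin> {l..r} \<Longrightarrow> \<theta> x = 0" "{l..r} \<subseteq> symint a"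
  shows "(\<lambda>f. T (\<lambda>t. \<theta> (t + y) * f (t + y))) \<in> U_dual a c \<omega>"
proof -
  have u: "udf UNIV (\<lambda>t. \<theta> t * f t)" if "f \<in> UU" for f by (rule udf_cutoff[OF that \<theta>])
  note u' = udf_translate[OF u]
  obtain q L C where b: "functional_bound T q L C" using T unfolding ufunctional_def by blast
  note q = functional_boundD(1,2)[OF b]
  define q' where "q' = (q + 1) / 2"
  have q': "q < q'" "q' < 1" "0 < q'" using q by (auto simp: q'_def)
  obtain P where P: "product_const q q' P" using product_const_exists[OF q(1) q'(1)] .
  have "P > 0" using P unfolding product_const_def by auto
  obtain B where B: "B > 0" "\<And>j x. x \<in> {l..r} \<Longrightarrow> norm (nd j \<theta> x) \<le> B * M q' j"
    using udf_bound[OF \<theta>(1) q'(3,2) compact_Icc subset_UNIV] by blast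
  obtain k where k: "{l..r} \<subseteq> {- c k..c k}" using exhausts_compact[OF compact_Icc \<theta>(3)] .
  have bound: "norm (T (\<lambda>t. \<theta> (t + y) * f (t + y))) \<le> (C * (P * B)) * s" if f: "f \<in> UU" "ubound q' k s f" for f s
  proof -
    have "norm (T (\<lambda>t. \<theta> (t + y) * f (t + y))) \<le> C * (P * B * s)"
    proof (rule functional_boundD(5)[OF b u'[OF f(1)]])
      fix j x
      have "nd j (\<lambda>t. \<theta> (t + y) * f (t + y)) x = nd j (\<lambda>t. \<theta> t * f t) (x + y)"
        by (rule nd_translate(1)[OF udf_smooth[OF u[OF f(1)]]])
      moreover have "norm (nd j (\<lambda>t. \<theta> t * f t) (x + y)) \<le> P * B * s * M q j"
      proof (cases "x + y \<in> {l..r}")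
        case True
        then have sx: "x + y \<in> symint a" and kx: "\<bar>x + y\<bar> \<le> c k" using \<theta>(3) k by auto
        show ?thesis
          by (rule product_constD[OF P open_symint _ udf_smooth[OF U_udf[OF f(1)]] sx])
            (use B True f(2) kx smooth_fun_subset[OF udf_smooth[OF \<theta>(1)]] in \<open>auto simp: ubound_def\<close>)
      next
        case False
        have "open (- {l..r})" by (simp add: open_Compl)
        from nd_eq_0[OF this, of "\<lambda>t. \<theta> t * f t" "x + y" j]
        show ?thesis using \<theta>(2) False \<open>P > 0\<close> B(1) ubound_nonneg[OF f(2)] M_pos[of q j] by simp
      qed
      ultimately show "norm (nd j (\<lambda>t. \<theta> (t + y) * f (t + y)) x) \<le> P * B * s * M q j" by simp
    qed
    then show ?thesis by (simp add: mult_ac)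
  qed
  show ?thesis
  proof (rule dual_I)
    show "dual_bound (\<lambda>f. T (\<lambda>t. \<theta> (t + y) * f (t + y))) q' k (C * (P * B))"
      unfolding dual_bound_def using q' bound functional_boundD(4)[OF b] \<open>P > 0\<close> B(1) by auto
    fix f g assume "f \<in> UU" "g \<in> UU"
    then show "T (\<lambda>t. \<theta> (t + y) * (f + g) (t + y)) = T (\<lambda>t. \<theta> (t + y) * f (t + y)) + T (\<lambda>t. \<theta> (t + y) * g (t + y))"
      using ufunctional_add[OF T u' u'] by (simp add: distrib_left)
  next
    fix f z assume "f \<in> UU"
    then show "T (\<lambda>t. \<theta> (t + y) * cscale z f (t + y)) = z * T (\<lambda>t. \<theta> (t + y) * f (t + y))"
      using ufunctional_cmult[OF T u', of f z] by (simp add: cscale_def mult_ac)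
  qed
qed

end

section \<open>Separation in the space of ultradifferentiable functions\<close>

context ultra_setting
begin

text \<open>The seminorm as a real number, as the real Hahn-Banach argument needs it. The infimum is
  attained (\<open>ubound_least_bound\<close>).\<close>

definition least_bound :: "real \<Rightarrow> nat \<Rightarrow> (real \<Rightarrow> complex) \<Rightarrow> real" where
  "least_bound q k v = Inf {r. ubound q k r v}"

lemma least_bound_le: "ubound q k r v \<Longrightarrow> least_bound q k v \<le> r"
  unfolding least_bound_def by (rule cInf_lower) (auto intro: ubound_nonneg bdd_belowI[of _ 0])

lemma ubound_least_bound:
  assumes "v \<in> UU" "0 < q" "q < 1"
  shows "ubound q k (least_bound q k v) v"
  unfolding ubound_def
proof (intro allI impI)
  fix j x assume x: "\<bar>x\<bar> \<le> c k"
  obtain r where r: "ubound q k r v" using ubound_exists[OF assms] by blast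
  have "norm (nd j v x) / M q j \<le> least_bound q k v"
    unfolding least_bound_def
    by (rule cInf_greatest) (use r x M_pos[of q j] in \<open>auto simp: ubound_def field_simps\<close>)
  then show "norm (nd j v x) \<le> least_bound q k v * M q j" using M_pos[of q j] by (simp add: field_simps)
qed

lemma least_bound_cscale:
  assumes "v \<in> UU" "0 < q" "q < 1"
  shows "least_bound q k (cscale z v) = norm z * least_bound q k v"
proof -
  have le: "least_bound q k (cscale z v) \<le> norm z * least_bound q k v" if "v \<in> UU" for z v
    by (intro least_bound_le ubound_cscale ubound_least_bound that assms)
  show ?thesis
  proof (cases "z = 0")
    case True
    then show ?thesis
      using le[OF assms(1), of z] ubound_nonneg[OF ubound_least_bound[OF U_cscale[OF assms(1), of z] assms(2,3), of k]] by simp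
  next
    case False
    have "cscale (inverse z) (cscale z v) = v" using False by (simp add: cscale_def fun_eq_iff)
    then have "least_bound q k v \<le> norm (inverse z) * least_bound q k (cscale z v)"
      using le[OF U_cscale[OF assms(1), of z], of "inverse z"] by simp
    then have "norm z * least_bound q k v \<le> least_bound q k (cscale z v)"
      unfolding norm_inverse using False by (simp add: field_simps)
    then show ?thesis using le[OF assms(1), of z] by simp
  qed
qed

text \<open>A point outside the closure has a neighbourhood, given by one seminorm, that misses
  \<open>E\<close>; so it has positive distance from \<open>E\<close> in that seminorm.\<close>

lemma dual_separation:
  assumes E: "E \<subseteq> UU" "cfun.subspace E" and f: "f \<in> UU" "f \<notin> TU closure_of E"
  obtains T where "T \<in> U_dual a c \<omega>" "\<And>g. g \<in> E \<Longrightarrow> T g = 0" "T f \<noteq> 0"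
proof -
  have "openin TU (UU - TU closure_of E)" using closedin_closure_of openin_diff openin_topspace topspace_TU by metis
  then obtain q k e where q: "0 < q" "q < 1" "0 < e" and sub: "unbhd f q k e \<subseteq> UU - TU closure_of E"
    using openin_TU_nbhd[of _ f] f by blast
  have "E \<subseteq> TU closure_of E" by (rule closure_of_subset) (use E topspace_TU in auto)
  then have disj: "unbhd f q k e \<inter> E = {}" using sub by blast
  let ?p = "least_bound q k"
  let ?s = "\<lambda>r. cscale (complex_of_real r)"
  interpret sublinear_space ?s UU
  proof -
    interpret vs: vector_space ?s
      by unfold_locales (auto simp: cscale_def fun_eq_iff algebra_simps)
    show "sublinear_space ?s UU"
      by unfold_locales (auto simp: vs.subspace_def U_0 intro: U_add U_cscale)
  qed
  have p: "sublinear ?p"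
    unfolding sublinear_def
  proof (intro conjI ballI allI impI)
    show "?p (x + y) \<le> ?p x + ?p y" if "x \<in> UU" "y \<in> UU" for x y
      by (intro least_bound_le ubound_add ubound_least_bound that q)
    show "?p (?s r x) = r * ?p x" if "x \<in> UU" "r \<ge> 0" for x r
      using least_bound_cscale[OF that(1) q(1,2), of k "complex_of_real r"] that(2) by simp
  qed
  have pos: "0 \<le> ?p v" if "v \<in> UU" for v by (rule ubound_nonneg[OF ubound_least_bound[OF that q(1,2)]])
  have subE: "subspace E"
    using E(2) unfolding subspace_def cfun.subspace_def by auto
  have far: "e \<le> ?p (f + g)" if g: "g \<in> E" for g
  proof (rule ccontr)
    assume lt: "\<not> e \<le> ?p (f + g)"
    have gU: "g \<in> UU" using g E by blast
    have mg: "cscale (- 1) g \<in> E" using E(2) g unfolding cfun.subspace_def by blast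
    have eq: "cscale (- 1) g - f = cscale (- 1) (f + g)" by (simp add: cscale_def fun_eq_iff)
    have "ubound q k (norm (- 1 :: complex) * ?p (f + g)) (cscale (- 1) g - f)"
      unfolding eq by (intro ubound_cscale ubound_least_bound U_add f gU q)
    moreover have "norm (- 1 :: complex) * ?p (f + g) < e" using lt by simp
    ultimately have "cscale (- 1) g \<in> unbhd f q k e"
      unfolding unbhd_def mem_Collect_eq using U_cscale[OF gU] by blast
    then show False using mg disj by blast
  qed
  obtain u where u: "\<And>v. v \<in> UU \<Longrightarrow> u v \<le> ?p v" and add: "\<And>v w. v \<in> UU \<Longrightarrow> w \<in> UU \<Longrightarrow> u (v + w) = u v + u w"
    and sc: "\<And>r v. v \<in> UU \<Longrightarrow> u (?s r v) = r * u v" and uE: "\<And>v. v \<in> E \<Longrightarrow> u v = 0" and uf: "u f > 0"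
    using separating_functional[OF p pos subE E(1) f(1) q(3) far] by blast
  have abs: "\<bar>u v\<bar> \<le> ?p v" if "v \<in> UU" for v
    using u[OF that] u[OF U_cscale[OF that, of "- 1"]] sc[OF that, of "- 1"] least_bound_cscale[OF that q(1,2), of k "- 1"]
    by (simp add: abs_le_iff)
  \<comment> \<open>The usual complexification of the real linear \<open>u\<close>: complex linear
    with real part \<open>u\<close>.\<close>
  define T where "T v = complex_of_real (u v) - \<i> * complex_of_real (u (cscale \<i> v))" for v
  have iU: "cscale \<i> v \<in> UU" if "v \<in> UU" for v by (rule U_cscale[OF that])
  have "T \<in> U_dual a c \<omega>"
  proof (rule dual_I)
    have "norm (T v) \<le> 2 * r" if v: "v \<in> UU" "ubound q k r v" for v r
    proof -
      have "norm (T v) \<le> \<bar>u v\<bar> + \<bar>u (cscale \<i> v)\<bar>"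
        unfolding T_def using norm_triangle_ineq4[of "complex_of_real (u v)" "\<i> * complex_of_real (u (cscale \<i> v))"]
        by (simp add: norm_mult)
      also have "\<dots> \<le> ?p v + ?p (cscale \<i> v)" by (intro add_mono abs v iU)
      also have "\<dots> = 2 * ?p v" using least_bound_cscale[OF v(1) q(1,2), of k \<i>] by simp
      also have "\<dots> \<le> 2 * r" using least_bound_le[OF v(2)] by simp
      finally show ?thesis .
    qed
    then show "dual_bound T q k 2" using q unfolding dual_bound_def by auto
    show "T (v + w) = T v + T w" if "v \<in> UU" "w \<in> UU" for v w
    proof -
      have "cscale \<i> (v + w) = cscale \<i> v + cscale \<i> w" by (simp add: cscale_def fun_eq_iff distrib_left)
      then show ?thesis using that iU by (simp add: T_def add algebra_simps)
    qed
    show "T (cscale z v) = z * T v" if v: "v \<in> UU" for z v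
    proof -
      have z: "cscale z v = ?s (Re z) v + ?s (Im z) (cscale \<i> v)"
        by (simp add: cscale_def fun_eq_iff complex_eq_iff)
      have iz: "cscale \<i> (cscale z v) = ?s (- Im z) v + ?s (Re z) (cscale \<i> v)"
        by (simp add: cscale_def fun_eq_iff complex_eq_iff)
      have "u (cscale z v) = Re z * u v + Im z * u (cscale \<i> v)"
        unfolding z add[OF U_cscale[OF v] U_cscale[OF iU[OF v]]] sc[OF v] sc[OF iU[OF v]] ..
      moreover have "u (cscale \<i> (cscale z v)) = - Im z * u v + Re z * u (cscale \<i> v)"
        unfolding iz add[OF U_cscale[OF v] U_cscale[OF iU[OF v]]] sc[OF v] sc[OF iU[OF v]] ..
      ultimately show ?thesis by (simp add: T_def complex_eq_iff)
    qed
  qed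
  moreover have "T g = 0" if "g \<in> E" for g
  proof -
    have "cscale \<i> g \<in> E" using E(2) that unfolding cfun.subspace_def by blast
    then show ?thesis using uE that by (simp add: T_def)
  qed
  moreover have "T f \<noteq> 0" using uf by (simp add: T_def complex_eq_iff)
  ultimately show ?thesis using that by blast
qed

end

section \<open>Weak spectral synthesis\<close>

lemma (in ultra_weight) ufunctional_0: "ufunctional T \<Longrightarrow> T (\<lambda>_. 0) = 0"
  using ufunctional_cmult[OF _ udf_0, of T 0] by simp

lemma (in ultra_weight) ufunctional_sum:
  assumes "ufunctional T" "finite F" "\<And>i. i \<in> F \<Longrightarrow> udf UNIV (f i)"
  shows "udf UNIV (\<lambda>t. \<Sum>i\<in>F. f i t) \<and> T (\<lambda>t. \<Sum>i\<in>F. f i t) = (\<Sum>i\<in>F. T (f i))"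
  using assms(2,3)
proof (induction F rule: finite_induct)
  case empty
  then show ?case using ufunctional_0[OF assms(1)] udf_0 by simp
next
  case (insert i F)
  then show ?case
    using ufunctional_add[OF assms(1), of "f i" "\<lambda>t. \<Sum>i\<in>F. f i t"] udf_add[OF open_UNIV, of "f i" "\<lambda>t. \<Sum>i\<in>F. f i t"]
    by simp
qed

lemma (in ultra_weight) udf_exp_poly: "udf V (\<lambda>t. of_real t ^ j * exp (- \<i> * l * of_real t))"
  by (rule udf_entire[of "\<lambda>w. w ^ j * exp (- \<i> * l * w)"]) (intro holomorphic_intros)

text \<open>Covers the zero function as well, where all derivatives vanish and the multiplicity is
  infinite.\<close>

lemma zero_mult_gt_iff:
  assumes "\<phi> holomorphic_on UNIV"
  shows "enat j < zero_mult \<phi> l \<longleftrightarrow> (\<forall>i\<le>j. (deriv ^^ i) \<phi> l = 0)"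
proof (cases "\<forall>z. \<phi> z = 0")
  case True
  then have "\<phi> = (\<lambda>_. 0)" by auto
  then show ?thesis by (simp add: zero_mult_def)
next
  case False
  then obtain w where w: "\<phi> w \<noteq> 0" by blast
  have "j < nat (zorder \<phi> l) \<longleftrightarrow> (\<forall>i\<le>j. (deriv ^^ i) \<phi> l = 0)"
    using entire_order(2)[OF assms w, where l = l] entire_order(3)[OF assms w, where l = l]
    by (meson le_less_trans not_le)
  then show ?thesis using w by (auto simp: zero_mult_def)
qed

lemma polynomial_infinite_zeros:
  fixes b :: "nat \<Rightarrow> complex"
  assumes "infinite X" "\<And>y. y \<in> X \<Longrightarrow> (\<Sum>i\<le>n. b i * complex_of_real y ^ (n - i)) = 0" "i \<le> n"
  shows "b i = 0"
proof (rule ccontr)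
  assume "b i \<noteq> 0"
  then have "\<exists>k\<le>n. b (n - k) \<noteq> 0" using assms(3) by (intro exI[of _ "n - i"]) auto
  then have fin: "finite {z. (\<Sum>k\<le>n. b (n - k) * z ^ k) = 0}"
    using polyfun_finite_roots[where n = n and c = "\<lambda>k. b (n - k)"] by blast
  have "(\<Sum>k\<le>n. b (n - k) * z ^ k) = (\<Sum>i\<le>n. b i * z ^ (n - i))" for z
    by (rule sum.reindex_bij_witness[of _ "\<lambda>i. n - i" "\<lambda>i. n - i"]) auto
  then have "complex_of_real ` X \<subseteq> {z. (\<Sum>k\<le>n. b (n - k) * z ^ k) = 0}" using assms(2) by auto
  then have "finite (complex_of_real ` X)" using fin by (rule finite_subset)
  then show False using assms(1) finite_imageD[OF _ inj_on_subset[OF inj_of_real subset_UNIV]] by blast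
qed

text \<open>The interior of \<open>I\<close> gives room for a cut point and infinitely many points
  to test polynomials; a nonzero \<open>S \<alpha>\<close> gives a transform with isolated zeros and
  hence finite multiplicities.\<close>

locale synthesis_setting = ultra_setting \<omega> a c for \<omega> a c +
  fixes I :: "real set" and A :: "'i set" and S :: "'i \<Rightarrow> (real \<Rightarrow> complex) \<Rightarrow> complex" and W
  assumes I: "rel_closed_interval a I" "interior I \<noteq> {}"
    and dual: "\<And>\<alpha>. \<alpha> \<in> A \<Longrightarrow> S \<alpha> \<in> U_dual a c \<omega>"
    and nonzero: "\<exists>\<alpha>\<in>A. \<exists>f\<in>U a c \<omega>. S \<alpha> f \<noteq> 0"
    and mult: "\<And>\<alpha>. \<alpha> \<in> A \<Longrightarrow> fourier_laplace a (S \<alpha>) \<in> multipliers \<omega>"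
    and W_def: "W = (\<Inter>\<alpha>\<in>A. ker_local_conv a c \<omega> (S \<alpha>) I)"
begin

abbreviation "\<phi> \<alpha> \<equiv> fourier_laplace a (S \<alpha>)"
abbreviation "T \<alpha> \<equiv> rest (S \<alpha>)"

lemma I_symint: "I \<subseteq> symint a"
  using I(1) closedin_subset by (fastforce simp: rel_closed_interval_def)

lemma I_convex: "convex I"
  using I(1) by (simp add: rel_closed_interval_def is_interval_convex)

lemma \<phi>_zero_type: "\<alpha> \<in> A \<Longrightarrow> zero_type (\<phi> \<alpha>)"
  by (rule multiplier_zero_type[OF mult])

lemma T_ufunctional: "\<alpha> \<in> A \<Longrightarrow> ufunctional (T \<alpha>)"
  by (rule rest_ufunctional[OF dual])

lemma W_iff: "f \<in> W \<longleftrightarrow> f \<in> UU \<and> (\<forall>\<alpha>\<in>A. \<forall>y\<in>I. local_conv a c \<omega> (S \<alpha>) f y = 0)"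
  using nonzero unfolding W_def by (auto simp: ker_local_conv_eq[OF dual \<phi>_zero_type])

text \<open>One cut-off serves all points near \<open>y\<close>, so that local convolution extends
  smoothly across \<open>y\<close> even if \<open>y\<close> is an end point of
  \<open>I\<close>.\<close>

definition cutoff_at :: "real \<Rightarrow> (real \<Rightarrow> complex) \<Rightarrow> real \<Rightarrow> bool" where
  "cutoff_at y \<theta> \<delta> \<longleftrightarrow> \<delta> > 0 \<and> udf UNIV \<theta> \<and> (\<forall>t. \<bar>t - y\<bar> < \<delta> \<longrightarrow> \<theta> t = 1) \<and>
     (\<exists>l r. {l..r} \<subseteq> symint a \<and> (\<forall>x. x \<notin> {l..r} \<longrightarrow> \<theta> x = 0))"

lemma cutoff_at_exists:
  assumes "y \<in> symint a"
  obtains \<theta> \<delta> where "cutoff_at y \<theta> \<delta>"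
proof -
  have "{y..y} \<subseteq> symint a" using assms by simp
  obtain \<theta> \<delta> where \<theta>: "\<delta> > 0" "udf UNIV \<theta>" "\<forall>x. y - \<delta> \<le> x \<longrightarrow> x \<le> y + \<delta> \<longrightarrow> \<theta> x = 1"
    "\<forall>x. x \<notin> {y - 2 * \<delta>..y + 2 * \<delta>} \<longrightarrow> \<theta> x = 0" "{y - 2 * \<delta>..y + 2 * \<delta>} \<subseteq> symint a"
    using symint_cutoff[OF order_refl \<open>{y..y} \<subseteq> symint a\<close>] .
  have "\<theta> t = 1" if "\<bar>t - y\<bar> < \<delta>" for t using \<theta>(3) that by (auto simp: abs_less_iff)
  then have "cutoff_at y \<theta> \<delta>" unfolding cutoff_at_def using \<theta> by blast
  then show ?thesis by (rule that)
qed

lemma cutoff_atD: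
  assumes "cutoff_at y \<theta> \<delta>"
  shows "\<delta> > 0" "udf UNIV \<theta>" "\<bar>t - y\<bar> < \<delta> \<Longrightarrow> \<theta> t = 1" "f \<in> UU \<Longrightarrow> udf UNIV (\<lambda>t. \<theta> t * f t)"
    and "ufunctional R \<Longrightarrow> (\<lambda>f. R (\<lambda>t. \<theta> (t + s) * f (t + s))) \<in> U_dual a c \<omega>"
proof -
  obtain l r where lr: "{l..r} \<subseteq> symint a" "\<And>x. x \<notin> {l..r} \<Longrightarrow> \<theta> x = 0"
    using assms unfolding cutoff_at_def by blast
  show "\<delta> > 0" "udf UNIV \<theta>" "\<bar>t - y\<bar> < \<delta> \<Longrightarrow> \<theta> t = 1" using assms unfolding cutoff_at_def by auto
  then show "f \<in> UU \<Longrightarrow> udf UNIV (\<lambda>t. \<theta> t * f t)" using udf_cutoff lr by blast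
  show "ufunctional R \<Longrightarrow> (\<lambda>f. R (\<lambda>t. \<theta> (t + s) * f (t + s))) \<in> U_dual a c \<omega>"
    by (rule cutoff_dual[OF _ \<open>udf UNIV \<theta>\<close> lr(2,1)])
qed

lemma local_conv_cutoff:
  assumes \<alpha>: "\<alpha> \<in> A" and \<theta>: "cutoff_at y \<theta> \<delta>" and f: "f \<in> UU" and s: "\<bar>s - y\<bar> < \<delta>"
  shows "local_conv a c \<omega> (S \<alpha>) f s = T \<alpha> (\<lambda>t. \<theta> (t + s) * f (t + s))"
proof (rule local_conv_eq[OF dual[OF \<alpha>] \<phi>_zero_type[OF \<alpha>] cutoff_atD(4)[OF \<theta> f], of "\<delta> - \<bar>s - y\<bar>"])
  show "\<theta> t * f t = f t" if "\<bar>t - s\<bar> < \<delta> - \<bar>s - y\<bar>" for t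
    using cutoff_atD(3)[OF \<theta>, of t] that by simp
qed (use s in simp)

section \<open>The kernel as a closed invariant subspace, and its residual interval\<close>

lemma W_subspace: "cfun.subspace W"
proof -
  have lc: "local_conv a c \<omega> (S \<alpha>) 0 y = 0"
    "f \<in> UU \<Longrightarrow> g \<in> UU \<Longrightarrow> local_conv a c \<omega> (S \<alpha>) (f + g) y = local_conv a c \<omega> (S \<alpha>) f y + local_conv a c \<omega> (S \<alpha>) g y"
    "f \<in> UU \<Longrightarrow> local_conv a c \<omega> (S \<alpha>) (cscale z f) y = z * local_conv a c \<omega> (S \<alpha>) f y"
    if \<alpha>: "\<alpha> \<in> A" and y: "y \<in> I" for \<alpha> y f g z
  proof -
    obtain \<theta> \<delta> where \<theta>: "cutoff_at y \<theta> \<delta>" using cutoff_at_exists I_symint y by blast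
    have eq: "local_conv a c \<omega> (S \<alpha>) h y = T \<alpha> (\<lambda>t. \<theta> (t + y) * h (t + y))" if "h \<in> UU" for h
      by (rule local_conv_cutoff[OF \<alpha> \<theta> that]) (use cutoff_atD(1)[OF \<theta>] in simp)
    note L = cutoff_atD(5)[OF \<theta> T_ufunctional[OF \<alpha>], of y]
    show add: "local_conv a c \<omega> (S \<alpha>) (f + g) y = local_conv a c \<omega> (S \<alpha>) f y + local_conv a c \<omega> (S \<alpha>) g y"
      if "f \<in> UU" "g \<in> UU"
      using dual_add[OF L that] that by (simp add: eq U_add)
    show "local_conv a c \<omega> (S \<alpha>) (cscale z f) y = z * local_conv a c \<omega> (S \<alpha>) f y" if "f \<in> UU"
      using dual_cscale[OF L that, of z] by (simp add: eq that U_cscale)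
    show "local_conv a c \<omega> (S \<alpha>) 0 y = 0"
      using eq[OF U_0] ufunctional_0[OF T_ufunctional[OF \<alpha>]] by simp
  qed
  show ?thesis
    unfolding cfun.subspace_def by (simp add: W_iff U_0 U_add U_cscale lc)
qed

lemma W_closed: "closedin TU W"
proof -
  have "openin TU (UU - W)"
  proof (subst openin_subopen, intro ballI)
    fix f assume "f \<in> UU - W"
    then obtain \<alpha> y where f: "f \<in> UU" and \<alpha>: "\<alpha> \<in> A" and y: "y \<in> I" and nz: "local_conv a c \<omega> (S \<alpha>) f y \<noteq> 0"
      using W_iff by blast
    obtain \<theta> \<delta> where \<theta>: "cutoff_at y \<theta> \<delta>" using cutoff_at_exists I_symint y by blast
    define L where "L f = T \<alpha> (\<lambda>t. \<theta> (t + y) * f (t + y))" for f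
    have eq: "local_conv a c \<omega> (S \<alpha>) h y = L h" if "h \<in> UU" for h
      unfolding L_def by (rule local_conv_cutoff[OF \<alpha> \<theta> that]) (use cutoff_atD(1)[OF \<theta>] in simp)
    have "continuous_map TU euclidean L"
      using cutoff_atD(5)[OF \<theta> T_ufunctional[OF \<alpha>], of y] by (simp add: U_dual_def L_def[abs_def])
    then have "openin TU {h \<in> topspace TU. L h \<in> - {0}}"
      by (rule openin_continuous_map_preimage) (simp add: open_Compl)
    moreover have "f \<in> {h \<in> topspace TU. L h \<in> - {0}}" using f nz eq by (simp add: topspace_TU)
    moreover have "L h = 0" if "h \<in> W" for h
      using eq[of h] that \<alpha> y by (simp add: W_iff)
    then have "{h \<in> topspace TU. L h \<in> - {0}} \<subseteq> UU - W" by (auto simp: topspace_TU)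
    ultimately show "\<exists>N. openin TU N \<and> f \<in> N \<and> N \<subseteq> UU - W" by blast
  qed
  then show ?thesis using W_iff by (auto simp: closedin_def topspace_TU)
qed

lemma I_limpt: "y \<in> I \<Longrightarrow> y islimpt I"
proof (rule connected_imp_perfect[OF convex_connected[OF I_convex]])
  show "I \<noteq> {x}" for x using I(2) by auto
qed

text \<open>The local convolution of \<open>D f\<close> at \<open>y\<close> is the derivative at
  \<open>y\<close> of that of \<open>f\<close>, which is zero along \<open>I\<close>. As
  \<open>y\<close> may be an end point, the derivative is taken within \<open>I\<close>, where no
  point is isolated.\<close>

lemma W_D_invariant: "D a ` W \<subseteq> W"
proof (rule image_subsetI)
  fix f assume f: "f \<in> W"
  then have fU: "f \<in> UU" using W_iff by blast
  have Df: "D a f = restr a (vd f)" by (simp add: D_def vd_def restr_def fun_eq_iff)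
  have DU: "D a f \<in> UU" unfolding Df by (intro restr_U udf_vd U_udf fU)
  have "local_conv a c \<omega> (S \<alpha>) (D a f) y = 0" if \<alpha>: "\<alpha> \<in> A" and y: "y \<in> I" for \<alpha> y
  proof -
    have ys: "y \<in> symint a" using y I_symint by blast
    obtain \<theta> \<delta> where \<theta>: "cutoff_at y \<theta> \<delta>" using cutoff_at_exists[OF ys] .
    obtain e where e: "e > 0" "ball y e \<subseteq> symint a" using openE[OF open_symint ys] .
    define g where "g t = \<theta> t * f t" for t
    have g: "udf UNIV g" unfolding g_def by (rule cutoff_atD(4)[OF \<theta> fU])
    have "local_conv a c \<omega> (S \<alpha>) (D a f) y = T \<alpha> (\<lambda>t. vd g (t + y))"
    proof (rule local_conv_eq[OF dual[OF \<alpha>] \<phi>_zero_type[OF \<alpha>] udf_vd[OF g], of "min e \<delta>"])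
      fix t assume t: "\<bar>t - y\<bar> < min e \<delta>"
      have "nd 1 g t = nd 1 f t"
      proof (rule nd_cong[of "{y - \<delta><..<y + \<delta>}"])
        show "g s = f s" if "s \<in> {y - \<delta><..<y + \<delta>}" for s
          using cutoff_atD(3)[OF \<theta>, of s] that by (simp add: g_def abs_less_iff)
      qed (use t in \<open>auto simp: abs_less_iff\<close>)
      moreover have "t \<in> symint a" using e(2) t by (auto simp: dist_real_def abs_minus_commute)
      ultimately show "vd g t = D a f t" by (simp add: Df restr_def)
    qed (use e cutoff_atD(1)[OF \<theta>] in simp)
    moreover have "T \<alpha> (\<lambda>t. vd g (t + y)) = 0"
    proof (rule vector_derivative_unique_within)
      show "at y within I \<noteq> bot" using I_limpt[OF y] by (simp add: trivial_limit_within)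
      show "((\<lambda>s. T \<alpha> (\<lambda>t. g (t + s))) has_vector_derivative T \<alpha> (\<lambda>t. vd g (t + y))) (at y within I)"
        by (rule has_vector_derivative_at_within[OF translate_derivative[OF T_ufunctional[OF \<alpha>] g]])
      show "((\<lambda>s. T \<alpha> (\<lambda>t. g (t + s))) has_vector_derivative 0) (at y within I)"
      proof (rule has_vector_derivative_transform_within[OF has_vector_derivative_const cutoff_atD(1)[OF \<theta>] y])
        fix s assume "s \<in> I" "dist s y < \<delta>"
        then show "0 = T \<alpha> (\<lambda>t. g (t + s))"
          using local_conv_cutoff[OF \<alpha> \<theta> fU, of s] f \<alpha> by (simp add: g_def W_iff dist_real_def)
      qed
    qed
    ultimately show ?thesis by simp
  qed
  then show "D a f \<in> W" using DU W_iff by blast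
qed

text \<open>Near an interior point of \<open>I\<close> the function vanishes identically. Near an
  end point it need not, and the value there follows by continuity from the interior.\<close>

lemma W_vanish_subset: "W_vanish a c \<omega> I \<subseteq> W"
proof
  fix f assume "f \<in> W_vanish a c \<omega> I"
  then have f: "f \<in> UU" "\<And>x. x \<in> I \<Longrightarrow> f x = 0" by (auto simp: W_vanish_def)
  have int: "local_conv a c \<omega> (S \<alpha>) f y = 0" if \<alpha>: "\<alpha> \<in> A" and y: "y \<in> interior I" for \<alpha> y
  proof -
    obtain e where e: "e > 0" "ball y e \<subseteq> interior I" using openE[OF open_interior y] .
    have "local_conv a c \<omega> (S \<alpha>) f y = T \<alpha> (\<lambda>t. 0)"
    proof (rule local_conv_eq[OF dual[OF \<alpha>] \<phi>_zero_type[OF \<alpha>] udf_0 e(1)])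
      fix t assume "\<bar>t - y\<bar> < e"
      then have "t \<in> ball y e" by (simp add: dist_real_def abs_minus_commute)
      then show "0 = f t" using e(2) interior_subset f(2) by fastforce
    qed
    then show ?thesis using ufunctional_0[OF T_ufunctional[OF \<alpha>]] by simp
  qed
  have "local_conv a c \<omega> (S \<alpha>) f y = 0" if \<alpha>: "\<alpha> \<in> A" and y: "y \<in> I" for \<alpha> y
  proof -
    obtain \<theta> \<delta> where \<theta>: "cutoff_at y \<theta> \<delta>" using cutoff_at_exists I_symint y by blast
    define k where "k s = T \<alpha> (\<lambda>t. \<theta> (t + s) * f (t + s))" for s
    have eq: "local_conv a c \<omega> (S \<alpha>) f s = k s" if "\<bar>s - y\<bar> < \<delta>" for s
      unfolding k_def by (rule local_conv_cutoff[OF \<alpha> \<theta> f(1) that])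
    have "continuous_on UNIV k"
      unfolding k_def by (rule translate_continuous[OF T_ufunctional[OF \<alpha>] cutoff_atD(4)[OF \<theta> f(1)]])
    then have "closed {s. k s = 0}" by (intro closed_Collect_eq continuous_on_const)
    moreover have "ball y \<delta> \<inter> interior I \<subseteq> {s. k s = 0}"
    proof
      fix s assume "s \<in> ball y \<delta> \<inter> interior I"
      then show "s \<in> {s. k s = 0}"
        using int[OF \<alpha>, of s] eq[of s] by (simp add: dist_real_def abs_minus_commute)
    qed
    ultimately have "closure (ball y \<delta> \<inter> interior I) \<subseteq> {s. k s = 0}" by (rule closure_minimal[rotated])
    moreover have "y \<in> closure (interior I)"
      unfolding convex_closure_interior[OF I_convex I(2)] using y closure_subset by blast
    then have "y \<in> closure (ball y \<delta> \<inter> interior I)"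
      using open_Int_closure_subset[OF open_ball, of y \<delta> "interior I"] cutoff_atD(1)[OF \<theta>] by auto
    ultimately show ?thesis using eq[of y] cutoff_atD(1)[OF \<theta>] by auto
  qed
  then show "f \<in> W" using f W_iff by blast
qed

text \<open>A bump near 0 on which some \<open>S \<alpha>\<close> is nonzero is moved to an interior
  point of \<open>I\<close> off \<open>J\<close>. The assumption
  \<open>\<not> I \<subseteq> J\<close>, weaker than \<open>J \<subset> I\<close>, also yields
  uniqueness of the residual interval.\<close>

lemma W_vanish_not_subset:
  assumes J: "rel_closed_interval a J" "\<not> I \<subseteq> J"
  shows "W_vanish a c \<omega> J - W \<noteq> {}"
proof -
  obtain C where C: "closed C" "J = symint a \<inter> C"
    using J(1) by (auto simp: rel_closed_interval_def closedin_closed)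
  obtain x where x: "x \<in> I" "x \<notin> J" using J(2) by blast
  have "open (symint a - C)" "x \<in> symint a - C" using C x I_symint open_symint[of a] by auto
  moreover have "x \<in> closure (interior I)"
    unfolding convex_closure_interior[OF I_convex I(2)] using x closure_subset by blast
  ultimately have "(symint a - C) \<inter> interior I \<noteq> {}"
    by (meson disjoint_iff open_Int_closure_eq_empty)
  then obtain y where y: "y \<in> symint a - C" "y \<in> interior I" by blast
  have "open ((symint a - C) \<inter> interior I)" using \<open>open (symint a - C)\<close> by auto
  then obtain e where e: "e > 0" "ball y e \<subseteq> (symint a - C) \<inter> interior I" using openE y by blast
  obtain \<alpha> where \<alpha>: "\<alpha> \<in> A" "\<exists>f\<in>UU. S \<alpha> f \<noteq> 0" using nonzero by blast
  have "e / 2 > 0" using e by simp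
  obtain h where h: "udf UNIV h" "\<forall>x. \<bar>x\<bar> > e / 2 \<longrightarrow> h x = 0" "T \<alpha> h \<noteq> 0"
    using dual_nonzero_near_0[OF dual[OF \<alpha>(1)] \<phi>_zero_type[OF \<alpha>(1)] \<alpha>(2) \<open>e / 2 > 0\<close>] .
  define g where "g t = h (t + - y)" for t
  have g: "udf UNIV g" unfolding g_def by (rule udf_translate[OF h(1)])
  have "local_conv a c \<omega> (S \<alpha>) (restr a g) y = T \<alpha> (\<lambda>t. g (t + y))"
  proof (rule local_conv_eq[OF dual[OF \<alpha>(1)] \<phi>_zero_type[OF \<alpha>(1)] g e(1)])
    fix t assume "\<bar>t - y\<bar> < e"
    then have "t \<in> ball y e" by (simp add: dist_real_def abs_minus_commute)
    then show "g t = restr a g t" using e(2) by (auto simp: restr_def)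
  qed
  also have "\<dots> = T \<alpha> h" by (simp add: g_def)
  finally have "restr a g \<notin> W" using W_iff \<alpha>(1) y(2) interior_subset h(3) by fastforce
  moreover have "restr a g \<in> W_vanish a c \<omega> J"
  proof -
    have "g t = 0" if "t \<in> J" for t
    proof -
      have "t \<notin> ball y e" using e(2) that C(2) by blast
      then show ?thesis using h(2) e(1) by (auto simp: g_def dist_real_def abs_minus_commute)
    qed
    then show ?thesis using restr_UNIV[OF g] by (auto simp: W_vanish_def restr_def)
  qed
  ultimately show ?thesis by blast
qed

lemma residual: "is_residual_interval a c \<omega> W I"
  unfolding is_residual_interval_def using I(1) W_vanish_subset W_vanish_not_subset by blast

lemma residual_unique: "residual_interval a c \<omega> W = I"
  unfolding residual_interval_def
proof (rule the_equality, rule residual)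
  fix J assume J: "is_residual_interval a c \<omega> W J"
  then have "I \<subseteq> J" using W_vanish_not_subset[of J] by (auto simp: is_residual_interval_def)
  moreover have "\<not> I \<subset> J" using J I(1) W_vanish_subset by (auto simp: is_residual_interval_def)
  ultimately show "J = I" by blast
qed

section \<open>The spectrum\<close>

lemma higher_deriv_\<phi>:
  "\<alpha> \<in> A \<Longrightarrow> (deriv ^^ n) (\<phi> \<alpha>) l = (- \<i>) ^ n * T \<alpha> (\<lambda>t. of_real t ^ n * exp (- \<i> * l * of_real t))"
proof -
  assume \<alpha>: "\<alpha> \<in> A"
  have "(deriv ^^ n) (\<phi> \<alpha>) l = T \<alpha> (\<lambda>t. (- \<i> * of_real t) ^ n * exp (- \<i> * of_real t * l))"
    using transform_higher_derivative[OF T_ufunctional[OF \<alpha>], of n l] by (simp add: transform_rest)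
  also have "(\<lambda>t. (- \<i> * of_real t) ^ n * exp (- \<i> * of_real t * l)) =
    (\<lambda>t. (- \<i>) ^ n * (of_real t ^ n * exp (- \<i> * l * of_real t)))"
    unfolding power_mult_distrib by (simp add: mult_ac)
  finally show ?thesis using ufunctional_cmult[OF T_ufunctional[OF \<alpha>] udf_exp_poly[of UNIV n l], of "(- \<i>) ^ n"] by simp
qed

text \<open>On a monomial the local convolution is \<open>exp (- \<i> * l * y)\<close> times a
  polynomial in \<open>y\<close>, whose coefficients are nonzero multiples of the moments
  \<open>m \<alpha> i\<close>. On the infinite set \<open>I\<close> it vanishes only if all moments
  do, and these are the derivatives of \<open>\<phi> \<alpha>\<close> at \<open>l\<close> up to
  powers of \<i>.\<close>

lemma exp_monomial_in_W:
  "exp_monomial a j l \<in> W \<longleftrightarrow> (\<forall>\<alpha>\<in>A. \<forall>i\<le>j. (deriv ^^ i) (\<phi> \<alpha>) l = 0)"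
proof -
  define m where "m \<alpha> i = T \<alpha> (\<lambda>t. of_real t ^ i * exp (- \<i> * l * of_real t))" for \<alpha> i
  have U: "exp_monomial a j l \<in> UU" unfolding exp_monomial_def by (intro restr_U udf_exp_poly)
  have lc: "local_conv a c \<omega> (S \<alpha>) (exp_monomial a j l) y =
    exp (- \<i> * l * of_real y) * (\<Sum>i\<le>j. (of_nat (j choose i) * m \<alpha> i) * of_real y ^ (j - i))"
    if \<alpha>: "\<alpha> \<in> A" and y: "y \<in> I" for \<alpha> y
  proof -
    have "y \<in> symint a" using y I_symint by blast
    then obtain e where e: "e > 0" "ball y e \<subseteq> symint a" using openE[OF open_symint] by blast
    have "local_conv a c \<omega> (S \<alpha>) (exp_monomial a j l) y =
      T \<alpha> (\<lambda>t. of_real (t + y) ^ j * exp (- \<i> * l * of_real (t + y)))"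
    proof (rule local_conv_eq[OF dual[OF \<alpha>] \<phi>_zero_type[OF \<alpha>] udf_exp_poly e(1)])
      fix t assume "\<bar>t - y\<bar> < e"
      then have "t \<in> symint a" using e(2) by (auto simp: dist_real_def abs_minus_commute)
      then show "of_real t ^ j * exp (- \<i> * l * of_real t) = exp_monomial a j l t"
        by (simp add: exp_monomial_def restr_def)
    qed
    also have "(\<lambda>t. of_real (t + y) ^ j * exp (- \<i> * l * of_real (t + y))) =
      (\<lambda>t. \<Sum>i\<le>j. (exp (- \<i> * l * of_real y) * of_nat (j choose i) * of_real y ^ (j - i)) *
        (of_real t ^ i * exp (- \<i> * l * of_real t)))"
    proof
      fix t
      have "exp (- \<i> * l * of_real (t + y)) = exp (- \<i> * l * of_real y) * exp (- \<i> * l * of_real t)"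
        by (simp add: algebra_simps flip: exp_add)
      then show "of_real (t + y) ^ j * exp (- \<i> * l * of_real (t + y)) =
        (\<Sum>i\<le>j. (exp (- \<i> * l * of_real y) * of_nat (j choose i) * of_real y ^ (j - i)) *
          (of_real t ^ i * exp (- \<i> * l * of_real t)))"
        by (simp add: binomial_ring sum_distrib_left sum_distrib_right mult_ac)
    qed
    also have "T \<alpha> \<dots> = (\<Sum>i\<le>j. T \<alpha> (\<lambda>t. (exp (- \<i> * l * of_real y) * of_nat (j choose i) * of_real y ^ (j - i)) *
        (of_real t ^ i * exp (- \<i> * l * of_real t))))"
      by (rule conjunct2[OF ufunctional_sum[OF T_ufunctional[OF \<alpha>]]]) (auto intro!: udf_cmult udf_exp_poly[simplified])
    also have "\<dots> = (\<Sum>i\<le>j. (exp (- \<i> * l * of_real y) * of_nat (j choose i) * of_real y ^ (j - i)) * m \<alpha> i)"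
      unfolding m_def by (intro sum.cong refl ufunctional_cmult T_ufunctional \<alpha> udf_exp_poly)
    finally show ?thesis by (simp add: sum_distrib_left mult_ac)
  qed
  have "(\<forall>y\<in>I. local_conv a c \<omega> (S \<alpha>) (exp_monomial a j l) y = 0) \<longleftrightarrow> (\<forall>i\<le>j. m \<alpha> i = 0)" if \<alpha>: "\<alpha> \<in> A" for \<alpha>
  proof
    assume "\<forall>y\<in>I. local_conv a c \<omega> (S \<alpha>) (exp_monomial a j l) y = 0"
    then have z: "(\<Sum>i\<le>j. (of_nat (j choose i) * m \<alpha> i) * of_real y ^ (j - i)) = 0" if "y \<in> I" for y
      using lc[OF \<alpha> that] that by simp
    have inf: "infinite I" using I(2) empty_interior_finite by blast
    have "m \<alpha> i = 0" if "i \<le> j" for i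
    proof -
      have "of_nat (j choose i) * m \<alpha> i = 0" by (rule polynomial_infinite_zeros[OF inf z that])
      then show ?thesis using that by simp
    qed
    then show "\<forall>i\<le>j. m \<alpha> i = 0" by blast
  qed (use lc[OF \<alpha>] in simp)
  moreover have "(deriv ^^ i) (\<phi> \<alpha>) l = 0 \<longleftrightarrow> m \<alpha> i = 0" if "\<alpha> \<in> A" for \<alpha> i
    unfolding higher_deriv_\<phi>[OF that] m_def by simp
  ultimately show ?thesis using U by (auto simp: W_iff)
qed

lemma hol_\<phi>: "\<alpha> \<in> A \<Longrightarrow> \<phi> \<alpha> holomorphic_on UNIV"
  using \<phi>_zero_type by (simp add: zero_type_def)

lemma \<phi>_nonzero:
  obtains k p where "k \<in> A" "\<phi> k p \<noteq> 0"
proof -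
  obtain k f where k: "k \<in> A" "f \<in> UU" "S k f \<noteq> 0" using nonzero by blast
  obtain h where h: "udf UNIV h" "\<forall>x. \<bar>x\<bar> > 1 \<longrightarrow> h x = 0" "T k h \<noteq> 0"
    using dual_nonzero_near_0[OF dual[OF k(1)] \<phi>_zero_type[OF k(1)] _ zero_less_one] k by blast
  have "\<exists>p. \<phi> k p \<noteq> 0"
  proof (rule ccontr)
    assume "\<not> ?thesis"
    then have "T k h = 0" by (intro transform_eq_0D[OF T_ufunctional[OF k(1)] _ h(1)]) (simp add: transform_rest)
    then show False using h(3) by simp
  qed
  then show ?thesis using that k(1) by blast
qed

lemma exponents: "is_exponent_sequence a W (\<lambda>l. INF \<alpha>\<in>A. zero_mult (\<phi> \<alpha>) l)"
proof -
  obtain k p where k: "k \<in> A" "\<phi> k p \<noteq> 0" using \<phi>_nonzero .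
  have le: "(INF \<alpha>\<in>A. zero_mult (\<phi> \<alpha>) l) \<le> zero_mult (\<phi> k) l" for l by (rule INF_lower[OF k(1)])
  have fin: "zero_mult (\<phi> k) l \<noteq> \<infinity>" for l using k(2) by (auto simp: zero_mult_def)
  \<comment> \<open>\<open>enat j <\<close> is the same as \<open>enat (Suc j) \<le>\<close>, and in
    this form it passes through the infimum.\<close>
  have iff: "enat j < (INF \<alpha>\<in>A. zero_mult (\<phi> \<alpha>) l) \<longleftrightarrow> (\<forall>\<alpha>\<in>A. enat j < zero_mult (\<phi> \<alpha>) l)" for j l
    by (simp add: Suc_ile_eq[symmetric] le_INF_iff)
  have "{l. (INF \<alpha>\<in>A. zero_mult (\<phi> \<alpha>) l) \<noteq> 0} \<subseteq> {l \<in> UNIV. \<phi> k l = 0}"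
  proof
    fix l assume "l \<in> {l. (INF \<alpha>\<in>A. zero_mult (\<phi> \<alpha>) l) \<noteq> 0}"
    then have "enat 0 < (INF \<alpha>\<in>A. zero_mult (\<phi> \<alpha>) l)" by (simp flip: zero_enat_def)
    then have "enat 0 < zero_mult (\<phi> k) l" using iff k(1) by blast
    then show "l \<in> {l \<in> UNIV. \<phi> k l = 0}" using zero_mult_gt_iff[OF hol_\<phi>[OF k(1)], of 0 l] by simp
  qed
  moreover have "countable {l \<in> UNIV. \<phi> k l = 0}"
  proof (cases "\<phi> k constant_on UNIV")
    case True
    then have "\<phi> k l \<noteq> 0" for l using k(2) unfolding constant_on_def by force
    then show ?thesis by simp
  next
    case False
    then show ?thesis by (intro holomorphic_countable_zeros hol_\<phi> k(1)) auto
  qed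
  moreover have "exp_monomial a j l \<in> W \<longleftrightarrow> enat j < (INF \<alpha>\<in>A. zero_mult (\<phi> \<alpha>) l)" for j l
    unfolding iff exp_monomial_in_W using zero_mult_gt_iff[OF hol_\<phi>] by simp
  moreover have "(INF \<alpha>\<in>A. zero_mult (\<phi> \<alpha>) l) \<noteq> \<infinity>" for l
  proof
    assume "(INF \<alpha>\<in>A. zero_mult (\<phi> \<alpha>) l) = \<infinity>"
    then show False using le[of l] fin[of l] by (metis enat_ord_simps(5))
  qed
  ultimately show ?thesis
    unfolding is_exponent_sequence_def Exp_set_def by (auto dest: countable_subset)
qed

lemma vanish_subspace: "cfun.subspace (W_vanish a c \<omega> I)"
  unfolding cfun.subspace_def by (auto simp: W_vanish_def U_0 U_add U_cscale) (simp add: cscale_def)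

lemma synthesis: "weak_spectral_synthesis a c \<omega> W"
proof -
  define E where "E = cfun.span (Exp_set a W) + W_vanish a c \<omega> I"
  have WU: "W \<subseteq> UU" using W_iff by blast
  have "Exp_set a W \<subseteq> W" by (auto simp: Exp_set_def)
  then have span: "cfun.span (Exp_set a W) \<subseteq> W" using W_subspace by (rule cfun.span_minimal)
  have EW: "E \<subseteq> W"
    unfolding E_def using span W_vanish_subset W_subspace by (auto simp: set_plus_def cfun.subspace_def)
  have Esub: "cfun.subspace E"
  proof -
    have "E = {x + y |x y. x \<in> cfun.span (Exp_set a W) \<and> y \<in> W_vanish a c \<omega> I}"
      by (auto simp: E_def set_plus_def)
    then show ?thesis using cfun.subspace_sums[OF cfun.subspace_span vanish_subspace] by simp
  qed
  have gen: "Exp_set a W \<subseteq> E" "W_vanish a c \<omega> I \<subseteq> E"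
  proof -
    have "g \<in> E" if "g \<in> Exp_set a W" for g
      unfolding E_def using set_plus_intro[OF cfun.span_base[OF that] cfun.subspace_0[OF vanish_subspace]] by simp
    moreover have "g \<in> E" if "g \<in> W_vanish a c \<omega> I" for g
      unfolding E_def using set_plus_intro[OF cfun.span_zero[of "Exp_set a W"] that] by simp
    ultimately show "Exp_set a W \<subseteq> E" "W_vanish a c \<omega> I \<subseteq> E" by blast+
  qed
  have "TU closure_of E \<subseteq> W" by (rule closure_of_minimal[OF EW W_closed])
  moreover have "f \<in> TU closure_of E" if fW: "f \<in> W" for f
  proof (rule ccontr)
    assume nf: "f \<notin> TU closure_of E"
    have f: "f \<in> UU" using fW WU by blast
    obtain R where R: "R \<in> U_dual a c \<omega>" "\<And>g. g \<in> E \<Longrightarrow> R g = 0" "R f \<noteq> 0"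
      using dual_separation[OF subset_trans[OF EW WU] Esub f nf] by blast
    obtain k where k: "local_index R k" using local_index_exists[OF R(1)] .
    \<comment> \<open>Two distinct points of \<open>I\<close>, so that the carrier \<open>K\<close>
      below is a nondegenerate interval.\<close>
    obtain x0 y0 where xy: "x0 \<in> interior I" "y0 \<in> interior I" "x0 < y0"
    proof -
      obtain x0 where x0: "x0 \<in> interior I" using I(2) by blast
      obtain e where "e > 0" "ball x0 e \<subseteq> interior I" using openE[OF open_interior x0] .
      moreover have "x0 + e / 2 \<in> ball x0 e" using \<open>e > 0\<close> by (simp add: dist_real_def)
      ultimately show ?thesis using that[of x0 "x0 + e / 2"] x0 by auto
    qed
    have xyI: "x0 \<in> I" "y0 \<in> I" using xy interior_subset by blast+
    \<comment> \<open>The strict inequality \<open>c k < c k'\<close> leaves a collar in which a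
      function can be cut off without changing its value under \<open>R\<close>.\<close>
    obtain k' where k': "c k < c k'" "{x0, y0} \<subseteq> {- c k'..c k'}"
    proof -
      have "compact {x0, y0, c k}" "{x0, y0, c k} \<subseteq> symint a"
        using xyI I_symint c_symint[of "c k" k] c_pos[of k] by auto
      then obtain i where i: "{x0, y0, c k} \<subseteq> {- c i..c i}" using exhausts_compact by blast
      have "c i \<in> symint a" using c_symint[of "c i" i] c_pos[of i] by auto
      then obtain k' where "\<bar>c i\<bar> < c k'" using exhausts by blast
      then show ?thesis using that[of k'] i c_pos[of i] by auto
    qed
    \<comment> \<open>\<open>K\<close> will carry \<open>R\<close>: \<open>[-c k;c k]\<close> does
      so because \<open>R\<close> is continuous, and \<open>I\<close> does so because
      \<open>R\<close> annihilates the functions that vanish on it.\<close>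
    define K where "K = I \<inter> {- c k'..c k'}"
    obtain C where C: "closed C" "I = symint a \<inter> C"
      using I(1) by (auto simp: rel_closed_interval_def closedin_closed)
    have "K = C \<inter> {- c k'..c k'}" using C(2) Icc_symint by (auto simp: K_def)
    then have "compact K" using C(1) by (simp add: closed_Int_compact)
    moreover have "connected K" unfolding K_def by (intro convex_connected convex_Int I_convex convex_real_interval)
    ultimately obtain \<alpha> \<beta> where ab: "K = {\<alpha>..\<beta>}" using connected_compact_interval_1[of K] by blast
    have "x0 \<in> K" "y0 \<in> K" using xyI k' by (auto simp: K_def)
    then have \<alpha>\<beta>: "\<alpha> < \<beta>" using xy(3) ab by auto
    have "- c k' \<le> c k'" using c_pos[of k'] by simp
    obtain \<theta> \<delta> where \<theta>: "\<delta> > 0" "udf UNIV \<theta>" "\<forall>x. - c k' - \<delta> \<le> x \<longrightarrow> x \<le> c k' + \<delta> \<longrightarrow> \<theta> x = 1"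
      "\<forall>x. x \<notin> {- c k' - 2 * \<delta>..c k' + 2 * \<delta>} \<longrightarrow> \<theta> x = 0" "{- c k' - 2 * \<delta>..c k' + 2 * \<delta>} \<subseteq> symint a"
      using symint_cutoff[OF \<open>- c k' \<le> c k'\<close> Icc_symint] .
    define g where "g t = \<theta> t * f t" for t
    have g: "udf UNIV g" unfolding g_def by (rule udf_cutoff[OF f \<theta>(2) _ \<theta>(5)]) (use \<theta>(4) in blast)
    have g0: "g t = 0" if "\<bar>t\<bar> > c k' + 2 * \<delta>" for t
    proof -
      have "t \<notin> {- c k' - 2 * \<delta>..c k' + 2 * \<delta>}" using that by auto
      then show ?thesis using \<theta>(4) by (simp add: g_def)
    qed
    have gf: "g t = f t" if "- c k' - \<delta> \<le> t" "t \<le> c k' + \<delta>" for t using \<theta>(3) that by (simp add: g_def)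
    have Rg: "R f = rest R g"
      by (rule dual_cutoff[OF R(1) k f g, of "{- c k' - \<delta><..<c k' + \<delta>}"]) (use gf k'(1) \<theta>(1) in auto)
    obtain i p where i: "i \<in> A" "\<phi> i p \<noteq> 0" using \<phi>_nonzero .
    have "rest R g = 0"
    proof (rule functional_vanishes[of A "\<lambda>\<alpha>. T \<alpha>", OF T_ufunctional _ i(1) _ \<alpha>\<beta> g g0 _ rest_ufunctional[OF R(1)]])
      show "zero_type (transform (T \<alpha>))" if "\<alpha> \<in> A" for \<alpha> using \<phi>_zero_type[OF that] by (simp add: transform_rest)
      show "transform (T i) p \<noteq> 0" using i(2) by (simp add: transform_rest)
      show "T j (\<lambda>t. g (t + y)) = 0" if "j \<in> A" "\<alpha> \<le> y" "y \<le> \<beta>" for j y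
      proof -
        have y: "y \<in> I" "y \<in> {- c k'..c k'}" using that(2,3) ab by (auto simp: K_def)
        have "local_conv a c \<omega> (S j) f y = T j (\<lambda>t. g (t + y))"
          by (rule local_conv_eq[OF dual[OF that(1)] \<phi>_zero_type[OF that(1)] g \<theta>(1)]) (use y(2) in \<open>auto intro!: gf\<close>)
        then show ?thesis using fW that(1) y(1) by (auto simp: W_iff)
      qed
      \<comment> \<open>\<open>h\<close> is known to vanish on \<open>K\<close> only. The factor
        \<open>\<chi>'\<close>, equal to 1 near \<open>[-c k;c k]\<close> and 0 off
        \<open>[-c k';c k']\<close>, makes it vanish on all of \<open>I\<close> and does not change
        its value under \<open>R\<close>.\<close>
      show "rest R h = 0" if h: "udf UNIV h" and h0: "\<And>x. \<alpha> \<le> x \<Longrightarrow> x \<le> \<beta> \<Longrightarrow> h x = 0" for h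
      proof -
        define d where "d = (c k' - c k) / 2"
        have d: "d > 0" "c k + 2 * d = c k'" using k'(1) by (auto simp: d_def field_simps)
        have "- c k \<le> c k" using c_pos[of k] by simp
        then obtain \<chi>' where \<chi>': "udf UNIV \<chi>'" "\<And>x. - c k - d \<le> x \<Longrightarrow> x \<le> c k + d \<Longrightarrow> \<chi>' x = 1"
          "\<And>x. x \<le> - c k - 2 * d \<Longrightarrow> \<chi>' x = 0" "\<And>x. x \<ge> c k + 2 * d \<Longrightarrow> \<chi>' x = 0"
          using udf_plateau[OF _ d(1), of "- c k" "c k"] by blast
        have ch: "udf UNIV (\<lambda>t. \<chi>' t * h t)" by (intro udf_mult \<chi>' h open_UNIV)
        have "\<chi>' x * h x = 0" if "x \<in> I" for x
        proof (cases "x \<in> {- c k'..c k'}")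
          case True
          then have "x \<in> {\<alpha>..\<beta>}" using that ab by (auto simp: K_def)
          then show ?thesis using h0[of x] by simp
        next
          case False
          then show ?thesis using \<chi>'(3)[of x] \<chi>'(4)[of x] d(2) by (cases "x < - c k'") auto
        qed
        then have "restr a (\<lambda>t. \<chi>' t * h t) \<in> W_vanish a c \<omega> I"
          using restr_UNIV[OF ch] by (auto simp: W_vanish_def restr_def)
        then have "rest R (\<lambda>t. \<chi>' t * h t) = 0" unfolding rest_def using R(2) gen(2) by blast
        moreover have "R (restr a h) = rest R (\<lambda>t. \<chi>' t * h t)"
          by (rule dual_cutoff[OF R(1) k restr_UNIV[OF h] ch, of "{- c k - d<..<c k + d} \<inter> symint a"])
            (use \<chi>'(2) d Icc_symint open_symint[of a] in \<open>auto simp: restr_def\<close>)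
        ultimately show ?thesis by (simp add: rest_def)
      qed
      \<comment> \<open>The assumption puts the monomial of degree \<open>n\<close> into
        \<open>W\<close>, so \<open>R\<close> annihilates it; its value under \<open>R\<close> is
        the n-th derivative of the transform up to a power of \<i>.\<close>
      show "(deriv ^^ n) (transform (rest R)) l = 0"
        if "\<And>i j. i \<in> A \<Longrightarrow> j \<le> n \<Longrightarrow> (deriv ^^ j) (transform (T i)) l = 0" for l n
      proof -
        have "exp_monomial a n l \<in> W" unfolding exp_monomial_in_W using that by (simp add: transform_rest)
        then have "R (exp_monomial a n l) = 0" using R(2) gen(1) by (auto simp: Exp_set_def)
        then have 0: "rest R (\<lambda>t. of_real t ^ n * exp (- \<i> * l * of_real t)) = 0"
          unfolding rest_def exp_monomial_def .
        have "(deriv ^^ n) (transform (rest R)) l = rest R (\<lambda>t. (- \<i> * of_real t) ^ n * exp (- \<i> * of_real t * l))"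
          by (rule transform_higher_derivative[OF rest_ufunctional[OF R(1)]])
        also have "(\<lambda>t. (- \<i> * of_real t) ^ n * exp (- \<i> * of_real t * l)) =
          (\<lambda>t. (- \<i>) ^ n * (of_real t ^ n * exp (- \<i> * l * of_real t)))"
          unfolding power_mult_distrib by (simp add: mult_ac)
        finally show ?thesis
          using ufunctional_cmult[OF rest_ufunctional[OF R(1)] udf_exp_poly[of UNIV n l], of "(- \<i>) ^ n"] 0 by simp
      qed
    qed
    then show False using R(3) Rg by simp
  qed
  ultimately show ?thesis unfolding weak_spectral_synthesis_def residual_unique E_def by blast
qed

end

theorem corollary3p7:
  fixes a :: ereal and c :: "nat \<Rightarrow> real" and \<omega> :: "real \<Rightarrow> real"
    and I :: "real set"
    and A :: "'i set" and S :: "'i \<Rightarrow> (real \<Rightarrow> complex) \<Rightarrow> complex"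
    and W :: "(real \<Rightarrow> complex) set"
  assumes "weight \<omega>"
    and "0 < a"
    and "exhausting a c"
    and "rel_closed_interval a I" and "interior I \<noteq> {}"
    and "\<And>\<alpha>. \<alpha> \<in> A \<Longrightarrow> S \<alpha> \<in> U_dual a c \<omega>"
    and "\<exists>\<alpha>\<in>A. \<exists>f\<in>U a c \<omega>. S \<alpha> f \<noteq> 0"
    and "\<And>\<alpha>. \<alpha> \<in> A \<Longrightarrow> fourier_laplace a (S \<alpha>) \<in> multipliers \<omega>"
    and W: "W = (\<Inter>\<alpha>\<in>A. ker_local_conv a c \<omega> (S \<alpha>) I)"
  shows "D_invariant_subspace a c \<omega> W \<and>
         weak_spectral_synthesis a c \<omega> W \<and>
         is_residual_interval a c \<omega> W I \<and> residual_interval a c \<omega> W = I \<and>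
         is_exponent_sequence a W (\<lambda>l. INF \<alpha>\<in>A. zero_mult (fourier_laplace a (S \<alpha>)) l)"
  proof -
  interpret synthesis_setting \<omega> a c I A S W
    using assms by unfold_locales auto
  show ?thesis
    unfolding D_invariant_subspace_def
    using W_subspace W_closed W_D_invariant synthesis residual residual_unique exponents by blast
qed

end
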